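(* Assume $0<|\gamma|<1/3$. The vector space $\mathfrak{A}(\mathbb{R}^2)_4=\mathfrak{A}_{12}(\mathbb{R}^2)\oplus\mathfrak{A}_2(\mathbb{R}^2)\oplus\mathfrak{A}_1(\mathbb{R}^2)\oplus\mathfrak{A}(\mathbb{R}^2)$ is a $\ast$-algebra with the product $\circ$ and involution $\star$ given, for $a=(a_1,a_2,a_3,a_4)$, $b=(b_1,b_2,b_3,b_4)$, by $$a\circ b=\tfrac14\big(a_1\natural b_1+a_2\natural b_2+a_3\natural b_3+a_4\natural b_4,\ a_1\natural b_2+a_2\natural b_1+a_3\natural b_4+a_4\natural b_3,$$ $$\qquad a_1\natural b_3+a_2\natural b_4+a_3\natural b_1+a_4\natural b_2,\ a_1\natural b_4+a_2\natural b_3+a_3\natural b_2+a_4\natural b_1\big),$$ $$a^\star=(a_1^\star,a_2^\star,a_3^\star,a_4^\star),$$ where $$a_j\natural b_k=\Big(\big(e^{\frac{\pi}{4}\beta\mathcal{P}_1}e^{-\frac{\pi}{2}\alpha\mathcal{Q}_1}\otimes e^{-\frac{\pi}{4}\alpha\mathcal{P}_2}e^{-\frac{\pi}{2}\beta\mathcal{Q}_2}\big)a_j\Big)\#\Big(\big(e^{-\frac{\pi}{4}\beta\mathcal{P}_1}e^{-\frac{\pi}{2}\alpha\mathcal{Q}_1}\otimes e^{\frac{\pi}{4}\alpha\mathcal{P}_2}e^{-\frac{\pi}{2}\beta\mathcal{Q}_2}\big)b_k\Big),$$ $$a_j^\star=e^{\pi(\beta\mathcal{P}_1-\alpha\ma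thcal{P}_2)}\,\overline{a_j}.$$
   Context: Parameters: $q\neq\pm1$ is a complex number of modulus one, $\gamma\in\mathbb{R}$ is fixed with $q=e^{2\pi i\gamma}$, and $\alpha,\beta\in\mathbb{R}$ satisfy $\alpha\beta=\gamma$. On $L^2(\mathbb{R}^2)$, $\mathcal{Q}_j$ is multiplication by $x_j$ and $\mathcal{P}_j=\frac{1}{2\pi i}\partial/\partial x_j$ (self-adjoint); for real $s$, $e^{2\pi s\mathcal{P}_1}$ acts on functions in its domain by $g\mapsto g(x_1-is,x_2)$ (holomorphic continuation), similarly for $\mathcal{P}_2$. $\overline{g}$ is the complex conjugate function on $\mathbb{R}^2$. $\mathfrak{A}(\mathbb{R}^2)$ is the space of functions $a(x_1,x_2)$ on $\mathbb{R}^2$ that extend to entire functions on $\mathbb{C}^2$ with $\sup_{|y_1|<\nu_1,|y_2|<\nu_2}\iint|a(x_1+iy_1,x_2+iy_2)|^2e^{4\pi(\mu_1|x_1|+\mu_2|x_2|)}dx_1dx_2<\infty$ for all $\mu_1,\mu_2,\nu_1,\nu_2>0$. With $f_\alpha(x)=-2\sinh\pi\beta(2x+\alpha i)$ and $f_\beta(x)=-2\sinh\pi\alpha(2x+\beta i)$, put $\mathfrak{A}_1(\mathbb{R}^2)=f_\alpha(\mathcal{P}_1)^{-1}\mathfrak{A}(\mathbb{R}^2)$, $\mathfrak{A}_2(\mathbb{R}^2)=f_\beta(\mathcal{P}_2)^{-1}\mathfrak{A}(\mathbb{R}^2)$, $\mathfrak{A}_{12}(\mathbb{R}^2)=\mathfrak{A}_1(\mathbb{R}^2)+\mathfrak{A}_2(\mathbb{R}^2)$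 (subspaces of $L^2(\mathbb{R}^2)$; $f_\alpha(\mathcal{P}_1)^{-1}$ and $f_\beta(\mathcal{P}_2)^{-1}$ are bounded normal operators given by functional calculus). The twisted product is $$(g\# h)(x_1,x_2)=4\iiiint g(u_1,u_2)h(v_1,v_2)e^{4\pi i[(x_1-u_1)(x_2-v_2)-(x_1-v_1)(x_2-u_2)]}du_1du_2dv_1dv_2.$$ The assertion includes that $\natural$ is well defined for the components involved and that $a\circ b$ and $a^\star$ again lie in $\mathfrak{A}(\mathbb{R}^2)_4$. *)

theory Defs
  imports "HOL-Analysis.Analysis"
begin

definition square_integrable :: "(real \<times> real \<Rightarrow> complex) \<Rightarrow> bool" where
  "square_integrable f \<longleftrightarrow>
     f \<in> borel_measurable lborel \<and> integrable lborel (\<lambda>x. (cmod (f x))\<^sup>2)"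

lemma square_integrable_zero: "square_integrable (\<lambda>x. 0)"
  by (simp add: square_integrable_def)

lemma square_integrable_mult_const:
  assumes "square_integrable f"
  shows "square_integrable (\<lambda>x. c * f x)"
  using assms by (auto simp: square_integrable_def norm_mult power_mult_distrib)

lemma square_integrable_cnj:
  assumes "square_integrable f"
  shows "square_integrable (\<lambda>x. cnj (f x))"
proof -
  have "(\<lambda>x. cnj (f x)) \<in> borel_measurable lborel"
    using assms by (intro borel_measurable_continuous_on[where f = cnj])
      (auto simp: square_integrable_def intro: continuous_intros)
  then show ?thesis using assms by (auto simp: square_integrable_def)
qed

lemma square_integrable_add:
  assumes "square_integrable f" "square_integrable g"
  shows "square_integrable (\<lambda>x. f x + g x)"
proof -
  have m: "f \<in> borel_measurable lborel" "g \<in> borel_measurable lborel"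
    using assms by (auto simp: square_integrable_def)
  have bound: "(cmod (a + b))\<^sup>2 \<le> 2 * (cmod a)\<^sup>2 + 2 * (cmod b)\<^sup>2" for a b :: complex
  proof -
    have "(cmod (a + b))\<^sup>2 \<le> (cmod a + cmod b)\<^sup>2"
      by (intro power_mono norm_triangle_ineq) auto
    also have "\<dots> \<le> 2 * (cmod a)\<^sup>2 + 2 * (cmod b)\<^sup>2"
      using zero_le_power2[of "cmod a - cmod b"] by (simp add: power2_eq_square algebra_simps)
    finally show ?thesis .
  qed
  have "integrable lborel (\<lambda>x. 2 * (cmod (f x))\<^sup>2 + 2 * (cmod (g x))\<^sup>2)"
    using assms by (auto simp: square_integrable_def)
  then have "integrable lborel (\<lambda>x. (cmod (f x + g x))\<^sup>2)"
    by (rule Bochner_Integration.integrable_bound) (use m bound in auto)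
  then show ?thesis using m by (auto simp: square_integrable_def)
qed

definition l2_rel :: "(real \<times> real \<Rightarrow> complex) \<Rightarrow> (real \<times> real \<Rightarrow> complex) \<Rightarrow> bool" where
  "l2_rel f g \<longleftrightarrow>
     square_integrable f \<and> square_integrable g \<and> (AE x in lborel. f x = g x)"

quotient_type l2 = "real \<times> real \<Rightarrow> complex" / partial: l2_rel
proof (rule part_equivpI)
  show "\<exists>f. l2_rel f f"
    using square_integrable_zero by (auto simp: l2_rel_def)
  show "symp l2_rel"
    by (auto simp: symp_def l2_rel_def)
  show "transp l2_rel"
    unfolding transp_def l2_rel_def by auto
qed

instantiation l2 :: ab_group_add
begin

lift_definition zero_l2 :: l2 is "\<lambda>x. 0"
  by (simp add: l2_rel_def square_integrable_zero)

lift_definition plus_l2 :: "l2 \<Rightarrow> l2 \<Rightarrow> l2" is "\<lambda>f g x. f x + g x"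
  by (auto simp: l2_rel_def square_integrable_add)

lift_definition uminus_l2 :: "l2 \<Rightarrow> l2" is "\<lambda>f x. - f x"
  by (auto simp: l2_rel_def square_integrable_def)

definition minus_l2 :: "l2 \<Rightarrow> l2 \<Rightarrow> l2" where
  "minus_l2 f g = f + (- g)"

instance
proof
  fix a b c :: l2
  show "a + b + c = a + (b + c)"
    by transfer (auto simp: l2_rel_def add.assoc intro!: square_integrable_add)
  show "a + b = b + a"
    by transfer (auto simp: l2_rel_def add.commute intro!: square_integrable_add)
  show "0 + a = a"
    by transfer (auto simp: l2_rel_def)
  show "- a + a = 0"
    by transfer (auto simp: l2_rel_def square_integrable_zero)
  show "a - b = a + - b"
    by (simp add: minus_l2_def)
qed

end

lift_definition scale_l2 :: "complex \<Rightarrow> l2 \<Rightarrow> l2" is "\<lambda>c f x. c * f x"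
  by (auto simp: l2_rel_def square_integrable_mult_const)

lift_definition cnj_l2 :: "l2 \<Rightarrow> l2" is "\<lambda>f x. cnj (f x)"
  by (auto simp: l2_rel_def square_integrable_cnj)

definition norm_l2 :: "l2 \<Rightarrow> real" where
  "norm_l2 f = sqrt (\<integral>x. (cmod (rep_l2 f x))\<^sup>2 \<partial>lborel)"

text \<open>
  Unbounded operators are partial maps \<open>l2 \<rightharpoonup> l2\<close>; the domain is
  \<^const>\<open>dom\<close> and composition (on its natural domain) is \<^const>\<open>map_comp\<close>.
  What is defined through \<open>rep_l2\<close> does not depend on the representative chosen.
  \<open>fun_Q\<close> is $\varphi(\mathcal{Q}_1,\mathcal{Q}_2)$ on its maximal domain.
\<close>

definition fun_Q :: "(real \<times> real \<Rightarrow> complex) \<Rightarrow> l2 \<rightharpoonup> l2" where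
  "fun_Q \<phi> f =
     (if square_integrable (\<lambda>x. \<phi> x * rep_l2 f x)
      then Some (abs_l2 (\<lambda>x. \<phi> x * rep_l2 f x)) else None)"

definition fourier_integral :: "(real \<times> real \<Rightarrow> complex) \<Rightarrow> real \<times> real \<Rightarrow> complex" where
  "fourier_integral f p = (\<integral>x. f x * cis (- 2 * pi * (p \<bullet> x)) \<partial>lborel)"

text \<open>The Fourier--Plancherel transform: the extension by continuity of the Fourier integral
  from $L^1 \cap L^2$ to $L^2$.\<close>

definition fourier :: "l2 \<Rightarrow> l2" where
  "fourier f = (THE F. \<exists>g :: nat \<Rightarrow> l2.
     (\<forall>n. integrable lborel (rep_l2 (g n)) \<and>
          square_integrable (fourier_integral (rep_l2 (g n)))) \<and>
     (\<lambda>n. norm_l2 (g n - f)) \<longlonglongrightarrow> 0 \<and>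
     (\<lambda>n. norm_l2 (abs_l2 (fourier_integral (rep_l2 (g n))) - F)) \<longlonglongrightarrow> 0)"

text \<open>
  Under the Fourier transform with kernel $e^{-2\pi i p\cdot x}$ the self-adjoint operator
  $\mathcal{P}_j = \frac{1}{2\pi i}\,\partial/\partial x_j$ becomes multiplication by $p_j$.  So
  the (joint) functional calculus of $\mathcal{P}_1, \mathcal{P}_2$ sends $\varphi$ to
  $\mathcal{F}^{-1} \varphi(p_1,p_2) \mathcal{F}$ with domain
  $\{f : \varphi \cdot \mathcal{F} f \in L^2\}$.
  For $\varphi(p) = e^{2\pi s p_1}$ this is the holomorphic continuation
  $f \mapsto f(x_1 - i s, x_2)$.
\<close>

definition fun_P :: "(real \<times> real \<Rightarrow> complex) \<Rightarrow> l2 \<rightharpoonup> l2" where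
  "fun_P \<phi> f = map_option (inv fourier) (fun_Q \<phi> (fourier f))"

definition exp_Q1 :: "real \<Rightarrow> l2 \<rightharpoonup> l2" where
  "exp_Q1 s = fun_Q (\<lambda>x. of_real (exp (s * fst x)))"

definition exp_Q2 :: "real \<Rightarrow> l2 \<rightharpoonup> l2" where
  "exp_Q2 s = fun_Q (\<lambda>x. of_real (exp (s * snd x)))"

definition exp_P1 :: "real \<Rightarrow> l2 \<rightharpoonup> l2" where
  "exp_P1 s = fun_P (\<lambda>p. of_real (exp (s * fst p)))"

definition exp_P2 :: "real \<Rightarrow> l2 \<rightharpoonup> l2" where
  "exp_P2 s = fun_P (\<lambda>p. of_real (exp (s * snd p)))"

definition entire2 :: "(complex \<times> complex \<Rightarrow> complex) \<Rightarrow> bool" where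
  "entire2 F \<longleftrightarrow>
     (\<forall>z. \<exists>c d. (F has_derivative (\<lambda>w. c * fst w + d * snd w)) (at z))"

definition frakA_functions :: "(real \<times> real \<Rightarrow> complex) set" where
  "frakA_functions = {a. \<exists>F. entire2 F \<and>
     (\<forall>x1 x2. a (x1, x2) = F (of_real x1, of_real x2)) \<and>
     (\<forall>\<mu>1>0. \<forall>\<mu>2>0. \<forall>\<nu>1>0. \<forall>\<nu>2>0.
        (SUP (y1, y2) \<in> {y. \<bar>fst y\<bar> < \<nu>1 \<and> \<bar>snd y\<bar> < \<nu>2}.
           \<integral>\<^sup>+ (x1, x2). ennreal ((cmod (F (Complex x1 y1, Complex x2 y2)))\<^sup>2 *
               exp (4 * pi * (\<mu>1 * \<bar>x1\<bar> + \<mu>2 * \<bar>x2\<bar>))) \<partial>lborel) < \<infinity>)}"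

definition frakA :: "l2 set" where
  "frakA = abs_l2 ` frakA_functions"

text \<open>\<open>sinh_symbol \<alpha> \<beta>\<close> is $f_\alpha$ and \<open>sinh_symbol \<beta> \<alpha>\<close> is $f_\beta$.\<close>

definition sinh_symbol :: "real \<Rightarrow> real \<Rightarrow> real \<Rightarrow> complex" where
  "sinh_symbol \<alpha> \<beta> x = - 2 * sinh (of_real (pi * \<beta>) * (2 * of_real x + of_real \<alpha> * \<i>))"

definition frakA1 :: "real \<Rightarrow> real \<Rightarrow> l2 set" where
  "frakA1 \<alpha> \<beta> = {g. \<exists>a\<in>frakA. fun_P (\<lambda>p. inverse (sinh_symbol \<alpha> \<beta> (fst p))) a = Some g}"

definition frakA2 :: "real \<Rightarrow> real \<Rightarrow> l2 set" where
  "frakA2 \<alpha> \<beta> = {g. \<exists>a\<in>frakA. fun_P (\<lambda>p. inverse (sinh_symbol \<beta> \<alpha> (snd p))) a = Some g}"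

definition frakA12 :: "real \<Rightarrow> real \<Rightarrow> l2 set" where
  "frakA12 \<alpha> \<beta> = {g + h | g h. g \<in> frakA1 \<alpha> \<beta> \<and> h \<in> frakA2 \<alpha> \<beta>}"

definition frakA_4 :: "real \<Rightarrow> real \<Rightarrow> (l2 \<times> l2 \<times> l2 \<times> l2) set" where
  "frakA_4 \<alpha> \<beta> = frakA12 \<alpha> \<beta> \<times> frakA2 \<alpha> \<beta> \<times> frakA1 \<alpha> \<beta> \<times> frakA"

definition twisted_integrand ::
  "(real \<times> real \<Rightarrow> complex) \<Rightarrow> (real \<times> real \<Rightarrow> complex) \<Rightarrow> real \<times> real \<Rightarrow>
   (real \<times> real) \<times> (real \<times> real) \<Rightarrow> complex" where
  "twisted_integrand g h = (\<lambda>(x1, x2) ((u1, u2), (v1, v2)).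
     g (u1, u2) * h (v1, v2) *
     cis (4 * pi * ((x1 - u1) * (x2 - v2) - (x1 - v1) * (x2 - u2))))"

text \<open>The twisted product, defined when the fourfold integral converges absolutely
  and yields an element of $L^2$.\<close>

definition twisted :: "l2 \<Rightarrow> l2 \<Rightarrow> l2 option" where
  "twisted g h =
     (let I = twisted_integrand (rep_l2 g) (rep_l2 h);
          k = (\<lambda>x. 4 * (\<integral>w. I x w \<partial>lborel))
      in if (\<forall>x. integrable lborel (I x)) \<and> square_integrable k then Some (abs_l2 k) else None)"

text \<open>A tensor product $A \otimes B$ of operators in the first and in the second variable is
  the composition $(A \otimes I)(I \otimes B)$.\<close>

definition natural_left :: "real \<Rightarrow> real \<Rightarrow> l2 \<rightharpoonup> l2" where
  "natural_left \<alpha> \<beta> =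
     (exp_P1 (pi / 4 * \<beta>) \<circ>\<^sub>m exp_Q1 (- (pi / 2) * \<alpha>)) \<circ>\<^sub>m
     (exp_P2 (- (pi / 4) * \<alpha>) \<circ>\<^sub>m exp_Q2 (- (pi / 2) * \<beta>))"

definition natural_right :: "real \<Rightarrow> real \<Rightarrow> l2 \<rightharpoonup> l2" where
  "natural_right \<alpha> \<beta> =
     (exp_P1 (- (pi / 4) * \<beta>) \<circ>\<^sub>m exp_Q1 (- (pi / 2) * \<alpha>)) \<circ>\<^sub>m
     (exp_P2 (pi / 4 * \<alpha>) \<circ>\<^sub>m exp_Q2 (- (pi / 2) * \<beta>))"

definition natural_opt :: "real \<Rightarrow> real \<Rightarrow> l2 \<Rightarrow> l2 \<Rightarrow> l2 option" where
  "natural_opt \<alpha> \<beta> a b =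
     Option.bind (natural_left \<alpha> \<beta> a)
       (\<lambda>g. Option.bind (natural_right \<alpha> \<beta> b) (\<lambda>h. twisted g h))"

definition natural :: "real \<Rightarrow> real \<Rightarrow> l2 \<Rightarrow> l2 \<Rightarrow> l2" where
  "natural \<alpha> \<beta> a b = the (natural_opt \<alpha> \<beta> a b)"

definition star_opt :: "real \<Rightarrow> real \<Rightarrow> l2 \<rightharpoonup> l2" where
  "star_opt \<alpha> \<beta> a =
     fun_P (\<lambda>p. of_real (exp (pi * (\<beta> * fst p - \<alpha> * snd p)))) (cnj_l2 a)"

definition star :: "real \<Rightarrow> real \<Rightarrow> l2 \<Rightarrow> l2" where
  "star \<alpha> \<beta> a = the (star_opt \<alpha> \<beta> a)"

definition scale_4 :: "complex \<Rightarrow> l2 \<times> l2 \<times> l2 \<times> l2 \<Rightarrow> l2 \<times> l2 \<times> l2 \<times> l2" where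
  "scale_4 c = (\<lambda>(a1, a2, a3, a4).
     (scale_l2 c a1, scale_l2 c a2, scale_l2 c a3, scale_l2 c a4))"

definition circ_4 :: "real \<Rightarrow> real \<Rightarrow>
    l2 \<times> l2 \<times> l2 \<times> l2 \<Rightarrow> l2 \<times> l2 \<times> l2 \<times> l2 \<Rightarrow> l2 \<times> l2 \<times> l2 \<times> l2" where
  "circ_4 \<alpha> \<beta> = (\<lambda>(a1, a2, a3, a4) (b1, b2, b3, b4).
     let n = natural \<alpha> \<beta> in
     scale_4 (1 / 4)
       (n a1 b1 + n a2 b2 + n a3 b3 + n a4 b4,
        n a1 b2 + n a2 b1 + n a3 b4 + n a4 b3,
        n a1 b3 + n a2 b4 + n a3 b1 + n a4 b2,
        n a1 b4 + n a2 b3 + n a3 b2 + n a4 b1))"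

definition star_4 :: "real \<Rightarrow> real \<Rightarrow> l2 \<times> l2 \<times> l2 \<times> l2 \<Rightarrow> l2 \<times> l2 \<times> l2 \<times> l2" where
  "star_4 \<alpha> \<beta> = (\<lambda>(a1, a2, a3, a4).
     (star \<alpha> \<beta> a1, star \<alpha> \<beta> a2, star \<alpha> \<beta> a3, star \<alpha> \<beta> a4))"

text \<open>A (not necessarily unital) complex $*$-algebra whose underlying vector space is a
  subspace \<open>A\<close> of an ambient complex vector space.\<close>

locale star_algebra = vector_space scale
  for scale :: "complex \<Rightarrow> 'a::ab_group_add \<Rightarrow> 'a" +
  fixes A :: "'a set" and mult :: "'a \<Rightarrow> 'a \<Rightarrow> 'a" and inv_op :: "'a \<Rightarrow> 'a"
  assumes subspace_A: "subspace A"
    and mult_closed: "\<lbrakk>x \<in> A; y \<in> A\<rbrakk> \<Longrightarrow> mult x y \<in> A"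
    and mult_assoc: "\<lbrakk>x \<in> A; y \<in> A; z \<in> A\<rbrakk> \<Longrightarrow> mult (mult x y) z = mult x (mult y z)"
    and mult_add_left: "\<lbrakk>x \<in> A; y \<in> A; z \<in> A\<rbrakk> \<Longrightarrow> mult (x + y) z = mult x z + mult y z"
    and mult_add_right: "\<lbrakk>x \<in> A; y \<in> A; z \<in> A\<rbrakk> \<Longrightarrow> mult x (y + z) = mult x y + mult x z"
    and mult_scale_left: "\<lbrakk>x \<in> A; y \<in> A\<rbrakk> \<Longrightarrow> mult (scale c x) y = scale c (mult x y)"
    and mult_scale_right: "\<lbrakk>x \<in> A; y \<in> A\<rbrakk> \<Longrightarrow> mult x (scale c y) = scale c (mult x y)"
    and inv_op_closed: "x \<in> A \<Longrightarrow> inv_op x \<in> A"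
    and inv_op_add: "\<lbrakk>x \<in> A; y \<in> A\<rbrakk> \<Longrightarrow> inv_op (x + y) = inv_op x + inv_op y"
    and inv_op_scale: "x \<in> A \<Longrightarrow> inv_op (scale c x) = scale (cnj c) (inv_op x)"
    and inv_op_inv_op: "x \<in> A \<Longrightarrow> inv_op (inv_op x) = x"
    and inv_op_mult: "\<lbrakk>x \<in> A; y \<in> A\<rbrakk> \<Longrightarrow> inv_op (mult x y) = mult (inv_op y) (inv_op x)"

end

theory Submission
  imports Defs "HOL-Complex_Analysis.Complex_Analysis" "HOL-Probability.Probability" "HOL-Real_Asymp.Real_Asymp"
begin

text \<open>
  Everything is done on the Fourier side. There the spaces \<open>frakA\<close>, \<open>frakA1\<close>, \<open>frakA2\<close>
  consist of functions that are holomorphic in tubes and decay faster than every exponential, dividing by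
  $f_\alpha$ or $f_\beta$ only shrinking one strip to $|\mathrm{Im}\,z_1| < |\alpha|/2$, respectively
  $|\mathrm{Im}\,z_2| < |\beta|/2$. The operators in the definition of $\natural$ act by imaginary
  translations and exponential factors, and the twisted product becomes a twisted convolution, so
  $a \natural b$ is the integral of $f(z)\, k(r - ie - z)$ times an exponential, with $e = (\alpha, \beta)/2$.
  By Cauchy's theorem the contour can be moved freely inside the domains of the factors. Moving it onto the
  factor with the larger domain, separately in each variable, continues the product and shows
  $\mathfrak{A}_1 \natural \mathfrak{A}_2 \subseteq \mathfrak{A}$ and that $\mathfrak{A}$ is an ideal; for
  $\mathfrak{A}_1 \natural \mathfrak{A}_1$ one multiplies by $f_\alpha$ and uses that the exponentials are
  multiplicative along the convolution. Associativity is Fubini's theorem after a suitable choice of contours.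
\<close>

subsection \<open>Integrals depending on a parameter, and functions on tubes\<close>

text \<open>The shift \<open>e\<close> comes from the two factors exp(-(pi/2) \<alpha> Q_1): each
  continues its transform to height -\<alpha>/4, and heights add under convolution. The half-width
  |\<alpha>|/2 of the strip matches it: if |y| < |\<alpha>|/2, then y - \<alpha>/2 is a sum of two
  heights inside the strip, so the functions on the common strip already yield a star algebra. The
  identities are proved once there; the four component spaces contribute closure properties, which
  follow the multiplication table of the Klein four-group. The symbols fit too: with E_c(z) = exp(c
  (2 pi \<beta> z + i pi \<alpha> \<beta>)) one has f_\<alpha> = E_(-1) - E_1, and the constant i pi
  \<alpha> \<beta> is exactly what the shift i \<alpha>/2 contributes to the exponent. An obstacle
  is that the operators act on classes of functions through a definite description of the
  Fourier-Plancherel transform. Its properties are extracted from pairings with Gaussians of complex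
  centre, whose transforms and inversion are explicit and which separate functions almost
  everywhere.\<close>

lemma holomorphic_on_integral:
  fixes q :: "complex \<Rightarrow> 'a \<Rightarrow> complex"
  assumes U: "open U"
    and hol: "\<And>x. x \<in> space M \<Longrightarrow> (\<lambda>z. q z x) holomorphic_on U"
    and meas: "\<And>z. z \<in> U \<Longrightarrow> q z \<in> borel_measurable M"
    and m: "integrable M m"
    and bound: "\<And>z x. z \<in> U \<Longrightarrow> x \<in> space M \<Longrightarrow> norm (q z x) \<le> m x"
  shows "(\<lambda>z. \<integral>x. q z x \<partial>M) holomorphic_on U"
proof -
  have int: "integrable M (q z)" if "z \<in> U" for z
    by (rule Bochner_Integration.integrable_bound[OF m])
       (use that meas bound in \<open>auto intro!: AE_I2 order_trans[OF bound]\<close>)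
  have "\<exists>D. ((\<lambda>z. \<integral>x. q z x \<partial>M) has_field_derivative D) (at z)" if z: "z \<in> U" for z
  proof -
    obtain e' where e': "e' > 0" "cball z e' \<subseteq> U" using U z open_contains_cball by blast
    \<comment> \<open>Halving the radius leaves a closed disc of radius \<open>e\<close> inside
      \<open>U\<close> around every point of \<open>ball z e\<close>, so Cauchy's inequality bounds
      the derivative there by \<open>m x / e\<close>, an integrable majorant of the difference
      quotients.\<close>
    define e where "e = e' / 2"
    have e: "e > 0" "cball z (2*e) \<subseteq> U" using e' by (auto simp: e_def)
    have sub: "cball y e \<subseteq> U" if "y \<in> ball z e" for y
    proof
      fix w assume "w \<in> cball y e"
      with that have "dist z w \<le> 2 * e" using dist_triangle[of z w y] by (auto simp: dist_commute)
      then show "w \<in> U" using e by auto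
    qed
    have zU: "ball z e \<subseteq> U" using sub e by force
    have dbound: "norm (deriv (\<lambda>z. q z x) y) \<le> m x / e" if y: "y \<in> ball z e" and x: "x \<in> space M" for y x
    proof -
      have "(\<lambda>z. q z x) holomorphic_on cball y e" using hol[OF x] sub[OF y] holomorphic_on_subset by blast
      then have "norm ((deriv ^^ 1) (\<lambda>z. q z x) y) \<le> fact 1 * m x / e ^ 1"
        using e sub[OF y] bound x
        by (intro Cauchy_inequality) (auto intro: holomorphic_on_subset holomorphic_on_imp_continuous_on simp: dist_norm subset_iff)
      then show ?thesis by simp
    qed
    have lip: "norm (q y x - q z x) \<le> m x / e * norm (y - z)" if y: "y \<in> ball z e" and x: "x \<in> space M" for y x
    proof (rule field_differentiable_bound[of "ball z e" "\<lambda>z. q z x" "deriv (\<lambda>z. q z x)"])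
      show "((\<lambda>z. q z x) has_field_derivative deriv (\<lambda>z. q z x) w) (at w within ball z e)" if "w \<in> ball z e" for w
        using hol[OF x] U that zU by (meson has_field_derivative_at_within holomorphic_derivI subsetD)
    qed (use y e dbound x in auto)
    define D where "D = (\<integral>x. deriv (\<lambda>z. q z x) z \<partial>M)"
    have "((\<lambda>y. ((\<integral>x. q y x \<partial>M) - (\<integral>x. q z x \<partial>M)) / (y - z)) \<longlongrightarrow> D) (at z within ball z e)"
      unfolding tendsto_at_iff_sequentially
    proof (intro allI impI)
      fix X assume X: "\<forall>i. X i \<in> ball z e - {z}" "X \<longlonglongrightarrow> z"
      have XU: "X i \<in> U" "X i \<noteq> z" for i using X zU by auto
      have lim: "(\<lambda>i. (q (X i) x - q z x) / (X i - z)) \<longlonglongrightarrow> deriv (\<lambda>z. q z x) z" if "x \<in> space M" for x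
      proof -
        have "((\<lambda>z. q z x) has_field_derivative deriv (\<lambda>z. q z x) z) (at z)"
          using hol[OF that] U z by (meson holomorphic_derivI)
        then have "((\<lambda>y. (q y x - q z x) / (y - z)) \<longlongrightarrow> deriv (\<lambda>z. q z x) z) (at z)"
          by (simp add: has_field_derivative_iff)
        then show ?thesis
          using X(2) XU(2) by (auto simp: tendsto_at_iff_sequentially o_def)
      qed
      have mq: "(\<lambda>x. (q (X i) x - q z x) / (X i - z)) \<in> borel_measurable M" for i
        using meas[OF XU(1)[of i]] meas[OF z] by measurable
      have "(\<lambda>i. \<integral>x. (q (X i) x - q z x) / (X i - z) \<partial>M) \<longlonglongrightarrow> D"
        unfolding D_def
      proof (rule integral_dominated_convergence[where w="\<lambda>x. m x / e"])
        show "(\<lambda>x. deriv (\<lambda>z. q z x) z) \<in> borel_measurable M"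
          by (rule borel_measurable_LIMSEQ_metric[where f="\<lambda>i x. (q (X i) x - q z x) / (X i - z)"]) (use mq lim in auto)
        show "integrable M (\<lambda>x. m x / e)" using m by simp
        show "AE x in M. norm ((q (X i) x - q z x) / (X i - z)) \<le> m x / e" for i
          using lip[of "X i"] X XU by (intro AE_I2) (auto simp: norm_divide divide_simps mult.commute)
      qed (use mq lim in auto)
      moreover have "(\<integral>x. (q (X i) x - q z x) / (X i - z) \<partial>M) = ((\<integral>x. q (X i) x \<partial>M) - (\<integral>x. q z x \<partial>M)) / (X i - z)" for i
        using int[OF XU(1)] int[OF z] by simp
      ultimately show "((\<lambda>y. ((\<integral>x. q y x \<partial>M) - (\<integral>x. q z x \<partial>M)) / (y - z)) \<circ> X) \<longlonglongrightarrow> D"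
        by (simp only: o_def)
    qed
    then have "((\<lambda>z. \<integral>x. q z x \<partial>M) has_field_derivative D) (at z within ball z e)"
      by (simp add: has_field_derivative_iff)
    then show ?thesis using e by (metis at_within_open centre_in_ball open_ball)
  qed
  then show ?thesis using U by (auto simp: holomorphic_on_open)
qed

lemma continuous_on_integral_dominated:
  fixes q :: "'b::metric_space \<Rightarrow> 'a \<Rightarrow> complex"
  assumes cont: "\<And>x. x \<in> space M \<Longrightarrow> continuous_on U (\<lambda>z. q z x)"
    and meas: "\<And>z. z \<in> U \<Longrightarrow> q z \<in> borel_measurable M"
    and m: "integrable M m"
    and bound: "\<And>z x. z \<in> U \<Longrightarrow> x \<in> space M \<Longrightarrow> norm (q z x) \<le> m x"
  shows "continuous_on U (\<lambda>z. \<integral>x. q z x \<partial>M)"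
  unfolding continuous_on_sequentially
proof (intro ballI allI impI)
  fix X a assume a: "a \<in> U" and X: "(\<forall>n. X n \<in> U) \<and> X \<longlonglongrightarrow> a"
  show "((\<lambda>z. \<integral>x. q z x \<partial>M) \<circ> X) \<longlonglongrightarrow> (\<integral>x. q a x \<partial>M)"
    unfolding o_def
  proof (rule integral_dominated_convergence[OF _ _ m])
    show "AE x in M. (\<lambda>i. q (X i) x) \<longlonglongrightarrow> q a x"
      using cont a X unfolding continuous_on_sequentially o_def by blast
  qed (use meas a X bound in auto)
qed

section \<open>Translations and reflections of Lebesgue measure, integrable exponentials\<close>

lemma lborel_integral_translate:
  fixes f :: "'a::euclidean_space \<Rightarrow> 'b::{banach, second_countable_topology}"
  shows "(\<integral>x. f (t + x) \<partial>lborel) = (\<integral>x. f x \<partial>lborel)"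
proof (cases "f \<in> borel_measurable borel")
  case True
  have "(\<integral>x. f x \<partial>lborel) = (\<integral>x. f x \<partial>distr lborel borel ((+) t))"
    by (simp only: lborel_distr_plus)
  also have "\<dots> = (\<integral>x. f (t + x) \<partial>lborel)" using True by (subst integral_distr) auto
  finally show ?thesis ..
next
  \<comment> \<open>Without measurability neither side is integrable, so both Bochner integrals take
    the default value 0; hence the equation holds for every \<open>f\<close>.\<close>
  case False
  have "(\<lambda>x. f (t + x)) \<notin> borel_measurable borel"
  proof
    assume "(\<lambda>x. f (t + x)) \<in> borel_measurable borel"
    then have "(\<lambda>x. f (t + (-t + x))) \<in> borel_measurable borel"
      by (rule measurable_compose[rotated]) auto
    with False show False by simp
  qed
  with False have "\<not> integrable lborel f" "\<not> integrable lborel (\<lambda>x. f (t + x))"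
    using borel_measurable_integrable[of lborel f] borel_measurable_integrable[of lborel "\<lambda>x. f (t + x)"] by auto
  then show ?thesis by (simp add: not_integrable_integral_eq)
qed

lemma lborel_distr_minus: "distr lborel borel uminus = (lborel :: 'a::euclidean_space measure)"
proof -
  have "(lborel :: 'a measure) = density (distr lborel borel (\<lambda>x. 0 + (-1) *\<^sub>R x)) (\<lambda>_. ennreal (\<bar>-1::real\<bar> ^ DIM('a)))"
    by (rule lborel_affine) simp
  then show ?thesis by (simp add: density_1)
qed

lemma lborel_integral_reflect:
  fixes f :: "'a::euclidean_space \<Rightarrow> 'b::{banach, second_countable_topology}"
  assumes "f \<in> borel_measurable borel"
  shows "(\<integral>x. f (- x) \<partial>lborel) = (\<integral>x. f x \<partial>lborel)"
proof -
  have "(\<integral>x. f x \<partial>lborel) = (\<integral>x. f x \<partial>distr lborel borel uminus)"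
    by (simp only: lborel_distr_minus)
  also have "\<dots> = (\<integral>x. f (- x) \<partial>lborel)" using assms by (subst integral_distr) auto
  finally show ?thesis ..
qed

lemma integrable_lborel_translate:
  fixes f :: "'a::euclidean_space \<Rightarrow> 'b::{banach, second_countable_topology}"
  assumes "integrable lborel f"
  shows "integrable lborel (\<lambda>x. f (t + x))"
proof -
  have "integrable (distr lborel borel ((+) t)) f" using assms by (simp only: lborel_distr_plus)
  then show ?thesis using assms by (subst (asm) integrable_distr_eq) auto
qed

lemma integrable_lborel_reflect:
  fixes f :: "'a::euclidean_space \<Rightarrow> 'b::{banach, second_countable_topology}"
  assumes "integrable lborel f"
  shows "integrable lborel (\<lambda>x. f (- x))"
proof -
  have "integrable (distr lborel borel uminus) f" using assms by (simp only: lborel_distr_minus)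
  then show ?thesis using assms by (subst (asm) integrable_distr_eq) auto
qed

lemma integrable_exp_abs:
  assumes "c > 0" shows "integrable lborel (\<lambda>x::real. exp (- (c * \<bar>x\<bar>)))"
proof -
  have "set_integrable lborel {0..} (\<lambda>x::real. exp (- c * x))"
  proof -
    have "(\<lambda>x::real. exp (- c * x)) absolutely_integrable_on {0..}"
      using assms by (intro nonnegative_absolutely_integrable_1 integrable_on_exp_minus_to_infinity) auto
    then show ?thesis
      unfolding set_integrable_def by (subst (asm) integrable_completion) auto
  qed
  then have 1: "integrable lborel (\<lambda>x::real. indicator {0..} x * exp (- (c * x)))"
    by (simp add: set_integrable_def)
  have "integrable lborel (\<lambda>x::real. indicator {0..} x * exp (- (c * x)) + indicator {0..} (-x) * exp (- (c * (-x))))"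
    by (intro Bochner_Integration.integrable_add 1 integrable_lborel_reflect[OF 1])
  then show ?thesis
    by (rule Bochner_Integration.integrable_bound) (auto simp: indicator_def abs_if)
qed

lemma integrable_exp_abs2:
  assumes "c > 0" shows "integrable lborel (\<lambda>p::real \<times> real. exp (- (c * (\<bar>fst p\<bar> + \<bar>snd p\<bar>))))"
proof -
  have "integrable (lborel \<Otimes>\<^sub>M lborel) (\<lambda>p::real \<times> real. exp (- (c * \<bar>fst p\<bar>)) * exp (- (c * \<bar>snd p\<bar>)))"
    using integrable_exp_abs[OF assms]
    by (intro lborel_pair.Fubini_integrable) (auto simp: abs_mult intro!: Bochner_Integration.integrable_mult_left)
  then show ?thesis by (simp add: lborel_prod exp_add[symmetric] algebra_simps)
qed

section \<open>Functions holomorphic in a tube that decay faster than every exponential\<close>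

text \<open>Joint continuity together with holomorphy in each variable is what integration over
  planes and moving contours one variable at a time require. Since \<open>M\<close> may depend on
  \<open>c\<close>, any factor of exponential growth is absorbed. The bounds are asked over compact
  sets of imaginary parts because f_\<alpha> has a zero on the boundary of its strip, at -i
  \<alpha>/2, so quotients by it may blow up there.\<close>

definition strip_decay :: "real set \<Rightarrow> real set \<Rightarrow> (complex \<Rightarrow> complex \<Rightarrow> complex) \<Rightarrow> bool" where
  "strip_decay S T f \<longleftrightarrow>
     continuous_on {z. Im (fst z) \<in> S \<and> Im (snd z) \<in> T} (\<lambda>z. f (fst z) (snd z)) \<and>
     (\<forall>w. Im w \<in> T \<longrightarrow> (\<lambda>z. f z w) holomorphic_on {z. Im z \<in> S}) \<and>
     (\<forall>z. Im z \<in> S \<longrightarrow> f z holomorphic_on {w. Im w \<in> T}) \<and>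
     (\<forall>K L c. compact K \<longrightarrow> K \<subseteq> S \<longrightarrow> compact L \<longrightarrow> L \<subseteq> T \<longrightarrow>
        (\<exists>M. \<forall>z w. Im z \<in> K \<longrightarrow> Im w \<in> L \<longrightarrow> cmod (f z w) \<le> M * exp (- (c * (\<bar>Re z\<bar> + \<bar>Re w\<bar>)))))"

text \<open>The contour with imaginary parts \<open>Im a\<close>, \<open>Im b\<close>. Complex
  shifts are allowed so that an integral over the contour becomes a holomorphic function of
  \<open>a\<close> and \<open>b\<close>.\<close>

definition slice :: "(complex \<Rightarrow> complex \<Rightarrow> complex) \<Rightarrow> complex \<Rightarrow> complex \<Rightarrow> real \<times> real \<Rightarrow> complex" where
  "slice f a b p = f (of_real (fst p) + a) (of_real (snd p) + b)"

lemma holomorphic_on_local: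
  assumes "open U" "\<And>z. z \<in> U \<Longrightarrow> \<exists>V. open V \<and> z \<in> V \<and> f holomorphic_on V"
  shows "f holomorphic_on U"
  using assms by (meson field_differentiable_at_within holomorphic_on_def holomorphic_on_imp_differentiable_at)

lemma continuous_on_local:
  fixes f :: "'a::t2_space \<Rightarrow> 'b::topological_space"
  assumes "\<And>z. z \<in> U \<Longrightarrow> \<exists>V. open V \<and> z \<in> V \<and> continuous_on V f"
  shows "continuous_on U f"
proof (rule continuous_at_imp_continuous_on, rule ballI)
  fix z assume "z \<in> U"
  then obtain V where "open V" "z \<in> V" "continuous_on V f" using assms by blast
  then show "isCont f z" by (simp add: continuous_on_eq_continuous_at)
qed

lemma open_Im: "open S \<Longrightarrow> open {z. Im z \<in> S}"
  using open_vimage[of S Im] by (simp add: vimage_def continuous_on_Im)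

lemma convex_Im: "convex S \<Longrightarrow> convex {z. Im z \<in> S}"
  unfolding convex_def by simp

lemma strip_decayD:
  assumes "strip_decay S T f"
  shows "continuous_on {z. Im (fst z) \<in> S \<and> Im (snd z) \<in> T} (\<lambda>z. f (fst z) (snd z))"
    and "Im w \<in> T \<Longrightarrow> (\<lambda>z. f z w) holomorphic_on {z. Im z \<in> S}"
    and "Im z \<in> S \<Longrightarrow> f z holomorphic_on {w. Im w \<in> T}"
  using assms by (auto simp: strip_decay_def)

lemma strip_decay_bound:
  assumes "strip_decay S T f" "compact K" "K \<subseteq> S" "compact L" "L \<subseteq> T"
  obtains M where "M > 0"
    "\<And>z w. Im z \<in> K \<Longrightarrow> Im w \<in> L \<Longrightarrow> cmod (f z w) \<le> M * exp (- (c * (\<bar>Re z\<bar> + \<bar>Re w\<bar>)))"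
proof -
  obtain M where M: "\<And>z w. Im z \<in> K \<Longrightarrow> Im w \<in> L \<Longrightarrow> cmod (f z w) \<le> M * exp (- (c * (\<bar>Re z\<bar> + \<bar>Re w\<bar>)))"
    using assms unfolding strip_decay_def by meson
  show ?thesis
  proof (rule that[of "\<bar>M\<bar> + 1"])
    fix z w assume "Im z \<in> K" "Im w \<in> L"
    from M[OF this] show "cmod (f z w) \<le> (\<bar>M\<bar> + 1) * exp (- (c * (\<bar>Re z\<bar> + \<bar>Re w\<bar>)))"
      by (rule order_trans) (intro mult_right_mono, auto)
  qed auto
qed

text \<open>The bound at rate |c| implies the one at rate \<open>c\<close>, so nonnegative rates
  suffice.\<close>

lemma strip_decayI:
  assumes "continuous_on {z. Im (fst z) \<in> S \<and> Im (snd z) \<in> T} (\<lambda>z. f (fst z) (snd z))"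
    and "\<And>w. Im w \<in> T \<Longrightarrow> (\<lambda>z. f z w) holomorphic_on {z. Im z \<in> S}"
    and "\<And>z. Im z \<in> S \<Longrightarrow> f z holomorphic_on {w. Im w \<in> T}"
    and "\<And>K L c. compact K \<Longrightarrow> K \<subseteq> S \<Longrightarrow> compact L \<Longrightarrow> L \<subseteq> T \<Longrightarrow> c \<ge> 0 \<Longrightarrow>
        (\<exists>M. \<forall>z w. Im z \<in> K \<longrightarrow> Im w \<in> L \<longrightarrow> cmod (f z w) \<le> M * exp (- (c * (\<bar>Re z\<bar> + \<bar>Re w\<bar>))))"
  shows "strip_decay S T f"
  unfolding strip_decay_def
proof (intro conjI allI impI)
  fix K L c assume K: "compact K" "K \<subseteq> S" "compact (L::real set)" "L \<subseteq> T"
  obtain M where M: "\<And>z w. Im z \<in> K \<Longrightarrow> Im w \<in> L \<Longrightarrow> cmod (f z w) \<le> M * exp (- (\<bar>c\<bar> * (\<bar>Re z\<bar> + \<bar>Re w\<bar>)))"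
    using assms(4)[OF K, of "\<bar>c\<bar>"] by auto
  show "\<exists>M. \<forall>z w. Im z \<in> K \<longrightarrow> Im w \<in> L \<longrightarrow> cmod (f z w) \<le> M * exp (- (c * (\<bar>Re z\<bar> + \<bar>Re w\<bar>)))"
  proof (intro exI[of _ "\<bar>M\<bar>"] allI impI)
    fix z w assume zw: "Im z \<in> K" "Im w \<in> L"
    have "M * exp (- (\<bar>c\<bar> * (\<bar>Re z\<bar> + \<bar>Re w\<bar>))) \<le> \<bar>M\<bar> * exp (- (c * (\<bar>Re z\<bar> + \<bar>Re w\<bar>)))"
      by (intro mult_mono) (auto intro!: mult_right_mono)
    with M[OF zw] show "cmod (f z w) \<le> \<bar>M\<bar> * exp (- (c * (\<bar>Re z\<bar> + \<bar>Re w\<bar>)))" by linarith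
  qed
qed (use assms in auto)

lemma strip_decay_mono:
  assumes "strip_decay S T f" "S' \<subseteq> S" "T' \<subseteq> T"
  shows "strip_decay S' T' f"
proof (rule strip_decayI)
  show "continuous_on {z. Im (fst z) \<in> S' \<and> Im (snd z) \<in> T'} (\<lambda>z. f (fst z) (snd z))"
    using strip_decayD(1)[OF assms(1)] by (rule continuous_on_subset) (use assms in auto)
  show "(\<lambda>z. f z w) holomorphic_on {z. Im z \<in> S'}" if "Im w \<in> T'" for w
    using strip_decayD(2)[OF assms(1), of w] that assms by (auto intro: holomorphic_on_subset)
  show "f z holomorphic_on {w. Im w \<in> T'}" if "Im z \<in> S'" for z
    using strip_decayD(3)[OF assms(1), of z] that assms by (auto intro: holomorphic_on_subset)
  show "\<exists>M. \<forall>z w. Im z \<in> K \<longrightarrow> Im w \<in> L \<longrightarrow> cmod (f z w) \<le> M * exp (- (c * (\<bar>Re z\<bar> + \<bar>Re w\<bar>)))"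
    if "compact K" "K \<subseteq> S'" "compact L" "L \<subseteq> T'" for K L c
    using strip_decay_bound[OF assms(1) that(1) _ that(3)] that assms by (metis order_trans)
qed

lemma strip_decay_cong:
  assumes "strip_decay S T f" "\<And>z w. Im z \<in> S \<Longrightarrow> Im w \<in> T \<Longrightarrow> g z w = f z w"
  shows "strip_decay S T g"
proof (rule strip_decayI)
  show "continuous_on {z. Im (fst z) \<in> S \<and> Im (snd z) \<in> T} (\<lambda>z. g (fst z) (snd z))"
    using strip_decayD(1)[OF assms(1)] by (rule continuous_on_eq) (use assms in auto)
  show "(\<lambda>z. g z w) holomorphic_on {z. Im z \<in> S}" if "Im w \<in> T" for w
    using strip_decayD(2)[OF assms(1) that] by (rule holomorphic_transform) (use that assms in auto)
  show "g z holomorphic_on {w. Im w \<in> T}" if "Im z \<in> S" for z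
    using strip_decayD(3)[OF assms(1) that] by (rule holomorphic_transform) (use that assms in auto)
  show "\<exists>M. \<forall>z w. Im z \<in> K \<longrightarrow> Im w \<in> L \<longrightarrow> cmod (g z w) \<le> M * exp (- (c * (\<bar>Re z\<bar> + \<bar>Re w\<bar>)))"
    if K: "compact K" "K \<subseteq> S" "compact L" "L \<subseteq> T" for K L c
    using strip_decay_bound[OF assms(1) K, where c = c] by (metis assms(2) that(2) that(4) subsetD)
qed

lemma strip_decay_add:
  assumes "strip_decay S T f" "strip_decay S T g"
  shows "strip_decay S T (\<lambda>z w. f z w + g z w)"
proof (rule strip_decayI)
  show "continuous_on {z. Im (fst z) \<in> S \<and> Im (snd z) \<in> T} (\<lambda>z. f (fst z) (snd z) + g (fst z) (snd z))"
    by (intro continuous_intros strip_decayD assms)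
  show "(\<lambda>z. f z w + g z w) holomorphic_on {z. Im z \<in> S}" if "Im w \<in> T" for w
    by (intro holomorphic_intros strip_decayD(2)[OF assms(1) that] strip_decayD(2)[OF assms(2) that])
  show "(\<lambda>w. f z w + g z w) holomorphic_on {w. Im w \<in> T}" if "Im z \<in> S" for z
    using strip_decayD(3)[OF assms(1) that] strip_decayD(3)[OF assms(2) that] by (rule holomorphic_on_add)
  fix K L c assume K: "compact K" "K \<subseteq> S" "compact (L::real set)" "L \<subseteq> T"
  obtain M1 where M1: "\<And>z w. Im z \<in> K \<Longrightarrow> Im w \<in> L \<Longrightarrow> cmod (f z w) \<le> M1 * exp (- (c * (\<bar>Re z\<bar> + \<bar>Re w\<bar>)))"
    using strip_decay_bound[OF assms(1) K] by metis
  obtain M2 where M2: "\<And>z w. Im z \<in> K \<Longrightarrow> Im w \<in> L \<Longrightarrow> cmod (g z w) \<le> M2 * exp (- (c * (\<bar>Re z\<bar> + \<bar>Re w\<bar>)))"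
    using strip_decay_bound[OF assms(2) K] by metis
  show "\<exists>M. \<forall>z w. Im z \<in> K \<longrightarrow> Im w \<in> L \<longrightarrow> cmod (f z w + g z w) \<le> M * exp (- (c * (\<bar>Re z\<bar> + \<bar>Re w\<bar>)))"
  proof (intro exI[of _ "M1 + M2"] allI impI)
    fix z w assume zw: "Im z \<in> K" "Im w \<in> L"
    show "cmod (f z w + g z w) \<le> (M1 + M2) * exp (- (c * (\<bar>Re z\<bar> + \<bar>Re w\<bar>)))"
      using norm_triangle_ineq[of "f z w" "g z w"] M1[OF zw] M2[OF zw] by (simp add: distrib_right)
  qed
qed

lemma strip_decay_mult:
  assumes f: "strip_decay S T f"
    and cont: "continuous_on {z. Im (fst z) \<in> S \<and> Im (snd z) \<in> T} (\<lambda>z. g (fst z) (snd z))"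
    and hol: "\<And>w. Im w \<in> T \<Longrightarrow> (\<lambda>z. g z w) holomorphic_on {z. Im z \<in> S}"
      "\<And>z. Im z \<in> S \<Longrightarrow> g z holomorphic_on {w. Im w \<in> T}"
    and growth: "\<And>K L. compact K \<Longrightarrow> K \<subseteq> S \<Longrightarrow> compact L \<Longrightarrow> L \<subseteq> T \<Longrightarrow>
        (\<exists>M c. \<forall>z w. Im z \<in> K \<longrightarrow> Im w \<in> L \<longrightarrow> cmod (g z w) \<le> M * exp (c * (\<bar>Re z\<bar> + \<bar>Re w\<bar>)))"
  shows "strip_decay S T (\<lambda>z w. g z w * f z w)"
proof (rule strip_decayI)
  show "continuous_on {z. Im (fst z) \<in> S \<and> Im (snd z) \<in> T} (\<lambda>z. g (fst z) (snd z) * f (fst z) (snd z))"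
    by (intro continuous_intros strip_decayD(1)[OF f] cont)
  show "(\<lambda>z. g z w * f z w) holomorphic_on {z. Im z \<in> S}" if "Im w \<in> T" for w
    by (intro holomorphic_intros strip_decayD(2)[OF f that] hol that)
  show "(\<lambda>w. g z w * f z w) holomorphic_on {w. Im w \<in> T}" if "Im z \<in> S" for z
    using hol(2)[OF that] strip_decayD(3)[OF f that] by (rule holomorphic_on_mult)
  fix K L c assume K: "compact K" "K \<subseteq> S" "compact (L::real set)" "L \<subseteq> T"
  obtain M c' where M: "\<And>z w. Im z \<in> K \<Longrightarrow> Im w \<in> L \<Longrightarrow> cmod (g z w) \<le> M * exp (c' * (\<bar>Re z\<bar> + \<bar>Re w\<bar>))"
    using growth[OF K] by blast
  \<comment> \<open>The rate \<open>c + c'\<close> pays for the growth \<open>c'\<close> of the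
    other factor.\<close>
  obtain M' where M': "\<And>z w. Im z \<in> K \<Longrightarrow> Im w \<in> L \<Longrightarrow> cmod (f z w) \<le> M' * exp (- ((c + c') * (\<bar>Re z\<bar> + \<bar>Re w\<bar>)))"
    using strip_decay_bound[OF f K] by metis
  show "\<exists>M. \<forall>z w. Im z \<in> K \<longrightarrow> Im w \<in> L \<longrightarrow> cmod (g z w * f z w) \<le> M * exp (- (c * (\<bar>Re z\<bar> + \<bar>Re w\<bar>)))"
  proof (intro exI[of _ "M * M'"] allI impI)
    fix z w assume zw: "Im z \<in> K" "Im w \<in> L"
    have "cmod (g z w * f z w) \<le> (M * exp (c' * (\<bar>Re z\<bar> + \<bar>Re w\<bar>))) * (M' * exp (- ((c + c') * (\<bar>Re z\<bar> + \<bar>Re w\<bar>))))"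
      unfolding norm_mult using M[OF zw] M'[OF zw] by (intro mult_mono) (auto intro: order_trans[OF norm_ge_zero])
    also have "\<dots> = M * M' * (exp (c' * (\<bar>Re z\<bar> + \<bar>Re w\<bar>)) * exp (- ((c + c') * (\<bar>Re z\<bar> + \<bar>Re w\<bar>))))" by simp
    also have "\<dots> = M * M' * exp (- (c * (\<bar>Re z\<bar> + \<bar>Re w\<bar>)))"
      unfolding exp_add[symmetric] by (simp add: algebra_simps)
    finally show "cmod (g z w * f z w) \<le> M * M' * exp (- (c * (\<bar>Re z\<bar> + \<bar>Re w\<bar>)))" .
  qed
qed

lemma compact_abs_bounded:
  fixes K :: "real set" assumes "compact K"
  obtains B where "B > 0" "\<And>x. x \<in> K \<Longrightarrow> \<bar>x\<bar> \<le> B"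
  using compact_imp_bounded[OF assms] by (auto simp: bounded_pos)

lemma norm_exp_affine_le:
  "cmod (exp (a * z + b * w + d)) \<le>
     exp (\<bar>Im a\<bar> * \<bar>Im z\<bar> + \<bar>Im b\<bar> * \<bar>Im w\<bar> + Re d) * exp ((\<bar>Re a\<bar> + \<bar>Re b\<bar>) * (\<bar>Re z\<bar> + \<bar>Re w\<bar>))"
proof -
  have "x * y \<le> \<bar>x\<bar> * \<bar>y\<bar>" "- (x * y) \<le> \<bar>x\<bar> * \<bar>y\<bar>" for x y :: real
    by (auto simp flip: abs_mult)
  note a = this
  have "0 \<le> \<bar>Re a\<bar> * \<bar>Re w\<bar>" "0 \<le> \<bar>Re b\<bar> * \<bar>Re z\<bar>" by auto
  then have "Re (a * z + b * w + d) \<le> (\<bar>Im a\<bar> * \<bar>Im z\<bar> + \<bar>Im b\<bar> * \<bar>Im w\<bar> + Re d) + (\<bar>Re a\<bar> + \<bar>Re b\<bar>) * (\<bar>Re z\<bar> + \<bar>Re w\<bar>)"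
    using a(1)[of "Re a" "Re z"] a(2)[of "Im a" "Im z"] a(1)[of "Re b" "Re w"] a(2)[of "Im b" "Im w"]
    unfolding distrib_left distrib_right plus_complex.sel times_complex.sel by linarith
  then show ?thesis by (simp flip: exp_add)
qed

lemma strip_decay_exp_mult:
  assumes f: "strip_decay S T f"
  shows "strip_decay S T (\<lambda>z w. exp (a * z + b * w + d) * f z w)"
proof (rule strip_decay_mult[OF f])
  fix K L assume K: "compact (K::real set)" "K \<subseteq> S" "compact (L::real set)" "L \<subseteq> T"
  obtain B1 where B1: "B1 > 0" "\<And>x. x \<in> K \<Longrightarrow> \<bar>x\<bar> \<le> B1" using compact_abs_bounded K by metis
  obtain B2 where B2: "B2 > 0" "\<And>x. x \<in> L \<Longrightarrow> \<bar>x\<bar> \<le> B2" using compact_abs_bounded K by metis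
  show "\<exists>M c. \<forall>z w. Im z \<in> K \<longrightarrow> Im w \<in> L \<longrightarrow> cmod (exp (a * z + b * w + d)) \<le> M * exp (c * (\<bar>Re z\<bar> + \<bar>Re w\<bar>))"
  proof (intro exI allI impI)
    fix z w assume zw: "Im z \<in> K" "Im w \<in> L"
    have "exp (\<bar>Im a\<bar> * \<bar>Im z\<bar> + \<bar>Im b\<bar> * \<bar>Im w\<bar> + Re d) \<le> exp (\<bar>Im a\<bar> * B1 + \<bar>Im b\<bar> * B2 + Re d)"
      using B1(2)[OF zw(1)] B2(2)[OF zw(2)] by (auto intro!: add_mono mult_left_mono)
    then show "cmod (exp (a * z + b * w + d)) \<le> exp (\<bar>Im a\<bar> * B1 + \<bar>Im b\<bar> * B2 + Re d) * exp ((\<bar>Re a\<bar> + \<bar>Re b\<bar>) * (\<bar>Re z\<bar> + \<bar>Re w\<bar>))"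
      by (rule order_trans[OF norm_exp_affine_le mult_right_mono]) auto
  qed
qed (auto intro!: continuous_intros holomorphic_intros)

lemma strip_decay_cmult:
  assumes "strip_decay S T f" shows "strip_decay S T (\<lambda>z w. c * f z w)"
proof (rule strip_decay_mult[OF assms])
  show "\<exists>M d. \<forall>z w. Im z \<in> K \<longrightarrow> Im w \<in> L \<longrightarrow> cmod c \<le> M * exp (d * (\<bar>Re z\<bar> + \<bar>Re w\<bar>))" for K L
    by (rule exI[of _ "cmod c"], rule exI[of _ "0::real"]) simp
qed (auto intro!: continuous_intros holomorphic_intros)

lemma strip_decay_zero: "strip_decay S T (\<lambda>z w. 0)"
  by (rule strip_decayI) (auto intro!: exI[of _ "0::real"])

lemma strip_decay_mult2:
  assumes "strip_decay S T f" "strip_decay S T g"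
  shows "strip_decay S T (\<lambda>z w. g z w * f z w)"
proof (rule strip_decay_mult[OF assms(1)])
  show "\<exists>M c. \<forall>z w. Im z \<in> K \<longrightarrow> Im w \<in> L \<longrightarrow> cmod (g z w) \<le> M * exp (c * (\<bar>Re z\<bar> + \<bar>Re w\<bar>))"
    if K: "compact K" "K \<subseteq> S" "compact L" "L \<subseteq> T" for K L
  proof -
    obtain M where "\<And>z w. Im z \<in> K \<Longrightarrow> Im w \<in> L \<Longrightarrow> cmod (g z w) \<le> M * exp (- (0 * (\<bar>Re z\<bar> + \<bar>Re w\<bar>)))"
      using strip_decay_bound[OF assms(2) K, where c = 0] by blast
    then show ?thesis by - (rule exI[of _ M], rule exI[of _ "0::real"], simp)
  qed
qed (use strip_decayD[OF assms(2)] in auto)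

text \<open>The case s = 1 moves a contour; the case s = -1 produces the argument r - z of a
  convolution. Both change the real parts by a bounded shift up to sign, which costs a constant
  factor in the decay.\<close>

lemma strip_decay_affine:
  assumes f: "strip_decay S T f" and s: "s = 1 \<or> s = -1"
  shows "strip_decay {y. Im a + s * y \<in> S} {y. Im b + s * y \<in> T} (\<lambda>z w. f (a + of_real s * z) (b + of_real s * w))"
proof (rule strip_decayI)
  have sub: "(\<lambda>z. (a + of_real s * fst z, b + of_real s * snd z)) ` {z. Im (fst z) \<in> {y. Im a + s * y \<in> S} \<and> Im (snd z) \<in> {y. Im b + s * y \<in> T}}
     \<subseteq> {z. Im (fst z) \<in> S \<and> Im (snd z) \<in> T}" by auto
  have "continuous_on {z. Im (fst z) \<in> {y. Im a + s * y \<in> S} \<and> Im (snd z) \<in> {y. Im b + s * y \<in> T}}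
     ((\<lambda>z. f (fst z) (snd z)) \<circ> (\<lambda>z. (a + of_real s * fst z, b + of_real s * snd z)))"
    by (rule continuous_on_compose[OF _ continuous_on_subset[OF strip_decayD(1)[OF f] sub]])
       (intro continuous_intros)
  then show "continuous_on {z. Im (fst z) \<in> {y. Im a + s * y \<in> S} \<and> Im (snd z) \<in> {y. Im b + s * y \<in> T}}
     (\<lambda>z. f (a + of_real s * fst z) (b + of_real s * snd z))" by (simp add: o_def)
  show "(\<lambda>z. f (a + of_real s * z) (b + of_real s * w)) holomorphic_on {z. Im z \<in> {y. Im a + s * y \<in> S}}"
    if "Im w \<in> {y. Im b + s * y \<in> T}" for w
  proof -
    have "((\<lambda>z. f z (b + of_real s * w)) \<circ> (\<lambda>z. a + of_real s * z)) holomorphic_on {z. Im z \<in> {y. Im a + s * y \<in> S}}"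
      by (rule holomorphic_on_compose_gen[OF _ strip_decayD(2)[OF f]]) (use that in \<open>auto intro!: holomorphic_intros\<close>)
    then show ?thesis by (simp add: o_def)
  qed
  show "(\<lambda>w. f (a + of_real s * z) (b + of_real s * w)) holomorphic_on {w. Im w \<in> {y. Im b + s * y \<in> T}}"
    if "Im z \<in> {y. Im a + s * y \<in> S}" for z
  proof -
    have "(f (a + of_real s * z) \<circ> (\<lambda>w. b + of_real s * w)) holomorphic_on {w. Im w \<in> {y. Im b + s * y \<in> T}}"
      by (rule holomorphic_on_compose_gen[OF _ strip_decayD(3)[OF f]]) (use that in \<open>auto intro!: holomorphic_intros\<close>)
    then show ?thesis by (simp add: o_def)
  qed
  fix K L and c :: real assume K: "compact (K::real set)" "K \<subseteq> {y. Im a + s * y \<in> S}" "compact (L::real set)" "L \<subseteq> {y. Im b + s * y \<in> T}" and c: "c \<ge> 0"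
  have "compact ((\<lambda>y. Im a + s * y) ` K)" "compact ((\<lambda>y. Im b + s * y) ` L)"
    using K by (auto intro!: compact_continuous_image continuous_intros)
  then obtain M where M: "M > 0" "\<And>z w. Im z \<in> (\<lambda>y. Im a + s * y) ` K \<Longrightarrow> Im w \<in> (\<lambda>y. Im b + s * y) ` L \<Longrightarrow> cmod (f z w) \<le> M * exp (- (c * (\<bar>Re z\<bar> + \<bar>Re w\<bar>)))"
    using strip_decay_bound[OF f, of "(\<lambda>y. Im a + s * y) ` K" "(\<lambda>y. Im b + s * y) ` L" c] K by (auto simp: image_subset_iff subset_iff)
  show "\<exists>M. \<forall>z w. Im z \<in> K \<longrightarrow> Im w \<in> L \<longrightarrow> cmod (f (a + of_real s * z) (b + of_real s * w)) \<le> M * exp (- (c * (\<bar>Re z\<bar> + \<bar>Re w\<bar>)))"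
  proof (intro exI allI impI)
    fix z w assume zw: "Im z \<in> K" "Im w \<in> L"
    have "cmod (f (a + of_real s * z) (b + of_real s * w)) \<le> M * exp (- (c * (\<bar>Re a + s * Re z\<bar> + \<bar>Re b + s * Re w\<bar>)))"
      using M(2)[of "a + of_real s * z" "b + of_real s * w"] zw by auto
    also have "\<dots> \<le> M * exp (c * (\<bar>Re a\<bar> + \<bar>Re b\<bar>) + - (c * (\<bar>Re z\<bar> + \<bar>Re w\<bar>)))"
    proof -
      have "\<bar>Re z\<bar> + \<bar>Re w\<bar> \<le> (\<bar>Re a\<bar> + \<bar>Re b\<bar>) + (\<bar>Re a + s * Re z\<bar> + \<bar>Re b + s * Re w\<bar>)" using s by auto
      then have "c * (\<bar>Re z\<bar> + \<bar>Re w\<bar>) \<le> c * ((\<bar>Re a\<bar> + \<bar>Re b\<bar>) + (\<bar>Re a + s * Re z\<bar> + \<bar>Re b + s * Re w\<bar>))"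
        using c by (rule mult_left_mono)
      then show ?thesis using M(1) by (simp add: distrib_left)
    qed
    finally show "cmod (f (a + of_real s * z) (b + of_real s * w)) \<le> (M * exp (c * (\<bar>Re a\<bar> + \<bar>Re b\<bar>))) * exp (- (c * (\<bar>Re z\<bar> + \<bar>Re w\<bar>)))"
      by (simp only: exp_add mult.assoc)
  qed
qed

lemmas strip_decay_shift = strip_decay_affine[where s = 1, simplified]
lemmas strip_decay_reflect = strip_decay_affine[where s = "-1", simplified]

lemma slice_continuous:
  assumes f: "strip_decay S T f" and "Im a \<in> S" "Im b \<in> T"
  shows "continuous_on A (slice f a b)"
proof -
  have sub: "(\<lambda>p::real\<times>real. (of_real (fst p) + a, of_real (snd p) + b)) ` A \<subseteq> {z. Im (fst z) \<in> S \<and> Im (snd z) \<in> T}"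
    using assms by auto
  have "continuous_on A ((\<lambda>z. f (fst z) (snd z)) \<circ> (\<lambda>p::real\<times>real. (of_real (fst p) + a, of_real (snd p) + b)))"
    by (rule continuous_on_compose[OF _ continuous_on_subset[OF strip_decayD(1)[OF f] sub]])
       (intro continuous_intros)
  then show ?thesis by (simp add: o_def slice_def[abs_def])
qed

lemma slice_measurable:
  assumes "strip_decay S T f" "Im a \<in> S" "Im b \<in> T"
  shows "slice f a b \<in> borel_measurable borel"
  using slice_continuous[OF assms, of UNIV] by (rule borel_measurable_continuous_onI)

text \<open>Uniformity over bounded shifts supplies the local majorants for integrals that depend on
  the contour; moving the real parts by at most \<open>B\<close> costs the factor exp (2 c
  B).\<close>

lemma slice_bound_uniform:
  assumes f: "strip_decay S T f" and K: "compact K" "K \<subseteq> S" "compact L" "L \<subseteq> T" and c: "c \<ge> 0"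
  obtains M where "M > 0"
    "\<And>a b p. Im a \<in> K \<Longrightarrow> Im b \<in> L \<Longrightarrow> \<bar>Re a\<bar> \<le> B \<Longrightarrow> \<bar>Re b\<bar> \<le> B \<Longrightarrow>
       cmod (slice f a b p) \<le> M * exp (- (c * (\<bar>fst p\<bar> + \<bar>snd p\<bar>)))"
proof -
  obtain M where M: "M > 0" "\<And>z w. Im z \<in> K \<Longrightarrow> Im w \<in> L \<Longrightarrow> cmod (f z w) \<le> M * exp (- (c * (\<bar>Re z\<bar> + \<bar>Re w\<bar>)))"
    using strip_decay_bound[OF f K] by metis
  show ?thesis
  proof (rule that[of "M * exp (c * (B + B))"])
    fix a b p assume a: "Im a \<in> K" "Im b \<in> L" "\<bar>Re a\<bar> \<le> B" "\<bar>Re b\<bar> \<le> B"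
    have "cmod (slice f a b p) \<le> M * exp (- (c * (\<bar>fst p + Re a\<bar> + \<bar>snd p + Re b\<bar>)))"
      using M(2)[of "of_real (fst p) + a" "of_real (snd p) + b"] a by (simp add: slice_def)
    also have "\<dots> \<le> M * exp (c * (B + B) + - (c * (\<bar>fst p\<bar> + \<bar>snd p\<bar>)))"
    proof -
      have "\<bar>fst p\<bar> + \<bar>snd p\<bar> \<le> (B + B) + (\<bar>fst p + Re a\<bar> + \<bar>snd p + Re b\<bar>)" using a by auto
      then have "c * (\<bar>fst p\<bar> + \<bar>snd p\<bar>) \<le> c * ((B + B) + (\<bar>fst p + Re a\<bar> + \<bar>snd p + Re b\<bar>))"
        using c by (rule mult_left_mono)
      then show ?thesis using M(1) by (simp add: distrib_left)
    qed
    finally show "cmod (slice f a b p) \<le> (M * exp (c * (B + B))) * exp (- (c * (\<bar>fst p\<bar> + \<bar>snd p\<bar>)))"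
      by (simp only: exp_add mult.assoc)
  qed (use M in auto)
qed

lemma slice_bound:
  assumes f: "strip_decay S T f" and "Im a \<in> S" "Im b \<in> T" and c: "c \<ge> 0"
  obtains M where "M > 0" "\<And>p. cmod (slice f a b p) \<le> M * exp (- (c * (\<bar>fst p\<bar> + \<bar>snd p\<bar>)))"
proof -
  obtain M where "M > 0" "\<And>x y p. Im x \<in> {Im a} \<Longrightarrow> Im y \<in> {Im b} \<Longrightarrow> \<bar>Re x\<bar> \<le> \<bar>Re a\<bar> + \<bar>Re b\<bar> \<Longrightarrow> \<bar>Re y\<bar> \<le> \<bar>Re a\<bar> + \<bar>Re b\<bar> \<Longrightarrow>
       cmod (slice f x y p) \<le> M * exp (- (c * (\<bar>fst p\<bar> + \<bar>snd p\<bar>)))"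
    using slice_bound_uniform[OF f, of "{Im a}" "{Im b}" c "\<bar>Re a\<bar> + \<bar>Re b\<bar>"] assms
    by (metis compact_sing empty_subsetI insert_subset)
  then show ?thesis using that by simp
qed

lemma integrable_exp_dominated:
  fixes f :: "real \<times> real \<Rightarrow> complex"
  assumes "f \<in> borel_measurable borel" "c > 0" "\<And>p. cmod (f p) \<le> M * exp (- (c * (\<bar>fst p\<bar> + \<bar>snd p\<bar>)))"
  shows "integrable lborel f"
proof (rule Bochner_Integration.integrable_bound)
  show "integrable lborel (\<lambda>p::real\<times>real. M * exp (- (c * (\<bar>fst p\<bar> + \<bar>snd p\<bar>))))"
    using integrable_exp_abs2[OF assms(2)] by simp
  show "AE p in lborel. norm (f p) \<le> norm (M * exp (- (c * (\<bar>fst p\<bar> + \<bar>snd p\<bar>))))"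
    unfolding real_norm_def by (intro AE_I2 order_trans[OF assms(3) abs_ge_self])
qed (use assms in auto)

lemma square_integrable_exp_dominated:
  fixes f :: "real \<times> real \<Rightarrow> complex"
  assumes "f \<in> borel_measurable borel" "c > 0" "\<And>p. cmod (f p) \<le> M * exp (- (c * (\<bar>fst p\<bar> + \<bar>snd p\<bar>)))"
  shows "square_integrable f"
proof -
  have "integrable lborel (\<lambda>p. (cmod (f p))\<^sup>2)"
  proof (rule Bochner_Integration.integrable_bound)
    show "integrable lborel (\<lambda>p::real\<times>real. M\<^sup>2 * exp (- (2 * c * (\<bar>fst p\<bar> + \<bar>snd p\<bar>))))"
      using integrable_exp_abs2[of "2 * c"] assms(2) by simp
    have "(cmod (f p))\<^sup>2 \<le> M\<^sup>2 * exp (- (2 * c * (\<bar>fst p\<bar> + \<bar>snd p\<bar>)))" for p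
    proof -
      have "(cmod (f p))\<^sup>2 \<le> (M * exp (- (c * (\<bar>fst p\<bar> + \<bar>snd p\<bar>))))\<^sup>2" using assms(3) by (intro power_mono) auto
      then show ?thesis by (simp add: power_mult_distrib exp_double[symmetric] algebra_simps)
    qed
    then show "AE p in lborel. norm ((cmod (f p))\<^sup>2) \<le> norm (M\<^sup>2 * exp (- (2 * c * (\<bar>fst p\<bar> + \<bar>snd p\<bar>))))"
      by auto
  qed (use assms in auto)
  then show ?thesis using assms by (auto simp: square_integrable_def)
qed

lemma slice_integrable:
  assumes "strip_decay S T f" "Im a \<in> S" "Im b \<in> T"
  shows "integrable lborel (slice f a b)"
  by (rule slice_bound[OF assms zero_le_one], rule integrable_exp_dominated[OF slice_measurable[OF assms] zero_less_one])

lemma slice_square_integrable: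
  assumes "strip_decay S T f" "Im a \<in> S" "Im b \<in> T"
  shows "square_integrable (slice f a b)"
  by (rule slice_bound[OF assms zero_le_one], rule square_integrable_exp_dominated[OF slice_measurable[OF assms] zero_less_one])

text \<open>Along the real direction the derivative vanishes, and it is the complex derivative.\<close>

lemma holomorphic_translation_invariant_const:
  assumes hol: "G holomorphic_on U" and U: "open U" "convex U"
    and inv: "\<And>a t::real. a \<in> U \<Longrightarrow> G (a + of_real t) = G a" and ab: "a \<in> U" "b \<in> U"
  shows "G a = G b"
proof -
  have "(G has_field_derivative 0) (at z within U)" if z: "z \<in> U" for z
  proof -
    obtain D where D: "(G has_field_derivative D) (at z)" using hol U z by (meson holomorphic_derivI)
    then have lim: "(\<lambda>h. (G (z + h) - G z) / h) \<midarrow>0\<rightarrow> D" by (simp add: DERIV_def)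
    have "(\<lambda>n. (G (z + of_real (inverse (real (Suc n)))) - G z) / of_real (inverse (real (Suc n)))) \<longlonglongrightarrow> D"
    proof (rule filterlim_compose[OF lim], rule filterlim_atI)
      show "(\<lambda>n. complex_of_real (inverse (real (Suc n)))) \<longlonglongrightarrow> 0"
        using tendsto_of_real[OF LIMSEQ_inverse_real_of_nat, where 'a = complex] by (simp only: of_real_0)
      have "complex_of_real (inverse (real (Suc n))) \<noteq> 0" for n
        using of_nat_eq_0_iff[of "Suc n", where 'a = real] by (simp only: of_real_eq_0_iff inverse_nonzero_iff_nonzero)
      then show "\<forall>\<^sub>F n in sequentially. complex_of_real (inverse (real (Suc n))) \<noteq> 0"
        by (intro always_eventually) blast
    qed
    then have "(\<lambda>n::nat. 0::complex) \<longlonglongrightarrow> D" unfolding inv[OF z] by simp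
    then have "D = 0" using LIMSEQ_unique tendsto_const by blast
    with D show ?thesis by (simp add: has_field_derivative_at_within)
  qed
  then show ?thesis using has_field_derivative_zero_constant[OF U(2)] ab by metis
qed

section \<open>Integrals over planes depending on two complex parameters\<close>

text \<open>The local majorant in both parameters under which continuity and holomorphy pass to the
  integral over \<open>p\<close>. One fixed integrable weight is enough, as all kernels decay faster
  than it.\<close>

definition locally_dominated :: "real set \<Rightarrow> real set \<Rightarrow> (complex \<Rightarrow> complex \<Rightarrow> real \<times> real \<Rightarrow> complex) \<Rightarrow> bool" where
  "locally_dominated S T q \<longleftrightarrow> (\<forall>a b. Im a \<in> S \<longrightarrow> Im b \<in> T \<longrightarrow>
     (\<exists>e>0. \<exists>M. \<forall>z w p. dist z a < e \<longrightarrow> dist w b < e \<longrightarrow> Im z \<in> S \<longrightarrow> Im w \<in> T \<longrightarrow>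
        cmod (q z w p) \<le> M * exp (- (\<bar>fst p\<bar> + \<bar>snd p\<bar>))))"

lemma integral_holomorphic1:
  assumes dom: "locally_dominated S T q" and S: "open S" and b: "Im b \<in> T"
    and hol: "\<And>p. (\<lambda>z. q z b p) holomorphic_on {z. Im z \<in> S}"
    and meas: "\<And>z. Im z \<in> S \<Longrightarrow> q z b \<in> borel_measurable borel"
  shows "(\<lambda>z. \<integral>p. q z b p \<partial>lborel) holomorphic_on {z. Im z \<in> S}"
proof (rule holomorphic_on_local[OF open_Im[OF S]])
  fix a assume a: "a \<in> {z. Im z \<in> S}"
  then obtain e M where e: "e > 0" "\<And>z w p. dist z a < e \<Longrightarrow> dist w b < e \<Longrightarrow> Im z \<in> S \<Longrightarrow> Im w \<in> T \<Longrightarrow>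
        cmod (q z w p) \<le> M * exp (- (\<bar>fst p\<bar> + \<bar>snd p\<bar>))"
    using dom b unfolding locally_dominated_def by (metis mem_Collect_eq)
  define V where "V = ball a e \<inter> {z. Im z \<in> S}"
  have V: "open V" "a \<in> V" using S a e by (auto simp: V_def intro!: open_Im)
  have "(\<lambda>z. \<integral>p. q z b p \<partial>lborel) holomorphic_on V"
  proof (rule holomorphic_on_integral[OF V(1)])
    show "integrable lborel (\<lambda>p::real\<times>real. M * exp (- (1 * (\<bar>fst p\<bar> + \<bar>snd p\<bar>))))"
      using integrable_exp_abs2[of 1] by simp
    show "(\<lambda>z. q z b p) holomorphic_on V" for p using hol by (rule holomorphic_on_subset) (auto simp: V_def)
    show "cmod (q z b p) \<le> M * exp (- (1 * (\<bar>fst p\<bar> + \<bar>snd p\<bar>)))" if "z \<in> V" for z p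
      using e(2)[of z b p] that e(1) b by (auto simp: V_def dist_commute)
  qed (use meas in \<open>auto simp: V_def\<close>)
  with V show "\<exists>V. open V \<and> a \<in> V \<and> (\<lambda>z. \<integral>p. q z b p \<partial>lborel) holomorphic_on V" by blast
qed

lemma integral_holomorphic2:
  assumes dom: "locally_dominated S T q" and T: "open T" and a: "Im a \<in> S"
    and hol: "\<And>p. (\<lambda>w. q a w p) holomorphic_on {w. Im w \<in> T}"
    and meas: "\<And>w. Im w \<in> T \<Longrightarrow> q a w \<in> borel_measurable borel"
  shows "(\<lambda>w. \<integral>p. q a w p \<partial>lborel) holomorphic_on {w. Im w \<in> T}"
proof (rule integral_holomorphic1[where q = "\<lambda>w z. q z w"])
  show "locally_dominated T S (\<lambda>w z. q z w)" using dom unfolding locally_dominated_def by meson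
qed (use assms in auto)

lemma integral_continuous:
  assumes dom: "locally_dominated S T q" and S: "open S" "open T"
    and cont: "\<And>p. continuous_on {z. Im (fst z) \<in> S \<and> Im (snd z) \<in> T} (\<lambda>z. q (fst z) (snd z) p)"
    and meas: "\<And>z w. Im z \<in> S \<Longrightarrow> Im w \<in> T \<Longrightarrow> q z w \<in> borel_measurable borel"
  shows "continuous_on {z. Im (fst z) \<in> S \<and> Im (snd z) \<in> T} (\<lambda>z. \<integral>p. q (fst z) (snd z) p \<partial>lborel)"
proof (rule continuous_on_local)
  let ?R = "{z. Im (fst z) \<in> S \<and> Im (snd z) \<in> T}"
  have oR: "open ?R"
  proof -
    have "?R = {z. Im z \<in> S} \<times> {w. Im w \<in> T}" by auto
    then show ?thesis using S by (simp add: open_Times open_Im)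
  qed
  fix z assume z: "z \<in> ?R"
  then obtain e M where e: "e > 0" "\<And>x w p. dist x (fst z) < e \<Longrightarrow> dist w (snd z) < e \<Longrightarrow> Im x \<in> S \<Longrightarrow> Im w \<in> T \<Longrightarrow>
        cmod (q x w p) \<le> M * exp (- (\<bar>fst p\<bar> + \<bar>snd p\<bar>))"
    using dom unfolding locally_dominated_def by (metis (mono_tags, lifting) mem_Collect_eq)
  define V where "V = (ball (fst z) e \<times> ball (snd z) e) \<inter> ?R"
  have V: "open V" "z \<in> V" using oR z e by (auto simp: V_def open_Times mem_Times_iff)
  have "continuous_on V (\<lambda>z. \<integral>p. q (fst z) (snd z) p \<partial>lborel)"
  proof (rule continuous_on_integral_dominated)
    show "integrable lborel (\<lambda>p::real\<times>real. M * exp (- (1 * (\<bar>fst p\<bar> + \<bar>snd p\<bar>))))"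
      using integrable_exp_abs2[of 1] by simp
    show "continuous_on V (\<lambda>z. q (fst z) (snd z) p)" for p
      using cont by (rule continuous_on_subset) (auto simp: V_def)
    show "cmod (q (fst z) (snd z) p) \<le> M * exp (- (1 * (\<bar>fst p\<bar> + \<bar>snd p\<bar>)))" if "z \<in> V" for z p
      using e(2)[of "fst z" "snd z" p] that by (auto simp: V_def dist_commute)
  qed (use meas in \<open>auto simp: V_def\<close>)
  with V show "\<exists>V. open V \<and> z \<in> V \<and> continuous_on V (\<lambda>z. \<integral>p. q (fst z) (snd z) p \<partial>lborel)" by blast
qed

lemma compact_Im_nbhd:
  assumes "open S" "Im a \<in> S"
  obtains e where "e > 0" "e \<le> 1" "cball (Im a) e \<subseteq> S" "\<And>z. dist z a < e \<Longrightarrow> Im z \<in> cball (Im a) e \<and> \<bar>Re z\<bar> \<le> \<bar>Re a\<bar> + 1"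
proof -
  obtain e' where e': "e' > 0" "cball (Im a) e' \<subseteq> S" using assms open_contains_cball by blast
  show ?thesis
  proof (rule that[of "min e' 1"])
    show "Im z \<in> cball (Im a) (min e' 1) \<and> \<bar>Re z\<bar> \<le> \<bar>Re a\<bar> + 1" if "dist z a < min e' 1" for z
      using that abs_Im_le_cmod[of "z - a"] abs_Re_le_cmod[of "z - a"] by (auto simp: dist_norm)
  qed (use e' in \<open>auto simp: subset_iff\<close>)
qed

lemma slice_locally_dominated:
  assumes f: "strip_decay S T f" and S: "open S" "open T"
  shows "locally_dominated S T (\<lambda>a b. slice f a b)"
  unfolding locally_dominated_def
proof (intro allI impI)
  fix a b assume ab: "Im a \<in> S" "Im b \<in> T"
  obtain e1 where e1: "e1 > 0" "cball (Im a) e1 \<subseteq> S" "\<And>z. dist z a < e1 \<Longrightarrow> Im z \<in> cball (Im a) e1 \<and> \<bar>Re z\<bar> \<le> \<bar>Re a\<bar> + 1"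
    using compact_Im_nbhd[OF S(1) ab(1)] by metis
  obtain e2 where e2: "e2 > 0" "cball (Im b) e2 \<subseteq> T" "\<And>z. dist z b < e2 \<Longrightarrow> Im z \<in> cball (Im b) e2 \<and> \<bar>Re z\<bar> \<le> \<bar>Re b\<bar> + 1"
    using compact_Im_nbhd[OF S(2) ab(2)] by metis
  obtain M where M: "\<And>z w p. Im z \<in> cball (Im a) e1 \<Longrightarrow> Im w \<in> cball (Im b) e2 \<Longrightarrow> \<bar>Re z\<bar> \<le> \<bar>Re a\<bar> + \<bar>Re b\<bar> + 1 \<Longrightarrow> \<bar>Re w\<bar> \<le> \<bar>Re a\<bar> + \<bar>Re b\<bar> + 1 \<Longrightarrow>
       cmod (slice f z w p) \<le> M * exp (- (1 * (\<bar>fst p\<bar> + \<bar>snd p\<bar>)))"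
    using slice_bound_uniform[OF f compact_cball e1(2) compact_cball e2(2) zero_le_one] by metis
  show "\<exists>e>0. \<exists>M. \<forall>z w p. dist z a < e \<longrightarrow> dist w b < e \<longrightarrow> Im z \<in> S \<longrightarrow> Im w \<in> T \<longrightarrow>
        cmod (slice f z w p) \<le> M * exp (- (\<bar>fst p\<bar> + \<bar>snd p\<bar>))"
  proof (rule exI[of _ "min e1 e2"], rule conjI, goal_cases)
    case 2
    show ?case
    proof (rule exI[of _ M], intro allI impI)
    fix z w p assume "dist z a < min e1 e2" "dist w b < min e1 e2"
    then show "cmod (slice f z w p) \<le> M * exp (- (\<bar>fst p\<bar> + \<bar>snd p\<bar>))"
      using M[of z w p] e1(3)[of z] e2(3)[of w] by force
    qed
  qed (use e1 e2 in auto)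
qed

text \<open>Cauchy's theorem without path integrals: the integral is holomorphic in the shift
  \<open>a\<close>, and translation invariance of Lebesgue measure makes it invariant under real
  translations of \<open>a\<close>, hence constant on the convex strip. The same argument applies to
  \<open>b\<close>.\<close>

lemma slice_integral_shift:
  assumes f: "strip_decay S T f" and S: "open S" "convex S" "open T" "convex T"
    and ab: "Im a \<in> S" "Im b \<in> T" "Im a' \<in> S" "Im b' \<in> T"
  shows "(\<integral>p. slice f a b p \<partial>lborel) = (\<integral>p. slice f a' b' p \<partial>lborel)"
proof -
  have hol1: "(\<lambda>a. \<integral>p. slice f a b p \<partial>lborel) holomorphic_on {z. Im z \<in> S}"
  proof (rule integral_holomorphic1[OF slice_locally_dominated[OF f S(1) S(3)] S(1) ab(2)])
    fix p
    have "((\<lambda>z. f z (of_real (snd p) + b)) \<circ> (\<lambda>z. of_real (fst p) + z)) holomorphic_on {z. Im z \<in> S}"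
      by (rule holomorphic_on_compose_gen[OF _ strip_decayD(2)[OF f]]) (use ab in \<open>auto intro!: holomorphic_intros\<close>)
    then show "(\<lambda>z. slice f z b p) holomorphic_on {z. Im z \<in> S}" by (simp add: o_def slice_def)
  qed (use slice_measurable[OF f] ab in auto)
  have inv1: "(\<integral>p. slice f (z + of_real t) b p \<partial>lborel) = (\<integral>p. slice f z b p \<partial>lborel)" for z t
    using lborel_integral_translate[of "\<lambda>p. slice f z b p" "(t, 0)"]
    by (simp add: slice_def add.commute add.left_commute)
  have hol2: "(\<lambda>b. \<integral>p. slice f a' b p \<partial>lborel) holomorphic_on {z. Im z \<in> T}"
  proof (rule integral_holomorphic2[OF slice_locally_dominated[OF f S(1) S(3)] S(3) ab(3)])
    fix p
    have "(f (of_real (fst p) + a') \<circ> (\<lambda>z. of_real (snd p) + z)) holomorphic_on {z. Im z \<in> T}"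
      by (rule holomorphic_on_compose_gen[OF _ strip_decayD(3)[OF f]]) (use ab in \<open>auto intro!: holomorphic_intros\<close>)
    then show "(\<lambda>z. slice f a' z p) holomorphic_on {z. Im z \<in> T}" by (simp add: o_def slice_def)
  qed (use slice_measurable[OF f] ab in auto)
  have inv2: "(\<integral>p. slice f a' (z + of_real t) p \<partial>lborel) = (\<integral>p. slice f a' z p \<partial>lborel)" for z t
    using lborel_integral_translate[of "\<lambda>p. slice f a' z p" "(0, t)"]
    by (simp add: slice_def add.commute add.left_commute)
  have "(\<integral>p. slice f a b p \<partial>lborel) = (\<integral>p. slice f a' b p \<partial>lborel)"
    by (rule holomorphic_translation_invariant_const[where G = "\<lambda>a. \<integral>p. slice f a b p \<partial>lborel" and U = "{z. Im z \<in> S}"])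
       (use hol1 inv1 open_Im[OF S(1)] convex_Im[OF S(2)] ab in simp_all)
  also have "\<dots> = (\<integral>p. slice f a' b' p \<partial>lborel)"
    by (rule holomorphic_translation_invariant_const[where G = "\<lambda>b. \<integral>p. slice f a' b p \<partial>lborel" and U = "{z. Im z \<in> T}"])
       (use hol2 inv2 open_Im[OF S(3)] convex_Im[OF S(4)] ab in simp_all)
  finally show ?thesis .
qed


subsection \<open>Gaussians and the uniqueness of functions with vanishing Gaussian moments\<close>

text \<open>The complex parameters cover real centres and modulations at once. The family is closed
  under products, and under the Fourier transform up to constants.\<close>

definition gauss :: "real \<Rightarrow> complex \<Rightarrow> complex \<Rightarrow> complex \<Rightarrow> complex \<Rightarrow> complex" where
  "gauss a w1 w2 z1 z2 = exp (- of_real (pi * a) * (z1\<^sup>2 + z2\<^sup>2) + 2 * of_real pi * (w1 * z1 + w2 * z2))"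

text \<open>Completing the square with a free \<open>c\<close>: a Gaussian decays faster than every
  exponential.\<close>

lemma neg_square_le:
  fixes x b c :: real assumes "b > 0" shows "- (b * x\<^sup>2) \<le> c\<^sup>2 / (4 * b) - c * \<bar>x\<bar>"
proof -
  have "0 \<le> (2 * b * \<bar>x\<bar> - c)\<^sup>2 / (4 * b)" using assms by simp
  also have "\<dots> = b * x\<^sup>2 - c * \<bar>x\<bar> + c\<^sup>2 / (4 * b)"
    using assms by (simp add: field_simps power2_eq_square)
  finally show ?thesis by simp
qed

lemma strip_decay_gauss: assumes a: "a > 0" shows "strip_decay UNIV UNIV (gauss a w1 w2)"
proof -
  have "strip_decay UNIV UNIV (\<lambda>z1 z2. exp (- of_real (pi * a) * (z1\<^sup>2 + z2\<^sup>2)))"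
  proof (rule strip_decayI)
    fix K L and c :: real assume K: "compact (K::real set)" "compact (L::real set)"
    obtain B1 where B1: "B1 > 0" "\<And>x. x \<in> K \<Longrightarrow> \<bar>x\<bar> \<le> B1" using compact_abs_bounded K by metis
    obtain B2 where B2: "B2 > 0" "\<And>x. x \<in> L \<Longrightarrow> \<bar>x\<bar> \<le> B2" using compact_abs_bounded K by metis
    show "\<exists>M. \<forall>z w. Im z \<in> K \<longrightarrow> Im w \<in> L \<longrightarrow>
       cmod (exp (- of_real (pi * a) * (z\<^sup>2 + w\<^sup>2))) \<le> M * exp (- (c * (\<bar>Re z\<bar> + \<bar>Re w\<bar>)))"
    proof (intro exI allI impI)
      fix z w :: complex assume zw: "Im z \<in> K" "Im w \<in> L"
      have sq: "(Im z)\<^sup>2 \<le> B1\<^sup>2" "(Im w)\<^sup>2 \<le> B2\<^sup>2"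
        using B1(2)[OF zw(1)] B2(2)[OF zw(2)] B1(1) B2(1) by (simp_all add: abs_le_square_iff[symmetric])
      have pa: "pi * a > 0" using a by simp
      have "Re (- of_real (pi * a) * (z\<^sup>2 + w\<^sup>2)) = - (pi * a * (Re z)\<^sup>2) - (pi * a * (Re w)\<^sup>2) + pi * a * ((Im z)\<^sup>2 + (Im w)\<^sup>2)"
        by (simp add: power2_eq_square algebra_simps)
      also have "\<dots> \<le> (c\<^sup>2 / (4 * (pi * a)) - c * \<bar>Re z\<bar>) + (c\<^sup>2 / (4 * (pi * a)) - c * \<bar>Re w\<bar>) + pi * a * (B1\<^sup>2 + B2\<^sup>2)"
        using neg_square_le[OF pa, of "Re z" c] neg_square_le[OF pa, of "Re w" c]
          mult_left_mono[OF add_mono[OF sq], of "pi * a"] pa by linarith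
      also have "\<dots> = (2 * (c\<^sup>2 / (4 * (pi * a))) + pi * a * (B1\<^sup>2 + B2\<^sup>2)) + - (c * (\<bar>Re z\<bar> + \<bar>Re w\<bar>))"
        by (simp add: algebra_simps)
      finally show "cmod (exp (- of_real (pi * a) * (z\<^sup>2 + w\<^sup>2))) \<le>
         exp (2 * (c\<^sup>2 / (4 * (pi * a))) + pi * a * (B1\<^sup>2 + B2\<^sup>2)) * exp (- (c * (\<bar>Re z\<bar> + \<bar>Re w\<bar>)))"
        unfolding norm_exp_eq_Re exp_add[symmetric] by simp
    qed
  qed (auto intro!: continuous_intros holomorphic_intros)
  from strip_decay_exp_mult[OF this, of "2 * of_real pi * w1" "2 * of_real pi * w2" 0]
  show ?thesis unfolding gauss_def[abs_def] exp_add[symmetric] by (simp add: algebra_simps)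
qed

lemma gauss_0: "slice (gauss a 0 0) 0 0 p = of_real (exp (- (pi * a) * ((fst p)\<^sup>2 + (snd p)\<^sup>2)))"
  by (simp add: slice_def gauss_def flip: exp_of_real)

lemma gauss_integral_0: assumes a: "a > 0"
  shows "(\<integral>p. slice (gauss a 0 0) 0 0 p \<partial>lborel) = of_real (1 / a)"
proof -
  \<comment> \<open>The standard deviation for which the normal density is a multiple of exp(-pi a
    x^2).\<close>
  define \<sigma> where "\<sigma> = 1 / sqrt (2 * pi * a)"
  have \<sigma>: "\<sigma>\<^sup>2 = 1 / (2 * pi * a)" using a by (simp add: \<sigma>_def power_divide)
  have nd: "exp (- (pi * a) * x\<^sup>2) = (1 / sqrt a) * normal_density 0 \<sigma> x" for x
    using a by (simp add: normal_density_def \<sigma> real_sqrt_divide)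
  have "\<sigma> > 0" using a by (simp add: \<sigma>_def)
  then have i1: "integrable lborel (\<lambda>x. exp (- (pi * a) * x\<^sup>2))" unfolding nd by simp
  have v1: "(\<integral>x. exp (- (pi * a) * x\<^sup>2) \<partial>lborel) = 1 / sqrt a" unfolding nd using a by (simp add: \<sigma>_def)
  have int: "integrable lborel (\<lambda>p. exp (- (pi * a) * (fst p)\<^sup>2) * exp (- (pi * a) * (snd p)\<^sup>2))"
    using slice_integrable[OF strip_decay_gauss[OF a], of 0 0 0 0]
    unfolding gauss_0[abs_def] by (simp add: exp_add[symmetric] algebra_simps complex_of_real_integrable_eq)
  have "(\<integral>p. exp (- (pi * a) * (fst p)\<^sup>2) * exp (- (pi * a) * (snd p)\<^sup>2) \<partial>(lborel::(real\<times>real) measure))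
    = (\<integral>x. \<integral>y. exp (- (pi * a) * x\<^sup>2) * exp (- (pi * a) * y\<^sup>2) \<partial>lborel \<partial>lborel)"
    using lborel_pair.integral_fst'[of "\<lambda>p. exp (- (pi * a) * (fst p)\<^sup>2) * exp (- (pi * a) * (snd p)\<^sup>2)"] int
    by (simp add: lborel_prod)
  also have "\<dots> = 1 / a" using v1 a by simp
  finally have "(\<integral>p. exp (- (pi * a) * ((fst p)\<^sup>2 + (snd p)\<^sup>2)) \<partial>(lborel::(real\<times>real) measure)) = 1 / a"
    by (simp add: exp_add[symmetric] algebra_simps)
  then show ?thesis unfolding gauss_0[abs_def] by (simp only: integral_complex_of_real)
qed

text \<open>Completing the square moves the Gaussian to the complex centre w / a, and
  \<open>slice_integral_shift\<close> brings the contour back to the real plane.\<close>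

lemma gauss_integral: assumes a: "a > 0"
  shows "(\<integral>p. slice (gauss a w1 w2) 0 0 p \<partial>lborel) = of_real (1 / a) * exp (of_real (pi / a) * (w1\<^sup>2 + w2\<^sup>2))"
proof -
  have e: "slice (gauss a w1 w2) 0 0 p = exp (of_real (pi / a) * (w1\<^sup>2 + w2\<^sup>2)) * slice (gauss a 0 0) (- w1 / of_real a) (- w2 / of_real a) p" for p
    unfolding slice_def gauss_def exp_add[symmetric] using a
    by (intro arg_cong[where f = exp]) (simp add: power2_eq_square field_simps)
  show ?thesis unfolding e
    using slice_integral_shift[OF strip_decay_gauss[OF a], of "- w1 / of_real a" "- w2 / of_real a" 0 0 0 0] gauss_integral_0[OF a]
    by simp
qed

lemma cis_inner: "cis (c * (p \<bullet> x)) = exp (\<i> * of_real c * (of_real (fst p) * of_real (fst x) + of_real (snd p) * of_real (snd x)))"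
  for p x :: "real \<times> real"
  by (simp add: cis_conv_exp inner_prod_def algebra_simps)

lemma slice_gauss_cis:
  "slice (gauss a w1 w2) 0 0 x * cis (2 * pi * (p \<bullet> x)) = slice (gauss a (w1 + \<i> * of_real (fst p)) (w2 + \<i> * of_real (snd p))) 0 0 x"
  unfolding cis_inner slice_def gauss_def exp_add[symmetric] by (simp add: algebra_simps)

lemma fourier_gauss: assumes a: "a > 0"
  shows "fourier_integral (slice (gauss a w1 w2) 0 0) p =
     of_real (1 / a) * exp (of_real (pi / a) * (w1\<^sup>2 + w2\<^sup>2)) * slice (gauss (1 / a) (- \<i> * w1 / of_real a) (- \<i> * w2 / of_real a)) 0 0 p"
proof -
  have "fourier_integral (slice (gauss a w1 w2) 0 0) p = (\<integral>x. slice (gauss a w1 w2) 0 0 x * cis (2 * pi * (- p \<bullet> x)) \<partial>lborel)"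
    by (simp add: fourier_integral_def)
  also have "\<dots> = of_real (1 / a) * exp (of_real (pi / a) * ((w1 - \<i> * of_real (fst p))\<^sup>2 + (w2 - \<i> * of_real (snd p))\<^sup>2))"
    unfolding slice_gauss_cis gauss_integral[OF a] by simp
  also have "exp (of_real (pi / a) * ((w1 - \<i> * of_real (fst p))\<^sup>2 + (w2 - \<i> * of_real (snd p))\<^sup>2)) =
     exp (of_real (pi / a) * (w1\<^sup>2 + w2\<^sup>2)) * slice (gauss (1 / a) (- \<i> * w1 / of_real a) (- \<i> * w2 / of_real a)) 0 0 p"
    unfolding slice_def gauss_def exp_add[symmetric] using a
    by (intro arg_cong[where f = exp]) (simp add: power2_eq_square field_simps)
  finally show ?thesis by simp
qed

definition fourier_inv_integral :: "(real \<times> real \<Rightarrow> complex) \<Rightarrow> real \<times> real \<Rightarrow> complex" where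
  "fourier_inv_integral f x = (\<integral>p. f p * cis (2 * pi * (p \<bullet> x)) \<partial>lborel)"

text \<open>Inversion for the one family with explicit integrals; the general inversion theorem is
  deduced from it by duality.\<close>

lemma fourier_inv_gauss:
  assumes a: "a > 0"
  shows "fourier_inv_integral (fourier_integral (slice (gauss a w1 w2) 0 0)) x = slice (gauss a w1 w2) 0 0 x"
proof -
  have "fourier_inv_integral (fourier_integral (slice (gauss a w1 w2) 0 0)) x =
    of_real (1 / a) * exp (of_real (pi / a) * (w1\<^sup>2 + w2\<^sup>2)) * (\<integral>p. slice (gauss (1 / a) (- \<i> * w1 / of_real a) (- \<i> * w2 / of_real a)) 0 0 p * cis (2 * pi * (x \<bullet> p)) \<partial>lborel)"
    unfolding fourier_inv_integral_def fourier_gauss[OF a] by (simp add: mult.assoc inner_commute)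
  also have "\<dots> = exp (of_real (pi / a) * (w1\<^sup>2 + w2\<^sup>2)) * exp (of_real (pi * a) * ((- \<i> * w1 / of_real a + \<i> * of_real (fst x))\<^sup>2 + (- \<i> * w2 / of_real a + \<i> * of_real (snd x))\<^sup>2))"
    unfolding slice_gauss_cis using a by (subst gauss_integral) simp_all
  also have "\<dots> = slice (gauss a w1 w2) 0 0 x"
    unfolding slice_def gauss_def exp_add[symmetric] using a
    by (intro arg_cong[where f = exp]) (simp add: power2_eq_square field_simps)
  finally show ?thesis .
qed


section \<open>From vanishing Gaussian moments to vanishing almost everywhere\<close>

lemma lborel_integral_affine:
  fixes f :: "'a::euclidean_space \<Rightarrow> 'b::{banach, second_countable_topology}"
  assumes [measurable]: "f \<in> borel_measurable borel" and c: "c \<noteq> 0"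
  shows "(\<integral>x. f x \<partial>lborel) = \<bar>c\<bar> ^ DIM('a) *\<^sub>R (\<integral>x. f (t + c *\<^sub>R x) \<partial>lborel)"
proof -
  have "(\<integral>x. f x \<partial>lborel) = (\<integral>x. f x \<partial>density (distr lborel borel (\<lambda>x. t + c *\<^sub>R x)) (\<lambda>_. ennreal (\<bar>c\<bar> ^ DIM('a))))"
    by (subst lborel_affine[OF c, of t]) simp
  also have "\<dots> = (\<integral>x. \<bar>c\<bar> ^ DIM('a) *\<^sub>R f x \<partial>distr lborel borel (\<lambda>x. t + c *\<^sub>R x))"
    by (subst integral_density) auto
  also have "\<dots> = (\<integral>x. \<bar>c\<bar> ^ DIM('a) *\<^sub>R f (t + c *\<^sub>R x) \<partial>lborel)"
    by (subst integral_distr) auto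
  finally show ?thesis by simp
qed

text \<open>Sets over which the integral vanishes form a Dynkin system, and the open sets are a
  generator closed under intersections. Real and imaginary parts are treated separately, as
  densities of the zero measure.\<close>

lemma AE_zero_of_open_integrals:
  fixes v :: "'a::euclidean_space \<Rightarrow> complex"
  assumes v: "integrable lborel v"
    and zero: "\<And>U. open U \<Longrightarrow> (\<integral>x. indicator U x *\<^sub>R v x \<partial>lborel) = 0"
  shows "AE x in lborel. v x = 0"
proof -
  have int: "integrable lborel (\<lambda>x. indicator A x *\<^sub>R v x)" if "A \<in> sets borel" for A
    using that v by (intro integrable_mult_indicator) auto
  have all: "(\<integral>x. indicator A x *\<^sub>R v x \<partial>lborel) = 0" if "A \<in> sets borel" for A
  proof -
    have "Int_stable {S::'a set. open S}" by (auto simp: Int_stable_def)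
    moreover have "{S::'a set. open S} \<subseteq> Pow UNIV" by auto
    moreover have "A \<in> sigma_sets UNIV {S. open S}" using that by (simp add: borel_def)
    ultimately show ?thesis
    proof (induction rule: sigma_sets_induct_disjoint)
      case (basic A) then show ?case using zero by auto
    next
      case empty then show ?case by simp
    next
      case (compl A)
      then have A: "A \<in> sets borel" by (simp add: borel_def)
      have "(\<integral>x. indicator (UNIV - A) x *\<^sub>R v x \<partial>lborel) = (\<integral>x. indicator UNIV x *\<^sub>R v x - indicator A x *\<^sub>R v x \<partial>lborel)"
        by (intro Bochner_Integration.integral_cong) (auto simp: indicator_def)
      also have "\<dots> = 0" using int[OF A] int[of UNIV] compl zero[of UNIV] by (subst Bochner_Integration.integral_diff) auto
      finally show ?case .
    next
      case (union A)
      then have A: "A i \<in> sets borel" for i by (auto simp: borel_def)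
      have "(\<integral>x. indicator (\<Union>i. A i) x *\<^sub>R v x \<partial>lborel) = (\<Sum>i. \<integral>x. indicator (A i) x *\<^sub>R v x \<partial>lborel)"
        using lebesgue_integral_countable_add[of A lborel v] A union(1) int[of "\<Union>i. A i"]
        by (auto simp: set_lebesgue_integral_def set_integrable_def disjoint_family_on_def)
      then show ?case using union by simp
    qed
  qed
  have re: "AE x in lborel. Re (v x) = 0"
  proof (rule density_unique_real)
    fix A assume "A \<in> sets (lborel::'a measure)"
    then have A: "A \<in> sets borel" by simp
    have "(\<integral>x. Re (indicator A x *\<^sub>R v x) \<partial>lborel) = 0" unfolding integral_Re[OF int[OF A]] all[OF A] by simp
    then show "(LINT x:A|lborel. Re (v x)) = (LINT x:A|lborel. 0)" by (simp add: set_lebesgue_integral_def)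
  qed (use v in auto)
  have im: "AE x in lborel. Im (v x) = 0"
  proof (rule density_unique_real)
    fix A assume "A \<in> sets (lborel::'a measure)"
    then have A: "A \<in> sets borel" by simp
    have "(\<integral>x. Im (indicator A x *\<^sub>R v x) \<partial>lborel) = 0" unfolding integral_Im[OF int[OF A]] all[OF A] by simp
    then show "(LINT x:A|lborel. Im (v x)) = (LINT x:A|lborel. 0)" by (simp add: set_lebesgue_integral_def)
  qed (use v in auto)
  from re im show ?thesis by eventually_elim (simp add: complex_eq_iff)
qed

text \<open>The indicator of an open set is the pointwise limit of the truncated multiples of the
  distance to its complement.\<close>

lemma AE_zero_of_continuous_integrals:
  fixes v :: "'a::euclidean_space \<Rightarrow> complex"
  assumes v: "integrable lborel v"
    and zero: "\<And>\<phi>::'a \<Rightarrow> real. continuous_on UNIV \<phi> \<Longrightarrow> (\<And>x. \<bar>\<phi> x\<bar> \<le> 1) \<Longrightarrow> (\<integral>x. \<phi> x *\<^sub>R v x \<partial>lborel) = 0"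
  shows "AE x in lborel. v x = 0"
proof (rule AE_zero_of_open_integrals[OF v])
  fix U :: "'a set" assume U: "open U"
  show "(\<integral>x. indicator U x *\<^sub>R v x \<partial>lborel) = 0"
  \<comment> \<open>The complement must be nonempty: \<open>infdist\<close> to the empty set is 0 by
    convention, and the approximation would vanish identically.\<close>
  proof (cases "U = UNIV")
    case True then show ?thesis using zero[of "\<lambda>_. 1"] by simp
  next
    case False
    define \<phi> where "\<phi> n x = min 1 (real n * infdist x (- U))" for n x
    have "(\<lambda>n. \<integral>x. \<phi> n x *\<^sub>R v x \<partial>lborel) \<longlonglongrightarrow> (\<integral>x. indicator U x *\<^sub>R v x \<partial>lborel)"
    proof (rule integral_dominated_convergence[where w = "\<lambda>x. norm (v x)"])
      show "(\<lambda>x. indicator U x *\<^sub>R v x) \<in> borel_measurable lborel" using borel_open[OF U] borel_measurable_integrable[OF v] by measurable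
      show "(\<lambda>x. \<phi> n x *\<^sub>R v x) \<in> borel_measurable lborel" for n
        unfolding \<phi>_def using v by (intro borel_measurable_scaleR) (auto intro!: borel_measurable_continuous_onI continuous_intros)
      show "AE x in lborel. norm (\<phi> n x *\<^sub>R v x) \<le> norm (v x)" for n
        by (intro AE_I2) (auto simp: \<phi>_def infdist_nonneg intro!: mult_left_le_one_le)
      show "AE x in lborel. (\<lambda>n. \<phi> n x *\<^sub>R v x) \<longlonglongrightarrow> indicator U x *\<^sub>R v x"
      proof (rule AE_I2)
        fix x
        have "(\<lambda>n. \<phi> n x) \<longlonglongrightarrow> indicator U x"
        proof (cases "x \<in> U")
          case True
          then have "infdist x (- U) > 0" using U False
            by (metis ComplD closed_Compl in_closed_iff_infdist_zero infdist_nonneg less_eq_real_def boolean_algebra.compl_zero double_compl)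
          then obtain N where N: "1 < real N * infdist x (- U)" using reals_Archimedean3 by blast
          have "\<forall>\<^sub>F n in sequentially. \<phi> n x = 1"
          proof (rule eventually_sequentiallyI[of N])
            fix n assume "N \<le> n"
            then have "real N * infdist x (- U) \<le> real n * infdist x (- U)" by (intro mult_right_mono) (auto simp: infdist_nonneg)
            with N show "\<phi> n x = 1" by (simp add: \<phi>_def)
          qed
          then show ?thesis using True by (simp add: tendsto_eventually)
        next
          case False
          then have "infdist x (- U) = 0" by simp
          then show ?thesis using False by (simp add: \<phi>_def)
        qed
        then show "(\<lambda>n. \<phi> n x *\<^sub>R v x) \<longlonglongrightarrow> indicator U x *\<^sub>R v x" by (intro tendsto_scaleR tendsto_const)
      qed
    qed (use v in auto)
    moreover have "(\<integral>x. \<phi> n x *\<^sub>R v x \<partial>lborel) = 0" for n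
      by (rule zero) (auto simp: \<phi>_def infdist_nonneg intro!: continuous_intros)
    ultimately show ?thesis by (simp add: LIMSEQ_const_iff)
  qed
qed

lemma slice_gauss_mult:
  "slice (gauss a w1 w2) 0 0 x * slice (gauss b u1 u2) 0 0 x = slice (gauss (a + b) (w1 + u1) (w2 + u2)) 0 0 x"
  unfolding slice_def gauss_def exp_add[symmetric]
  by (intro arg_cong[where f = exp]) (simp add: algebra_simps)

text \<open>A Gaussian centred at a real point is a multiple of a member of the family in
  \<open>x\<close>; vanishing moments therefore annihilate convolutions with Gaussian approximate
  identities.\<close>

lemma gauss_0_diff:
  "slice (gauss a 0 0) 0 0 (q - x) = slice (gauss a 0 0) 0 0 q * slice (gauss a (of_real (a * fst q)) (of_real (a * snd q))) 0 0 x"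
  unfolding slice_def gauss_def exp_add[symmetric]
  by (intro arg_cong[where f = exp]) (simp add: algebra_simps power2_eq_square)

text \<open>A bounded continuous test function is the limit of its Gaussian averages, and by
  Fubini's theorem the integral against an average is an average of Gaussian moments, which are
  zero.\<close>

lemma AE_zero_of_gauss_integrals:
  fixes v :: "real \<times> real \<Rightarrow> complex"
  assumes int: "\<And>a w1 w2. a > 0 \<Longrightarrow> integrable lborel (\<lambda>x. v x * slice (gauss a w1 w2) 0 0 x)"
    and zero: "\<And>a w1 w2. a > 0 \<Longrightarrow> (\<integral>x. v x * slice (gauss a w1 w2) 0 0 x \<partial>lborel) = 0"
  shows "AE x in lborel. v x = 0"
proof -
  \<comment> \<open>\<open>v\<close> itself is not assumed integrable; one Gaussian factor makes it
    so and stays within the family.\<close>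
  define v0 where "v0 = (\<lambda>x. v x * slice (gauss 1 0 0) 0 0 x)"
  have v0: "integrable lborel v0" unfolding v0_def by (rule int) simp
  have [measurable]: "v0 \<in> borel_measurable borel" using borel_measurable_integrable[OF v0] by simp
  define g where "g a = slice (gauss a 0 0) 0 0" for a
  have g_cont: "continuous_on UNIV (g a)" and g_int: "integrable lborel (g a)" if "a > 0" for a
    unfolding g_def using that slice_continuous[OF strip_decay_gauss] slice_integrable[OF strip_decay_gauss] by auto
  have "AE x in lborel. v0 x = 0"
  proof (rule AE_zero_of_continuous_integrals[OF v0])
    fix \<phi> :: "real \<times> real \<Rightarrow> real" assume \<phi>: "continuous_on UNIV \<phi>" "\<And>x. \<bar>\<phi> x\<bar> \<le> 1"
    have [measurable]: "\<phi> \<in> borel_measurable borel" using \<phi> by (intro borel_measurable_continuous_onI)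
    \<comment> \<open>The average of \<phi> at scale 1 / sqrt (n + 1), written with a fixed Gaussian
      so that dominated convergence gives the limit.\<close>
    define \<Theta> where "\<Theta> n x = (\<integral>s. \<phi> (x + (1 / sqrt (real (Suc n))) *\<^sub>R s) *\<^sub>R g 1 s \<partial>lborel)" for n x
    have g1: "integrable lborel (g 1)" "(\<integral>s. g 1 s \<partial>lborel) = 1"
      using g_int[of 1] gauss_integral_0[of 1] by (auto simp: g_def)
    have [measurable]: "g a \<in> borel_measurable borel" if "a > 0" for a
      using g_cont[OF that] by (rule borel_measurable_continuous_onI)
    have [measurable]: "g 1 \<in> borel_measurable borel" by simp
    have int_s: "integrable lborel (\<lambda>s. \<phi> (x + c *\<^sub>R s) *\<^sub>R g 1 s)" for x c
    proof (rule Bochner_Integration.integrable_bound[OF g1(1)])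
      show "AE s in lborel. norm (\<phi> (x + c *\<^sub>R s) *\<^sub>R g 1 s) \<le> norm (g 1 s)"
        by (intro AE_I2) (simp add: mult_left_le_one_le \<phi>(2))
    qed measurable
    have \<Theta>_lim: "(\<lambda>n. \<Theta> n x) \<longlonglongrightarrow> of_real (\<phi> x)" for x
    proof -
      have "(\<lambda>n. \<Theta> n x) \<longlonglongrightarrow> (\<integral>s. \<phi> x *\<^sub>R g 1 s \<partial>lborel)"
        unfolding \<Theta>_def
      proof (rule integral_dominated_convergence[where w = "\<lambda>s. norm (g 1 s)"])
        show "AE s in lborel. (\<lambda>n. \<phi> (x + (1 / sqrt (real (Suc n))) *\<^sub>R s) *\<^sub>R g 1 s) \<longlonglongrightarrow> \<phi> x *\<^sub>R g 1 s"
        proof (intro AE_I2 tendsto_scaleR tendsto_const)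
          fix s :: "real \<times> real"
          have "(\<lambda>n. 1 / sqrt (real (Suc n))) \<longlonglongrightarrow> 0" by real_asymp
          then have "(\<lambda>n. x + (1 / sqrt (real (Suc n))) *\<^sub>R s) \<longlonglongrightarrow> x + 0 *\<^sub>R s" by (intro tendsto_intros)
          then show "(\<lambda>n. \<phi> (x + (1 / sqrt (real (Suc n))) *\<^sub>R s)) \<longlonglongrightarrow> \<phi> x"
            using \<phi>(1) by (intro continuous_on_tendsto_compose[OF \<phi>(1)]) auto
        qed
        show "AE s in lborel. norm (\<phi> (x + (1 / sqrt (real (Suc n))) *\<^sub>R s) *\<^sub>R g 1 s) \<le> norm (g 1 s)" for n
          by (intro AE_I2) (simp add: mult_left_le_one_le \<phi>(2))
        show "integrable lborel (\<lambda>s. norm (g 1 s))" using g1 by simp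
      qed measurable
      then show ?thesis using g1 by (simp add: scaleR_conv_of_real)
    qed
    \<comment> \<open>The same average as a convolution with the Gaussian of parameter n + 1, whose
      integral is 1 / (n + 1). This is the form for Fubini's theorem.\<close>
    have \<Theta>_eq: "\<Theta> n x = of_real (real (Suc n)) * (\<integral>q. \<phi> q *\<^sub>R g (real (Suc n)) (q - x) \<partial>lborel)" for n x
    proof -
      have "(\<integral>q. \<phi> q *\<^sub>R g (real (Suc n)) (q - x) \<partial>lborel) =
         (1 / real (Suc n)) *\<^sub>R (\<integral>s. \<phi> (x + (1 / sqrt (real (Suc n))) *\<^sub>R s) *\<^sub>R g (real (Suc n)) ((1 / sqrt (real (Suc n))) *\<^sub>R s) \<partial>lborel)"
        by (subst lborel_integral_affine[where t = x and c = "1 / sqrt (real (Suc n))"]) (auto simp: power_divide)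
      moreover have "g (real (Suc n)) ((1 / sqrt (real (Suc n))) *\<^sub>R s) = g 1 s" for s
      proof -
        have "real (Suc n) * (1 / sqrt (real (Suc n)))\<^sup>2 = 1" by (simp add: power_divide)
        then have "real (Suc n) * ((1 / sqrt (real (Suc n)) * fst s)\<^sup>2 + (1 / sqrt (real (Suc n)) * snd s)\<^sup>2) = (fst s)\<^sup>2 + (snd s)\<^sup>2"
          unfolding power_mult_distrib distrib_left[symmetric] mult.assoc[symmetric]
          by (simp only: mult.left_commute mult.assoc mult_1_right mult.commute distrib_left)
        then show ?thesis unfolding g_def gauss_0 by (simp add: mult.assoc)
      qed
      ultimately show ?thesis using of_nat_neq_0[of n, where 'a = complex]
        by (simp add: \<Theta>_def scaleR_conv_of_real del: of_nat_Suc)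
    qed
    have vT: "(\<integral>x. \<Theta> n x * v0 x \<partial>lborel) = 0" for n
    proof -
      let ?m = "real (Suc n)"
      have inner: "(\<integral>x. g ?m (q - x) * v0 x \<partial>lborel) = 0" for q
      proof -
        have "(\<integral>x. g ?m (q - x) * v0 x \<partial>lborel) = (\<integral>x. g ?m q * (v x * slice (gauss (1 + ?m) (of_real (?m * fst q)) (of_real (?m * snd q))) 0 0 x) \<partial>lborel)"
        proof (rule Bochner_Integration.integral_cong[OF refl])
          fix x
          show "g ?m (q - x) * v0 x = g ?m q * (v x * slice (gauss (1 + ?m) (of_real (?m * fst q)) (of_real (?m * snd q))) 0 0 x)"
            unfolding g_def v0_def gauss_0_diff using slice_gauss_mult[of 1 0 0 x ?m "of_real (?m * fst q)" "of_real (?m * snd q)"]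
            by (simp add: mult_ac)
        qed
        also have "\<dots> = 0" by (subst integral_mult_right_zero) (simp add: zero)
        finally show ?thesis .
      qed
      have "integrable (lborel \<Otimes>\<^sub>M lborel) (\<lambda>(x, q). \<phi> q *\<^sub>R (g ?m (q - x) * v0 x))"
      proof (rule lborel_pair.Fubini_integrable)
        have gm: "integrable lborel (g ?m)" by (rule g_int) simp
        have bd: "integrable lborel (\<lambda>q. \<phi> q *\<^sub>R (g ?m (q - x) * v0 x))" for x
        proof (rule Bochner_Integration.integrable_bound)
          show "integrable lborel (\<lambda>q. norm (g ?m (- x + q)) * norm (v0 x))"
            using integrable_lborel_translate[OF gm, of "- x"] by simp
          show "AE q in lborel. norm (\<phi> q *\<^sub>R (g ?m (q - x) * v0 x)) \<le> norm (norm (g ?m (- x + q)) * norm (v0 x))"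
            using \<phi>(2) by (intro AE_I2) (auto simp: norm_mult intro!: mult_left_le_one_le)
        qed measurable
        show "AE x in lborel. integrable lborel (\<lambda>q. case (x, q) of (x, q) \<Rightarrow> \<phi> q *\<^sub>R (g ?m (q - x) * v0 x))" using bd by simp
        show "integrable lborel (\<lambda>x. \<integral>q. norm (case (x, q) of (x, q) \<Rightarrow> \<phi> q *\<^sub>R (g ?m (q - x) * v0 x)) \<partial>lborel)"
        proof (rule Bochner_Integration.integrable_bound)
          show "integrable lborel (\<lambda>x. (\<integral>q. norm (g ?m q) \<partial>lborel) * norm (v0 x))" using v0 by simp
          have "(\<integral>q. norm (\<phi> q *\<^sub>R (g ?m (q - x) * v0 x)) \<partial>lborel) \<le> (\<integral>q. norm (g ?m q) \<partial>lborel) * norm (v0 x)" for x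
          proof -
            have "(\<integral>q. norm (\<phi> q *\<^sub>R (g ?m (q - x) * v0 x)) \<partial>lborel) \<le> (\<integral>q. norm (g ?m (- x + q)) * norm (v0 x) \<partial>lborel)"
            proof (rule integral_mono[OF integrable_norm[OF bd]])
              show "integrable lborel (\<lambda>q. norm (g ?m (- x + q)) * norm (v0 x))"
                using integrable_lborel_translate[OF gm, of "- x"] by simp
              show "norm (\<phi> q *\<^sub>R (g ?m (q - x) * v0 x)) \<le> norm (g ?m (- x + q)) * norm (v0 x)" for q
                using mult_right_mono[OF \<phi>(2)[of q], of "norm (g ?m (q - x) * v0 x)"] by (simp add: norm_mult)
            qed
            also have "\<dots> = (\<integral>q. norm (g ?m q) \<partial>lborel) * norm (v0 x)"
              using lborel_integral_translate[of "\<lambda>q. norm (g ?m q)" "- x"] by simp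
            finally show ?thesis .
          qed
          then show "AE x in lborel. norm (\<integral>q. norm (case (x, q) of (x, q) \<Rightarrow> \<phi> q *\<^sub>R (g ?m (q - x) * v0 x)) \<partial>lborel)
              \<le> norm ((\<integral>q. norm (g ?m q) \<partial>lborel) * norm (v0 x))"
            by (intro AE_I2) (auto intro!: order_trans[OF _ abs_ge_self])
        qed measurable
      qed measurable
      then have "(\<integral>x. \<integral>q. \<phi> q *\<^sub>R (g ?m (q - x) * v0 x) \<partial>lborel \<partial>lborel) = (\<integral>q. \<integral>x. \<phi> q *\<^sub>R (g ?m (q - x) * v0 x) \<partial>lborel \<partial>lborel)"
        using lborel_pair.Fubini_integral[of "\<lambda>x q. \<phi> q *\<^sub>R (g ?m (q - x) * v0 x)"] by simp
      also have "\<dots> = 0" using inner by simp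
      finally have "(\<integral>x. (\<integral>q. \<phi> q *\<^sub>R g ?m (q - x) \<partial>lborel) * v0 x \<partial>lborel) = 0"
        by (simp add: scaleR_conv_of_real mult.assoc[symmetric])
      then show ?thesis unfolding \<Theta>_eq by (simp add: mult.assoc)
    qed
    have "(\<lambda>n. \<integral>x. \<Theta> n x * v0 x \<partial>lborel) \<longlonglongrightarrow> (\<integral>x. of_real (\<phi> x) * v0 x \<partial>lborel)"
    proof (rule integral_dominated_convergence[where w = "\<lambda>x. (\<integral>s. norm (g 1 s) \<partial>lborel) * norm (v0 x)"])
      show "AE x in lborel. (\<lambda>n. \<Theta> n x * v0 x) \<longlonglongrightarrow> of_real (\<phi> x) * v0 x"
        by (intro AE_I2 tendsto_mult \<Theta>_lim tendsto_const)
      show "(\<lambda>x. \<Theta> n x * v0 x) \<in> borel_measurable lborel" for n unfolding \<Theta>_def by measurable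
      have "norm (\<Theta> n x) \<le> (\<integral>s. norm (g 1 s) \<partial>lborel)" for n x
        unfolding \<Theta>_def
      proof (rule order_trans[OF integral_norm_bound integral_mono[OF integrable_norm[OF int_s]]])
        show "norm (\<phi> (x + (1 / sqrt (real (Suc n))) *\<^sub>R s) *\<^sub>R g 1 s) \<le> norm (g 1 s)" for s
          using mult_right_mono[OF \<phi>(2), of "norm (g 1 s)"] by simp
      qed (use g1 in auto)
      then show "AE x in lborel. norm (\<Theta> n x * v0 x) \<le> (\<integral>s. norm (g 1 s) \<partial>lborel) * norm (v0 x)" for n
        by (intro AE_I2) (auto simp: norm_mult intro!: mult_right_mono)
    qed (use v0 in auto)
    with vT show "(\<integral>x. \<phi> x *\<^sub>R v0 x \<partial>lborel) = 0"
      by (simp add: LIMSEQ_const_iff scaleR_conv_of_real)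
  qed
  \<comment> \<open>The Gaussian factor of \<open>v0\<close> has no zeros.\<close>
  then show ?thesis by eventually_elim (simp add: v0_def slice_def gauss_def)
qed

subsection \<open>Square integrable functions\<close>

lemma l2_rel_refl: "l2_rel f f \<longleftrightarrow> square_integrable f"
  by (auto simp: l2_rel_def)

lemma square_integrable_rep: "square_integrable (rep_l2 u)"
  using Quotient3_rep_reflp[OF Quotient3_l2, of u] by (simp add: l2_rel_refl)

lemma abs_rep_l2: "abs_l2 (rep_l2 u) = u"
  by (rule Quotient3_abs_rep[OF Quotient3_l2])

lemma abs_l2_eqI:
  assumes "square_integrable f" "square_integrable g" "AE x in lborel. f x = g x"
  shows "abs_l2 f = abs_l2 g"
  using assms Quotient3_rel[OF Quotient3_l2, of f g] by (auto simp: l2_rel_def)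

lemma rep_abs_l2:
  assumes "square_integrable f" shows "AE x in lborel. rep_l2 (abs_l2 f) x = f x"
proof -
  have "l2_rel (rep_l2 (abs_l2 f)) f"
    using Quotient3_rel[OF Quotient3_l2, of "rep_l2 (abs_l2 f)" f] assms
    by (simp add: l2_rel_refl square_integrable_rep abs_rep_l2)
  then show ?thesis by (simp add: l2_rel_def)
qed

lemma l2_eqI: "AE x in lborel. rep_l2 u x = rep_l2 v x \<Longrightarrow> u = v"
  using abs_l2_eqI[OF square_integrable_rep square_integrable_rep, of u v] by (simp add: abs_rep_l2)

lemma abs_l2_add:
  "square_integrable f \<Longrightarrow> square_integrable g \<Longrightarrow> abs_l2 f + abs_l2 g = abs_l2 (\<lambda>x. f x + g x)"
  by (rule plus_l2.abs_eq) (simp_all add: l2_rel_refl)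

lemma abs_l2_uminus: "square_integrable f \<Longrightarrow> - abs_l2 f = abs_l2 (\<lambda>x. - f x)"
  by (rule uminus_l2.abs_eq) (simp_all add: l2_rel_refl)

lemma abs_l2_scale: "square_integrable f \<Longrightarrow> scale_l2 c (abs_l2 f) = abs_l2 (\<lambda>x. c * f x)"
  by (rule scale_l2.abs_eq) (simp_all add: l2_rel_refl)

lemma abs_l2_cnj: "square_integrable f \<Longrightarrow> cnj_l2 (abs_l2 f) = abs_l2 (\<lambda>x. cnj (f x))"
  by (rule cnj_l2.abs_eq) (simp_all add: l2_rel_refl)

lemma square_integrable_uminus: "square_integrable f \<Longrightarrow> square_integrable (\<lambda>x. - f x)"
  by (simp add: square_integrable_def)

lemma square_integrable_diff:
  "square_integrable f \<Longrightarrow> square_integrable g \<Longrightarrow> square_integrable (\<lambda>x. f x - g x)"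
  using square_integrable_add[OF _ square_integrable_uminus, of f g] by simp

lemma abs_l2_diff:
  assumes "square_integrable f" "square_integrable g"
  shows "abs_l2 f - abs_l2 g = abs_l2 (\<lambda>x. f x - g x)"
  using assms by (simp add: minus_l2_def abs_l2_uminus abs_l2_add square_integrable_uminus)

lemma square_integrable_measurable [measurable_dest]: "square_integrable f \<Longrightarrow> f \<in> borel_measurable borel"
  by (simp add: square_integrable_def)

definition sqnorm :: "(real \<times> real \<Rightarrow> complex) \<Rightarrow> real" where
  "sqnorm f = (\<integral>x. (cmod (f x))\<^sup>2 \<partial>lborel)"

lemma sqnorm_nonneg: "sqnorm f \<ge> 0"
  by (simp add: sqnorm_def)

lemma norm_l2_abs: "square_integrable f \<Longrightarrow> norm_l2 (abs_l2 f) = sqrt (sqnorm f)"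
  unfolding norm_l2_def sqnorm_def
  by (intro arg_cong[where f = sqrt] integral_cong_AE)
     (use rep_abs_l2[of f] square_integrable_measurable[OF square_integrable_rep] square_integrable_measurable[of f] in auto)

lemma norm_l2_rep_diff: "norm_l2 (u - v) = sqrt (sqnorm (\<lambda>x. rep_l2 u x - rep_l2 v x))"
  using norm_l2_abs[OF square_integrable_diff[OF square_integrable_rep square_integrable_rep], of u v]
    abs_l2_diff[OF square_integrable_rep square_integrable_rep, of u v]
  by (simp add: abs_rep_l2)

lemma square_integrable_bound:
  assumes "square_integrable f" "g \<in> borel_measurable borel" "\<And>x. cmod (g x) \<le> cmod (f x)"
  shows "square_integrable g"
proof -
  have "integrable lborel (\<lambda>x. (cmod (g x))\<^sup>2)"
    by (rule Bochner_Integration.integrable_bound[of lborel "\<lambda>x. (cmod (f x))\<^sup>2"])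
       (use assms in \<open>auto simp: square_integrable_def intro!: power_mono\<close>)
  then show ?thesis using assms by (simp add: square_integrable_def)
qed

lemma square_integrable_mult_integrable:
  assumes "square_integrable f" "square_integrable g"
  shows "integrable lborel (\<lambda>x. f x * g x)"
proof (rule Bochner_Integration.integrable_bound)
  show "integrable lborel (\<lambda>x. (cmod (f x))\<^sup>2 + (cmod (g x))\<^sup>2)"
    using assms by (auto simp: square_integrable_def)
  have "cmod (f x) * cmod (g x) \<le> (cmod (f x))\<^sup>2 + (cmod (g x))\<^sup>2" for x
  proof -
    have "0 \<le> cmod (f x) * cmod (g x)" by simp
    then show ?thesis using sum_squares_bound[of "cmod (f x)" "cmod (g x)"] unfolding mult.assoc by linarith
  qed
  then show "AE x in lborel. norm (f x * g x) \<le> norm ((cmod (f x))\<^sup>2 + (cmod (g x))\<^sup>2)"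
    by (auto simp: norm_mult)
qed (use assms in \<open>auto dest: square_integrable_measurable\<close>)

text \<open>The Cauchy-Schwarz inequality with the parameter left open; it comes from integrating 2
  a b <= a^2 / s + s b^2.\<close>

lemma norm_integral_mult_le:
  assumes "square_integrable f" "square_integrable g" "s > 0"
  shows "cmod (\<integral>x. f x * g x \<partial>lborel) \<le> (sqnorm f / s + s * sqnorm g) / 2"
proof -
  have "cmod (\<integral>x. f x * g x \<partial>lborel) \<le> (\<integral>x. cmod (f x * g x) \<partial>lborel)" by (rule integral_norm_bound)
  also have "\<dots> \<le> (\<integral>x. ((cmod (f x))\<^sup>2 / s + s * (cmod (g x))\<^sup>2) / 2 \<partial>lborel)"
  proof (rule integral_mono[OF integrable_norm[OF square_integrable_mult_integrable[OF assms(1,2)]]])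
    show "integrable lborel (\<lambda>x. ((cmod (f x))\<^sup>2 / s + s * (cmod (g x))\<^sup>2) / 2)"
      using assms by (auto simp: square_integrable_def)
    fix x
    have "0 \<le> (cmod (f x) - s * cmod (g x))\<^sup>2 / (2 * s)" using assms by simp
    also have "\<dots> = ((cmod (f x))\<^sup>2 / s + s * (cmod (g x))\<^sup>2) / 2 - cmod (f x * g x)"
      using assms(3) by (simp add: field_simps power2_eq_square norm_mult)
    finally show "cmod (f x * g x) \<le> ((cmod (f x))\<^sup>2 / s + s * (cmod (g x))\<^sup>2) / 2" by simp
  qed
  also have "\<dots> = (sqnorm f / s + s * sqnorm g) / 2"
    using assms by (simp add: sqnorm_def square_integrable_def)
  finally show ?thesis .
qed

lemma sqnorm_tendsto_integral:
  assumes h: "\<And>n. square_integrable (h n)" "square_integrable h'" and \<psi>: "square_integrable \<psi>"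
    and lim: "(\<lambda>n. sqnorm (\<lambda>x. h n x - h' x)) \<longlonglongrightarrow> 0"
  shows "(\<lambda>n. \<integral>x. h n x * \<psi> x \<partial>lborel) \<longlonglongrightarrow> (\<integral>x. h' x * \<psi> x \<partial>lborel)"
proof -
  define N where "N n = sqnorm (\<lambda>x. h n x - h' x)" for n
  \<comment> \<open>The summand 1 / (n + 1) keeps the parameter positive when \<open>N n\<close> is
    0; both \<open>N n / s n\<close> and \<open>s n\<close> are bounded by \<open>s n\<close>, which
    tends to 0.\<close>
  define s where "s n = sqrt (N n + 1 / real (Suc n))" for n
  have N0: "N n \<ge> 0" for n by (simp add: N_def sqnorm_nonneg)
  then have s0: "s n > 0" for n unfolding s_def by (intro real_sqrt_gt_zero add_nonneg_pos) auto
  have bd: "cmod (\<integral>x. (h n x - h' x) * \<psi> x \<partial>lborel) \<le> s n * (1 + sqnorm \<psi>) / 2" for n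
  proof -
    have "N n / s n \<le> s n"
    proof -
      have "N n \<le> s n * s n" using N0[of n] by (simp add: s_def)
      then show ?thesis using s0[of n] by (simp add: divide_le_eq)
    qed
    then show ?thesis
      using norm_integral_mult_le[OF square_integrable_diff[OF h(1)[of n] h(2)] \<psi> s0[of n]]
      by (simp add: N_def distrib_left)
  qed
  have "(\<lambda>n. s n * (1 + sqnorm \<psi>) / 2) \<longlonglongrightarrow> sqrt (0 + 0) * (1 + sqnorm \<psi>) / 2"
    unfolding s_def using lim LIMSEQ_Suc[OF lim_1_over_n] unfolding N_def by (intro tendsto_intros) simp_all
  then have "(\<lambda>n. s n * (1 + sqnorm \<psi>) / 2) \<longlonglongrightarrow> 0" by simp
  then have "(\<lambda>n. \<integral>x. (h n x - h' x) * \<psi> x \<partial>lborel) \<longlonglongrightarrow> 0"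
    by (rule Lim_null_comparison[rotated]) (use bd in auto)
  moreover have "(\<integral>x. (h n x - h' x) * \<psi> x \<partial>lborel) = (\<integral>x. h n x * \<psi> x \<partial>lborel) - (\<integral>x. h' x * \<psi> x \<partial>lborel)" for n
    unfolding left_diff_distrib
    by (intro Bochner_Integration.integral_diff square_integrable_mult_integrable h \<psi>)
  ultimately show ?thesis by (simp add: LIM_zero_iff)
qed

text \<open>It serves twice: for completeness, and to remove the Gaussian weights from Plancherel's
  inequality.\<close>

lemma sqnorm_Fatou:
  assumes lim: "AE x in lborel. (\<lambda>n. h n x) \<longlonglongrightarrow> h' x" and h: "\<And>n. square_integrable (h n)"
    and h': "h' \<in> borel_measurable borel" and bd: "\<And>n. sqnorm (h n) \<le> C"
  shows "square_integrable h' \<and> sqnorm h' \<le> C"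
proof -
  note [measurable] = h' square_integrable_measurable[OF h]
  have C: "C \<ge> 0" using bd[of 0] sqnorm_nonneg[of "h 0"] by linarith
  have "(\<integral>\<^sup>+x. ennreal ((cmod (h' x))\<^sup>2) \<partial>lborel) = (\<integral>\<^sup>+x. liminf (\<lambda>n. ennreal ((cmod (h n x))\<^sup>2)) \<partial>lborel)"
  proof (rule nn_integral_cong_AE)
    from lim show "AE x in lborel. ennreal ((cmod (h' x))\<^sup>2) = liminf (\<lambda>n. ennreal ((cmod (h n x))\<^sup>2))"
    proof eventually_elim
      case (elim x)
      then have "(\<lambda>n. ennreal ((cmod (h n x))\<^sup>2)) \<longlonglongrightarrow> ennreal ((cmod (h' x))\<^sup>2)" by (intro tendsto_intros) auto
      then show ?case by (intro lim_imp_Liminf[symmetric]) simp_all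
    qed
  qed
  also have "\<dots> \<le> liminf (\<lambda>n. \<integral>\<^sup>+x. ennreal ((cmod (h n x))\<^sup>2) \<partial>lborel)"
    by (rule nn_integral_liminf) measurable
  also have "\<dots> \<le> liminf (\<lambda>n. ennreal C)"
  proof (intro Liminf_mono always_eventually allI)
    fix n
    have "(\<integral>\<^sup>+x. ennreal ((cmod (h n x))\<^sup>2) \<partial>lborel) = ennreal (sqnorm (h n))"
      unfolding sqnorm_def using h by (intro nn_integral_eq_integral) (auto simp: square_integrable_def)
    then show "(\<integral>\<^sup>+x. ennreal ((cmod (h n x))\<^sup>2) \<partial>lborel) \<le> ennreal C" using bd[of n] by (simp add: ennreal_leI)
  qed
  also have "\<dots> = ennreal C" by (simp add: Liminf_const)
  finally have le: "(\<integral>\<^sup>+x. ennreal ((cmod (h' x))\<^sup>2) \<partial>lborel) \<le> ennreal C" .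
  then have int: "integrable lborel (\<lambda>x. (cmod (h' x))\<^sup>2)"
    by (intro integrableI_bounded) (auto intro: le_less_trans)
  have "ennreal (sqnorm h') \<le> ennreal C"
    using le nn_integral_eq_integral[OF int] by (simp add: sqnorm_def)
  then show ?thesis using int C by (simp add: square_integrable_def)
qed

lemma sqnorm_triangle:
  assumes "square_integrable f" "square_integrable g"
  shows "sqnorm (\<lambda>x. f x + g x) \<le> 2 * sqnorm f + 2 * sqnorm g"
proof -
  have "sqnorm (\<lambda>x. f x + g x) \<le> (\<integral>x. 2 * (cmod (f x))\<^sup>2 + 2 * (cmod (g x))\<^sup>2 \<partial>lborel)"
    unfolding sqnorm_def
  proof (rule integral_mono)
    fix x
    have "(cmod (f x + g x))\<^sup>2 \<le> (cmod (f x) + cmod (g x))\<^sup>2"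
      by (intro power_mono norm_triangle_ineq) auto
    also have "\<dots> \<le> 2 * (cmod (f x))\<^sup>2 + 2 * (cmod (g x))\<^sup>2"
      using zero_le_power2[of "cmod (f x) - cmod (g x)"] by (simp add: power2_eq_square algebra_simps)
    finally show "(cmod (f x + g x))\<^sup>2 \<le> 2 * (cmod (f x))\<^sup>2 + 2 * (cmod (g x))\<^sup>2" .
  qed (use assms square_integrable_add[OF assms] in \<open>auto simp: square_integrable_def\<close>)
  also have "\<dots> = 2 * sqnorm f + 2 * sqnorm g"
    using assms by (simp add: sqnorm_def square_integrable_def)
  finally show ?thesis .
qed

lemma sqnorm_cmod_cong: "(\<And>x. cmod (f x) = cmod (g x)) \<Longrightarrow> sqnorm f = sqnorm g"
  by (simp add: sqnorm_def)

text \<open>Riesz-Fischer: a rapidly converging subsequence converges almost everywhere, and Fatou's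
  lemma identifies its limit as the limit in the mean.\<close>

lemma l2_complete:
  assumes h: "\<And>n. square_integrable (h n)"
    and cauchy: "\<And>e. e > 0 \<Longrightarrow> \<exists>N. \<forall>n\<ge>N. \<forall>m\<ge>N. sqnorm (\<lambda>x. h n x - h m x) < e"
  obtains h' where "square_integrable h'" "(\<lambda>n. sqnorm (\<lambda>x. h n x - h' x)) \<longlonglongrightarrow> 0"
proof -
  \<comment> \<open>The bound 16^(-k) stays summable after multiplication by 4^k. Almost everywhere
    4^k |d k x|^2 is then bounded by some C, so |d k x| <= sqrt C / 2^k and the increments are
    summable.\<close>
  have "\<forall>k. \<exists>N. \<forall>n\<ge>N. \<forall>m\<ge>N. sqnorm (\<lambda>x. h n x - h m x) < (1/4) ^ k * (1/4)^k" using cauchy by simp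
  then obtain N0 where N0: "\<And>k n m. n \<ge> N0 k \<Longrightarrow> m \<ge> N0 k \<Longrightarrow> sqnorm (\<lambda>x. h n x - h m x) < (1/4) ^ k * (1/4)^k" by metis
  \<comment> \<open>The sum makes \<open>r k\<close> at least \<open>N0 k\<close>; the summand
    \<open>k\<close> makes \<open>r\<close> strictly increasing.\<close>
  define r where "r k = (\<Sum>j\<le>k. N0 j) + k" for k
  have r_ge: "r k \<ge> N0 k" for k unfolding r_def by (simp add: member_le_sum trans_le_add1)
  have r_mono: "strict_mono r" by (rule strict_monoI_Suc) (simp add: r_def)
  define d where "d k x = h (r (Suc k)) x - h (r k) x" for k x
  have d: "square_integrable (d k)" for k unfolding d_def by (intro square_integrable_diff h)
  note [measurable] = square_integrable_measurable[OF d] square_integrable_measurable[OF h]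
  have dn: "sqnorm (d k) \<le> (1/4) ^ k * (1/4)^k" for k
  proof -
    have "r (Suc k) \<ge> N0 k" using r_ge[of k] strict_monoD[OF r_mono, of k "Suc k"] by simp
    from N0[OF this r_ge] show ?thesis unfolding d_def by simp
  qed
  have "(\<integral>\<^sup>+x. (\<Sum>k. ennreal (4 ^ k * (cmod (d k x))\<^sup>2)) \<partial>lborel) = (\<Sum>k. \<integral>\<^sup>+x. ennreal (4 ^ k * (cmod (d k x))\<^sup>2) \<partial>lborel)"
    by (rule nn_integral_suminf) measurable
  also have "\<dots> \<le> (\<Sum>k. ennreal ((1/4) ^ k))"
  proof (intro suminf_le summableI)
    fix k
    have "(\<integral>\<^sup>+x. ennreal (4 ^ k * (cmod (d k x))\<^sup>2) \<partial>lborel) = ennreal (4 ^ k * sqnorm (d k))"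
      unfolding sqnorm_def using d[of k]
      by (subst nn_integral_eq_integral) (auto simp: square_integrable_def)
    also have "\<dots> \<le> ennreal (4 ^ k * ((1/4) ^ k * (1/4)^k))" using dn by (intro ennreal_leI mult_left_mono) auto
    also have "\<dots> = ennreal ((1/4) ^ k)" by (simp add: power_divide)
    finally show "(\<integral>\<^sup>+x. ennreal (4 ^ k * (cmod (d k x))\<^sup>2) \<partial>lborel) \<le> ennreal ((1/4) ^ k)" .
  qed
  also have "\<dots> < \<infinity>"
    using summable_geometric[of "1/4::real"] by (subst suminf_ennreal_eq[OF _ summable_sums]) (auto simp: summable_geometric)
  finally have "AE x in lborel. (\<Sum>k. ennreal (4 ^ k * (cmod (d k x))\<^sup>2)) \<noteq> \<infinity>"
    by (intro nn_integral_PInf_AE) auto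
  then have conv: "AE x in lborel. convergent (\<lambda>k. h (r k) x)"
  proof eventually_elim
    case (elim x)
    define C where "C = enn2real (\<Sum>k. ennreal (4 ^ k * (cmod (d k x))\<^sup>2))"
    have "ennreal (4 ^ k * (cmod (d k x))\<^sup>2) \<le> ennreal C" for k
    proof -
      define e where "e j = ennreal (4 ^ j * (cmod (d j x))\<^sup>2)" for j
      have "sum e {k} \<le> suminf e" by (rule sum_le_suminf) auto
      then show ?thesis using elim unfolding C_def e_def[symmetric] by (simp add: ennreal_enn2real_if)
    qed
    then have b: "4 ^ k * (cmod (d k x))\<^sup>2 \<le> C" for k by (simp add: C_def)
    have "cmod (d k x) \<le> sqrt C * (1/2) ^ k" for k
    proof (rule power2_le_imp_le)
      have "C \<ge> 0" by (simp add: C_def)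
      then have "(sqrt C * (1/2) ^ k)\<^sup>2 = C / 4 ^ k"
      proof -
        have "((1/2::real) ^ k)\<^sup>2 = ((1/2)\<^sup>2) ^ k" by (metis power_mult mult.commute)
        then show ?thesis using \<open>C \<ge> 0\<close> by (simp add: power_mult_distrib power_divide)
      qed
      then show "(cmod (d k x))\<^sup>2 \<le> (sqrt C * (1/2) ^ k)\<^sup>2" using b[of k] by (simp add: pos_le_divide_eq mult.commute)
    qed (simp add: C_def)
    moreover have "summable (\<lambda>k. sqrt C * (1/2::real) ^ k)"
      by (rule summable_mult[OF summable_geometric]) simp
    ultimately have "summable (\<lambda>k. d k x)"
      by (metis (no_types, lifting) summable_comparison_test')
    then have "convergent (\<lambda>n. \<Sum>k<n. d k x)" by (simp add: summable_iff_convergent)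
    then have "convergent (\<lambda>n. (\<Sum>k<n. d k x) + h (r 0) x)" by (simp add: convergent_add convergent_const)
    moreover have "(\<Sum>k<n. d k x) + h (r 0) x = h (r n) x" for n
      using sum_lessThan_telescope[of "\<lambda>k. h (r k) x" n] by (simp add: d_def)
    ultimately show ?case by simp
  qed
  define h' where "h' x = lim (\<lambda>k. h (r k) x)" for x
  have h'_meas [measurable]: "h' \<in> borel_measurable borel"
    unfolding h'_def by (intro borel_measurable_lim_metric) measurable
  have h'_lim: "AE x in lborel. (\<lambda>k. h (r k) x) \<longlonglongrightarrow> h' x"
    using conv by eventually_elim (simp add: h'_def convergent_LIMSEQ_iff)
  \<comment> \<open>Fatou's lemma in the second index along the subsequence; the offset
    \<open>N\<close> puts all its indices beyond the Cauchy threshold.\<close>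
  have key: "square_integrable (\<lambda>x. h n x - h' x) \<and> sqnorm (\<lambda>x. h n x - h' x) \<le> e"
    if N: "\<forall>n\<ge>N. \<forall>m\<ge>N. sqnorm (\<lambda>x. h n x - h m x) < e" and n: "n \<ge> N" for N n e
  proof (rule sqnorm_Fatou)
    show "AE x in lborel. (\<lambda>k. h n x - h (r (k + N)) x) \<longlonglongrightarrow> h n x - h' x"
      using h'_lim by eventually_elim (intro tendsto_diff tendsto_const LIMSEQ_ignore_initial_segment)
    show "square_integrable (\<lambda>x. h n x - h (r (k + N)) x)" for k by (intro square_integrable_diff h)
    show "sqnorm (\<lambda>x. h n x - h (r (k + N)) x) \<le> e" for k
      using N n seq_suble[OF r_mono, of "k + N"] by (auto intro!: less_imp_le)
  qed measurable
  obtain N1 where N1: "\<forall>n\<ge>N1. \<forall>m\<ge>N1. sqnorm (\<lambda>x. h n x - h m x) < 1" using cauchy[of 1] by auto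
  have "square_integrable (\<lambda>x. h N1 x - (h N1 x - h' x))"
    by (rule square_integrable_diff[OF h conjunct1[OF key[OF N1 order_refl]]])
  then have "square_integrable h'" by simp
  moreover have "(\<lambda>n. sqnorm (\<lambda>x. h n x - h' x)) \<longlonglongrightarrow> 0"
  proof (rule LIMSEQ_I)
    fix e :: real assume "e > 0"
    then obtain N where N: "\<forall>n\<ge>N. \<forall>m\<ge>N. sqnorm (\<lambda>x. h n x - h m x) < e / 2" using cauchy[of "e/2"] by auto
    show "\<exists>no. \<forall>n\<ge>no. norm (sqnorm (\<lambda>x. h n x - h' x) - 0) < e"
    proof (intro exI[of _ N] allI impI)
      fix n assume "n \<ge> N"
      then have "sqnorm (\<lambda>x. h n x - h' x) \<le> e / 2" using key[OF N] by blast
      then show "norm (sqnorm (\<lambda>x. h n x - h' x) - 0) < e"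
        using \<open>e > 0\<close> sqnorm_nonneg[of "\<lambda>x. h n x - h' x"] by simp
    qed
  qed
  ultimately show ?thesis by (rule that)
qed

subsection \<open>The Fourier--Plancherel transform\<close>

lemma fourier_integral_continuous:
  assumes "integrable lborel g" shows "continuous_on UNIV (fourier_integral g)"
  unfolding fourier_integral_def[abs_def]
proof (rule continuous_on_integral_dominated)
  show "integrable lborel (\<lambda>x. norm (g x))" using assms by simp
  show "(\<lambda>x. g x * cis (- 2 * pi * (z \<bullet> x))) \<in> borel_measurable lborel" for z
    using borel_measurable_integrable[OF assms]
    by (intro borel_measurable_times borel_measurable_continuous_onI) (auto intro!: borel_measurable_continuous_onI continuous_intros)
qed (auto intro!: continuous_intros simp: norm_mult)

lemma fourier_integral_measurable [measurable]:
  "integrable lborel g \<Longrightarrow> fourier_integral g \<in> borel_measurable borel"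
  using fourier_integral_continuous by (rule borel_measurable_continuous_onI)

lemma fourier_inv_eq: "fourier_inv_integral f x = fourier_integral f (- x)"
  by (simp add: fourier_inv_integral_def fourier_integral_def inner_commute)

lemma fourier_eq_inv: "fourier_integral f x = fourier_inv_integral f (- x)"
  by (simp add: fourier_inv_eq)

lemma integrable_cis_mult:
  assumes "integrable lborel f" shows "integrable lborel (\<lambda>x. f x * cis (c * (p \<bullet> x)))"
proof (rule Bochner_Integration.integrable_bound[OF assms])
  have "(\<lambda>x. cis (c * (p \<bullet> x))) \<in> borel_measurable borel"
    by (intro borel_measurable_continuous_onI continuous_intros)
  then show "(\<lambda>x. f x * cis (c * (p \<bullet> x))) \<in> borel_measurable lborel"
    using borel_measurable_integrable[OF assms] by simp
qed (simp add: norm_mult)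

lemma norm_fourier_integral_le:
  assumes "integrable lborel g" shows "cmod (fourier_integral g p) \<le> (\<integral>x. cmod (g x) \<partial>lborel)"
  unfolding fourier_integral_def
  by (rule order_trans[OF integral_norm_bound]) (simp add: norm_mult)

lemma fourier_integral_diff:
  assumes "integrable lborel f" "integrable lborel g"
  shows "fourier_integral (\<lambda>x. f x - g x) p = fourier_integral f p - fourier_integral g p"
  unfolding fourier_integral_def left_diff_distrib
  by (intro Bochner_Integration.integral_diff integrable_cis_mult assms)

lemma fourier_integral_cong_AE:
  assumes "f \<in> borel_measurable borel" "g \<in> borel_measurable borel" "AE x in lborel. f x = g x"
  shows "fourier_integral f = fourier_integral g"
proof
  fix p :: "real \<times> real"
  have "(\<lambda>x. cis (- 2 * pi * (p \<bullet> x))) \<in> borel_measurable borel"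
    by (intro borel_measurable_continuous_onI continuous_intros)
  then show "fourier_integral f p = fourier_integral g p"
    unfolding fourier_integral_def using assms by (intro integral_cong_AE) auto
qed

lemma integrable_product:
  fixes f g :: "real \<times> real \<Rightarrow> complex"
  assumes f: "integrable lborel f" and g: "integrable lborel g"
  shows "integrable (lborel \<Otimes>\<^sub>M lborel) (\<lambda>(x, y). f x * g y)"
proof (rule lborel_pair.Fubini_integrable)
  note [measurable] = borel_measurable_integrable[OF f] borel_measurable_integrable[OF g]
  show "(\<lambda>(x, y). f x * g y) \<in> borel_measurable (lborel \<Otimes>\<^sub>M lborel)" by measurable
  show "integrable lborel (\<lambda>x. \<integral>y. norm (case (x, y) of (x, y) \<Rightarrow> f x * g y) \<partial>lborel)"
    using f by (simp add: norm_mult)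
qed (use g in simp)

lemma integrable_product_cis:
  fixes f g :: "real \<times> real \<Rightarrow> complex"
  assumes f: "integrable lborel f" and g: "integrable lborel g"
  shows "integrable (lborel \<Otimes>\<^sub>M lborel) (\<lambda>(x, y). f x * g y * cis (c * (y \<bullet> x)))"
proof (rule Bochner_Integration.integrable_bound[OF integrable_product[OF f g]])
  note [measurable] = borel_measurable_integrable[OF f] borel_measurable_integrable[OF g]
  have [measurable]: "(\<lambda>z. cis (c * (snd z \<bullet> fst z))) \<in> borel_measurable (lborel \<Otimes>\<^sub>M (lborel :: (real \<times> real) measure))"
    unfolding lborel_prod by (auto intro!: borel_measurable_continuous_onI continuous_intros)
  have "(\<lambda>z. f (fst z) * g (snd z) * cis (c * (snd z \<bullet> fst z))) \<in> borel_measurable (lborel \<Otimes>\<^sub>M lborel)" by measurable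
  then show "(\<lambda>(x, y). f x * g y * cis (c * (y \<bullet> x))) \<in> borel_measurable (lborel \<Otimes>\<^sub>M lborel)"
    by (simp add: split_def)
qed (auto simp: norm_mult)

lemma fourier_multiplication:
  assumes f: "integrable lborel f" and g: "integrable lborel g"
  shows "(\<integral>p. fourier_integral f p * g p \<partial>lborel) = (\<integral>x. f x * fourier_integral g x \<partial>lborel)"
proof -
  have "(\<integral>p. fourier_integral f p * g p \<partial>lborel) = (\<integral>p. \<integral>x. f x * g p * cis (- 2 * pi * (p \<bullet> x)) \<partial>lborel \<partial>lborel)"
  proof (intro Bochner_Integration.integral_cong refl)
    fix p
    have "fourier_integral f p * g p = (\<integral>x. f x * cis (- 2 * pi * (p \<bullet> x)) * g p \<partial>lborel)"
      unfolding fourier_integral_def by (subst integral_mult_left_zero) simp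
    then show "fourier_integral f p * g p = (\<integral>x. f x * g p * cis (- 2 * pi * (p \<bullet> x)) \<partial>lborel)" by (simp add: mult_ac)
  qed
  also have "\<dots> = (\<integral>x. \<integral>p. f x * g p * cis (- 2 * pi * (p \<bullet> x)) \<partial>lborel \<partial>lborel)"
    using lborel_pair.Fubini_integral[OF integrable_product_cis[OF f g, of "- 2 * pi"]] by simp
  also have "\<dots> = (\<integral>x. f x * fourier_integral g x \<partial>lborel)"
    unfolding fourier_integral_def by (simp add: mult.assoc inner_commute)
  finally show ?thesis .
qed

lemma fourier_inv_multiplication:
  assumes f: "integrable lborel f" and g: "integrable lborel g"
  shows "(\<integral>p. fourier_inv_integral f p * g p \<partial>lborel) = (\<integral>x. f x * fourier_inv_integral g x \<partial>lborel)"
proof -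
  have "(\<integral>p. fourier_inv_integral f p * g p \<partial>lborel) = (\<integral>p. fourier_integral f p * g (- p) \<partial>lborel)"
    using lborel_integral_reflect[of "\<lambda>p. fourier_integral f p * g (- p)"] f g integrable_lborel_reflect[OF g]
    by (simp add: fourier_inv_eq borel_measurable_times fourier_integral_measurable)
  also have "\<dots> = (\<integral>x. f x * fourier_integral (\<lambda>p. g (- p)) x \<partial>lborel)"
    by (rule fourier_multiplication[OF f integrable_lborel_reflect[OF g]])
  moreover have "fourier_integral (\<lambda>p. g (- p)) x = fourier_inv_integral g x" for x
  proof -
    have "(\<lambda>p. g p * cis (2 * pi * (x \<bullet> p))) \<in> borel_measurable borel"
      using borel_measurable_integrable[OF integrable_cis_mult[OF g, of "2 * pi" x]] by simp
    from lborel_integral_reflect[OF this] show ?thesis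
      by (simp add: fourier_integral_def fourier_inv_integral_def inner_commute)
  qed
  ultimately show ?thesis by simp
qed

lemma gauss_slice_props:
  assumes "a > 0"
  shows "integrable lborel (slice (gauss a w1 w2) 0 0)" "square_integrable (slice (gauss a w1 w2) 0 0)"
    "slice (gauss a w1 w2) 0 0 \<in> borel_measurable borel"
  using slice_integrable[OF strip_decay_gauss[OF assms]] slice_square_integrable[OF strip_decay_gauss[OF assms]]
    slice_measurable[OF strip_decay_gauss[OF assms]] by auto

lemma fourier_gauss_props:
  assumes "a > 0"
  shows "integrable lborel (fourier_integral (slice (gauss a w1 w2) 0 0))"
    "square_integrable (fourier_integral (slice (gauss a w1 w2) 0 0))"
proof -
  have "1 / a > 0" using assms by simp
  note g = gauss_slice_props[OF this]
  show "integrable lborel (fourier_integral (slice (gauss a w1 w2) 0 0))"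
    unfolding fourier_gauss[OF assms, abs_def] by (rule integrable_mult_right[OF g(1)])
  show "square_integrable (fourier_integral (slice (gauss a w1 w2) 0 0))"
    unfolding fourier_gauss[OF assms, abs_def] by (rule square_integrable_mult_const[OF g(2)])
qed

lemma integrable_bounded_mult:
  fixes f :: "real \<times> real \<Rightarrow> complex"
  assumes g: "integrable lborel g" and f: "f \<in> borel_measurable borel" "\<And>x. cmod (f x) \<le> B"
  shows "integrable lborel (\<lambda>x. f x * g x)"
proof (rule Bochner_Integration.integrable_bound)
  show "integrable lborel (\<lambda>x. B * norm (g x))" using g by simp
  have "B \<ge> 0" using f(2)[of 0] norm_ge_zero order_trans by blast
  then show "AE x in lborel. norm (f x * g x) \<le> norm (B * norm (g x))"
    using f(2) by (auto simp: norm_mult intro!: mult_right_mono)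
qed (use f borel_measurable_integrable[OF g] in simp)

lemma gauss_bounded: assumes "a > 0" obtains B where "\<And>x. cmod (slice (gauss a w1 w2) 0 0 x) \<le> B"
proof -
  obtain M where "\<And>p. cmod (slice (gauss a w1 w2) 0 0 p) \<le> M * exp (- (0 * (\<bar>fst p\<bar> + \<bar>snd p\<bar>)))"
    using slice_bound[OF strip_decay_gauss[OF assms], of 0 0 0 w1 w2] by (metis UNIV_I order_refl)
  then show ?thesis by (intro that[of M]) simp
qed

text \<open>Tested against Gaussians, the two multiplication formulas move both transforms onto the
  Gaussian, where inversion is explicit.\<close>

theorem fourier_inversion:
  assumes f: "integrable lborel f" and fi: "integrable lborel (fourier_inv_integral f)"
  shows "AE x in lborel. fourier_integral (fourier_inv_integral f) x = f x"
proof -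
  let ?F = "fourier_integral (fourier_inv_integral f)"
  have i1: "integrable lborel (\<lambda>x. ?F x * slice (gauss a w1 w2) 0 0 x)" if "a > 0" for a w1 w2
    by (rule integrable_bounded_mult[OF gauss_slice_props(1)[OF that] fourier_integral_measurable[OF fi] norm_fourier_integral_le[OF fi]])
  have i2: "integrable lborel (\<lambda>x. f x * slice (gauss a w1 w2) 0 0 x)" if a: "a > 0" for a w1 w2
  proof -
    obtain B where "\<And>x. cmod (slice (gauss a w1 w2) 0 0 x) \<le> B" using gauss_bounded[OF a] by metis
    from integrable_bounded_mult[OF f gauss_slice_props(3)[OF a] this] show ?thesis by (simp add: mult.commute)
  qed
  have "AE x in lborel. ?F x - f x = 0"
  proof (rule AE_zero_of_gauss_integrals)
    fix a :: real and w1 w2 assume a: "a > 0"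
    show "integrable lborel (\<lambda>x. (?F x - f x) * slice (gauss a w1 w2) 0 0 x)"
      unfolding left_diff_distrib by (intro Bochner_Integration.integrable_diff i1 i2 a)
    have "(\<integral>x. ?F x * slice (gauss a w1 w2) 0 0 x \<partial>lborel) = (\<integral>x. fourier_inv_integral f x * fourier_integral (slice (gauss a w1 w2) 0 0) x \<partial>lborel)"
      by (rule fourier_multiplication[OF fi gauss_slice_props(1)[OF a]])
    also have "\<dots> = (\<integral>x. f x * slice (gauss a w1 w2) 0 0 x \<partial>lborel)"
      using fourier_inv_multiplication[OF f fourier_gauss_props(1)[OF a]] by (simp add: fourier_inv_gauss[OF a])
    finally show "(\<integral>x. (?F x - f x) * slice (gauss a w1 w2) 0 0 x \<partial>lborel) = 0"
      unfolding left_diff_distrib using i1[OF a] i2[OF a] by simp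
  qed
  then show ?thesis by simp
qed

lemma integrable_convolution_kernel:
  fixes f K :: "real \<times> real \<Rightarrow> real"
  assumes f: "integrable lborel f" and K: "integrable lborel K" and nn: "\<And>x. f x \<ge> 0" "\<And>x. K x \<ge> 0"
  shows "integrable lborel (\<lambda>x. \<integral>y. f y * K (y - x) \<partial>lborel)"
    and "(\<integral>x. \<integral>y. f y * K (y - x) \<partial>lborel \<partial>lborel) = (\<integral>x. f x \<partial>lborel) * (\<integral>x. K x \<partial>lborel)"
    and "AE x in lborel. integrable lborel (\<lambda>y. f y * K (y - x))"
proof -
  have Kb [measurable]: "K \<in> borel_measurable borel" using borel_measurable_integrable[OF K] by simp
  have fb [measurable]: "f \<in> borel_measurable borel" using borel_measurable_integrable[OF f] by simp
  have Kt: "integrable lborel (\<lambda>x. K (y - x))" "(\<integral>x. K (y - x) \<partial>lborel) = (\<integral>x. K x \<partial>lborel)" for y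
  proof -
    have "integrable lborel (\<lambda>x. K (y + - (x)))"
      using integrable_lborel_reflect[OF integrable_lborel_translate[OF K, of y]] by simp
    then show "integrable lborel (\<lambda>x. K (y - x))" by simp
    show "(\<integral>x. K (y - x) \<partial>lborel) = (\<integral>x. K x \<partial>lborel)"
      using lborel_integral_reflect[of "\<lambda>x. K (y + x)"] lborel_integral_translate[of K y] by simp
  qed
  have int: "integrable (lborel \<Otimes>\<^sub>M lborel) (\<lambda>(y, x). f y * K (y - x))"
  proof (rule lborel_pair.Fubini_integrable)
    show "integrable lborel (\<lambda>y. \<integral>x. norm (case (y, x) of (y, x) \<Rightarrow> f y * K (y - x)) \<partial>lborel)"
      using nn Kt f by (simp add: abs_mult)
    show "AE y in lborel. integrable lborel (\<lambda>x. case (y, x) of (y, x) \<Rightarrow> f y * K (y - x))" using Kt by simp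
  qed measurable
  show "integrable lborel (\<lambda>x. \<integral>y. f y * K (y - x) \<partial>lborel)" using lborel_pair.integrable_snd[OF int] by simp
  show "AE x in lborel. integrable lborel (\<lambda>y. f y * K (y - x))" using lborel_pair.AE_integrable_snd[OF int] by simp
  have "(\<integral>x. \<integral>y. f y * K (y - x) \<partial>lborel \<partial>lborel) = (\<integral>y. \<integral>x. f y * K (y - x) \<partial>lborel \<partial>lborel)"
    using lborel_pair.Fubini_integral[OF int] by simp
  also have "\<dots> = (\<integral>x. f x \<partial>lborel) * (\<integral>x. K x \<partial>lborel)" using Kt by simp
  finally show "(\<integral>x. \<integral>y. f y * K (y - x) \<partial>lborel \<partial>lborel) = (\<integral>x. f x \<partial>lborel) * (\<integral>x. K x \<partial>lborel)" .
qed

text \<open>Plancherel's inequality with a Gaussian weight, which makes the left side finite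
  beforehand. By the multiplication formula the weighted norm is the integral of \<open>g\<close>
  against the convolution of its conjugate with a Gaussian of mass 1, and a b <= (a^2 + b^2) / 2
  under the kernel bounds this by \<open>sqnorm g\<close>.\<close>

lemma sqnorm_fourier_gauss_weight_le:
  assumes g: "integrable lborel g" and g2: "square_integrable g" and m: "m > 0"
  defines "s \<equiv> (\<lambda>p::real\<times>real. complex_of_real (exp (- (pi / (2 * m)) * ((fst p)\<^sup>2 + (snd p)\<^sup>2))))"
  shows "square_integrable (\<lambda>p. fourier_integral g p * s p)"
    and "sqnorm (\<lambda>p. fourier_integral g p * s p) \<le> sqnorm g"
proof -
  let ?G = "fourier_integral g"
  define E where "E = slice (gauss (1 / m) 0 0) 0 0"
  have s: "s = slice (gauss (1 / (2 * m)) 0 0) 0 0" unfolding s_def gauss_0[abs_def] using m by (simp add: fun_eq_iff)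
  have sE: "cnj (s p) * s p = E p" for p
  proof -
    have "cnj (s p) = s p" by (simp add: s_def)
    then show ?thesis unfolding E_def s using slice_gauss_mult[of "1/(2*m)" 0 0 p "1/(2*m)" 0 0] m by simp
  qed
  have E: "integrable lborel E" "E \<in> borel_measurable borel"
    unfolding E_def using m by (auto intro!: gauss_slice_props)
  \<comment> \<open>The Fourier transform of the squared weight \<open>E\<close>: nonnegative and of
    total mass 1.\<close>
  define K where "K x = m * exp (- (pi * m) * ((fst x)\<^sup>2 + (snd x)\<^sup>2))" for x :: "real \<times> real"
  have K': "of_real (K x) = of_real m * slice (gauss m 0 0) 0 0 x" for x by (simp add: K_def gauss_0)
  have Kc: "integrable lborel (\<lambda>x. complex_of_real (K x))" unfolding K' using gauss_slice_props(1)[OF m] by simp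
  have K: "integrable lborel K" using Kc by (simp add: complex_of_real_integrable_eq)
  have "complex_of_real (\<integral>x. K x \<partial>lborel) = 1"
    unfolding integral_complex_of_real[symmetric] K' using m gauss_integral_0[OF m] by simp
  then have K1: "(\<integral>x. K x \<partial>lborel) = 1" by (metis of_real_eq_1_iff)
  have K0: "K x \<ge> 0" for x using m by (simp add: K_def)
  have Gm: "?G \<in> borel_measurable borel" using g by (rule fourier_integral_measurable)
  have sq: "square_integrable s" unfolding s using m by (intro gauss_slice_props) simp
  show "square_integrable (\<lambda>p. ?G p * s p)"
  proof (rule square_integrable_bound[OF square_integrable_mult_const[OF sq, of "of_real (\<integral>x. cmod (g x) \<partial>lborel)"]])
    show "cmod (?G p * s p) \<le> cmod (of_real (\<integral>x. cmod (g x) \<partial>lborel) * s p)" for p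
      using norm_fourier_integral_le[OF g, of p] by (auto simp: norm_mult abs_of_nonneg intro!: mult_right_mono)
  qed (use Gm square_integrable_measurable[OF sq] in simp)
  note sqi = this
  define \<psi> where "\<psi> p = cnj (?G p) * E p" for p
  have cnjG: "(\<lambda>p. cnj (?G p)) \<in> borel_measurable borel"
    using fourier_integral_continuous[OF g] by (intro borel_measurable_continuous_onI continuous_on_cnj)
  have \<psi>: "integrable lborel \<psi>" unfolding \<psi>_def
    by (rule integrable_bounded_mult[OF E(1) cnjG, of "\<integral>x. cmod (g x) \<partial>lborel"]) (use norm_fourier_integral_le[OF g] in simp)
  have "complex_of_real (sqnorm (\<lambda>p. ?G p * s p)) = (\<integral>p. ?G p * \<psi> p \<partial>lborel)"
    unfolding sqnorm_def integral_complex_of_real[symmetric] complex_norm_square \<psi>_def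
    by (intro Bochner_Integration.integral_cong) (simp_all add: sE[symmetric] mult_ac)
  also have "\<dots> = (\<integral>x. g x * fourier_integral \<psi> x \<partial>lborel)" by (rule fourier_multiplication[OF g \<psi>])
  finally have main: "complex_of_real (sqnorm (\<lambda>p. ?G p * s p)) = (\<integral>x. g x * fourier_integral \<psi> x \<partial>lborel)" .
  have gc: "integrable lborel (\<lambda>x. cnj (g x))" using g by simp
  have psi_hat: "fourier_integral \<psi> x = (\<integral>y. cnj (g y) * of_real (K (y - x)) \<partial>lborel)" for x
  proof -
    let ?\<chi> = "\<lambda>p. E p * cis (- 2 * pi * (x \<bullet> p))"
    have cG: "cnj (?G p) = fourier_inv_integral (\<lambda>y. cnj (g y)) p" for p
      unfolding fourier_integral_def fourier_inv_integral_def Bochner_Integration.integral_cnj[symmetric]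
      by (intro Bochner_Integration.integral_cong refl) (simp add: cis_cnj inner_commute)
    have "fourier_integral \<psi> x = (\<integral>p. fourier_inv_integral (\<lambda>y. cnj (g y)) p * ?\<chi> p \<partial>lborel)"
      unfolding fourier_integral_def[of \<psi>] \<psi>_def cG by (simp add: mult.assoc)
    also have "\<dots> = (\<integral>y. cnj (g y) * fourier_inv_integral ?\<chi> y \<partial>lborel)"
      by (rule fourier_inv_multiplication[OF gc integrable_cis_mult[OF E(1)]])
    moreover have "fourier_inv_integral ?\<chi> y = of_real (K (y - x))" for y
    proof -
      have "fourier_inv_integral ?\<chi> y = (\<integral>p. E p * cis (2 * pi * ((y - x) \<bullet> p)) \<partial>lborel)"
        unfolding fourier_inv_integral_def
        by (intro Bochner_Integration.integral_cong) (simp_all add: mult.assoc cis_mult inner_diff_left inner_commute algebra_simps)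
      also have "\<dots> = of_real m * exp (of_real (pi * m) * ((\<i> * of_real (fst (y - x)))\<^sup>2 + (\<i> * of_real (snd (y - x)))\<^sup>2))"
        unfolding E_def slice_gauss_cis using m by (subst gauss_integral) simp_all
      also have "of_real (pi * m) * ((\<i> * of_real (fst (y - x)))\<^sup>2 + (\<i> * of_real (snd (y - x)))\<^sup>2) = of_real (- (pi * m) * ((fst (y - x))\<^sup>2 + (snd (y - x))\<^sup>2))"
        unfolding power_mult_distrib power2_i by (simp add: algebra_simps)
      finally show ?thesis unfolding exp_of_real by (simp only: K_def of_real_mult)
    qed
    ultimately show ?thesis by simp
  qed
  have "sqnorm (\<lambda>p. ?G p * s p) = cmod (\<integral>x. g x * fourier_integral \<psi> x \<partial>lborel)"
    unfolding main[symmetric] by (simp add: sqnorm_nonneg)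
  also have "\<dots> \<le> (\<integral>x. cmod (g x * fourier_integral \<psi> x) \<partial>lborel)" by (rule integral_norm_bound)
  also have "\<dots> \<le> (\<integral>x. ((cmod (g x))\<^sup>2 + (\<integral>y. (cmod (g y))\<^sup>2 * K (y - x) \<partial>lborel)) / 2 \<partial>lborel)"
  proof (rule integral_mono_AE)
    have sqg: "integrable lborel (\<lambda>x. (cmod (g x))\<^sup>2)" using g2 by (simp add: square_integrable_def)
    note conv = integrable_convolution_kernel[OF sqg K zero_le_power2 K0]
    have "integrable lborel (\<lambda>x. fourier_integral \<psi> x * g x)"
      by (rule integrable_bounded_mult[OF g fourier_integral_measurable[OF \<psi>] norm_fourier_integral_le[OF \<psi>]])
    then show "integrable lborel (\<lambda>x. cmod (g x * fourier_integral \<psi> x))" by (simp add: mult.commute)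
    show "integrable lborel (\<lambda>x. ((cmod (g x))\<^sup>2 + (\<integral>y. (cmod (g y))\<^sup>2 * K (y - x) \<partial>lborel)) / 2)"
      using sqg conv(1) by simp
    have Kx: "integrable lborel (\<lambda>y. K (y - x))" "(\<integral>y. K (y - x) \<partial>lborel) = 1" for x
      using integrable_lborel_translate[OF K, of "- x"] lborel_integral_translate[of K "- x"] K1 by simp_all
    show "AE x in lborel. cmod (g x * fourier_integral \<psi> x) \<le> ((cmod (g x))\<^sup>2 + (\<integral>y. (cmod (g y))\<^sup>2 * K (y - x) \<partial>lborel)) / 2"
      using conv(3)
    proof eventually_elim
      fix x assume i: "integrable lborel (\<lambda>y. (cmod (g y))\<^sup>2 * K (y - x))"
      have "cmod (g x * fourier_integral \<psi> x) \<le> cmod (g x) * (\<integral>y. cmod (cnj (g y) * of_real (K (y - x))) \<partial>lborel)"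
        unfolding psi_hat norm_mult[of "g x"] by (intro mult_left_mono integral_norm_bound) simp
      also have "\<dots> = (\<integral>y. cmod (g x) * (cmod (g y) * K (y - x)) \<partial>lborel)"
        using K0 by (simp add: norm_mult)
      also have "\<dots> \<le> (\<integral>y. ((cmod (g x))\<^sup>2 * K (y - x) + (cmod (g y))\<^sup>2 * K (y - x)) / 2 \<partial>lborel)"
      proof (rule integral_mono')
        show "integrable lborel (\<lambda>y. ((cmod (g x))\<^sup>2 * K (y - x) + (cmod (g y))\<^sup>2 * K (y - x)) / 2)"
          using i Kx by simp
        fix y
        have "2 * (cmod (g x) * cmod (g y)) \<le> (cmod (g x))\<^sup>2 + (cmod (g y))\<^sup>2"
          using sum_squares_bound[of "cmod (g x)" "cmod (g y)"] by (simp add: mult.assoc)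
        from mult_right_mono[OF this K0[of "y - x"]]
        show "cmod (g x) * (cmod (g y) * K (y - x)) \<le> ((cmod (g x))\<^sup>2 * K (y - x) + (cmod (g y))\<^sup>2 * K (y - x)) / 2"
          by (simp add: distrib_right mult.assoc)
        show "0 \<le> ((cmod (g x))\<^sup>2 * K (y - x) + (cmod (g y))\<^sup>2 * K (y - x)) / 2" using K0 by simp
      qed
      also have "\<dots> = ((cmod (g x))\<^sup>2 + (\<integral>y. (cmod (g y))\<^sup>2 * K (y - x) \<partial>lborel)) / 2"
        using i Kx by simp
      finally show "cmod (g x * fourier_integral \<psi> x) \<le> ((cmod (g x))\<^sup>2 + (\<integral>y. (cmod (g y))\<^sup>2 * K (y - x) \<partial>lborel)) / 2" .
    qed
  qed
  also have "\<dots> = sqnorm g"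
    using integrable_convolution_kernel[of "\<lambda>x. (cmod (g x))\<^sup>2" K] K K0 K1 g2
    by (simp add: sqnorm_def square_integrable_def)
  finally show "sqnorm (\<lambda>p. ?G p * s p) \<le> sqnorm g" .
qed

text \<open>The Gaussian weights increase to 1, and Fatou's lemma carries the uniform bound over to
  the limit.\<close>

lemma fourier_integral_square_integrable:
  assumes g: "integrable lborel g" and g2: "square_integrable g"
  shows "square_integrable (fourier_integral g)" "sqnorm (fourier_integral g) \<le> sqnorm g"
proof -
  define s where "s n p = complex_of_real (exp (- (pi / (2 * real (Suc n))) * ((fst p)\<^sup>2 + (snd p)\<^sup>2)))" for n and p :: "real \<times> real"
  have "square_integrable (fourier_integral g) \<and> sqnorm (fourier_integral g) \<le> sqnorm g"
  proof (rule sqnorm_Fatou[where h = "\<lambda>n p. fourier_integral g p * s n p"])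
    show "AE p in lborel. (\<lambda>n. fourier_integral g p * s n p) \<longlonglongrightarrow> fourier_integral g p"
    proof (rule AE_I2)
      fix p :: "real \<times> real"
      have "(\<lambda>n. exp (- (pi / (2 * real (Suc n))) * ((fst p)\<^sup>2 + (snd p)\<^sup>2))) \<longlonglongrightarrow> 1" by real_asymp
      then have "(\<lambda>n. s n p) \<longlonglongrightarrow> of_real 1" unfolding s_def by (rule tendsto_of_real)
      from tendsto_mult[OF tendsto_const this] show "(\<lambda>n. fourier_integral g p * s n p) \<longlonglongrightarrow> fourier_integral g p" by simp
    qed
    show "square_integrable (\<lambda>p. fourier_integral g p * s n p)" "sqnorm (\<lambda>p. fourier_integral g p * s n p) \<le> sqnorm g" for n
      unfolding s_def by (rule sqnorm_fourier_gauss_weight_le[OF g g2]; simp)+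
  qed (rule fourier_integral_measurable[OF g])
  then show "square_integrable (fourier_integral g)" "sqnorm (fourier_integral g) \<le> sqnorm g" by auto
qed

text \<open>The Fourier--Plancherel transform is characterised by the multiplication formula against Gaussians;
  this gives its uniqueness, its linearity and its injectivity.\<close>

definition gauss_pair :: "(real \<times> real \<Rightarrow> complex) \<Rightarrow> (real \<times> real \<Rightarrow> complex) \<Rightarrow> bool" where
  "gauss_pair u F \<longleftrightarrow> (\<forall>a>0. \<forall>w1 w2. (\<integral>p. F p * slice (gauss a w1 w2) 0 0 p \<partial>lborel) =
     (\<integral>x. u x * fourier_integral (slice (gauss a w1 w2) 0 0) x \<partial>lborel))"

lemma gauss_pair_unique_right:
  assumes "gauss_pair u F" "gauss_pair u F'" "square_integrable F" "square_integrable F'"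
  shows "AE x in lborel. F x = F' x"
proof -
  have "AE x in lborel. F x - F' x = 0"
  proof (rule AE_zero_of_gauss_integrals)
    fix a :: real and w1 w2 assume a: "a > 0"
    note i = square_integrable_mult_integrable[OF _ gauss_slice_props(2)[OF a, of w1 w2]]
    show "integrable lborel (\<lambda>x. (F x - F' x) * slice (gauss a w1 w2) 0 0 x)"
      by (rule i[OF square_integrable_diff[OF assms(3,4)]])
    show "(\<integral>x. (F x - F' x) * slice (gauss a w1 w2) 0 0 x \<partial>lborel) = 0"
      unfolding left_diff_distrib using i[OF assms(3)] i[OF assms(4)] assms(1,2) a by (simp add: gauss_pair_def)
  qed
  then show ?thesis by simp
qed

lemma gauss_pair_unique_left:
  assumes "gauss_pair u F" "gauss_pair u' F" "square_integrable u" "square_integrable u'"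
  shows "AE x in lborel. u x = u' x"
proof -
  have "AE x in lborel. u x - u' x = 0"
  proof (rule AE_zero_of_gauss_integrals)
    fix a :: real and w1 w2 assume a: "a > 0"
    note i = square_integrable_mult_integrable[OF _ gauss_slice_props(2)[OF a, of w1 w2]]
    show "integrable lborel (\<lambda>x. (u x - u' x) * slice (gauss a w1 w2) 0 0 x)"
      by (rule i[OF square_integrable_diff[OF assms(3,4)]])
    \<comment> \<open>Parameters for which the transform of the Gaussian with 1 / a is a nonzero
      multiple of \<open>gauss a w1 w2\<close>: the transforms of Gaussians test against all
      Gaussians again.\<close>
    let ?w1 = "\<i> * w1 / of_real a" and ?w2 = "\<i> * w2 / of_real a"
    define C where "C = of_real a * exp (of_real (pi * a) * (?w1\<^sup>2 + ?w2\<^sup>2))"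
    have C0: "C \<noteq> 0" using a by (simp add: C_def)
    have fg: "fourier_integral (slice (gauss (1 / a) ?w1 ?w2) 0 0) x = C * slice (gauss a w1 w2) 0 0 x" for x
      using a by (subst fourier_gauss) (simp_all add: C_def)
    have "(\<integral>x. u x * fourier_integral (slice (gauss (1 / a) ?w1 ?w2) 0 0) x \<partial>lborel) = (\<integral>x. u' x * fourier_integral (slice (gauss (1 / a) ?w1 ?w2) 0 0) x \<partial>lborel)"
      using assms(1,2)[unfolded gauss_pair_def, rule_format, of "1 / a" ?w1 ?w2] a by simp
    then have "C * (\<integral>x. u x * slice (gauss a w1 w2) 0 0 x \<partial>lborel) = C * (\<integral>x. u' x * slice (gauss a w1 w2) 0 0 x \<partial>lborel)"
      unfolding fg by (simp add: mult.left_commute[of _ C])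
    then show "(\<integral>x. (u x - u' x) * slice (gauss a w1 w2) 0 0 x \<partial>lborel) = 0"
      unfolding left_diff_distrib using i[OF assms(3)] i[OF assms(4)] C0 by simp
  qed
  then show ?thesis by simp
qed

lemma gauss_pair_fourier_integral: "integrable lborel f \<Longrightarrow> gauss_pair f (fourier_integral f)"
  unfolding gauss_pair_def by (intro allI impI fourier_multiplication gauss_slice_props)

text \<open>The relation under the definite description in \<open>fourier\<close>, with the
  approximating sequence made explicit.\<close>

definition fourier_approx :: "l2 \<Rightarrow> l2 \<Rightarrow> (nat \<Rightarrow> l2) \<Rightarrow> bool" where
  "fourier_approx f F g \<longleftrightarrow>
     (\<forall>n. integrable lborel (rep_l2 (g n)) \<and> square_integrable (fourier_integral (rep_l2 (g n)))) \<and>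
     (\<lambda>n. norm_l2 (g n - f)) \<longlonglongrightarrow> 0 \<and>
     (\<lambda>n. norm_l2 (abs_l2 (fourier_integral (rep_l2 (g n))) - F)) \<longlonglongrightarrow> 0"

lemma sqrt_tendsto_0D: "(\<lambda>n. sqrt (X n)) \<longlonglongrightarrow> 0 \<Longrightarrow> (\<And>n. X n \<ge> 0) \<Longrightarrow> X \<longlonglongrightarrow> (0::real)"
  using tendsto_power[of "\<lambda>n. sqrt (X n)" 0 sequentially 2] by simp

lemma norm_l2_abs_diff:
  assumes "square_integrable h"
  shows "norm_l2 (abs_l2 h - F) = sqrt (sqnorm (\<lambda>x. h x - rep_l2 F x))"
  using norm_l2_abs[OF square_integrable_diff[OF assms square_integrable_rep[of F]]] abs_l2_diff[OF assms square_integrable_rep[of F]]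
  by (simp add: abs_rep_l2)

lemma fourier_approx_gauss_pair:
  assumes "fourier_approx f F g" shows "gauss_pair (rep_l2 f) (rep_l2 F)"
  unfolding gauss_pair_def
proof (intro allI impI)
  fix a :: real and w1 w2 assume a: "a > 0"
  have g: "integrable lborel (rep_l2 (g n))" "square_integrable (fourier_integral (rep_l2 (g n)))" for n
    using assms by (auto simp: fourier_approx_def)
  have l1: "(\<lambda>n. sqnorm (\<lambda>x. rep_l2 (g n) x - rep_l2 f x)) \<longlonglongrightarrow> 0"
    using assms by - (rule sqrt_tendsto_0D, simp_all add: fourier_approx_def norm_l2_rep_diff sqnorm_nonneg)
  have l2: "(\<lambda>n. sqnorm (\<lambda>x. fourier_integral (rep_l2 (g n)) x - rep_l2 F x)) \<longlonglongrightarrow> 0"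
    using assms g by - (rule sqrt_tendsto_0D, simp_all add: fourier_approx_def norm_l2_abs_diff sqnorm_nonneg)
  have "(\<lambda>n. \<integral>p. fourier_integral (rep_l2 (g n)) p * slice (gauss a w1 w2) 0 0 p \<partial>lborel) \<longlonglongrightarrow> (\<integral>p. rep_l2 F p * slice (gauss a w1 w2) 0 0 p \<partial>lborel)"
    by (rule sqnorm_tendsto_integral[OF g(2) square_integrable_rep gauss_slice_props(2)[OF a] l2])
  moreover have "(\<lambda>n. \<integral>x. rep_l2 (g n) x * fourier_integral (slice (gauss a w1 w2) 0 0) x \<partial>lborel) \<longlonglongrightarrow> (\<integral>x. rep_l2 f x * fourier_integral (slice (gauss a w1 w2) 0 0) x \<partial>lborel)"
    by (rule sqnorm_tendsto_integral[OF square_integrable_rep square_integrable_rep fourier_gauss_props(2)[OF a] l1])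
  ultimately show "(\<integral>p. rep_l2 F p * slice (gauss a w1 w2) 0 0 p \<partial>lborel) = (\<integral>x. rep_l2 f x * fourier_integral (slice (gauss a w1 w2) 0 0) x \<partial>lborel)"
    unfolding fourier_multiplication[OF g(1) gauss_slice_props(1)[OF a]] by (rule LIMSEQ_unique)
qed

text \<open>Damping by exp(-(|x1| + |x2|) / (n + 1)) makes a square integrable function integrable
  and converges to it in the mean. By Plancherel's inequality the transforms form a Cauchy sequence,
  and completeness supplies \<open>F\<close>.\<close>

lemma fourier_approx_exists: "\<exists>F g. fourier_approx f F g"
proof -
  define e where "e n x = exp (- (1 / real (Suc n) * (\<bar>fst x\<bar> + \<bar>snd x\<bar>)))" for n and x :: "real \<times> real"
  have e_meas [measurable]: "e n \<in> borel_measurable borel" for n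
    unfolding e_def by (intro borel_measurable_continuous_onI continuous_intros)
  have e1: "0 \<le> e n x" "e n x \<le> 1" for n x by (simp_all add: e_def)
  have f2: "square_integrable (rep_l2 f)" by (rule square_integrable_rep)
  note [measurable] = square_integrable_measurable[OF f2]
  define h where "h n x = of_real (e n x) * rep_l2 f x" for n x
  have h2: "square_integrable (h n)" for n
  proof (rule square_integrable_bound[OF f2])
    show "h n \<in> borel_measurable borel" unfolding h_def by measurable
    show "cmod (h n x) \<le> cmod (rep_l2 f x)" for x
      using e1[of n x] by (simp add: h_def norm_mult mult_left_le_one_le)
  qed
  have "square_integrable (\<lambda>x. complex_of_real (e n x))" for n
  proof (rule square_integrable_exp_dominated)
    show "cmod (complex_of_real (e n p)) \<le> 1 * exp (- (1 / real (Suc n) * (\<bar>fst p\<bar> + \<bar>snd p\<bar>)))" for p by (simp add: e_def)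
  qed auto
  then have h1: "integrable lborel (h n)" for n unfolding h_def by (rule square_integrable_mult_integrable[OF _ f2])
  define g where "g n = abs_l2 (h n)" for n
  have gh: "AE x in lborel. rep_l2 (g n) x = h n x" for n unfolding g_def by (rule rep_abs_l2[OF h2])
  have hm: "h n \<in> borel_measurable borel" for n using square_integrable_measurable[OF h2] .
  have gm: "rep_l2 (g n) \<in> borel_measurable borel" for n using square_integrable_measurable[OF square_integrable_rep] .
  have gi: "integrable lborel (rep_l2 (g n))" for n
    using h1[of n] gh[of n] hm[of n] gm[of n] by (subst integrable_cong_AE) auto
  have gF: "fourier_integral (rep_l2 (g n)) = fourier_integral (h n)" for n
    by (rule fourier_integral_cong_AE[OF gm hm gh])
  have F2: "square_integrable (fourier_integral (h n))" for n by (rule fourier_integral_square_integrable[OF h1 h2])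
  have lim: "(\<lambda>n. sqnorm (\<lambda>x. h n x - rep_l2 f x)) \<longlonglongrightarrow> (\<integral>x. 0 \<partial>(lborel :: (real\<times>real) measure))"
    unfolding sqnorm_def
  proof (rule integral_dominated_convergence[where w = "\<lambda>x. (cmod (rep_l2 f x))\<^sup>2"])
    show "AE x in lborel. (\<lambda>n. (cmod (h n x - rep_l2 f x))\<^sup>2) \<longlonglongrightarrow> 0"
    proof (rule AE_I2)
      fix x
      have "(\<lambda>n. e n x) \<longlonglongrightarrow> 1" unfolding e_def by real_asymp
      then have "(\<lambda>n. (cmod (of_real (e n x) * rep_l2 f x - rep_l2 f x))\<^sup>2) \<longlonglongrightarrow> (cmod (of_real 1 * rep_l2 f x - rep_l2 f x))\<^sup>2"
        by (intro tendsto_intros)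
      then show "(\<lambda>n. (cmod (h n x - rep_l2 f x))\<^sup>2) \<longlonglongrightarrow> 0" by (simp add: h_def)
    qed
    show "AE x in lborel. norm ((cmod (h n x - rep_l2 f x))\<^sup>2) \<le> (cmod (rep_l2 f x))\<^sup>2" for n
    proof (rule AE_I2)
      fix x
      have "h n x - rep_l2 f x = of_real (e n x - 1) * rep_l2 f x" by (simp add: h_def left_diff_distrib)
      then have "cmod (h n x - rep_l2 f x) \<le> cmod (rep_l2 f x)"
        using e1[of n x] by (auto simp: norm_mult simp del: of_real_diff intro!: mult_left_le_one_le)
      then show "norm ((cmod (h n x - rep_l2 f x))\<^sup>2) \<le> (cmod (rep_l2 f x))\<^sup>2" by (simp add: power_mono)
    qed
  qed (use f2 hm in \<open>auto simp: square_integrable_def\<close>)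
  then have lim0: "(\<lambda>n. sqnorm (\<lambda>x. h n x - rep_l2 f x)) \<longlonglongrightarrow> 0" by simp
  obtain H where H: "square_integrable H" "(\<lambda>n. sqnorm (\<lambda>x. fourier_integral (h n) x - H x)) \<longlonglongrightarrow> 0"
  proof (rule l2_complete[OF F2])
    fix d :: real assume d: "d > 0"
    then obtain N where N: "\<And>n. n \<ge> N \<Longrightarrow> norm (sqnorm (\<lambda>x. h n x - rep_l2 f x)) < d / 4"
      using LIMSEQ_D[OF lim0, of "d / 4"] by auto
    have "sqnorm (\<lambda>x. fourier_integral (h n) x - fourier_integral (h m) x) < d" if "n \<ge> N" "m \<ge> N" for n m
    proof -
      have "sqnorm (\<lambda>x. fourier_integral (h n) x - fourier_integral (h m) x) = sqnorm (fourier_integral (\<lambda>x. h n x - h m x))"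
        by (intro arg_cong[where f = sqnorm] ext fourier_integral_diff[OF h1 h1, symmetric])
      also have "\<dots> \<le> sqnorm (\<lambda>x. h n x - h m x)"
        by (rule fourier_integral_square_integrable(2)[OF Bochner_Integration.integrable_diff[OF h1 h1] square_integrable_diff[OF h2 h2]])
      also have "\<dots> = sqnorm (\<lambda>x. (h n x - rep_l2 f x) + (rep_l2 f x - h m x))" by simp
      also have "\<dots> \<le> 2 * sqnorm (\<lambda>x. h n x - rep_l2 f x) + 2 * sqnorm (\<lambda>x. rep_l2 f x - h m x)"
        by (rule sqnorm_triangle[OF square_integrable_diff[OF h2 f2] square_integrable_diff[OF f2 h2]])
      also have "sqnorm (\<lambda>x. rep_l2 f x - h m x) = sqnorm (\<lambda>x. h m x - rep_l2 f x)"
        by (rule sqnorm_cmod_cong) (rule norm_minus_commute)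
      finally show ?thesis using N[OF that(1)] N[OF that(2)] sqnorm_nonneg[of "\<lambda>x. h n x - rep_l2 f x"] sqnorm_nonneg[of "\<lambda>x. h m x - rep_l2 f x"] by simp
    qed
    then show "\<exists>N. \<forall>n\<ge>N. \<forall>m\<ge>N. sqnorm (\<lambda>x. fourier_integral (h n) x - fourier_integral (h m) x) < d" by blast
  qed
  have "norm_l2 (abs_l2 (fourier_integral (h n)) - abs_l2 H) = sqrt (sqnorm (\<lambda>x. fourier_integral (h n) x - H x))" for n
    using norm_l2_abs[OF square_integrable_diff[OF F2 H(1)]] abs_l2_diff[OF F2 H(1)] by simp
  moreover have "(\<lambda>n. norm_l2 (g n - f)) \<longlonglongrightarrow> 0"
    unfolding g_def norm_l2_abs_diff[OF h2] using tendsto_real_sqrt[OF lim0] by simp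
  ultimately have "fourier_approx f (abs_l2 H) g"
    unfolding fourier_approx_def gF using gi F2 tendsto_real_sqrt[OF H(2)] by simp
  then show ?thesis by blast
qed

text \<open>Evaluates the definite description: a limit exists, and any two limits have the same
  Gaussian pairings and so agree. Later facts about \<open>fourier\<close> rest on this
  pairing.\<close>

lemma gauss_pair_fourier: "gauss_pair (rep_l2 f) (rep_l2 (fourier f))"
proof -
  obtain F g where Fg: "fourier_approx f F g" using fourier_approx_exists by blast
  have "fourier f = F"
    unfolding fourier_def fourier_approx_def[symmetric]
  proof (rule the_equality)
    show "\<exists>g. fourier_approx f F g" using Fg by blast
    show "F' = F" if "\<exists>g. fourier_approx f F' g" for F'
      using that Fg fourier_approx_gauss_pair gauss_pair_unique_right square_integrable_rep by (metis l2_eqI)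
  qed
  then show ?thesis using fourier_approx_gauss_pair[OF Fg] by simp
qed

lemma fourier_inj: assumes "fourier u = fourier v" shows "u = v"
  using gauss_pair_unique_left[OF gauss_pair_fourier[of u] _ square_integrable_rep square_integrable_rep, of v]
    gauss_pair_fourier[of v] assms
  by (intro l2_eqI) simp

lemma gauss_pair_cong_AE:
  assumes "gauss_pair u F" "AE x in lborel. u x = u' x" "AE x in lborel. F x = F' x"
    and "square_integrable u" "square_integrable u'" "square_integrable F" "square_integrable F'"
  shows "gauss_pair u' F'"
  unfolding gauss_pair_def
proof (intro allI impI)
  fix a :: real and w1 w2 assume a: "a > 0"
  note [measurable] = assms(4-7)[THEN square_integrable_measurable] gauss_slice_props(3)[OF a]
    square_integrable_measurable[OF fourier_gauss_props(2)[OF a]]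
  have "(\<integral>p. F' p * slice (gauss a w1 w2) 0 0 p \<partial>lborel) = (\<integral>p. F p * slice (gauss a w1 w2) 0 0 p \<partial>lborel)"
    using assms(3) by (intro integral_cong_AE) auto
  moreover have "(\<integral>x. u' x * fourier_integral (slice (gauss a w1 w2) 0 0) x \<partial>lborel) = (\<integral>x. u x * fourier_integral (slice (gauss a w1 w2) 0 0) x \<partial>lborel)"
    using assms(2) by (intro integral_cong_AE) auto
  ultimately show "(\<integral>p. F' p * slice (gauss a w1 w2) 0 0 p \<partial>lborel) = (\<integral>x. u' x * fourier_integral (slice (gauss a w1 w2) 0 0) x \<partial>lborel)"
    using assms(1) a by (simp add: gauss_pair_def)
qed

lemma fourier_eqI:
  assumes "gauss_pair u F" "square_integrable u" "square_integrable F"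
  shows "fourier (abs_l2 u) = abs_l2 F"
proof -
  have "gauss_pair (rep_l2 (abs_l2 u)) F"
    using rep_abs_l2[OF assms(2)] by (intro gauss_pair_cong_AE[OF assms(1)]) (auto simp: assms square_integrable_rep elim: AE_mp)
  from gauss_pair_unique_right[OF gauss_pair_fourier this square_integrable_rep assms(3)]
  have "AE x in lborel. rep_l2 (fourier (abs_l2 u)) x = F x" .
  then have "abs_l2 (rep_l2 (fourier (abs_l2 u))) = abs_l2 F" by (rule abs_l2_eqI[OF square_integrable_rep assms(3)])
  then show ?thesis by (simp add: abs_rep_l2)
qed

lemma fourier_add: "fourier (u + v) = fourier u + fourier v"
proof -
  have "gauss_pair (\<lambda>x. rep_l2 u x + rep_l2 v x) (\<lambda>x. rep_l2 (fourier u) x + rep_l2 (fourier v) x)"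
    unfolding gauss_pair_def
  proof (intro allI impI)
    fix a :: real and w1 w2 assume a: "a > 0"
    note i = square_integrable_mult_integrable[OF square_integrable_rep gauss_slice_props(2)[OF a]]
       square_integrable_mult_integrable[OF square_integrable_rep fourier_gauss_props(2)[OF a]]
    show "(\<integral>p. (rep_l2 (fourier u) p + rep_l2 (fourier v) p) * slice (gauss a w1 w2) 0 0 p \<partial>lborel) =
      (\<integral>x. (rep_l2 u x + rep_l2 v x) * fourier_integral (slice (gauss a w1 w2) 0 0) x \<partial>lborel)"
      unfolding distrib_right using gauss_pair_fourier[of u] gauss_pair_fourier[of v] a
      by (simp add: i gauss_pair_def)
  qed
  from fourier_eqI[OF this] show ?thesis
    using abs_l2_add[OF square_integrable_rep square_integrable_rep]
    by (simp add: square_integrable_add square_integrable_rep abs_rep_l2 flip: abs_l2_add)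
qed

lemma fourier_scale: "fourier (scale_l2 c u) = scale_l2 c (fourier u)"
proof -
  have "gauss_pair (\<lambda>x. c * rep_l2 u x) (\<lambda>x. c * rep_l2 (fourier u) x)"
    using gauss_pair_fourier[of u] by (simp add: gauss_pair_def mult.assoc)
  from fourier_eqI[OF this] show ?thesis
    by (simp add: square_integrable_mult_const square_integrable_rep abs_rep_l2 flip: abs_l2_scale)
qed

lemma fourier_abs_l2:
  assumes "integrable lborel f" "square_integrable f"
  shows "fourier (abs_l2 f) = abs_l2 (fourier_integral f)"
  by (rule fourier_eqI[OF gauss_pair_fourier_integral[OF assms(1)] assms(2) fourier_integral_square_integrable(1)[OF assms]])

subsection \<open>Elements of L2 with holomorphic Fourier transform\<close>

text \<open>Both strips contain 0, so the real plane lies in the domain, and convexity lets contours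
  be moved freely.\<close>

definition strip_fun :: "real set \<Rightarrow> real set \<Rightarrow> (complex \<Rightarrow> complex \<Rightarrow> complex) \<Rightarrow> bool" where
  "strip_fun S T f \<longleftrightarrow> strip_decay S T f \<and> open S \<and> convex S \<and> 0 \<in> S \<and> open T \<and> convex T \<and> 0 \<in> T"

text \<open>The class whose Fourier transform is the restriction of \<open>f\<close> to the real
  plane. It is given by an absolutely convergent integral, so that pointwise formulas are at
  hand.\<close>

definition of_strip :: "(complex \<Rightarrow> complex \<Rightarrow> complex) \<Rightarrow> l2" where
  "of_strip f = abs_l2 (fourier_inv_integral (slice f 0 0))"

lemma strip_funD:
  assumes "strip_fun S T f"
  shows "strip_decay S T f" "open S" "convex S" "0 \<in> S" "open T" "convex T" "0 \<in> T"
  using assms by (auto simp: strip_fun_def)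

text \<open>Cauchy's theorem for f(z, w) times exp(2 pi i (x1 z + x2 w)). It yields both the decay
  of the inverse transform and the action of exponentials of Q as imaginary translations.\<close>

lemma fourier_inv_integral_shift:
  assumes f: "strip_decay S T f" and S: "open S" "convex S" "open T" "convex T"
    and mem: "Im a \<in> S" "Im b \<in> T" "Im a' \<in> S" "Im b' \<in> T"
  shows "exp (2 * of_real pi * \<i> * (a * of_real (fst x) + b * of_real (snd x))) * fourier_inv_integral (slice f a b) x =
     exp (2 * of_real pi * \<i> * (a' * of_real (fst x) + b' * of_real (snd x))) * fourier_inv_integral (slice f a' b') x"
proof -
  define F where "F z w = exp (2 * of_real pi * \<i> * of_real (fst x) * z + 2 * of_real pi * \<i> * of_real (snd x) * w + 0) * f z w" for z w
  have F: "strip_decay S T F" unfolding F_def[abs_def] by (rule strip_decay_exp_mult[OF f])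
  have e: "exp (2 * of_real pi * \<i> * (a * of_real (fst x) + b * of_real (snd x))) * fourier_inv_integral (slice f a b) x = (\<integral>p. slice F a b p \<partial>lborel)" for a b
  proof -
    have "exp (2 * of_real pi * \<i> * (a * of_real (fst x) + b * of_real (snd x))) * (slice f a b p * cis (2 * pi * (p \<bullet> x))) = slice F a b p" for p
      unfolding slice_def F_def cis_inner mult.left_commute[of _ "f _ _"] mult.commute[of "f _ _"] mult.assoc[symmetric] exp_add[symmetric]
      by (intro arg_cong2[where f = "(*)"] arg_cong[where f = exp] refl) (simp add: algebra_simps)
    then show ?thesis unfolding fourier_inv_integral_def by (simp flip: integral_mult_right_zero)
  qed
  show ?thesis unfolding e by (rule slice_integral_shift[OF F S mem])
qed

lemma slice_shift: "slice (\<lambda>z w. f (a + z) (b + w)) c d = slice f (a + c) (b + d)"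
  by (simp add: slice_def fun_eq_iff add_ac)

text \<open>A Paley-Wiener estimate: a contour moved off the real plane by \<open>e\<close> in each
  variable gains exponential decay.\<close>

lemma fourier_inv_slice_decay:
  assumes "strip_fun S T f"
  obtains M c where "c > 0" "\<And>x. cmod (fourier_inv_integral (slice f 0 0) x) \<le> M * exp (- (c * (\<bar>fst x\<bar> + \<bar>snd x\<bar>)))"
proof -
  note f = strip_funD[OF assms]
  obtain e1 where e1: "e1 > 0" "cball 0 e1 \<subseteq> S" using f open_contains_cball by metis
  obtain e2 where e2: "e2 > 0" "cball 0 e2 \<subseteq> T" using f open_contains_cball by metis
  define e where "e = min e1 e2"
  have e: "e > 0" "e \<in> S" "- e \<in> S" "e \<in> T" "- e \<in> T"
    using e1 e2 by (auto simp: e_def subset_iff)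
  define N where "N s t = (\<integral>p. cmod (slice f (of_real s * \<i>) (of_real t * \<i>) p) \<partial>lborel)" for s t
  have N0: "N s t \<ge> 0" for s t by (simp add: N_def)
  have bd: "exp (2 * pi * (- (s * fst x + t * snd x))) * cmod (fourier_inv_integral (slice f 0 0) x) \<le> exp (4 * pi * (- (s * fst x + t * snd x))) * N s t"
    if "s \<in> S" "t \<in> T" for s t x
  proof -
    have "cmod (exp (2 * of_real pi * \<i> * (of_real s * \<i> * of_real (fst x) + of_real t * \<i> * of_real (snd x)))) = exp (2 * pi * (- (s * fst x + t * snd x)))"
      by (simp add: norm_exp_eq_Re algebra_simps)
    moreover have "exp (2 * of_real pi * \<i> * (of_real s * \<i> * of_real (fst x) + of_real t * \<i> * of_real (snd x))) * fourier_inv_integral (slice f (of_real s * \<i>) (of_real t * \<i>)) x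
       = fourier_inv_integral (slice f 0 0) x"
      using fourier_inv_integral_shift[OF f(1,2,3,5,6), of 0 0 "of_real s * \<i>" "of_real t * \<i>" x] that f by simp
    moreover have "cmod (fourier_inv_integral (slice f (of_real s * \<i>) (of_real t * \<i>)) x) \<le> N s t"
      unfolding fourier_inv_integral_def N_def by (rule order_trans[OF integral_norm_bound]) (simp add: norm_mult)
    ultimately have "cmod (fourier_inv_integral (slice f 0 0) x) \<le> exp (2 * pi * (- (s * fst x + t * snd x))) * N s t"
      by (metis norm_mult mult_left_mono exp_ge_zero)
    from mult_left_mono[OF this, of "exp (2 * pi * (- (s * fst x + t * snd x)))"]
    show ?thesis by (simp add: mult.assoc[symmetric] exp_add[symmetric])
  qed
  define M where "M = N e e + N e (- e) + N (- e) e + N (- e) (- e)"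
  have "cmod (fourier_inv_integral (slice f 0 0) x) \<le> M * exp (- (2 * pi * e * (\<bar>fst x\<bar> + \<bar>snd x\<bar>)))" for x
  proof -
    \<comment> \<open>Choosing the signs of the shifts as those of the coordinates gives s x1 + t x2
      = e (|x1| + |x2|); four contours serve all \<open>x\<close>.\<close>
    define s where "s = (if fst x \<ge> 0 then e else - e)"
    define t where "t = (if snd x \<ge> 0 then e else - e)"
    have st: "s \<in> S" "t \<in> T" "s * fst x + t * snd x = e * (\<bar>fst x\<bar> + \<bar>snd x\<bar>)"
      using e by (auto simp: s_def t_def algebra_simps)
    have "N s t \<le> M" using N0[of e e] N0[of e "- e"] N0[of "- e" e] N0[of "- e" "- e"] by (simp add: s_def t_def M_def)
    moreover have "cmod (fourier_inv_integral (slice f 0 0) x) \<le> exp (2 * pi * (- (s * fst x + t * snd x))) * N s t"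
    proof -
      have "exp (4 * pi * (- (s * fst x + t * snd x))) = exp (2 * pi * (- (s * fst x + t * snd x))) * exp (2 * pi * (- (s * fst x + t * snd x)))"
        by (simp add: exp_add[symmetric])
      with bd[OF st(1,2), of x] show ?thesis by simp
    qed
    moreover have "exp (2 * pi * (- (s * fst x + t * snd x))) * N s t \<le> exp (2 * pi * (- (s * fst x + t * snd x))) * M"
      using \<open>N s t \<le> M\<close> by (intro mult_left_mono) auto
    ultimately have "cmod (fourier_inv_integral (slice f 0 0) x) \<le> exp (2 * pi * (- (s * fst x + t * snd x))) * M" by linarith
    then show ?thesis unfolding st by (simp add: mult_ac)
  qed
  then show ?thesis using that[of "2 * pi * e" M] e by simp
qed

lemma fourier_inv_integral_continuous:
  assumes "integrable lborel g" shows "continuous_on UNIV (fourier_inv_integral g)"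
proof -
  have "continuous_on UNIV (fourier_integral g \<circ> uminus)"
    by (rule continuous_on_compose[OF _ continuous_on_subset[OF fourier_integral_continuous[OF assms]]]) (auto intro!: continuous_intros)
  then show ?thesis by (simp add: o_def fourier_inv_eq[abs_def])
qed

lemma fourier_inv_slice_props:
  assumes "strip_fun S T f"
  shows "integrable lborel (fourier_inv_integral (slice f 0 0))"
    "square_integrable (fourier_inv_integral (slice f 0 0))"
    "fourier_inv_integral (slice f 0 0) \<in> borel_measurable borel"
    "square_integrable (slice f 0 0)" "integrable lborel (slice f 0 0)"
proof -
  note f = strip_funD[OF assms]
  show s: "square_integrable (slice f 0 0)" "integrable lborel (slice f 0 0)"
    using slice_square_integrable[OF f(1)] slice_integrable[OF f(1)] f by auto
  show m: "fourier_inv_integral (slice f 0 0) \<in> borel_measurable borel"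
    by (rule borel_measurable_continuous_onI[OF fourier_inv_integral_continuous[OF s(2)]])
  obtain M c where c: "c > 0" "\<And>x. cmod (fourier_inv_integral (slice f 0 0) x) \<le> M * exp (- (c * (\<bar>fst x\<bar> + \<bar>snd x\<bar>)))"
    using fourier_inv_slice_decay[OF assms] by metis
  show "integrable lborel (fourier_inv_integral (slice f 0 0))" by (rule integrable_exp_dominated[OF m c])
  show "square_integrable (fourier_inv_integral (slice f 0 0))" by (rule square_integrable_exp_dominated[OF m c])
qed

lemma fourier_of_strip:
  assumes "strip_fun S T f" shows "fourier (of_strip f) = abs_l2 (slice f 0 0)"
proof -
  note p = fourier_inv_slice_props[OF assms]
  have "fourier (of_strip f) = abs_l2 (fourier_integral (fourier_inv_integral (slice f 0 0)))"
    unfolding of_strip_def by (rule fourier_abs_l2[OF p(1,2)])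
  also have "\<dots> = abs_l2 (slice f 0 0)"
    by (rule abs_l2_eqI[OF fourier_integral_square_integrable(1)[OF p(1,2)] p(4) fourier_inversion[OF p(5,1)]])
  finally show ?thesis .
qed

lemma of_strip_cong: "(\<And>x y::real. f (of_real x) (of_real y) = g (of_real x) (of_real y)) \<Longrightarrow> of_strip f = of_strip g"
  by (simp add: of_strip_def slice_def[abs_def])

lemma inv_fourier: "inv fourier (fourier u) = u"
  by (rule inv_f_f) (auto intro: injI fourier_inj)

lemma square_integrable_cong_AE:
  assumes "square_integrable f" "g \<in> borel_measurable borel" "AE x in lborel. f x = g x"
  shows "square_integrable g"
proof -
  have "integrable lborel (\<lambda>x. (cmod (g x))\<^sup>2)"
    using assms(1) unfolding square_integrable_def
    by (elim conjE, subst integrable_cong_AE[where g = "\<lambda>x. (cmod (f x))\<^sup>2"]) (use assms square_integrable_measurable[OF assms(1)] in auto)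
  then show ?thesis using assms(2) by (simp add: square_integrable_def)
qed

section \<open>The unbounded operators on elements with holomorphic transform\<close>

text \<open>Both the domain test and the value refer to the chosen representative
  \<open>rep_l2\<close>; they are transported along equality almost everywhere.\<close>

lemma fun_Q_abs:
  assumes "square_integrable g" "square_integrable h" "\<phi> \<in> borel_measurable borel" "\<And>x. \<phi> x * g x = h x"
  shows "fun_Q \<phi> (abs_l2 g) = Some (abs_l2 h)"
proof -
  have m: "(\<lambda>x. \<phi> x * rep_l2 (abs_l2 g) x) \<in> borel_measurable borel"
    using assms(3) square_integrable_measurable[OF square_integrable_rep] by simp
  have ae: "AE x in lborel. h x = \<phi> x * rep_l2 (abs_l2 g) x"
    using rep_abs_l2[OF assms(1)] by eventually_elim (simp add: assms(4))
  have sq: "square_integrable (\<lambda>x. \<phi> x * rep_l2 (abs_l2 g) x)"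
    by (rule square_integrable_cong_AE[OF assms(2) m ae])
  show ?thesis using sq abs_l2_eqI[OF assms(2) sq ae] by (simp add: fun_Q_def)
qed

text \<open>\<open>fun_P\<close> applies \<open>inv fourier\<close>, which injectivity evaluates
  once the multiplied transform is recognised as that of \<open>of_strip k\<close>.\<close>

lemma fun_P_of_strip:
  assumes "strip_fun S T f" "strip_fun S' T' k" "\<phi> \<in> borel_measurable borel"
    and "\<And>p. \<phi> p * slice f 0 0 p = slice k 0 0 p"
  shows "fun_P \<phi> (of_strip f) = Some (of_strip k)"
proof -
  have "fun_Q \<phi> (abs_l2 (slice f 0 0)) = Some (abs_l2 (slice k 0 0))"
    by (rule fun_Q_abs[OF fourier_inv_slice_props(4)[OF assms(1)] fourier_inv_slice_props(4)[OF assms(2)] assms(3,4)])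
  then show ?thesis
    unfolding fun_P_def fourier_of_strip[OF assms(1)] by (simp add: inv_fourier flip: fourier_of_strip[OF assms(2)])
qed

lemma strip_fun_shift:
  assumes "strip_fun S T f" "s \<in> S" "t \<in> T"
  shows "strip_fun {y. s + y \<in> S} {y. t + y \<in> T} (\<lambda>z w. f (\<i> * of_real s + z) (\<i> * of_real t + w))"
proof -
  note f = strip_funD[OF assms(1)]
  have *: "open {y. s + y \<in> S}" "convex {y. s + y \<in> S}" if "open S" "convex S" for s and S :: "real set"
  proof -
    have "{y. s + y \<in> S} = (\<lambda>y. - s + y) ` S" by (auto simp: image_iff intro!: bexI[of _ "s + _"])
    show "open {y. s + y \<in> S}" unfolding \<open>{y. s + y \<in> S} = (\<lambda>y. - s + y) ` S\<close> by (rule open_translation[OF that(1)])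
    show "convex {y. s + y \<in> S}" unfolding \<open>{y. s + y \<in> S} = (\<lambda>y. - s + y) ` S\<close> by (rule convex_translation[OF that(2)])
  qed
  show ?thesis
    unfolding strip_fun_def using strip_decay_shift[OF f(1), of "\<i> * of_real s" "\<i> * of_real t"] * f assms by simp
qed

lemma strip_fun_exp_mult:
  assumes "strip_fun S T f" shows "strip_fun S T (\<lambda>z w. exp (a * z + b * w + d) * f z w)"
  using assms by (simp add: strip_fun_def strip_decay_exp_mult)

lemma strip_fun_cmult:
  assumes "strip_fun S T f" shows "strip_fun S T (\<lambda>z w. c * f z w)"
  using assms by (simp add: strip_fun_def strip_decay_cmult)

lemma of_strip_add:
  assumes "strip_fun S T f" "strip_fun S' T' g" "strip_fun S'' T'' (\<lambda>z w. f z w + g z w)"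
  shows "of_strip (\<lambda>z w. f z w + g z w) = of_strip f + of_strip g"
proof (rule fourier_inj)
  show "fourier (of_strip (\<lambda>z w. f z w + g z w)) = fourier (of_strip f + of_strip g)"
    unfolding fourier_add fourier_of_strip[OF assms(1)] fourier_of_strip[OF assms(2)] fourier_of_strip[OF assms(3)]
    using abs_l2_add[OF fourier_inv_slice_props(4)[OF assms(1)] fourier_inv_slice_props(4)[OF assms(2)]]
    by (simp add: slice_def[abs_def])
qed

lemma of_strip_scale:
  assumes "strip_fun S T f" shows "of_strip (\<lambda>z w. c * f z w) = scale_l2 c (of_strip f)"
proof (rule fourier_inj)
  show "fourier (of_strip (\<lambda>z w. c * f z w)) = fourier (scale_l2 c (of_strip f))"
    unfolding fourier_scale fourier_of_strip[OF assms] fourier_of_strip[OF strip_fun_cmult[OF assms]]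
    using abs_l2_scale[OF fourier_inv_slice_props(4)[OF assms]] by (simp add: slice_def[abs_def])
qed

text \<open>Multiplication by an exponential is an imaginary translation of the transform; that the
  translated real plane stays in the strips places the element in the domain of the
  operator.\<close>

lemma exp_Q_of_strip:
  assumes "strip_fun S T f" "s / (2 * pi) \<in> S" "t / (2 * pi) \<in> T"
  shows "fun_Q (\<lambda>x. of_real (exp (s * fst x + t * snd x))) (of_strip f) =
     Some (of_strip (\<lambda>z w. f (\<i> * of_real (s / (2 * pi)) + z) (\<i> * of_real (t / (2 * pi)) + w)))"
  unfolding of_strip_def
proof (rule fun_Q_abs)
  note f = strip_funD[OF assms(1)]
  note sh = strip_fun_shift[OF assms]
  show "square_integrable (fourier_inv_integral (slice f 0 0))" by (rule fourier_inv_slice_props[OF assms(1)])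
  show "square_integrable (fourier_inv_integral (slice (\<lambda>z w. f (\<i> * of_real (s / (2 * pi)) + z) (\<i> * of_real (t / (2 * pi)) + w)) 0 0))"
    by (rule fourier_inv_slice_props[OF sh])
  show "(\<lambda>x. complex_of_real (exp (s * fst x + t * snd x))) \<in> borel_measurable borel"
    by (intro borel_measurable_continuous_onI continuous_intros)
  fix x
  let ?a = "\<i> * of_real (s / (2 * pi))" and ?b = "\<i> * of_real (t / (2 * pi))"
  have "exp (2 * of_real pi * \<i> * (?a * of_real (fst x) + ?b * of_real (snd x))) * fourier_inv_integral (slice f ?a ?b) x =
      fourier_inv_integral (slice f 0 0) x"
    using fourier_inv_integral_shift[OF f(1,2,3,5,6), of ?a ?b 0 0 x] f assms by simp
  moreover have "2 * of_real pi * \<i> * (?a * of_real (fst x) + ?b * of_real (snd x)) = - of_real (s * fst x + t * snd x)"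
    by (simp add: field_simps)
  ultimately have "exp (- of_real (s * fst x + t * snd x)) * fourier_inv_integral (slice f ?a ?b) x = fourier_inv_integral (slice f 0 0) x" by simp
  then have "of_real (exp (s * fst x + t * snd x)) * fourier_inv_integral (slice f 0 0) x = (exp (of_real (s * fst x + t * snd x)) * exp (- of_real (s * fst x + t * snd x))) * fourier_inv_integral (slice f ?a ?b) x"
    by (metis exp_of_real mult.assoc)
  also have "\<dots> = fourier_inv_integral (slice f ?a ?b) x" by (simp flip: exp_add)
  finally show "of_real (exp (s * fst x + t * snd x)) * fourier_inv_integral (slice f 0 0) x =
      fourier_inv_integral (slice (\<lambda>z w. f (?a + z) (?b + w)) 0 0) x"
    unfolding slice_shift by simp
qed

lemma exp_P_of_strip:
  assumes "strip_fun S T f"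
  shows "fun_P (\<lambda>p. of_real (exp (s * fst p + t * snd p))) (of_strip f) =
     Some (of_strip (\<lambda>z w. exp (of_real s * z + of_real t * w) * f z w))"
proof (rule fun_P_of_strip[OF assms])
  show "strip_fun S T (\<lambda>z w. exp (of_real s * z + of_real t * w) * f z w)"
    using strip_fun_exp_mult[OF assms, of "of_real s" "of_real t" 0] by simp
  show "(\<lambda>x. complex_of_real (exp (s * fst x + t * snd x))) \<in> borel_measurable borel"
    by (intro borel_measurable_continuous_onI continuous_intros)
  show "of_real (exp (s * fst p + t * snd p)) * slice f 0 0 p = slice (\<lambda>z w. exp (of_real s * z + of_real t * w) * f z w) 0 0 p" for p
    by (simp add: slice_def flip: exp_of_real)
qed

text \<open>Conjugating a function turns its transform into the conjugate of f(-p), whose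
  continuation uses the map sending z to -cnj z. This map keeps imaginary parts, so the strips do
  not change.\<close>

lemma strip_decay_cnj:
  assumes f: "strip_decay S T f" and S: "open S" "open T"
  shows "strip_decay S T (\<lambda>z w. cnj (f (- cnj z) (- cnj w)))"
proof (rule strip_decayI)
  have sub: "(\<lambda>z. (- cnj (fst z), - cnj (snd z))) ` {z. Im (fst z) \<in> S \<and> Im (snd z) \<in> T} \<subseteq> {z. Im (fst z) \<in> S \<and> Im (snd z) \<in> T}" by auto
  have "continuous_on {z. Im (fst z) \<in> S \<and> Im (snd z) \<in> T} ((\<lambda>z. f (fst z) (snd z)) \<circ> (\<lambda>z. (- cnj (fst z), - cnj (snd z))))"
    by (rule continuous_on_compose[OF _ continuous_on_subset[OF strip_decayD(1)[OF f] sub]]) (intro continuous_intros)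
  then show "continuous_on {z. Im (fst z) \<in> S \<and> Im (snd z) \<in> T} (\<lambda>z. cnj (f (- cnj (fst z)) (- cnj (snd z))))"
    by (intro continuous_on_cnj) (simp add: o_def)
  have key: "(\<lambda>z. cnj (h (- cnj z))) holomorphic_on {z. Im z \<in> S}" if "h holomorphic_on {z. Im z \<in> S}" "open S" for h S
  proof -
    have "(h \<circ> uminus) holomorphic_on (cnj ` {z. Im z \<in> S})"
      by (rule holomorphic_on_compose_gen[OF _ that(1)]) (auto intro!: holomorphic_intros)
    from holomorphic_on_compose_cnj_cnj[OF this] that show ?thesis by (simp add: o_def open_Im)
  qed
  show "(\<lambda>z. cnj (f (- cnj z) (- cnj w))) holomorphic_on {z. Im z \<in> S}" if "Im w \<in> T" for w
    using key[OF strip_decayD(2)[OF f, of "- cnj w"] S(1)] that by simp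
  show "(\<lambda>w. cnj (f (- cnj z) (- cnj w))) holomorphic_on {w. Im w \<in> T}" if "Im z \<in> S" for z
    using key[OF strip_decayD(3)[OF f, of "- cnj z"] S(2)] that by simp
  show "\<exists>M. \<forall>z w. Im z \<in> K \<longrightarrow> Im w \<in> L \<longrightarrow> cmod (cnj (f (- cnj z) (- cnj w))) \<le> M * exp (- (c * (\<bar>Re z\<bar> + \<bar>Re w\<bar>)))"
    if K: "compact K" "K \<subseteq> S" "compact L" "L \<subseteq> T" for K L c
  proof -
    obtain M where M: "\<And>z w. Im z \<in> K \<Longrightarrow> Im w \<in> L \<Longrightarrow> cmod (f z w) \<le> M * exp (- (c * (\<bar>Re z\<bar> + \<bar>Re w\<bar>)))"
      using strip_decay_bound[OF f K] by metis
    show ?thesis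
    proof (intro exI[of _ M] allI impI)
      fix z w assume "Im z \<in> K" "Im w \<in> L"
      then show "cmod (cnj (f (- cnj z) (- cnj w))) \<le> M * exp (- (c * (\<bar>Re z\<bar> + \<bar>Re w\<bar>)))"
        using M[of "- cnj z" "- cnj w"] by simp
    qed
  qed
qed

lemma strip_fun_cnj: "strip_fun S T f \<Longrightarrow> strip_fun S T (\<lambda>z w. cnj (f (- cnj z) (- cnj w)))"
  by (simp add: strip_fun_def strip_decay_cnj)

lemma cnj_of_strip:
  assumes "strip_fun S T f" shows "cnj_l2 (of_strip f) = of_strip (\<lambda>z w. cnj (f (- cnj z) (- cnj w)))"
proof -
  note p = fourier_inv_slice_props[OF assms]
  have "cnj (fourier_inv_integral (slice f 0 0) x) = fourier_inv_integral (slice (\<lambda>z w. cnj (f (- cnj z) (- cnj w))) 0 0) x" for x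
  proof -
    let ?h = "\<lambda>p. cnj (slice f 0 0 p * cis (2 * pi * (p \<bullet> x)))"
    have "integrable lborel ?h"
      using integrable_cis_mult[OF p(5), of "2 * pi" x] by (simp add: inner_commute del: complex_cnj_mult)
    from borel_measurable_integrable[OF this] have "?h \<in> borel_measurable borel" by simp
    from lborel_integral_reflect[OF this]
    have "(\<integral>p. ?h (- p) \<partial>lborel) = cnj (fourier_inv_integral (slice f 0 0) x)"
      unfolding fourier_inv_integral_def Bochner_Integration.integral_cnj .
    moreover have "?h (- p) = slice (\<lambda>z w. cnj (f (- cnj z) (- cnj w))) 0 0 p * cis (2 * pi * (p \<bullet> x))" for p
      by (simp add: slice_def cis_cnj)
    ultimately show ?thesis by (simp add: fourier_inv_integral_def)
  qed
  then show ?thesis unfolding of_strip_def abs_l2_cnj[OF p(2)] by simp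
qed

subsection \<open>The space \<open>frakA\<close>\<close>

text \<open>Cauchy's formula on the circle of radius 2: points within distance 1 of the centre keep
  distance at least 1 from the circle, so the kernel is at most 1, and the factor 2 is the
  radius.\<close>

lemma cmod_le_circle_integral:
  assumes hol: "f holomorphic_on UNIV" and c: "cmod (z - c) \<le> 1"
  shows "ennreal (cmod (f z)) \<le> 2 * (\<integral>\<^sup>+t. indicator {0..1} t * ennreal (cmod (f (c + 2 * cis (2 * pi * t)))) \<partial>lborel)"
proof -
  let ?\<gamma> = "\<lambda>t. c + 2 * cis (2 * pi * t)"
  have contf: "continuous_on A f" for A using hol holomorphic_on_imp_continuous_on continuous_on_subset by blast
  have cont: "continuous_on A (\<lambda>t. cmod (f (?\<gamma> t)))" for A
    by (intro continuous_on_norm continuous_on_compose2[OF contf[of UNIV]] continuous_intros) auto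
  have "((\<lambda>u. f u / (u - z)) has_contour_integral (2 * of_real pi * \<i> * f z)) (circlepath c 2)"
    using c by (intro Cauchy_integral_circlepath_simple holomorphic_on_subset[OF hol]) (auto simp: dist_norm norm_minus_commute)
  then have hi: "((\<lambda>t. f (circlepath c 2 t) / (circlepath c 2 t - z) * vector_derivative (circlepath c 2) (at t within {0..1}))
      has_integral (2 * of_real pi * \<i> * f z)) {0..1}"
    by (simp add: has_contour_integral_def)
  have cp: "circlepath c 2 t = ?\<gamma> t" for t by (simp add: circlepath cis_conv_exp mult_ac)
  have "norm (2 * of_real pi * \<i> * f z) \<le> integral {0..1} (\<lambda>t. 4 * pi * cmod (f (?\<gamma> t)))"
    unfolding integral_unique[OF hi, symmetric]
  proof (rule integral_norm_bound_integral)
    show "(\<lambda>t. 4 * pi * cmod (f (?\<gamma> t))) integrable_on {0..1}"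
      by (intro integrable_continuous_real continuous_intros cont)
    fix t :: real assume t: "t \<in> {0..1}"
    have "2 \<le> cmod (?\<gamma> t - z) + cmod (z - c)" using norm_triangle_ineq[of "?\<gamma> t - z" "z - c"] by (simp add: norm_mult)
    then have ge: "cmod (?\<gamma> t - z) \<ge> 1" using c by linarith
    have vd: "cmod (vector_derivative (circlepath c 2) (at t within {0..1})) = 4 * pi"
      using t by (subst vector_derivative_circlepath01) (auto simp: norm_mult)
    have div: "cmod (f (?\<gamma> t)) / cmod (?\<gamma> t - z) \<le> cmod (f (?\<gamma> t))"
      using ge by (simp add: divide_le_eq mult_le_cancel_left1)
    show "cmod (f (circlepath c 2 t) / (circlepath c 2 t - z) * vector_derivative (circlepath c 2) (at t within {0..1})) \<le> 4 * pi * cmod (f (?\<gamma> t))"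
      unfolding norm_mult norm_divide vd cp using mult_left_mono[OF div, of "4 * pi"] by (simp add: mult_ac)
  qed (use hi in auto)
  then have "2 * pi * cmod (f z) \<le> 2 * pi * (2 * integral {0..1} (\<lambda>t. cmod (f (?\<gamma> t))))"
    by (simp add: norm_mult)
  then have le: "cmod (f z) \<le> 2 * integral {0..1} (\<lambda>t. cmod (f (?\<gamma> t)))" by simp
  have "ennreal (integral {0..1} (\<lambda>t. cmod (f (?\<gamma> t)))) = (\<integral>\<^sup>+t. indicator {0..1} t * ennreal (cmod (f (?\<gamma> t))) \<partial>lborel)"
  proof -
    have "((\<lambda>t. cmod (f (?\<gamma> t))) has_integral integral {0..1} (\<lambda>t. cmod (f (?\<gamma> t)))) {0..1}"
      by (intro integrable_integral integrable_continuous_real cont)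
    moreover have "(\<lambda>t. cmod (f (?\<gamma> t))) \<in> borel_measurable borel"
      by (rule borel_measurable_continuous_onI[OF cont])
    ultimately have "(\<integral>\<^sup>+t. ennreal (cmod (f (?\<gamma> t))) * indicator {0..1} t \<partial>lborel) = ennreal (integral {0..1} (\<lambda>t. cmod (f (?\<gamma> t))))"
      by (intro nn_integral_has_integral_lebesgue') auto
    then show ?thesis by (simp add: mult.commute)
  qed
  moreover have "ennreal (cmod (f z)) \<le> ennreal (2 * integral {0..1} (\<lambda>t. cmod (f (?\<gamma> t))))" using le by (rule ennreal_leI)
  ultimately show ?thesis by (simp add: ennreal_mult')
qed

lemma nn_integral_lborel_translate:
  fixes f :: "'a::euclidean_space \<Rightarrow> ennreal"
  assumes "f \<in> borel_measurable borel"
  shows "(\<integral>\<^sup>+x. f (t + x) \<partial>lborel) = (\<integral>\<^sup>+x. f x \<partial>lborel)"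
proof -
  have "(\<integral>\<^sup>+x. f x \<partial>lborel) = (\<integral>\<^sup>+x. f x \<partial>distr lborel borel ((+) t))" by (simp only: lborel_distr_plus)
  also have "\<dots> = (\<integral>\<^sup>+x. f (t + x) \<partial>lborel)" using assms by (subst nn_integral_distr) auto
  finally show ?thesis ..
qed

lemma entire2_continuous: "entire2 F \<Longrightarrow> continuous_on A F"
  unfolding entire2_def by (meson has_derivative_continuous continuous_at_imp_continuous_on)

lemma entire2_holomorphic:
  assumes "entire2 F"
  shows "(\<lambda>z. F (z, w)) holomorphic_on A" "(\<lambda>w. F (z, w)) holomorphic_on A"
proof -
  have 1: "\<exists>D. ((\<lambda>z. F (z, w)) has_field_derivative D) (at z)" for z w
  proof -
    obtain c d where "(F has_derivative (\<lambda>u. c * fst u + d * snd u)) (at (z, w))" using assms unfolding entire2_def by blast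
    moreover have "((\<lambda>z. (z, w)) has_derivative (\<lambda>u. (u, 0))) (at z)" by (auto intro!: derivative_eq_intros)
    ultimately have "((\<lambda>z. F (z, w)) has_field_derivative c) (at z)"
      using has_derivative_compose by (fastforce simp: has_field_derivative_def)
    then show ?thesis by blast
  qed
  have 2: "\<exists>D. ((\<lambda>w. F (z, w)) has_field_derivative D) (at w)" for z w
  proof -
    obtain c d where "(F has_derivative (\<lambda>u. c * fst u + d * snd u)) (at (z, w))" using assms unfolding entire2_def by blast
    moreover have "((\<lambda>w. (z, w)) has_derivative (\<lambda>u. (0, u))) (at w)" by (auto intro!: derivative_eq_intros)
    ultimately have "((\<lambda>w. F (z, w)) has_field_derivative d) (at w)"
      using has_derivative_compose by (fastforce simp: has_field_derivative_def)
    then show ?thesis by blast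
  qed
  have "(\<lambda>z. F (z, w)) holomorphic_on UNIV" "(\<lambda>w. F (z, w)) holomorphic_on UNIV"
    using 1 2 by (auto simp: holomorphic_on_open)
  then show "(\<lambda>z. F (z, w)) holomorphic_on A" "(\<lambda>w. F (z, w)) holomorphic_on A"
    by (auto intro: holomorphic_on_subset)
qed

text \<open>Averaging Cauchy's formula over circles with real-translated centres bounds a point value by
  integrals along horizontal planes.\<close>

lemma entire2_pointwise_bound:
  assumes F: "entire2 F" and \<mu>: "\<mu> \<ge> 0"
    and C: "\<And>y1 y2. \<bar>y1\<bar> \<le> \<nu> + 2 \<Longrightarrow> \<bar>y2\<bar> \<le> \<nu> + 2 \<Longrightarrow>
      (\<integral>\<^sup>+ x. ennreal ((cmod (F (Complex (fst x) y1, Complex (snd x) y2)))\<^sup>2 * exp (\<mu> * (\<bar>fst x\<bar> + \<bar>snd x\<bar>))) \<partial>lborel) \<le> ennreal C"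
    and C0: "C \<ge> 0"
    and zw: "\<bar>Im z\<bar> \<le> \<nu>" "\<bar>Im w\<bar> \<le> \<nu>"
  shows "(cmod (F (z, w)))\<^sup>2 \<le> C * exp (6 * \<mu>) * exp (- (\<mu> * (\<bar>Re z\<bar> + \<bar>Re w\<bar>)))"
proof -
  \<comment> \<open>The square is holomorphic and |G| = |F|^2, so averaging |G| uses exactly the
    given L2 bounds.\<close>
  define G where "G z w = (F (z, w))\<^sup>2" for z w
  have G1: "(\<lambda>z. G z w) holomorphic_on UNIV" for w unfolding G_def by (intro holomorphic_intros entire2_holomorphic[OF F])
  have G2: "G z holomorphic_on UNIV" for z unfolding G_def[abs_def] by (intro holomorphic_intros entire2_holomorphic[OF F])
  have contF: "continuous_on UNIV F" by (rule entire2_continuous[OF F])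
  have contG: "continuous_on A (\<lambda>x. cmod (G (u x) (v x)))" if "continuous_on A u" "continuous_on A v" for u v and A :: "'b::topological_space set"
    unfolding G_def by (intro continuous_intros continuous_on_compose2[OF contF] that) auto
  define I where "I x = (indicator ({0..1} \<times> {0..1}) x :: ennreal)" for x :: "real \<times> real"
  define B where "B x = (indicator ({-1..1} \<times> {-1..1}) x :: ennreal)" for x :: "real \<times> real"
  define H where "H p x = ennreal (cmod (G (z + of_real (fst p) + 2 * cis (2 * pi * fst x)) (w + of_real (snd p) + 2 * cis (2 * pi * snd x))))" for p x :: "real \<times> real"
  have "(\<lambda>q. H (fst q) (snd q)) \<in> borel_measurable borel"
    unfolding H_def
    by (intro measurable_compose[OF _ measurable_ennreal] borel_measurable_continuous_onI contG continuous_intros)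
  then have H_meas: "(\<lambda>q. H (fst q) (snd q)) \<in> borel_measurable (borel \<Otimes>\<^sub>M borel)" by (simp only: borel_prod)
  have H_comp [measurable]: "(\<lambda>y. H (u y) (v y)) \<in> borel_measurable M"
    if "u \<in> borel_measurable M" "v \<in> borel_measurable M" for u v and M :: "'c measure"
    using measurable_compose[OF measurable_Pair[OF that] H_meas] by simp
  have IB [measurable]: "I \<in> borel_measurable borel" "B \<in> borel_measurable borel"
    unfolding I_def B_def by (auto intro!: borel_measurable_indicator borel_closed closed_Times)
  have pt: "ennreal (cmod (G z w)) \<le> 4 * (\<integral>\<^sup>+x. I x * H p x \<partial>lborel)" if "B p \<noteq> 0" for p
  proof -
    have p: "\<bar>fst p\<bar> \<le> 1" "\<bar>snd p\<bar> \<le> 1" using that by (auto simp: B_def indicator_def split: if_splits)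
    let ?J = "\<lambda>t. indicator {0..1::real} t :: ennreal"
    have "ennreal (cmod (G z w)) \<le> 2 * (\<integral>\<^sup>+t. ?J t * ennreal (cmod (G (z + of_real (fst p) + 2 * cis (2 * pi * t)) w)) \<partial>lborel)"
      by (rule cmod_le_circle_integral[OF G1]) (use p in simp)
    also have "\<dots> \<le> 2 * (\<integral>\<^sup>+t. ?J t * (2 * (\<integral>\<^sup>+s. ?J s * H p (t, s) \<partial>lborel)) \<partial>lborel)"
      unfolding H_def fst_conv snd_conv
      by (intro mult_left_mono nn_integral_mono cmod_le_circle_integral[OF G2]) (use p in auto)
    also have "\<dots> = 2 * (\<integral>\<^sup>+t. \<integral>\<^sup>+s. 2 * (I (t, s) * H p (t, s)) \<partial>lborel \<partial>lborel)"
    proof -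
      have "?J t * (2 * (\<integral>\<^sup>+s. ?J s * H p (t, s) \<partial>lborel)) = (\<integral>\<^sup>+s. 2 * (I (t, s) * H p (t, s)) \<partial>lborel)" for t
      proof -
        have "?J t * (2 * (\<integral>\<^sup>+s. ?J s * H p (t, s) \<partial>lborel)) = (\<integral>\<^sup>+s. (?J t * 2) * (?J s * H p (t, s)) \<partial>lborel)"
          by (subst nn_integral_cmult) (auto simp: mult.assoc)
        also have "\<dots> = (\<integral>\<^sup>+s. 2 * (I (t, s) * H p (t, s)) \<partial>lborel)"
          by (intro nn_integral_cong) (auto simp: I_def indicator_def)
        finally show ?thesis .
      qed
      then show ?thesis by simp
    qed
    also have "(\<integral>\<^sup>+t. \<integral>\<^sup>+s. 2 * (I (t, s) * H p (t, s)) \<partial>lborel \<partial>lborel) = (\<integral>\<^sup>+x. 2 * (I x * H p x) \<partial>(lborel \<Otimes>\<^sub>M lborel))"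
      by (rule lborel.nn_integral_fst) (simp add: lborel_prod)
    also have "\<dots> = 2 * (\<integral>\<^sup>+x. I x * H p x \<partial>lborel)"
      unfolding lborel_prod by (rule nn_integral_cmult) simp
    finally show ?thesis by (simp add: mult.assoc[symmetric])
  qed
  have B4: "(\<integral>\<^sup>+p. B p \<partial>lborel) = 4"
  proof -
    have "(\<integral>\<^sup>+p. B p \<partial>lborel) = emeasure (lborel \<Otimes>\<^sub>M lborel) ({-1..1::real} \<times> {-1..1::real})"
      unfolding B_def by (simp add: lborel_prod borel_closed closed_Times)
    also have "\<dots> = 2 * 2" by (subst lborel.emeasure_pair_measure_Times) auto
    finally show ?thesis by simp
  qed
  \<comment> \<open>Each real part moves by at most 1 with the centre and by at most 2 along the
    circle; over two variables this makes 6.\<close>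
  define E where "E = exp (\<mu> * (\<bar>Re z\<bar> + \<bar>Re w\<bar> - 6))"
  have inner: "ennreal E * (\<integral>\<^sup>+p. B p * H p (t, s) \<partial>lborel) \<le> ennreal C" for t s
  proof -
    define y1 where "y1 = Im z + 2 * sin (2 * pi * t)"
    define y2 where "y2 = Im w + 2 * sin (2 * pi * s)"
    define x0 where "x0 = (Re z + 2 * cos (2 * pi * t), Re w + 2 * cos (2 * pi * s))"
    define \<Phi> where "\<Phi> x = ennreal ((cmod (F (Complex (fst x) y1, Complex (snd x) y2)))\<^sup>2 * exp (\<mu> * (\<bar>fst x\<bar> + \<bar>snd x\<bar>)))" for x
    have \<Phi>_meas: "\<Phi> \<in> borel_measurable borel"
      unfolding \<Phi>_def Complex_eq
      by (intro measurable_compose[OF _ measurable_ennreal] borel_measurable_continuous_onI continuous_intros continuous_on_compose2[OF contF]) auto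
    have "ennreal E * (\<integral>\<^sup>+p. B p * H p (t, s) \<partial>lborel) = (\<integral>\<^sup>+p. ennreal E * (B p * H p (t, s)) \<partial>lborel)"
      by (rule nn_integral_cmult[symmetric]) simp
    also have "\<dots> \<le> (\<integral>\<^sup>+p. \<Phi> (x0 + p) \<partial>lborel)"
    proof (rule nn_integral_mono)
      fix p
      show "ennreal E * (B p * H p (t, s)) \<le> \<Phi> (x0 + p)"
      proof (cases "B p = 0")
        case False
        then have p: "\<bar>fst p\<bar> \<le> 1" "\<bar>snd p\<bar> \<le> 1" and B1: "B p = 1" by (auto simp: B_def indicator_def split: if_splits)
        have "z + of_real (fst p) + 2 * cis (2 * pi * t) = Complex (fst (x0 + p)) y1" "w + of_real (snd p) + 2 * cis (2 * pi * s) = Complex (snd (x0 + p)) y2"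
          by (simp_all add: complex_eq_iff x0_def y1_def y2_def)
        then have H: "H p (t, s) = ennreal ((cmod (F (Complex (fst (x0 + p)) y1, Complex (snd (x0 + p)) y2)))\<^sup>2)"
          unfolding H_def G_def by (simp add: norm_power)
        have cs: "\<bar>cos (2 * pi * t)\<bar> \<le> 1" "\<bar>cos (2 * pi * s)\<bar> \<le> 1" by simp_all
        have "\<bar>Re z\<bar> + \<bar>Re w\<bar> - 6 \<le> \<bar>fst (x0 + p)\<bar> + \<bar>snd (x0 + p)\<bar>"
          unfolding x0_def fst_add snd_add fst_conv snd_conv using p cs by linarith
        then have "E \<le> exp (\<mu> * (\<bar>fst (x0 + p)\<bar> + \<bar>snd (x0 + p)\<bar>))" unfolding E_def using \<mu> by (simp add: mult_left_mono)
        then have "ennreal (E * (cmod (F (Complex (fst (x0 + p)) y1, Complex (snd (x0 + p)) y2)))\<^sup>2) \<le> \<Phi> (x0 + p)"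
          unfolding \<Phi>_def by (intro ennreal_leI) (subst mult.commute, intro mult_left_mono, auto)
        then show ?thesis unfolding B1 H by (simp add: ennreal_mult E_def)
      qed simp
    qed
    also have "\<dots> = (\<integral>\<^sup>+p. \<Phi> p \<partial>lborel)" by (rule nn_integral_lborel_translate[OF \<Phi>_meas])
    also have "\<dots> \<le> ennreal C" unfolding \<Phi>_def
    proof (rule C)
      have "\<bar>sin (2 * pi * t)\<bar> \<le> 1" "\<bar>sin (2 * pi * s)\<bar> \<le> 1" by simp_all
      then show "\<bar>y1\<bar> \<le> \<nu> + 2" "\<bar>y2\<bar> \<le> \<nu> + 2" using zw unfolding y1_def y2_def by linarith+
    qed
    finally show ?thesis .
  qed
  \<comment> \<open>The estimate \<open>pt\<close> is integrated over the square of area 4. After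
    the exchange of integrals the circle parameters are fixed and \<open>p\<close> runs through part
    of one horizontal plane, where the hypothesis on \<open>F\<close> applies.\<close>
  have "4 * ennreal (cmod (G z w)) = (\<integral>\<^sup>+p. B p * ennreal (cmod (G z w)) \<partial>lborel)"
    by (subst nn_integral_multc) (simp_all add: B4)
  also have "\<dots> \<le> (\<integral>\<^sup>+p. B p * (4 * (\<integral>\<^sup>+x. I x * H p x \<partial>lborel)) \<partial>lborel)"
  proof (rule nn_integral_mono)
    fix p show "B p * ennreal (cmod (G z w)) \<le> B p * (4 * (\<integral>\<^sup>+x. I x * H p x \<partial>lborel))"
      using pt[of p] by (cases "B p = 0") (auto intro: mult_left_mono)
  qed
  also have "\<dots> = (\<integral>\<^sup>+p. \<integral>\<^sup>+x. 4 * (B p * (I x * H p x)) \<partial>lborel \<partial>lborel)"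
  proof (rule nn_integral_cong)
    fix p
    have "(\<integral>\<^sup>+x. 4 * (B p * (I x * H p x)) \<partial>lborel) = (\<integral>\<^sup>+x. (4 * B p) * (I x * H p x) \<partial>lborel)" by (simp only: mult.assoc)
    also have "\<dots> = 4 * B p * (\<integral>\<^sup>+x. I x * H p x \<partial>lborel)" by (rule nn_integral_cmult) simp
    finally show "B p * (4 * (\<integral>\<^sup>+x. I x * H p x \<partial>lborel)) = (\<integral>\<^sup>+x. 4 * (B p * (I x * H p x)) \<partial>lborel)" by (simp only: mult_ac)
  qed
  also have "\<dots> = (\<integral>\<^sup>+x. \<integral>\<^sup>+p. 4 * (B p * (I x * H p x)) \<partial>lborel \<partial>lborel)"
    using lborel_pair.Fubini'[of "\<lambda>p x. 4 * (B p * (I x * H p x))"] by simp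
  also have "\<dots> = (\<integral>\<^sup>+x. 4 * (I x * (\<integral>\<^sup>+p. B p * H p x \<partial>lborel)) \<partial>lborel)"
  proof (rule nn_integral_cong)
    fix x
    have "(\<integral>\<^sup>+p. 4 * (B p * (I x * H p x)) \<partial>lborel) = (\<integral>\<^sup>+p. (4 * I x) * (B p * H p x) \<partial>lborel)" by (simp only: mult_ac)
    also have "\<dots> = 4 * I x * (\<integral>\<^sup>+p. B p * H p x \<partial>lborel)" by (rule nn_integral_cmult) simp
    finally show "(\<integral>\<^sup>+p. 4 * (B p * (I x * H p x)) \<partial>lborel) = 4 * (I x * (\<integral>\<^sup>+p. B p * H p x \<partial>lborel))" by (simp only: mult.assoc)
  qed
  finally have "ennreal E * (4 * ennreal (cmod (G z w))) \<le> ennreal E * (\<integral>\<^sup>+x. 4 * (I x * (\<integral>\<^sup>+p. B p * H p x \<partial>lborel)) \<partial>lborel)"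
    by (rule mult_left_mono) simp
  also have "\<dots> = (\<integral>\<^sup>+x. 4 * (I x * (ennreal E * (\<integral>\<^sup>+p. B p * H p x \<partial>lborel))) \<partial>lborel)"
    by (subst nn_integral_cmult[symmetric]) (auto intro!: nn_integral_cong simp: mult_ac)
  also have "\<dots> \<le> (\<integral>\<^sup>+x. (4 * ennreal C) * I x \<partial>lborel)"
  proof (rule nn_integral_mono)
    fix x :: "real \<times> real"
    have "I x * (ennreal E * (\<integral>\<^sup>+p. B p * H p x \<partial>lborel)) \<le> I x * ennreal C"
      using inner[of "fst x" "snd x"] by (intro mult_left_mono) auto
    then have "4 * (I x * (ennreal E * (\<integral>\<^sup>+p. B p * H p x \<partial>lborel))) \<le> 4 * (I x * ennreal C)"
      by (rule mult_left_mono) simp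
    then show "4 * (I x * (ennreal E * (\<integral>\<^sup>+p. B p * H p x \<partial>lborel))) \<le> (4 * ennreal C) * I x" by (simp add: mult_ac)
  qed
  also have "\<dots> = 4 * ennreal C * (\<integral>\<^sup>+x. I x \<partial>lborel)" by (rule nn_integral_cmult) simp
  also have "(\<integral>\<^sup>+x. I x \<partial>lborel) = 1"
  proof -
    have "(\<integral>\<^sup>+x. I x \<partial>lborel) = emeasure (lborel \<Otimes>\<^sub>M lborel) ({0..1::real} \<times> {0..1::real})"
      unfolding I_def by (simp add: lborel_prod borel_closed closed_Times)
    also have "\<dots> = 1 * 1" by (subst lborel.emeasure_pair_measure_Times) auto
    finally show ?thesis by simp
  qed
  finally have "ennreal (4 * (E * cmod (G z w))) \<le> ennreal (4 * C)"
    using C0 by (simp add: ennreal_mult E_def mult_ac)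
  then have le: "E * cmod (G z w) \<le> C" using C0 by (subst (asm) ennreal_le_iff) auto
  have "exp (6 * \<mu>) * exp (- (\<mu> * (\<bar>Re z\<bar> + \<bar>Re w\<bar>))) * E = 1"
    unfolding E_def by (simp add: exp_add[symmetric] algebra_simps)
  then have "(cmod (F (z, w)))\<^sup>2 = (exp (6 * \<mu>) * exp (- (\<mu> * (\<bar>Re z\<bar> + \<bar>Re w\<bar>)))) * (E * cmod (G z w))"
    by (simp add: G_def norm_power mult.assoc[symmetric])
  also have "\<dots> \<le> (exp (6 * \<mu>) * exp (- (\<mu> * (\<bar>Re z\<bar> + \<bar>Re w\<bar>)))) * C"
    using le by (intro mult_left_mono) auto
  finally show ?thesis by (simp add: mult_ac)
qed

section \<open>The inverse transform of a rapidly decreasing entire function\<close>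

definition fourier_inv_ext :: "(complex \<Rightarrow> complex \<Rightarrow> complex) \<Rightarrow> complex \<Rightarrow> complex \<Rightarrow> complex" where
  "fourier_inv_ext f z w = (\<integral>p. slice f 0 0 p * exp (2 * of_real pi * \<i> * (of_real (fst p) * z + of_real (snd p) * w)) \<partial>lborel)"

lemma fourier_inv_ext_real: "slice (fourier_inv_ext f) 0 0 = fourier_inv_integral (slice f 0 0)"
proof
  fix x
  have "cis (2 * pi * (p \<bullet> x)) = exp (2 * of_real pi * \<i> * (of_real (fst p) * of_real (fst x) + of_real (snd p) * of_real (snd x)))" for p
    unfolding cis_inner by (simp add: algebra_simps)
  then show "slice (fourier_inv_ext f) 0 0 x = fourier_inv_integral (slice f 0 0) x"
    by (simp add: fourier_inv_ext_def fourier_inv_integral_def slice_def[of "fourier_inv_ext f"])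
qed

text \<open>The decay of \<open>f\<close> along the real plane allows complex arguments and
  differentiation under the integral; decay of the result in the real directions comes from moving
  the contour, which is possible at every height because \<open>f\<close> is entire.\<close>

lemma strip_decay_fourier_inv_ext:
  assumes f: "strip_decay UNIV UNIV f" shows "strip_decay UNIV UNIV (fourier_inv_ext f)"
proof -
  define q where "q z w p = slice f 0 0 p * exp (2 * of_real pi * \<i> * (of_real (fst p) * z + of_real (snd p) * w))" for z w :: complex and p :: "real \<times> real"
  have qF: "q z w = slice (\<lambda>a b. exp ((2 * of_real pi * \<i> * z) * a + (2 * of_real pi * \<i> * w) * b + 0) * f a b) 0 0" for z w
    by (simp add: q_def slice_def fun_eq_iff algebra_simps)
  have sd: "strip_decay UNIV UNIV (\<lambda>a b. exp ((2 * of_real pi * \<i> * z) * a + (2 * of_real pi * \<i> * w) * b + 0) * f a b)" for z w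
    by (rule strip_decay_exp_mult[OF f])
  have q_meas: "q z w \<in> borel_measurable borel" for z w
    unfolding qF by (rule slice_measurable[OF sd]) auto
  have ext: "fourier_inv_ext f z w = (\<integral>p. q z w p \<partial>lborel)" for z w
    by (simp add: fourier_inv_ext_def q_def)
  \<comment> \<open>\<open>B\<close> bounds the imaginary parts of the arguments and
    \<open>C\<close> the contour shifts; the rate 2 pi B + 1 outweighs the exponential kernel and
    leaves the rate 1.\<close>
  have bound: "\<exists>M. \<forall>z w s t. \<bar>Im z\<bar> \<le> B \<longrightarrow> \<bar>Im w\<bar> \<le> B \<longrightarrow> \<bar>s\<bar> \<le> C \<longrightarrow> \<bar>t\<bar> \<le> C \<longrightarrow> (\<forall>p. cmod (slice f (of_real s * \<i>) (of_real t * \<i>) p) *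
     exp (2 * pi * (\<bar>Im z\<bar> * \<bar>fst p\<bar> + \<bar>Im w\<bar> * \<bar>snd p\<bar>)) \<le> M * exp (- (1 * (\<bar>fst p\<bar> + \<bar>snd p\<bar>))))" if B: "B \<ge> 0" for B C
  proof -
    obtain M where M: "M > 0" "\<And>a b p. Im a \<in> {- C..C} \<Longrightarrow> Im b \<in> {- C..C} \<Longrightarrow> \<bar>Re a\<bar> \<le> 0 \<Longrightarrow> \<bar>Re b\<bar> \<le> 0 \<Longrightarrow>
       cmod (slice f a b p) \<le> M * exp (- ((2 * pi * B + 1) * (\<bar>fst p\<bar> + \<bar>snd p\<bar>)))"
      using slice_bound_uniform[OF f, of "{- C..C}" "{- C..C}" "2 * pi * B + 1" 0] B by auto
    show ?thesis
    proof (intro exI[of _ M] allI impI)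
      fix z w s t and p :: "real \<times> real" assume zw: "\<bar>Im z\<bar> \<le> B" "\<bar>Im w\<bar> \<le> B" and st: "\<bar>s\<bar> \<le> C" "\<bar>t\<bar> \<le> C"
      have "\<bar>Im z\<bar> * \<bar>fst p\<bar> + \<bar>Im w\<bar> * \<bar>snd p\<bar> \<le> B * \<bar>fst p\<bar> + B * \<bar>snd p\<bar>"
        using zw by (intro add_mono mult_right_mono) auto
      then have "exp (2 * pi * (\<bar>Im z\<bar> * \<bar>fst p\<bar> + \<bar>Im w\<bar> * \<bar>snd p\<bar>)) \<le> exp (2 * pi * B * (\<bar>fst p\<bar> + \<bar>snd p\<bar>))"
        by (simp add: mult.assoc distrib_left[symmetric])
      moreover have "cmod (slice f (of_real s * \<i>) (of_real t * \<i>) p) \<le> M * exp (- ((2 * pi * B + 1) * (\<bar>fst p\<bar> + \<bar>snd p\<bar>)))"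
        using st by (intro M(2)) auto
      ultimately have "cmod (slice f (of_real s * \<i>) (of_real t * \<i>) p) * exp (2 * pi * (\<bar>Im z\<bar> * \<bar>fst p\<bar> + \<bar>Im w\<bar> * \<bar>snd p\<bar>))
        \<le> (M * exp (- ((2 * pi * B + 1) * (\<bar>fst p\<bar> + \<bar>snd p\<bar>)))) * exp (2 * pi * B * (\<bar>fst p\<bar> + \<bar>snd p\<bar>))"
        using M(1) by (intro mult_mono) auto
      also have "\<dots> = M * exp (- ((2 * pi * B + 1) * (\<bar>fst p\<bar> + \<bar>snd p\<bar>)) + 2 * pi * B * (\<bar>fst p\<bar> + \<bar>snd p\<bar>))"
        by (simp only: exp_add mult.assoc)
      also have "- ((2 * pi * B + 1) * (\<bar>fst p\<bar> + \<bar>snd p\<bar>)) + 2 * pi * B * (\<bar>fst p\<bar> + \<bar>snd p\<bar>) = - (1 * (\<bar>fst p\<bar> + \<bar>snd p\<bar>))"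
        by (simp add: algebra_simps)
      finally show "cmod (slice f (of_real s * \<i>) (of_real t * \<i>) p) * exp (2 * pi * (\<bar>Im z\<bar> * \<bar>fst p\<bar> + \<bar>Im w\<bar> * \<bar>snd p\<bar>)) \<le> M * exp (- (1 * (\<bar>fst p\<bar> + \<bar>snd p\<bar>)))" .
    qed
  qed
  have exp_le: "cmod (exp (2 * of_real pi * \<i> * (of_real a * z + of_real b * w))) \<le> exp (2 * pi * (\<bar>Im z\<bar> * \<bar>a\<bar> + \<bar>Im w\<bar> * \<bar>b\<bar>))" for a b :: real and z w
  proof -
    have "- (a * Im z + b * Im w) \<le> \<bar>Im z\<bar> * \<bar>a\<bar> + \<bar>Im w\<bar> * \<bar>b\<bar>"
      using abs_ge_minus_self[of "a * Im z"] abs_ge_minus_self[of "b * Im w"] by (simp add: abs_mult mult.commute)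
    then have "2 * pi * (- (a * Im z + b * Im w)) \<le> 2 * pi * (\<bar>Im z\<bar> * \<bar>a\<bar> + \<bar>Im w\<bar> * \<bar>b\<bar>)" by (intro mult_left_mono) auto
    then show ?thesis by (simp add: algebra_simps)
  qed
  have dom: "locally_dominated UNIV UNIV q"
    unfolding locally_dominated_def
  proof (intro allI impI)
    fix a b :: complex
    define B where "B = \<bar>Im a\<bar> + \<bar>Im b\<bar> + 1"
    obtain M where M: "\<forall>z w s t. \<bar>Im z\<bar> \<le> B \<longrightarrow> \<bar>Im w\<bar> \<le> B \<longrightarrow> \<bar>s\<bar> \<le> 0 \<longrightarrow> \<bar>t\<bar> \<le> 0 \<longrightarrow> (\<forall>p. cmod (slice f (of_real s * \<i>) (of_real t * \<i>) p) *
     exp (2 * pi * (\<bar>Im z\<bar> * \<bar>fst p\<bar> + \<bar>Im w\<bar> * \<bar>snd p\<bar>)) \<le> M * exp (- (1 * (\<bar>fst p\<bar> + \<bar>snd p\<bar>))))"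
      using bound[of B 0] by (auto simp: B_def)
    have "cmod (q z w p) \<le> M * exp (- (\<bar>fst p\<bar> + \<bar>snd p\<bar>))" if "dist z a < 1" "dist w b < 1" for z w p
    proof -
      have "\<bar>Im z\<bar> \<le> B" "\<bar>Im w\<bar> \<le> B" using that abs_Im_le_cmod[of "z - a"] abs_Im_le_cmod[of "w - b"] by (auto simp: B_def dist_norm)
      then have "cmod (slice f 0 0 p) * exp (2 * pi * (\<bar>Im z\<bar> * \<bar>fst p\<bar> + \<bar>Im w\<bar> * \<bar>snd p\<bar>)) \<le> M * exp (- (\<bar>fst p\<bar> + \<bar>snd p\<bar>))"
        using M[rule_format, of z w 0 0 p] by simp
      then show ?thesis unfolding q_def norm_mult
        by (rule order_trans[OF mult_left_mono[OF exp_le norm_ge_zero]])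
    qed
    then show "\<exists>e>0. \<exists>M. \<forall>z w p. dist z a < e \<longrightarrow> dist w b < e \<longrightarrow> Im z \<in> UNIV \<longrightarrow> Im w \<in> UNIV \<longrightarrow>
        cmod (q z w p) \<le> M * exp (- (\<bar>fst p\<bar> + \<bar>snd p\<bar>))"
      using zero_less_one by blast
  qed
  show ?thesis
  proof (rule strip_decayI)
    show "continuous_on {z. Im (fst z) \<in> UNIV \<and> Im (snd z) \<in> UNIV} (\<lambda>z. fourier_inv_ext f (fst z) (snd z))"
      unfolding ext by (rule integral_continuous[OF dom]) (use q_meas in \<open>auto simp: q_def intro!: continuous_intros\<close>)
    show "(\<lambda>z. fourier_inv_ext f z w) holomorphic_on {z. Im z \<in> UNIV}" for w
      unfolding ext by (rule integral_holomorphic1[OF dom]) (use q_meas in \<open>auto simp: q_def intro!: holomorphic_intros\<close>)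
    show "fourier_inv_ext f z holomorphic_on {w. Im w \<in> UNIV}" for z
      unfolding ext by (rule integral_holomorphic2[OF dom]) (use q_meas in \<open>auto simp: q_def intro!: holomorphic_intros\<close>)
    fix K L :: "real set" and c :: real assume K: "compact K" "compact L" and c: "c \<ge> 0"
    obtain B1 where B1: "B1 > 0" "\<And>x. x \<in> K \<Longrightarrow> \<bar>x\<bar> \<le> B1" using compact_abs_bounded K by metis
    obtain B2 where B2: "B2 > 0" "\<And>x. x \<in> L \<Longrightarrow> \<bar>x\<bar> \<le> B2" using compact_abs_bounded K by metis
    define B where "B = B1 + B2"
    \<comment> \<open>Moving the contour by \<open>C\<close>, with the signs of Re z and Re w, gains
      the factor exp(-c (|Re z| + |Re w|)).\<close>
    define C where "C = c / (2 * pi)"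
    obtain M where M: "\<forall>z w s t. \<bar>Im z\<bar> \<le> B \<longrightarrow> \<bar>Im w\<bar> \<le> B \<longrightarrow> \<bar>s\<bar> \<le> C \<longrightarrow> \<bar>t\<bar> \<le> C \<longrightarrow> (\<forall>p. cmod (slice f (of_real s * \<i>) (of_real t * \<i>) p) *
     exp (2 * pi * (\<bar>Im z\<bar> * \<bar>fst p\<bar> + \<bar>Im w\<bar> * \<bar>snd p\<bar>)) \<le> M * exp (- (1 * (\<bar>fst p\<bar> + \<bar>snd p\<bar>))))"
      using bound[of B C] B1 B2 by (auto simp: B_def)
    define N where "N = (\<integral>p. M * exp (- (1 * (\<bar>fst p\<bar> + \<bar>snd p\<bar>))) \<partial>(lborel :: (real \<times> real) measure))"
    show "\<exists>M. \<forall>z w. Im z \<in> K \<longrightarrow> Im w \<in> L \<longrightarrow> cmod (fourier_inv_ext f z w) \<le> M * exp (- (c * (\<bar>Re z\<bar> + \<bar>Re w\<bar>)))"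
    proof (intro exI[of _ N] allI impI)
      fix z w assume zw: "Im z \<in> K" "Im w \<in> L"
      have ib: "\<bar>Im z\<bar> \<le> B" "\<bar>Im w\<bar> \<le> B" using B1 B2 zw by (auto simp: B_def add_increasing add_increasing2 less_imp_le)
      define s where "s = (if Re z \<ge> 0 then C else - C)"
      define t where "t = (if Re w \<ge> 0 then C else - C)"
      have C0: "C \<ge> 0" using c by (simp add: C_def)
      have st: "\<bar>s\<bar> \<le> C" "\<bar>t\<bar> \<le> C" "2 * pi * (s * Re z + t * Re w) = c * (\<bar>Re z\<bar> + \<bar>Re w\<bar>)"
        using C0 by (auto simp: s_def t_def C_def field_simps)
      define F where "F = (\<lambda>a b. exp ((2 * of_real pi * \<i> * z) * a + (2 * of_real pi * \<i> * w) * b + 0) * f a b)"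
      define J where "J p = slice f (of_real s * \<i>) (of_real t * \<i>) p *
           exp (2 * of_real pi * \<i> * (of_real (fst p) * z + of_real (snd p) * w))" for p
      have "fourier_inv_ext f z w = (\<integral>p. slice F 0 0 p \<partial>lborel)" unfolding ext qF F_def ..
      also have "\<dots> = (\<integral>p. slice F (of_real s * \<i>) (of_real t * \<i>) p \<partial>lborel)"
        unfolding F_def by (rule slice_integral_shift[OF sd]) auto
      also have "\<dots> = (\<integral>p. exp (- of_real (2 * pi) * (of_real s * z + of_real t * w)) * (slice f (of_real s * \<i>) (of_real t * \<i>) p *
           exp (2 * of_real pi * \<i> * (of_real (fst p) * z + of_real (snd p) * w))) \<partial>lborel)"
      proof (intro Bochner_Integration.integral_cong refl)
        fix p
        have "exp ((2 * of_real pi * \<i> * z) * (of_real (fst p) + of_real s * \<i>) + (2 * of_real pi * \<i> * w) * (of_real (snd p) + of_real t * \<i>) + 0)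
           = exp (- of_real (2 * pi) * (of_real s * z + of_real t * w)) * exp (2 * of_real pi * \<i> * (of_real (fst p) * z + of_real (snd p) * w))"
          unfolding exp_add[symmetric] by (intro arg_cong[where f = exp]) (simp add: algebra_simps)
        then show "slice F (of_real s * \<i>) (of_real t * \<i>) p = exp (- of_real (2 * pi) * (of_real s * z + of_real t * w)) * (slice f (of_real s * \<i>) (of_real t * \<i>) p *
           exp (2 * of_real pi * \<i> * (of_real (fst p) * z + of_real (snd p) * w)))"
          by (simp add: slice_def F_def)
      qed
      also have "\<dots> = (\<integral>p. exp (- of_real (2 * pi) * (of_real s * z + of_real t * w)) * J p \<partial>lborel)"
        unfolding J_def ..
      also have "\<dots> = exp (- of_real (2 * pi) * (of_real s * z + of_real t * w)) * (\<integral>p. J p \<partial>lborel)"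
        by (rule integral_mult_right_zero)
      finally have eq: "cmod (fourier_inv_ext f z w) = exp (- (c * (\<bar>Re z\<bar> + \<bar>Re w\<bar>))) * cmod (\<integral>p. J p \<partial>lborel)"
        unfolding st(3)[symmetric] by (simp add: norm_mult algebra_simps)
      have J_le: "cmod (J p) \<le> M * exp (- (1 * (\<bar>fst p\<bar> + \<bar>snd p\<bar>)))" for p
        unfolding J_def norm_mult
        using M[rule_format, OF ib st(1,2), of p] by (rule order_trans[OF mult_left_mono[OF exp_le norm_ge_zero]])
      have "cmod (\<integral>p. J p \<partial>lborel) \<le> (\<integral>p. cmod (J p) \<partial>lborel)" by (rule integral_norm_bound)
      also have "\<dots> \<le> N"
        unfolding N_def
      proof (rule integral_mono')
        show "integrable lborel (\<lambda>p::real\<times>real. M * exp (- (1 * (\<bar>fst p\<bar> + \<bar>snd p\<bar>))))"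
          by (intro integrable_mult_right integrable_exp_abs2) simp
        show "0 \<le> M * exp (- (1 * (\<bar>fst p\<bar> + \<bar>snd p\<bar>)))" for p
          using norm_ge_zero J_le by (rule order_trans)
      qed (rule J_le)
      finally have JN: "cmod (\<integral>p. J p \<partial>lborel) \<le> N" .
      show "cmod (fourier_inv_ext f z w) \<le> N * exp (- (c * (\<bar>Re z\<bar> + \<bar>Re w\<bar>)))"
        unfolding eq using mult_left_mono[OF JN, of "exp (- (c * (\<bar>Re z\<bar> + \<bar>Re w\<bar>)))"] by (simp add: mult.commute)
    qed
  qed
qed

lemma norm_exp_remainder: "cmod (exp x - 1 - x) \<le> (cmod x)\<^sup>2 * exp (cmod x)"
proof -
  have "norm (exp x - (\<Sum>k\<le>1. x ^ k / fact k)) \<le> exp \<bar>Re x\<bar> * (norm x ^ Suc 1) / fact 1" by (rule Taylor_exp)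
  also have "\<dots> \<le> exp (cmod x) * (norm x ^ Suc 1) / fact 1"
    by (intro divide_right_mono mult_right_mono) (auto simp: abs_Re_le_cmod)
  finally show ?thesis by (simp add: power2_eq_square algebra_simps)
qed

text \<open>\<open>entire2\<close> asks for a total complex derivative. Its coefficients are the
  first moments of the integrand, and the quadratic remainder of the exponential makes the error
  O(|h|^2).\<close>

lemma entire2_fourier_inv_ext:
  assumes f: "strip_decay UNIV UNIV f" shows "entire2 (\<lambda>z. fourier_inv_ext f (fst z) (snd z))"
  unfolding entire2_def
proof
  fix z :: "complex \<times> complex"
  define e where "e p h = 2 * of_real pi * \<i> * (of_real (fst p) * fst h + of_real (snd p) * snd h)" for p :: "real \<times> real" and h :: "complex \<times> complex"
  define q where "q h p = slice f 0 0 p * exp (e p h)" for h p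
  have sd: "strip_decay UNIV UNIV (\<lambda>a b. exp ((2 * of_real pi * \<i> * fst h) * a + (2 * of_real pi * \<i> * snd h) * b + 0) * f a b)" for h :: "complex \<times> complex"
    by (rule strip_decay_exp_mult[OF f])
  have qF: "q h = slice (\<lambda>a b. exp ((2 * of_real pi * \<i> * fst h) * a + (2 * of_real pi * \<i> * snd h) * b + 0) * f a b) 0 0" for h
    by (simp add: q_def e_def slice_def fun_eq_iff algebra_simps)
  have q_meas: "q h \<in> borel_measurable borel" for h unfolding qF by (rule slice_measurable[OF sd]) auto
  have q_int: "integrable lborel (q h)" for h unfolding qF by (rule slice_integrable[OF sd]) auto
  have q_bd: "\<exists>M>0. \<forall>p. cmod (q h p) \<le> M * exp (- (C * (\<bar>fst p\<bar> + \<bar>snd p\<bar>)))" if C: "C \<ge> 0" for h C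
  proof -
    obtain M where "M > 0" "\<And>p. cmod (q h p) \<le> M * exp (- (C * (\<bar>fst p\<bar> + \<bar>snd p\<bar>)))"
      unfolding qF by (rule slice_bound[OF sd _ _ C, of 0 0 h]) auto
    then show ?thesis by blast
  qed
  have ext: "fourier_inv_ext f (fst h) (snd h) = (\<integral>p. q h p \<partial>lborel)" for h
    by (simp add: fourier_inv_ext_def q_def e_def)
  have poly_le: "x \<le> exp x" "x\<^sup>2 \<le> 2 * exp x" if "x \<ge> 0" for x :: real
    using exp_ge_add_one_self[of x] exp_lower_Taylor_quadratic[OF that] that zero_le_power2[of x] by linarith+
  have lin_int: "integrable lborel (\<lambda>p. q h p * of_real (g p))" if "\<And>p. \<bar>g p\<bar> \<le> \<bar>fst p\<bar> + \<bar>snd p\<bar>" "g \<in> borel_measurable borel" for h g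
  proof -
    obtain M where M: "M > 0" "\<And>p. cmod (q h p) \<le> M * exp (- (2 * (\<bar>fst p\<bar> + \<bar>snd p\<bar>)))" using q_bd[of 2 h] by auto
    show ?thesis
    proof (rule integrable_exp_dominated[of _ 1 M])
      show "cmod (q h p * of_real (g p)) \<le> M * exp (- (1 * (\<bar>fst p\<bar> + \<bar>snd p\<bar>)))" for p
      proof -
        have "cmod (q h p * of_real (g p)) \<le> (M * exp (- (2 * (\<bar>fst p\<bar> + \<bar>snd p\<bar>)))) * exp (\<bar>fst p\<bar> + \<bar>snd p\<bar>)"
          unfolding norm_mult using M that(1)[of p] poly_le(1)[of "\<bar>fst p\<bar> + \<bar>snd p\<bar>"] by (intro mult_mono) auto
        also have "\<dots> = M * exp (- (2 * (\<bar>fst p\<bar> + \<bar>snd p\<bar>)) + (\<bar>fst p\<bar> + \<bar>snd p\<bar>))" by (simp only: exp_add mult.assoc)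
        also have "- (2 * (\<bar>fst p\<bar> + \<bar>snd p\<bar>)) + (\<bar>fst p\<bar> + \<bar>snd p\<bar>) = - (1 * (\<bar>fst p\<bar> + \<bar>snd p\<bar>))" by simp
        finally show ?thesis .
      qed
    qed (use q_meas that in auto)
  qed
  define c where "c = 2 * of_real pi * \<i> * (\<integral>p. q z p * of_real (fst p) \<partial>lborel)"
  define d where "d = 2 * of_real pi * \<i> * (\<integral>p. q z p * of_real (snd p) \<partial>lborel)"
  have i1: "integrable lborel (\<lambda>p. q z p * of_real (fst p))"
    by (rule lin_int) (auto intro: borel_measurable_continuous_onI continuous_on_fst[OF continuous_on_id])
  have i2: "integrable lborel (\<lambda>p. q z p * of_real (snd p))"
    by (rule lin_int) (auto intro: borel_measurable_continuous_onI continuous_on_snd[OF continuous_on_id])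
  have D: "c * fst h + d * snd h = (\<integral>p. q z p * e p h \<partial>lborel)" "integrable lborel (\<lambda>p. q z p * e p h)" for h
  proof -
    have eq: "q z p * e p h = (2 * of_real pi * \<i> * fst h) * (q z p * of_real (fst p)) + (2 * of_real pi * \<i> * snd h) * (q z p * of_real (snd p))" for p
      by (simp add: e_def algebra_simps)
    show "integrable lborel (\<lambda>p. q z p * e p h)" unfolding eq using i1 i2 by (intro Bochner_Integration.integrable_add integrable_mult_right)
    show "c * fst h + d * snd h = (\<integral>p. q z p * e p h \<partial>lborel)"
      unfolding eq c_def d_def using i1 i2 by (subst Bochner_Integration.integral_add) (auto simp: mult_ac)
  qed
  \<comment> \<open>With r = 2 pi (|p1| + |p2|) the remainder contributes two factors exp r, that is
    the growth rate 4 pi; the extra 1 leaves an integrable function.\<close>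
  obtain M where M: "M > 0" "\<And>p. cmod (q z p) \<le> M * exp (- ((4 * pi + 1) * (\<bar>fst p\<bar> + \<bar>snd p\<bar>)))" using q_bd[of "4 * pi + 1" z] by auto
  define N where "N = (\<integral>p. M * 2 * exp (- (1 * (\<bar>fst p\<bar> + \<bar>snd p\<bar>))) \<partial>(lborel :: (real \<times> real) measure))"
  have rem: "cmod (fourier_inv_ext f (fst (z + h)) (snd (z + h)) - fourier_inv_ext f (fst z) (snd z) - (c * fst h + d * snd h)) \<le> N * (norm h)\<^sup>2"
    if h: "norm h \<le> 1" for h
  proof -
    have qh: "q (z + h) p = q z p * exp (e p h)" for p
      unfolding q_def mult.assoc exp_add[symmetric] by (intro arg_cong2[where f = "(*)"] arg_cong[where f = exp] refl) (simp add: e_def algebra_simps)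
    have "fourier_inv_ext f (fst (z + h)) (snd (z + h)) - fourier_inv_ext f (fst z) (snd z) - (c * fst h + d * snd h) = (\<integral>p. q z p * (exp (e p h) - 1 - e p h) \<partial>lborel)"
    proof -
      have i3: "integrable lborel (\<lambda>p. q z p * exp (e p h))" using q_int[of "z + h"] by (simp add: qh[symmetric])
      have "fourier_inv_ext f (fst (z + h)) (snd (z + h)) = (\<integral>p. q z p * exp (e p h) \<partial>lborel)"
        unfolding ext qh[symmetric] ..
      then show ?thesis unfolding D(1) using i3 q_int[of z] D(2)[of h] by (simp add: ext[of z] right_diff_distrib)
    qed
    also have "cmod \<dots> \<le> (\<integral>p. (M * 2 * exp (- (1 * (\<bar>fst p\<bar> + \<bar>snd p\<bar>)))) * (norm h)\<^sup>2 \<partial>lborel)"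
    proof (rule order_trans[OF integral_norm_bound], rule integral_mono')
      show "integrable lborel (\<lambda>p::real\<times>real. (M * 2 * exp (- (1 * (\<bar>fst p\<bar> + \<bar>snd p\<bar>)))) * (norm h)\<^sup>2)"
        by (intro integrable_mult_left integrable_mult_right integrable_exp_abs2) simp
      fix p :: "real \<times> real"
      define r where "r = 2 * pi * (\<bar>fst p\<bar> + \<bar>snd p\<bar>)"
      have r0: "r \<ge> 0" by (simp add: r_def)
      have hn: "cmod (fst h) \<le> norm h" "cmod (snd h) \<le> norm h"
        using norm_fst_le[of "fst h" "snd h"] norm_snd_le[of "snd h" "fst h"] by auto
      have "cmod (of_real (fst p) * fst h + of_real (snd p) * snd h) \<le> \<bar>fst p\<bar> * norm h + \<bar>snd p\<bar> * norm h"
        by (rule order_trans[OF norm_triangle_ineq]) (use hn in \<open>auto simp: norm_mult intro!: add_mono mult_left_mono\<close>)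
      from mult_left_mono[OF this, of "2 * pi"]
      have "2 * pi * cmod (of_real (fst p) * fst h + of_real (snd p) * snd h) \<le> r * norm h"
        by (simp add: r_def algebra_simps)
      moreover have "cmod (e p h) = 2 * pi * cmod (of_real (fst p) * fst h + of_real (snd p) * snd h)"
        unfolding e_def norm_mult[of "2 * of_real pi * \<i>"] by (simp add: norm_mult)
      ultimately have er: "cmod (e p h) \<le> r * norm h" by simp
      have er': "cmod (e p h) \<le> r" using er h r0 by (meson mult_left_le order_trans)
      have "cmod (exp (e p h) - 1 - e p h) \<le> (r * norm h)\<^sup>2 * exp r"
        by (rule order_trans[OF norm_exp_remainder]) (use er er' in \<open>auto intro!: mult_mono power_mono\<close>)
      also have "\<dots> \<le> (2 * exp r * (norm h)\<^sup>2) * exp r"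
        unfolding power_mult_distrib using poly_le(2)[OF r0] by (intro mult_right_mono) auto
      finally have "cmod (q z p * (exp (e p h) - 1 - e p h)) \<le> (M * exp (- ((4 * pi + 1) * (\<bar>fst p\<bar> + \<bar>snd p\<bar>)))) * ((2 * exp r * (norm h)\<^sup>2) * exp r)"
        unfolding norm_mult using M by (intro mult_mono) auto
      also have "\<dots> = M * 2 * exp (- ((4 * pi + 1) * (\<bar>fst p\<bar> + \<bar>snd p\<bar>)) + r + r) * (norm h)\<^sup>2"
        by (simp only: exp_add mult_ac)
      also have "- ((4 * pi + 1) * (\<bar>fst p\<bar> + \<bar>snd p\<bar>)) + r + r = - (1 * (\<bar>fst p\<bar> + \<bar>snd p\<bar>))" by (simp add: r_def algebra_simps)
      finally show "cmod (q z p * (exp (e p h) - 1 - e p h)) \<le> M * 2 * exp (- (1 * (\<bar>fst p\<bar> + \<bar>snd p\<bar>))) * (norm h)\<^sup>2" .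
      show "0 \<le> M * 2 * exp (- (1 * (\<bar>fst p\<bar> + \<bar>snd p\<bar>))) * (norm h)\<^sup>2" using M by simp
    qed
    also have "\<dots> = N * (norm h)\<^sup>2" by (simp add: N_def)
    finally show ?thesis .
  qed
  have "((\<lambda>z. fourier_inv_ext f (fst z) (snd z)) has_derivative (\<lambda>h. c * fst h + d * snd h)) (at z)"
    unfolding has_derivative_at
  proof
    show "bounded_linear (\<lambda>h. c * fst h + d * snd h)"
      by (intro bounded_linear_add bounded_linear_const_mult bounded_linear_fst bounded_linear_snd)
    show "(\<lambda>h. norm (fourier_inv_ext f (fst (z + h)) (snd (z + h)) - fourier_inv_ext f (fst z) (snd z) - (c * fst h + d * snd h)) / norm h) \<midarrow>0\<rightarrow> 0"
    proof (rule Lim_null_comparison)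
      have "\<forall>\<^sub>F h in at (0 :: complex \<times> complex). norm h < 1"
        using eventually_at[of "\<lambda>h. norm h < 1" "0 :: complex \<times> complex" UNIV] by (auto intro: exI[of _ 1])
      then show "\<forall>\<^sub>F h in at 0. norm (norm (fourier_inv_ext f (fst (z + h)) (snd (z + h)) - fourier_inv_ext f (fst z) (snd z) - (c * fst h + d * snd h)) / norm h) \<le> N * norm h"
      proof eventually_elim
        case (elim h)
        then have "norm (fourier_inv_ext f (fst (z + h)) (snd (z + h)) - fourier_inv_ext f (fst z) (snd z) - (c * fst h + d * snd h)) \<le> N * norm h * norm h"
          using rem[of h] by (simp add: power2_eq_square mult.assoc)
        then show ?case
          by (cases "norm h = 0") (simp_all add: divide_le_eq)
      qed
      show "(\<lambda>h. N * norm h) \<midarrow>0\<rightarrow> 0" by (intro tendsto_eq_intros) auto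
    qed
  qed
  then show "\<exists>c d. ((\<lambda>z. fourier_inv_ext f (fst z) (snd z)) has_derivative (\<lambda>w. c * fst w + d * snd w)) (at z)" by blast
qed


lemma frakA_functions_strip_decay:
  assumes "a \<in> frakA_functions"
  obtains F where "strip_decay UNIV UNIV F" "a = slice F 0 0"
proof -
  obtain F where F: "entire2 F" "\<And>x1 x2. a (x1, x2) = F (of_real x1, of_real x2)"
    and sup: "\<And>\<mu>1 \<mu>2 \<nu>1 \<nu>2. \<mu>1 > 0 \<Longrightarrow> \<mu>2 > 0 \<Longrightarrow> \<nu>1 > 0 \<Longrightarrow> \<nu>2 > 0 \<Longrightarrow>
        (SUP (y1, y2) \<in> {y. \<bar>fst y\<bar> < \<nu>1 \<and> \<bar>snd y\<bar> < \<nu>2}.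
           \<integral>\<^sup>+ (x1, x2). ennreal ((cmod (F (Complex x1 y1, Complex x2 y2)))\<^sup>2 *
               exp (4 * pi * (\<mu>1 * \<bar>x1\<bar> + \<mu>2 * \<bar>x2\<bar>))) \<partial>lborel) < \<infinity>"
    using assms unfolding frakA_functions_def by blast
  have "strip_decay UNIV UNIV (\<lambda>z w. F (z, w))"
  proof (rule strip_decayI)
    show "continuous_on {z. Im (fst z) \<in> UNIV \<and> Im (snd z) \<in> UNIV} (\<lambda>z. F (fst z, snd z))"
      using entire2_continuous[OF F(1)] by simp
    show "(\<lambda>z. F (z, w)) holomorphic_on {z. Im z \<in> UNIV}" "(\<lambda>w. F (z, w)) holomorphic_on {w. Im w \<in> UNIV}" for z w
      by (rule entire2_holomorphic[OF F(1)])+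
    fix K L :: "real set" and c :: real assume K: "compact K" "compact L" and c: "c \<ge> 0"
    obtain B1 where B1: "B1 > 0" "\<And>x. x \<in> K \<Longrightarrow> \<bar>x\<bar> \<le> B1" using compact_abs_bounded K by metis
    obtain B2 where B2: "B2 > 0" "\<And>x. x \<in> L \<Longrightarrow> \<bar>x\<bar> \<le> B2" using compact_abs_bounded K by metis
    define \<nu> where "\<nu> = B1 + B2"
    \<comment> \<open>The weight then has exponent 4 pi m = 2 (c + 1), more than the rate 2 c
      required of |F|^2.\<close>
    define m where "m = (c + 1) / (2 * pi)"
    \<comment> \<open>The supremum runs over open rectangles, while the pointwise estimate needs all
      heights up to and including \<nu> + 2; hence \<nu> + 3.\<close>
    define S where "S = (SUP (y1, y2) \<in> {y. \<bar>fst y\<bar> < \<nu> + 3 \<and> \<bar>snd y\<bar> < \<nu> + 3}.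
           \<integral>\<^sup>+ (x1, x2). ennreal ((cmod (F (Complex x1 y1, Complex x2 y2)))\<^sup>2 * exp (4 * pi * (m * \<bar>x1\<bar> + m * \<bar>x2\<bar>))) \<partial>lborel)"
    have "S < \<infinity>" unfolding S_def by (rule sup) (use B1 B2 c in \<open>auto simp: \<nu>_def m_def\<close>)
    define C where "C = enn2real S"
    have SC: "S = ennreal C" "C \<ge> 0" using \<open>S < \<infinity>\<close> by (auto simp: C_def)
    define \<mu> where "\<mu> = 2 * (c + 1)"
    have mm: "4 * pi * (m * a + m * b) = \<mu> * (a + b)" for a b by (simp add: m_def \<mu>_def field_simps)
    have key: "(cmod (F (z, w)))\<^sup>2 \<le> C * exp (6 * \<mu>) * exp (- (\<mu> * (\<bar>Re z\<bar> + \<bar>Re w\<bar>)))" if "\<bar>Im z\<bar> \<le> \<nu>" "\<bar>Im w\<bar> \<le> \<nu>" for z w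
    proof (rule entire2_pointwise_bound[OF F(1) _ _ SC(2) that])
      show "\<mu> \<ge> 0" using c by (simp add: \<mu>_def)
      fix y1 y2 :: real assume y: "\<bar>y1\<bar> \<le> \<nu> + 2" "\<bar>y2\<bar> \<le> \<nu> + 2"
      have "(\<integral>\<^sup>+ (x1, x2). ennreal ((cmod (F (Complex x1 y1, Complex x2 y2)))\<^sup>2 * exp (4 * pi * (m * \<bar>x1\<bar> + m * \<bar>x2\<bar>))) \<partial>lborel) \<le> S"
        unfolding S_def by (rule SUP_upper2[of "(y1, y2)"]) (use y in auto)
      then show "(\<integral>\<^sup>+ x. ennreal ((cmod (F (Complex (fst x) y1, Complex (snd x) y2)))\<^sup>2 * exp (\<mu> * (\<bar>fst x\<bar> + \<bar>snd x\<bar>))) \<partial>lborel) \<le> ennreal C"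
        by (simp add: SC(1) mm split_def)
    qed
    show "\<exists>M. \<forall>z w. Im z \<in> K \<longrightarrow> Im w \<in> L \<longrightarrow> cmod (F (z, w)) \<le> M * exp (- (c * (\<bar>Re z\<bar> + \<bar>Re w\<bar>)))"
    proof (intro exI[of _ "sqrt (C * exp (6 * \<mu>))"] allI impI)
      fix z w assume zw: "Im z \<in> K" "Im w \<in> L"
      have ib: "\<bar>Im z\<bar> \<le> \<nu>" "\<bar>Im w\<bar> \<le> \<nu>" using B1 B2 zw by (auto simp: \<nu>_def add_increasing add_increasing2 less_imp_le)
      have "(cmod (F (z, w)))\<^sup>2 \<le> C * exp (6 * \<mu>) * exp (- (2 * c * (\<bar>Re z\<bar> + \<bar>Re w\<bar>)))"
        by (rule order_trans[OF key[OF ib]]) (use SC in \<open>auto intro!: mult_left_mono mult_right_mono simp: \<mu>_def\<close>)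
      also have "\<dots> = (sqrt (C * exp (6 * \<mu>)) * exp (- (c * (\<bar>Re z\<bar> + \<bar>Re w\<bar>))))\<^sup>2"
        using SC by (simp add: power_mult_distrib exp_double[symmetric])
      finally show "cmod (F (z, w)) \<le> sqrt (C * exp (6 * \<mu>)) * exp (- (c * (\<bar>Re z\<bar> + \<bar>Re w\<bar>)))"
        by (rule power2_le_imp_le) (use SC in auto)
    qed
  qed
  moreover have "a = slice (\<lambda>z w. F (z, w)) 0 0" using F(2) by (auto simp: slice_def fun_eq_iff)
  ultimately show ?thesis by (rule that)
qed

lemma fourier_inv_in_frakA_functions:
  assumes f: "strip_decay UNIV UNIV f"
  shows "fourier_inv_integral (slice f 0 0) \<in> frakA_functions"
proof -
  define F where "F z = fourier_inv_ext f (fst z) (snd z)" for z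
  have "(SUP (y1, y2) \<in> {y. \<bar>fst y\<bar> < \<nu>1 \<and> \<bar>snd y\<bar> < \<nu>2}.
           \<integral>\<^sup>+ (x1, x2). ennreal ((cmod (F (Complex x1 y1, Complex x2 y2)))\<^sup>2 *
               exp (4 * pi * (\<mu>1 * \<bar>x1\<bar> + \<mu>2 * \<bar>x2\<bar>))) \<partial>lborel) < \<infinity>"
    if pos: "\<mu>1 > 0" "\<mu>2 > 0" "\<nu>1 > 0" "\<nu>2 > 0" for \<mu>1 \<mu>2 \<nu>1 \<nu>2
  proof -
    \<comment> \<open>Squaring doubles the rate, so the weight of the norm is cancelled and the rate
      2 remains.\<close>
    define c where "c = 2 * pi * (\<mu>1 + \<mu>2) + 1"
    obtain M where M: "M > 0" "\<And>z w. Im z \<in> {- \<nu>1..\<nu>1} \<Longrightarrow> Im w \<in> {- \<nu>2..\<nu>2} \<Longrightarrow> cmod (fourier_inv_ext f z w) \<le> M * exp (- (c * (\<bar>Re z\<bar> + \<bar>Re w\<bar>)))"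
      using strip_decay_bound[OF strip_decay_fourier_inv_ext[OF f], of "{- \<nu>1..\<nu>1}" "{- \<nu>2..\<nu>2}" c] by auto
    have pt: "(cmod (F (Complex x1 y1, Complex x2 y2)))\<^sup>2 * exp (4 * pi * (\<mu>1 * \<bar>x1\<bar> + \<mu>2 * \<bar>x2\<bar>)) \<le> M\<^sup>2 * exp (- (2 * (\<bar>x1\<bar> + \<bar>x2\<bar>)))"
      if y: "\<bar>y1\<bar> < \<nu>1" "\<bar>y2\<bar> < \<nu>2" for x1 x2 y1 y2
    proof -
      have "cmod (F (Complex x1 y1, Complex x2 y2)) \<le> M * exp (- (c * (\<bar>x1\<bar> + \<bar>x2\<bar>)))"
        using M(2)[of "Complex x1 y1" "Complex x2 y2"] y unfolding F_def by (simp add: abs_less_iff)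
      then have "(cmod (F (Complex x1 y1, Complex x2 y2)))\<^sup>2 \<le> (M * exp (- (c * (\<bar>x1\<bar> + \<bar>x2\<bar>))))\<^sup>2" by (intro power_mono) auto
      also have "\<dots> = M\<^sup>2 * exp (- (2 * c * (\<bar>x1\<bar> + \<bar>x2\<bar>)))" by (simp add: power_mult_distrib exp_double[symmetric] mult.assoc)
      finally have "(cmod (F (Complex x1 y1, Complex x2 y2)))\<^sup>2 * exp (4 * pi * (\<mu>1 * \<bar>x1\<bar> + \<mu>2 * \<bar>x2\<bar>)) \<le>
         (M\<^sup>2 * exp (- (2 * c * (\<bar>x1\<bar> + \<bar>x2\<bar>)))) * exp (4 * pi * (\<mu>1 + \<mu>2) * (\<bar>x1\<bar> + \<bar>x2\<bar>))"
      proof (rule mult_mono)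
        have "\<mu>1 * \<bar>x1\<bar> + \<mu>2 * \<bar>x2\<bar> \<le> (\<mu>1 + \<mu>2) * (\<bar>x1\<bar> + \<bar>x2\<bar>)" using pos by (simp add: algebra_simps)
        then show "exp (4 * pi * (\<mu>1 * \<bar>x1\<bar> + \<mu>2 * \<bar>x2\<bar>)) \<le> exp (4 * pi * (\<mu>1 + \<mu>2) * (\<bar>x1\<bar> + \<bar>x2\<bar>))" by (simp add: mult.assoc)
      qed auto
      also have "\<dots> = M\<^sup>2 * exp (- (2 * c * (\<bar>x1\<bar> + \<bar>x2\<bar>)) + 4 * pi * (\<mu>1 + \<mu>2) * (\<bar>x1\<bar> + \<bar>x2\<bar>))" by (simp only: exp_add mult.assoc)
      also have "- (2 * c * (\<bar>x1\<bar> + \<bar>x2\<bar>)) + 4 * pi * (\<mu>1 + \<mu>2) * (\<bar>x1\<bar> + \<bar>x2\<bar>) = - (2 * (\<bar>x1\<bar> + \<bar>x2\<bar>))" by (simp add: c_def algebra_simps)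
      finally show ?thesis .
    qed
    have int: "integrable lborel (\<lambda>x::real\<times>real. M\<^sup>2 * exp (- (2 * (\<bar>fst x\<bar> + \<bar>snd x\<bar>))))"
      by (intro integrable_mult_right integrable_exp_abs2) simp
    have "(SUP (y1, y2) \<in> {y. \<bar>fst y\<bar> < \<nu>1 \<and> \<bar>snd y\<bar> < \<nu>2}.
           \<integral>\<^sup>+ (x1, x2). ennreal ((cmod (F (Complex x1 y1, Complex x2 y2)))\<^sup>2 *
               exp (4 * pi * (\<mu>1 * \<bar>x1\<bar> + \<mu>2 * \<bar>x2\<bar>))) \<partial>lborel) \<le> (\<integral>\<^sup>+x. ennreal (M\<^sup>2 * exp (- (2 * (\<bar>fst x\<bar> + \<bar>snd x\<bar>)))) \<partial>(lborel :: (real \<times> real) measure))"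
    proof (rule SUP_least)
      fix y :: "real \<times> real" assume "y \<in> {y. \<bar>fst y\<bar> < \<nu>1 \<and> \<bar>snd y\<bar> < \<nu>2}"
      then show "(case y of (y1, y2) \<Rightarrow> \<integral>\<^sup>+ (x1, x2). ennreal ((cmod (F (Complex x1 y1, Complex x2 y2)))\<^sup>2 *
               exp (4 * pi * (\<mu>1 * \<bar>x1\<bar> + \<mu>2 * \<bar>x2\<bar>))) \<partial>lborel) \<le> (\<integral>\<^sup>+x. ennreal (M\<^sup>2 * exp (- (2 * (\<bar>fst x\<bar> + \<bar>snd x\<bar>)))) \<partial>(lborel :: (real \<times> real) measure))"
        unfolding split_def by (intro nn_integral_mono ennreal_leI pt) auto
    qed
    also have "\<dots> < \<infinity>" using nn_integral_eq_integral[OF int] by simp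
    finally show ?thesis .
  qed
  moreover have "fourier_inv_integral (slice f 0 0) (x1, x2) = F (of_real x1, of_real x2)" for x1 x2
    unfolding fourier_inv_ext_real[symmetric] by (simp add: slice_def F_def)
  moreover have "entire2 F" unfolding F_def by (rule entire2_fourier_inv_ext[OF f])
  ultimately show ?thesis unfolding frakA_functions_def by blast
qed

lemma strip_fun_UNIV: "strip_fun UNIV UNIV f \<longleftrightarrow> strip_decay UNIV UNIV f"
  by (simp add: strip_fun_def)

text \<open>The class is its own Fourier image: \<open>fourier_inv_ext\<close> maps it to itself,
  and reflecting the argument turns the inverse transform into the transform.\<close>

theorem frakA_eq: "frakA = of_strip ` {f. strip_decay UNIV UNIV f}"
proof
  show "of_strip ` {f. strip_decay UNIV UNIV f} \<subseteq> frakA"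
    using fourier_inv_in_frakA_functions by (auto simp: of_strip_def frakA_def)
  show "frakA \<subseteq> of_strip ` {f. strip_decay UNIV UNIV f}"
  proof
    fix u assume "u \<in> frakA"
    then obtain a where "a \<in> frakA_functions" "u = abs_l2 a" by (auto simp: frakA_def)
    then obtain F where F: "strip_decay UNIV UNIV F" "u = abs_l2 (slice F 0 0)" using frakA_functions_strip_decay by metis
    define G where "G z w = fourier_inv_ext F (0 - z) (0 - w)" for z w
    have G: "strip_decay UNIV UNIV G"
      using strip_decay_reflect[OF strip_decay_fourier_inv_ext[OF F(1)], of 0 0] by (simp add: G_def[abs_def])
    have sF: "integrable lborel (slice F 0 0)" "square_integrable (slice F 0 0)"
      using slice_integrable[OF F(1)] slice_square_integrable[OF F(1)] by auto
    have "slice G 0 0 = fourier_integral (slice F 0 0)"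
    proof
      fix x
      have "slice G 0 0 x = slice (fourier_inv_ext F) 0 0 (- x)" by (simp add: slice_def G_def)
      then show "slice G 0 0 x = fourier_integral (slice F 0 0) x"
        unfolding fourier_inv_ext_real by (simp add: fourier_eq_inv)
    qed
    then have "fourier (of_strip G) = fourier u"
      using fourier_of_strip[of UNIV UNIV G] G fourier_abs_l2[OF sF] F(2) by (simp add: strip_fun_UNIV)
    then have "u = of_strip G" using fourier_inj by metis
    with G show "u \<in> of_strip ` {f. strip_decay UNIV UNIV f}" by blast
  qed
qed

subsection \<open>The twisted product on the Fourier side\<close>

text \<open>The symplectic form on the frequency plane, the cocycle of the twisted
  convolution.\<close>

definition bracket :: "real \<times> real \<Rightarrow> real \<times> real \<Rightarrow> real" where
  "bracket p r = fst p * snd r - snd p * fst r"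

text \<open>A quarter turn maps boxes to boxes, so invariance of the measure can be checked
  there.\<close>

lemma lborel_distr_rotate: "distr lborel borel (\<lambda>q. (- snd q, fst q)) = (lborel :: (real \<times> real) measure)"
proof (rule lborel_eqI[symmetric])
  have meas: "(\<lambda>q::real\<times>real. (- snd q, fst q)) \<in> borel_measurable borel"
    by (intro borel_measurable_continuous_onI continuous_intros)
  fix l u :: "real \<times> real" assume le: "\<And>b. b \<in> Basis \<Longrightarrow> l \<bullet> b \<le> u \<bullet> b"
  have lu: "fst l \<le> fst u" "snd l \<le> snd u" using le[of "(1, 0)"] le[of "(0, 1)"] by (auto simp: Basis_prod_def inner_prod_def)
  have "(\<lambda>q::real\<times>real. (- snd q, fst q)) -` box l u = box (snd l, - fst u) (snd u, - fst l)"
    by (auto simp: box_def Basis_prod_def inner_prod_def)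
  then have "emeasure (distr lborel borel (\<lambda>q. (- snd q, fst q))) (box l u) = emeasure lborel (box (snd l, - fst u) (snd u, - fst l))"
    using meas by (subst emeasure_distr) auto
  also have "\<dots> = (\<Prod>b\<in>Basis. ((snd u, - fst l) - (snd l, - fst u)) \<bullet> b)"
    by (rule emeasure_lborel_box) (use lu in \<open>auto simp: Basis_prod_def inner_prod_def\<close>)
  also have "\<dots> = ennreal (\<Prod>b\<in>Basis. (u - l) \<bullet> b)"
    by (simp add: Basis_prod_def inner_prod_def mult.commute)
  finally show "emeasure (distr lborel borel (\<lambda>q. (- snd q, fst q))) (box l u) = ennreal (\<Prod>b\<in>Basis. (u - l) \<bullet> b)" .
qed simp

text \<open>The substitution u = x + J q / 2 with the quarter turn J; its Jacobian 1/4 cancels the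
  factor 4 of the twisted product.\<close>

lemma lborel_integral_symplectic:
  fixes \<phi> :: "real \<times> real \<Rightarrow> complex"
  assumes "\<phi> \<in> borel_measurable borel"
  shows "4 * (\<integral>u. \<phi> u \<partial>lborel) = (\<integral>q. \<phi> (fst x - snd q / 2, snd x + fst q / 2) \<partial>lborel)"
proof -
  have "4 * (\<integral>u. \<phi> u \<partial>lborel) = (\<integral>q. \<phi> (x + (1/2) *\<^sub>R q) \<partial>lborel)"
    by (subst lborel_integral_affine[OF assms, of "1/2" x]) (simp_all add: power2_eq_square scaleR_conv_of_real)
  also have "\<dots> = (\<integral>q. \<phi> (x + (1/2) *\<^sub>R q) \<partial>distr lborel borel (\<lambda>q. (- snd q, fst q)))"
    by (simp only: lborel_distr_rotate)
  also have "\<dots> = (\<integral>q. \<phi> (x + (1/2) *\<^sub>R (- snd q, fst q)) \<partial>lborel)"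
  proof (rule integral_distr)
    show "(\<lambda>q::real\<times>real. (- snd q, fst q)) \<in> lborel \<rightarrow>\<^sub>M borel"
      by (simp, intro borel_measurable_continuous_onI continuous_intros)
    show "(\<lambda>q. \<phi> (x + (1/2) *\<^sub>R q)) \<in> borel_measurable borel"
      by (rule measurable_compose[OF _ assms]) (intro borel_measurable_continuous_onI continuous_intros)
  qed
  also have "\<dots> = (\<integral>q. \<phi> (fst x - snd q / 2, snd x + fst q / 2) \<partial>lborel)"
    by (intro Bochner_Integration.integral_cong refl arg_cong[where f = \<phi>]) (simp add: prod_eq_iff)
  finally show ?thesis .
qed

lemma integrable_product_phase:
  fixes g h :: "real \<times> real \<Rightarrow> complex"
  assumes g: "integrable lborel g" and h: "integrable lborel h" and \<theta>: "continuous_on UNIV \<theta>"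
  shows "integrable lborel (\<lambda>w. g (fst w) * h (snd w) * cis (\<theta> w))"
proof -
  have "integrable lborel (\<lambda>w. g (fst w) * h (snd w))"
    using integrable_product[OF g h] by (simp add: lborel_prod split_def)
  then show ?thesis
  proof (rule Bochner_Integration.integrable_bound)
    have "(\<lambda>w. cis (\<theta> w)) \<in> borel_measurable borel" by (intro borel_measurable_continuous_onI continuous_intros \<theta>)
    then show "(\<lambda>w. g (fst w) * h (snd w) * cis (\<theta> w)) \<in> borel_measurable lborel"
      using borel_measurable_integrable[OF \<open>integrable lborel (\<lambda>w. g (fst w) * h (snd w))\<close>] by simp
  qed (simp add: norm_mult)
qed

lemma twisted_integrand_eq:
  "twisted_integrand g h x w = g (fst w) * h (snd w) *
     cis (4 * pi * ((fst x - fst (fst w)) * (snd x - snd (snd w)) - (fst x - fst (snd w)) * (snd x - snd (fst w))))"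
  by (cases x, cases w, cases "fst w", cases "snd w") (simp add: twisted_integrand_def)

lemma twisted_integrand_integrable:
  assumes "integrable lborel g" "integrable lborel h"
  shows "integrable lborel (twisted_integrand g h x)"
  unfolding twisted_integrand_eq[abs_def]
  by (rule integrable_product_phase[OF assms]) (intro continuous_intros)

text \<open>For fixed \<open>u\<close> the phase is affine in \<open>v\<close>, so the inner
  integral is the Fourier transform of \<open>h\<close> at a frequency \<open>q\<close> that is
  affine in \<open>u\<close>; the symplectic substitution makes \<open>q\<close> the
  variable.\<close>

lemma twisted_integral:
  assumes g: "integrable lborel g" and h: "integrable lborel h"
  shows "4 * (\<integral>w. twisted_integrand g h x w \<partial>lborel) =
    (\<integral>q. g (fst x - snd q / 2, snd x + fst q / 2) * fourier_integral h q * cis (2 * pi * (q \<bullet> x)) \<partial>lborel)"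
proof -
  have int: "integrable (lborel \<Otimes>\<^sub>M lborel) (twisted_integrand g h x)"
    using twisted_integrand_integrable[OF g h] by (simp add: lborel_prod)
  define \<phi> where "\<phi> u = g u * fourier_integral h (- 2 * (snd x - snd u), 2 * (fst x - fst u)) * cis (4 * pi * bracket x u)" for u
  have hc: "continuous_on UNIV (fourier_integral h)" by (rule fourier_integral_continuous[OF h])
  have \<phi>_meas: "\<phi> \<in> borel_measurable borel"
  proof -
    have "(\<lambda>u. fourier_integral h (- 2 * (snd x - snd u), 2 * (fst x - fst u)) * cis (4 * pi * bracket x u)) \<in> borel_measurable borel"
      unfolding bracket_def by (intro borel_measurable_continuous_onI continuous_intros continuous_on_compose2[OF hc]) auto
    then show ?thesis unfolding \<phi>_def mult.assoc using borel_measurable_integrable[OF g] by simp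
  qed
  have "(\<integral>w. twisted_integrand g h x w \<partial>lborel) = (\<integral>u. \<integral>v. twisted_integrand g h x (u, v) \<partial>lborel \<partial>lborel)"
    using lborel_pair.integral_fst'[OF int] by (simp add: lborel_prod)
  also have "\<dots> = (\<integral>u. \<phi> u \<partial>lborel)"
  proof (intro Bochner_Integration.integral_cong refl)
    fix u
    have "twisted_integrand g h x (u, v) = (g u * cis (4 * pi * bracket x u)) * (h v * cis (- 2 * pi * ((- 2 * (snd x - snd u), 2 * (fst x - fst u)) \<bullet> v)))" for v
    proof -
      have "4 * pi * ((fst x - fst u) * (snd x - snd v) - (fst x - fst v) * (snd x - snd u)) =
         4 * pi * bracket x u + - 2 * pi * ((- 2 * (snd x - snd u), 2 * (fst x - fst u)) \<bullet> v)"
        by (simp add: bracket_def inner_prod_def algebra_simps)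
      then show ?thesis unfolding twisted_integrand_eq fst_conv snd_conv by (simp only: cis_mult[symmetric] mult_ac)
    qed
    then show "(\<integral>v. twisted_integrand g h x (u, v) \<partial>lborel) = \<phi> u"
      by (simp add: \<phi>_def fourier_integral_def)
  qed
  finally have "4 * (\<integral>w. twisted_integrand g h x w \<partial>lborel) = 4 * (\<integral>u. \<phi> u \<partial>lborel)" by simp
  also have "\<dots> = (\<integral>q. \<phi> (fst x - snd q / 2, snd x + fst q / 2) \<partial>lborel)" by (rule lborel_integral_symplectic[OF \<phi>_meas])
  also have "\<dots> = (\<integral>q. g (fst x - snd q / 2, snd x + fst q / 2) * fourier_integral h q * cis (2 * pi * (q \<bullet> x)) \<partial>lborel)"
  proof (intro Bochner_Integration.integral_cong refl)
    fix q
    have "4 * pi * bracket x (fst x - snd q / 2, snd x + fst q / 2) = 2 * pi * (q \<bullet> x)"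
      by (simp add: bracket_def inner_prod_def field_simps)
    then have "cis (4 * pi * bracket x (fst x - snd q / 2, snd x + fst q / 2)) = cis (2 * pi * (q \<bullet> x))" by (simp only:)
    then show "\<phi> (fst x - snd q / 2, snd x + fst q / 2) = g (fst x - snd q / 2, snd x + fst q / 2) * fourier_integral h q * cis (2 * pi * (q \<bullet> x))"
      by (simp add: \<phi>_def)
  qed
  finally show ?thesis .
qed

text \<open>\<open>twisted\<close> is evaluated on representatives, which agree with the explicit
  inverse transforms almost everywhere only.\<close>

lemma twisted_integral_cong_AE:
  assumes g: "integrable lborel g" "integrable lborel g'" "AE u in lborel. g u = g' u"
    and h: "integrable lborel h" "integrable lborel h'" "AE u in lborel. h u = h' u"
  shows "(\<integral>w. twisted_integrand g h x w \<partial>lborel) = (\<integral>w. twisted_integrand g' h' x w \<partial>lborel)"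
proof -
  have int: "integrable (lborel \<Otimes>\<^sub>M lborel) (twisted_integrand a b x)" if "integrable lborel a" "integrable lborel b" for a b
    using twisted_integrand_integrable[OF that] by (simp add: lborel_prod)
  have it: "(\<integral>w. twisted_integrand a b x w \<partial>lborel) = (\<integral>u. \<integral>v. twisted_integrand a b x (u, v) \<partial>lborel \<partial>lborel)"
    if "integrable lborel a" "integrable lborel b" for a b
    using lborel_pair.integral_fst'[OF int[OF that]] by (simp add: lborel_prod)
  have eq: "(\<integral>v. twisted_integrand a b x (u, v) \<partial>lborel) = a u * (\<integral>v. b v * cis (4 * pi * ((fst x - fst u) * (snd x - snd v) - (fst x - fst v) * (snd x - snd u))) \<partial>lborel)" for a b u
    unfolding twisted_integrand_eq by (simp add: mult.assoc)
  have c: "(\<lambda>v. cis (4 * pi * ((fst x - fst u) * (snd x - snd v) - (fst x - fst v) * (snd x - snd u)))) \<in> borel_measurable borel" for u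
    by (intro borel_measurable_continuous_onI continuous_intros)
  have hh: "(\<integral>v. h v * cis (4 * pi * ((fst x - fst u) * (snd x - snd v) - (fst x - fst v) * (snd x - snd u))) \<partial>lborel) =
     (\<integral>v. h' v * cis (4 * pi * ((fst x - fst u) * (snd x - snd v) - (fst x - fst v) * (snd x - snd u))) \<partial>lborel)" for u
    using h c[of u] by (intro integral_cong_AE) (auto dest: borel_measurable_integrable)
  show ?thesis
    unfolding it[OF g(1) h(1)] it[OF g(2) h(2)]
  proof (rule integral_cong_AE)
    show "(\<lambda>u. \<integral>v. twisted_integrand g h x (u, v) \<partial>lborel) \<in> borel_measurable lborel"
      "(\<lambda>u. \<integral>v. twisted_integrand g' h' x (u, v) \<partial>lborel) \<in> borel_measurable lborel"
      using lborel_pair.integrable_fst'[OF int[OF g(1) h(1)]] lborel_pair.integrable_fst'[OF int[OF g(2) h(2)]]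
      by (auto dest: borel_measurable_integrable)
    show "AE u in lborel. (\<integral>v. twisted_integrand g h x (u, v) \<partial>lborel) = (\<integral>v. twisted_integrand g' h' x (u, v) \<partial>lborel)"
      using g(3) unfolding eq hh by eventually_elim simp
  qed
qed

definition twisted_conv :: "(real \<times> real \<Rightarrow> complex) \<Rightarrow> (real \<times> real \<Rightarrow> complex) \<Rightarrow> real \<times> real \<Rightarrow> complex" where
  "twisted_conv f k r = (\<integral>p. f p * k (r - p) * cis (- pi * bracket p r) \<partial>lborel)"

lemma integrable_convolution_phase:
  fixes f k :: "real \<times> real \<Rightarrow> complex"
  assumes f: "integrable lborel f" and k: "integrable lborel k" and \<theta>: "continuous_on UNIV \<theta>"
  shows "integrable (lborel \<Otimes>\<^sub>M lborel) (\<lambda>(p, r). f p * k (r - p) * cis (\<theta> (p, r)))"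
proof (rule lborel_pair.Fubini_integrable)
  have fm [measurable]: "f \<in> borel_measurable borel" and km [measurable]: "k \<in> borel_measurable borel"
    using borel_measurable_integrable[OF f] borel_measurable_integrable[OF k] by auto
  have \<theta>m [measurable]: "(\<lambda>z. cis (\<theta> z)) \<in> borel_measurable (borel \<Otimes>\<^sub>M borel)"
    unfolding borel_prod by (intro borel_measurable_continuous_onI continuous_intros \<theta>)
  show m: "(\<lambda>(p, r). f p * k (r - p) * cis (\<theta> (p, r))) \<in> borel_measurable (lborel \<Otimes>\<^sub>M lborel)"
    by measurable
  have kt: "integrable lborel (\<lambda>r. k (r - p))" "(\<integral>r. cmod (k (r - p)) \<partial>lborel) = (\<integral>r. cmod (k r) \<partial>lborel)" for p
    using integrable_lborel_translate[OF k, of "- p"] lborel_integral_translate[of "\<lambda>r. cmod (k r)" "- p"] by simp_all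
  show "integrable lborel (\<lambda>p. \<integral>r. norm (case (p, r) of (p, r) \<Rightarrow> f p * k (r - p) * cis (\<theta> (p, r))) \<partial>lborel)"
    using f kt by (simp add: norm_mult)
  show "AE p in lborel. integrable lborel (\<lambda>r. case (p, r) of (p, r) \<Rightarrow> f p * k (r - p) * cis (\<theta> (p, r)))"
  proof (rule AE_I2)
    fix p
    show "integrable lborel (\<lambda>r. case (p, r) of (p, r) \<Rightarrow> f p * k (r - p) * cis (\<theta> (p, r)))"
    proof (rule Bochner_Integration.integrable_bound)
      show "integrable lborel (\<lambda>r. f p * k (r - p))" using kt(1) by simp
      have "(\<lambda>r. cis (\<theta> (p, r))) \<in> borel_measurable borel"
        by (intro borel_measurable_continuous_onI continuous_intros continuous_on_compose2[OF \<theta>]) auto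
      then show "(\<lambda>r. case (p, r) of (p, r) \<Rightarrow> f p * k (r - p) * cis (\<theta> (p, r))) \<in> borel_measurable lborel" by simp
    qed (auto simp: norm_mult)
  qed
qed

text \<open>Expanding the inverse transform of \<open>f\<close> gives a double integral over the
  frequencies \<open>p\<close> and \<open>q\<close>; the twisted convolution appears when it is
  sorted by the total frequency r = p + q.\<close>

lemma fourier_inv_twisted_conv:
  assumes f: "integrable lborel f" and k: "integrable lborel k"
  shows "(\<integral>q. fourier_inv_integral f (fst x - snd q / 2, snd x + fst q / 2) * k q * cis (2 * pi * (q \<bullet> x)) \<partial>lborel) =
    fourier_inv_integral (twisted_conv f k) x"
proof -
  define \<theta> where "\<theta> z = 2 * pi * ((fst z + snd z) \<bullet> x) - pi * bracket (fst z) (snd z)" for z :: "(real \<times> real) \<times> (real \<times> real)"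
  have \<theta>c: "continuous_on UNIV \<theta>" unfolding \<theta>_def bracket_def by (intro continuous_intros)
  define \<theta>' where "\<theta>' z = 2 * pi * (snd z \<bullet> x) - pi * bracket (fst z) (snd z)" for z :: "(real \<times> real) \<times> (real \<times> real)"
  have \<theta>c': "continuous_on UNIV \<theta>'" unfolding \<theta>'_def bracket_def by (intro continuous_intros)
  have int: "integrable (lborel \<Otimes>\<^sub>M lborel) (\<lambda>(p, q). f p * k q * cis (\<theta> (p, q)))"
    using integrable_product_phase[OF f k \<theta>c] by (simp add: lborel_prod split_def)
  have "(\<integral>q. fourier_inv_integral f (fst x - snd q / 2, snd x + fst q / 2) * k q * cis (2 * pi * (q \<bullet> x)) \<partial>lborel) =
    (\<integral>q. \<integral>p. f p * k q * cis (\<theta> (p, q)) \<partial>lborel \<partial>lborel)"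
  proof (intro Bochner_Integration.integral_cong refl)
    fix q
    have eq: "f p * k q * cis (\<theta> (p, q)) = f p * cis (2 * pi * (p \<bullet> (fst x - snd q / 2, snd x + fst q / 2))) * (k q * cis (2 * pi * (q \<bullet> x)))" for p
    proof -
      have "\<theta> (p, q) = 2 * pi * (p \<bullet> (fst x - snd q / 2, snd x + fst q / 2)) + 2 * pi * (q \<bullet> x)"
        by (simp add: \<theta>_def bracket_def inner_prod_def field_simps)
      then show ?thesis by (simp only: cis_mult[symmetric] mult_ac)
    qed
    show "fourier_inv_integral f (fst x - snd q / 2, snd x + fst q / 2) * k q * cis (2 * pi * (q \<bullet> x)) = (\<integral>p. f p * k q * cis (\<theta> (p, q)) \<partial>lborel)"
      unfolding eq unfolding integral_mult_left_zero unfolding fourier_inv_integral_def mult.assoc ..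
  qed
  also have "\<dots> = (\<integral>p. \<integral>q. f p * k q * cis (\<theta> (p, q)) \<partial>lborel \<partial>lborel)"
    using lborel_pair.Fubini_integral[OF int] by simp
  also have "\<dots> = (\<integral>p. \<integral>r. f p * k (r - p) * cis (\<theta>' (p, r)) \<partial>lborel \<partial>lborel)"
  proof (rule Bochner_Integration.integral_cong[OF refl])
    fix p
    \<comment> \<open>The form is alternating, so
      \<open>bracket p (r - p) = bracket p r\<close>.\<close>
    have "\<theta> (p, - p + r) = \<theta>' (p, r)" for r by (simp add: \<theta>_def \<theta>'_def bracket_def algebra_simps)
    then show "(\<integral>q. f p * k q * cis (\<theta> (p, q)) \<partial>lborel) = (\<integral>r. f p * k (r - p) * cis (\<theta>' (p, r)) \<partial>lborel)"
      using lborel_integral_translate[of "\<lambda>q. f p * k q * cis (\<theta> (p, q))" "- p"] by simp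
  qed
  also have "\<dots> = (\<integral>r. \<integral>p. f p * k (r - p) * cis (\<theta>' (p, r)) \<partial>lborel \<partial>lborel)"
    using lborel_pair.Fubini_integral[OF integrable_convolution_phase[OF f k \<theta>c']] by simp
  also have "\<dots> = fourier_inv_integral (twisted_conv f k) x"
    unfolding fourier_inv_integral_def
  proof (intro Bochner_Integration.integral_cong refl)
    fix r
    have eq: "f p * k (r - p) * cis (\<theta>' (p, r)) = f p * k (r - p) * cis (- pi * bracket p r) * cis (2 * pi * (r \<bullet> x))" for p
    proof -
      have "\<theta>' (p, r) = - pi * bracket p r + 2 * pi * (r \<bullet> x)" by (simp add: \<theta>'_def)
      then show ?thesis by (simp only: cis_mult[symmetric] mult_ac)
    qed
    show "(\<integral>p. f p * k (r - p) * cis (\<theta>' (p, r)) \<partial>lborel) = twisted_conv f k r * cis (2 * pi * (r \<bullet> x))"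
      unfolding eq integral_mult_left_zero twisted_conv_def ..
  qed
  finally show ?thesis .
qed

text \<open>The representatives are replaced by continuous inverse transforms, and inversion
  recovers the transform of the second factor. The function \<open>m\<close> supplies the square
  integrability that \<open>twisted\<close> tests.\<close>

theorem twisted_of_strip:
  assumes f: "strip_fun S T f" and k: "strip_fun S' T' k" and m: "strip_fun S'' T'' m"
    and fk: "slice m 0 0 = twisted_conv (slice f 0 0) (slice k 0 0)"
  shows "twisted (of_strip f) (of_strip k) = Some (of_strip m)"
proof -
  note pf = fourier_inv_slice_props[OF f] and pk = fourier_inv_slice_props[OF k] and pm = fourier_inv_slice_props[OF m]
  let ?g = "fourier_inv_integral (slice f 0 0)" and ?h = "fourier_inv_integral (slice k 0 0)"
  let ?g' = "rep_l2 (of_strip f)" and ?h' = "rep_l2 (of_strip k)"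
  have ae: "AE u in lborel. ?g' u = ?g u" "AE u in lborel. ?h' u = ?h u"
    unfolding of_strip_def by (rule rep_abs_l2[OF pf(2)], rule rep_abs_l2[OF pk(2)])
  have g': "integrable lborel ?g'"
    using pf(1) by (rule integrable_cong_AE_imp) (use ae square_integrable_measurable[OF square_integrable_rep] in auto)
  have h': "integrable lborel ?h'"
    using pk(1) by (rule integrable_cong_AE_imp) (use ae square_integrable_measurable[OF square_integrable_rep] in auto)
  have val: "4 * (\<integral>w. twisted_integrand ?g' ?h' x w \<partial>lborel) = fourier_inv_integral (slice m 0 0) x" for x
  proof -
    have "4 * (\<integral>w. twisted_integrand ?g' ?h' x w \<partial>lborel) = 4 * (\<integral>w. twisted_integrand ?g ?h x w \<partial>lborel)"
      using twisted_integral_cong_AE[OF g' pf(1) ae(1) h' pk(1) ae(2)] by simp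
    also have "\<dots> = (\<integral>q. ?g (fst x - snd q / 2, snd x + fst q / 2) * fourier_integral ?h q * cis (2 * pi * (q \<bullet> x)) \<partial>lborel)"
      by (rule twisted_integral[OF pf(1) pk(1)])
    also have "\<dots> = (\<integral>q. ?g (fst x - snd q / 2, snd x + fst q / 2) * slice k 0 0 q * cis (2 * pi * (q \<bullet> x)) \<partial>lborel)"
    proof (rule integral_cong_AE)
      have gm: "(\<lambda>q. ?g (fst x - snd q / 2, snd x + fst q / 2)) \<in> borel_measurable borel"
        by (intro borel_measurable_continuous_onI continuous_on_compose2[OF fourier_inv_integral_continuous[OF pf(5)]] continuous_intros) auto
      have cm: "(\<lambda>q. cis (2 * pi * (q \<bullet> x))) \<in> borel_measurable borel" by (intro borel_measurable_continuous_onI continuous_intros)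
      show "(\<lambda>q. ?g (fst x - snd q / 2, snd x + fst q / 2) * fourier_integral ?h q * cis (2 * pi * (q \<bullet> x))) \<in> borel_measurable lborel"
        using gm cm fourier_integral_measurable[OF pk(1)] by simp
      show "(\<lambda>q. ?g (fst x - snd q / 2, snd x + fst q / 2) * slice k 0 0 q * cis (2 * pi * (q \<bullet> x))) \<in> borel_measurable lborel"
        using gm cm borel_measurable_integrable[OF pk(5)] by simp
      show "AE q in lborel. ?g (fst x - snd q / 2, snd x + fst q / 2) * fourier_integral ?h q * cis (2 * pi * (q \<bullet> x)) =
         ?g (fst x - snd q / 2, snd x + fst q / 2) * slice k 0 0 q * cis (2 * pi * (q \<bullet> x))"
        using fourier_inversion[OF pk(5,1)] by eventually_elim simp
    qed
    also have "\<dots> = fourier_inv_integral (slice m 0 0) x"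
      unfolding fk by (rule fourier_inv_twisted_conv[OF pf(5) pk(5)])
    finally show ?thesis .
  qed
  have "(\<lambda>x. 4 * (\<integral>w. twisted_integrand ?g' ?h' x w \<partial>lborel)) = fourier_inv_integral (slice m 0 0)"
    using val by auto
  then show ?thesis
    unfolding twisted_def Let_def using twisted_integrand_integrable[OF g' h'] pm(2) by (simp add: of_strip_def)
qed

subsection \<open>The product on the Fourier side\<close>

text \<open>The first term continues -i pi times the symplectic form. With e1 = \<alpha>/2 and e2 =
  \<beta>/2 and the contour at the heights -e1/2, -e2/2, the remaining terms complete it to the
  exponential factors in P_1 and P_2 of the two arguments of the product; the formula is their
  entire continuation.\<close>

definition phase :: "real \<Rightarrow> real \<Rightarrow> complex \<Rightarrow> complex \<Rightarrow> complex \<Rightarrow> complex \<Rightarrow> complex" where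
  "phase e1 e2 r1 r2 z w = - of_real pi * \<i> * (z * r2 - w * r1) - of_real pi * (of_real e1 * w - of_real e2 * z) +
     of_real pi * (of_real e1 * r2 - of_real e2 * r1)"

definition kern :: "real \<Rightarrow> real \<Rightarrow> (complex \<Rightarrow> complex \<Rightarrow> complex) \<Rightarrow> (complex \<Rightarrow> complex \<Rightarrow> complex) \<Rightarrow>
    complex \<Rightarrow> complex \<Rightarrow> complex \<Rightarrow> complex \<Rightarrow> complex" where
  "kern e1 e2 f k r1 r2 z w = f z w * k (r1 - \<i> * of_real e1 - z) (r2 - \<i> * of_real e2 - w) * exp (phase e1 e2 r1 r2 z w)"

text \<open>Apart from linear terms the phase is bilinear with an imaginary coefficient, so every
  product in its real part has one bounded factor and growth in the real parts is linear.\<close>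

lemma Re_phase_le:
  assumes "\<bar>Im r1\<bar> \<le> B" "\<bar>Im r2\<bar> \<le> B" "\<bar>Im z\<bar> \<le> B" "\<bar>Im w\<bar> \<le> B" "\<bar>e1\<bar> \<le> B" "\<bar>e2\<bar> \<le> B"
  shows "Re (phase e1 e2 r1 r2 z w) \<le> 2 * pi * B * (\<bar>Re z\<bar> + \<bar>Re w\<bar> + (\<bar>Re r1\<bar> + \<bar>Re r2\<bar>))"
proof -
  have m: "x * y \<le> B * \<bar>y\<bar>" "- (x * y) \<le> B * \<bar>y\<bar>" if "\<bar>x\<bar> \<le> B" for x y
  proof -
    have "\<bar>x * y\<bar> \<le> B * \<bar>y\<bar>" unfolding abs_mult using that by (rule mult_right_mono) simp
    then show "x * y \<le> B * \<bar>y\<bar>" "- (x * y) \<le> B * \<bar>y\<bar>" by auto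
  qed
  have "Re (phase e1 e2 r1 r2 z w) = pi * (Im r2 * Re z + Im z * Re r2 + - (Im r1 * Re w) + - (Im w * Re r1)
      + - (e1 * Re w) + e2 * Re z + e1 * Re r2 + - (e2 * Re r1))"
    by (simp add: phase_def algebra_simps)
  also have "\<dots> \<le> pi * (B * \<bar>Re z\<bar> + B * \<bar>Re r2\<bar> + B * \<bar>Re w\<bar> + B * \<bar>Re r1\<bar> + B * \<bar>Re w\<bar> + B * \<bar>Re z\<bar> + B * \<bar>Re r2\<bar> + B * \<bar>Re r1\<bar>)"
    by (intro mult_left_mono add_mono m assms) auto
  also have "\<dots> = 2 * pi * B * (\<bar>Re z\<bar> + \<bar>Re w\<bar> + (\<bar>Re r1\<bar> + \<bar>Re r2\<bar>))" by (simp add: algebra_simps)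
  finally show ?thesis .
qed

text \<open>The decay of \<open>f\<close> in \<open>p\<close> and of \<open>k\<close> in \<open>r - p\<close> yields decay in \<open>p\<close> and in \<open>r\<close>.\<close>

lemma kern_bound:
  assumes f: "strip_decay S T f" and k: "strip_decay S' T' k"
    and A: "compact A1" "A1 \<subseteq> S" "compact A2" "A2 \<subseteq> T" "compact B1" "B1 \<subseteq> S'" "compact B2" "B2 \<subseteq> T'"
    and c: "c \<ge> 0"
  obtains M where "M > 0" "\<And>r1 r2 z w. Im z \<in> A1 \<Longrightarrow> Im w \<in> A2 \<Longrightarrow>
     Im r1 - e1 - Im z \<in> B1 \<Longrightarrow> Im r2 - e2 - Im w \<in> B2 \<Longrightarrow>
     cmod (kern e1 e2 f k r1 r2 z w) \<le> M * (exp (- (c * (\<bar>Re r1\<bar> + \<bar>Re r2\<bar>))) * exp (- (\<bar>Re z\<bar> + \<bar>Re w\<bar>)))"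
proof -
  obtain b1 where b1: "b1 > 0" "\<And>x. x \<in> A1 \<Longrightarrow> \<bar>x\<bar> \<le> b1" using compact_abs_bounded A by metis
  obtain b2 where b2: "b2 > 0" "\<And>x. x \<in> A2 \<Longrightarrow> \<bar>x\<bar> \<le> b2" using compact_abs_bounded A by metis
  obtain b3 where b3: "b3 > 0" "\<And>x. x \<in> B1 \<Longrightarrow> \<bar>x\<bar> \<le> b3" using compact_abs_bounded A by metis
  obtain b4 where b4: "b4 > 0" "\<And>x. x \<in> B2 \<Longrightarrow> \<bar>x\<bar> \<le> b4" using compact_abs_bounded A by metis
  define B where "B = b1 + b2 + b3 + b4 + \<bar>e1\<bar> + \<bar>e2\<bar>"
  define D where "D = 2 * pi * B"
  have D0: "D \<ge> 0" using b1 b2 b3 b4 by (simp add: D_def B_def)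
  \<comment> \<open>The phase grows like D (x + \<rho>) with \<rho> <= x + y, which 2 D covers;
    \<open>c\<close> is left for \<rho> and 1 for x.\<close>
  define C where "C = 2 * D + c + 1"
  obtain M1 where M1: "M1 > 0" "\<And>z w. Im z \<in> A1 \<Longrightarrow> Im w \<in> A2 \<Longrightarrow> cmod (f z w) \<le> M1 * exp (- (C * (\<bar>Re z\<bar> + \<bar>Re w\<bar>)))"
    using strip_decay_bound[OF f A(1-4)] by metis
  obtain M2 where M2: "M2 > 0" "\<And>z w. Im z \<in> B1 \<Longrightarrow> Im w \<in> B2 \<Longrightarrow> cmod (k z w) \<le> M2 * exp (- (C * (\<bar>Re z\<bar> + \<bar>Re w\<bar>)))"
    using strip_decay_bound[OF k A(5-8)] by metis
  show ?thesis
  proof (rule that[of "M1 * M2"])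
    fix r1 r2 z w assume im: "Im z \<in> A1" "Im w \<in> A2" "Im r1 - e1 - Im z \<in> B1" "Im r2 - e2 - Im w \<in> B2"
    define x where "x = \<bar>Re z\<bar> + \<bar>Re w\<bar>"
    define y where "y = \<bar>Re r1 - Re z\<bar> + \<bar>Re r2 - Re w\<bar>"
    define \<rho> where "\<rho> = \<bar>Re r1\<bar> + \<bar>Re r2\<bar>"
    have tri: "\<rho> \<le> x + y" "x \<ge> 0" "y \<ge> 0" by (simp_all add: x_def y_def \<rho>_def)
    have fb: "cmod (f z w) \<le> M1 * exp (- (C * x))" unfolding x_def by (rule M1(2)[OF im(1,2)])
    have kb: "cmod (k (r1 - \<i> * of_real e1 - z) (r2 - \<i> * of_real e2 - w)) \<le> M2 * exp (- (C * y))"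
      using M2(2)[of "r1 - \<i> * of_real e1 - z" "r2 - \<i> * of_real e2 - w"] im by (simp add: y_def)
    have "Re (phase e1 e2 r1 r2 z w) \<le> D * (x + \<rho>)"
      unfolding D_def x_def \<rho>_def
      by (rule Re_phase_le) (use b1(2)[OF im(1)] b2(2)[OF im(2)] b3(2)[OF im(3)] b4(2)[OF im(4)] b1(1) b2(1) b3(1) b4(1) in \<open>simp_all add: B_def\<close>)
    then have pb: "cmod (exp (phase e1 e2 r1 r2 z w)) \<le> exp (D * (x + \<rho>))" by simp
    have "cmod (kern e1 e2 f k r1 r2 z w) \<le> (M1 * exp (- (C * x))) * (M2 * exp (- (C * y))) * exp (D * (x + \<rho>))"
      unfolding kern_def norm_mult using fb kb pb M1(1) M2(1) by (intro mult_mono) auto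
    also have "\<dots> = M1 * M2 * exp (- (C * x) + - (C * y) + D * (x + \<rho>))"
      by (simp only: exp_add mult_ac)
    also have "\<dots> \<le> M1 * M2 * exp (- (c * \<rho>) + - x)"
    proof -
      have "c * \<rho> + D * \<rho> \<le> (c + D) * (x + y)" using mult_left_mono[OF tri(1), of "c + D"] c D0 by (simp add: distrib_right)
      moreover have "0 \<le> D * y" using D0 tri by simp
      ultimately have "- (C * x) + - (C * y) + D * (x + \<rho>) \<le> - (c * \<rho>) + - x"
        using tri by (simp add: C_def algebra_simps)
      then show ?thesis using M1(1) M2(1) by simp
    qed
    finally show "cmod (kern e1 e2 f k r1 r2 z w) \<le> M1 * M2 * (exp (- (c * (\<bar>Re r1\<bar> + \<bar>Re r2\<bar>))) * exp (- (\<bar>Re z\<bar> + \<bar>Re w\<bar>)))"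
      by (simp only: exp_add x_def \<rho>_def)
  qed (use M1 M2 in auto)
qed

text \<open>For fixed \<open>r\<close> the phase is affine in the integration variables, so the
  kernel is a product of two rapidly decreasing functions and the exponential of an affine function.
  Its domain collects the heights admissible for both factors.\<close>

lemma strip_decay_kern:
  assumes f: "strip_decay S T f" and k: "strip_decay S' T' k"
  shows "strip_decay {y \<in> S. Im r1 - e1 - y \<in> S'} {y \<in> T. Im r2 - e2 - y \<in> T'} (kern e1 e2 f k r1 r2)"
proof -
  let ?S = "{y \<in> S. Im r1 - e1 - y \<in> S'}" and ?T = "{y \<in> T. Im r2 - e2 - y \<in> T'}"
  have 1: "strip_decay ?S ?T f" by (rule strip_decay_mono[OF f]) auto
  have 2: "strip_decay ?S ?T (\<lambda>z w. k (r1 - \<i> * of_real e1 - z) (r2 - \<i> * of_real e2 - w))"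
    by (rule strip_decay_mono[OF strip_decay_reflect[OF k, of "r1 - \<i> * of_real e1" "r2 - \<i> * of_real e2"]]) auto
  have 3: "strip_decay ?S ?T (\<lambda>z w. exp ((- of_real pi * \<i> * r2 + of_real (pi * e2)) * z + (of_real pi * \<i> * r1 - of_real (pi * e1)) * w
     + of_real pi * (of_real e1 * r2 - of_real e2 * r1)) * (f z w * k (r1 - \<i> * of_real e1 - z) (r2 - \<i> * of_real e2 - w)))"
    by (rule strip_decay_exp_mult[OF strip_decay_mult2[OF 2 1]])
  show ?thesis
  proof (rule strip_decay_cong[OF 3])
    fix z w
    have "phase e1 e2 r1 r2 z w = (- of_real pi * \<i> * r2 + of_real (pi * e2)) * z + (of_real pi * \<i> * r1 - of_real (pi * e1)) * w
     + of_real pi * (of_real e1 * r2 - of_real e2 * r1)"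
      by (simp add: phase_def algebra_simps)
    then show "kern e1 e2 f k r1 r2 z w = exp ((- of_real pi * \<i> * r2 + of_real (pi * e2)) * z + (of_real pi * \<i> * r1 - of_real (pi * e1)) * w
     + of_real pi * (of_real e1 * r2 - of_real e2 * r1)) * (f z w * k (r1 - \<i> * of_real e1 - z) (r2 - \<i> * of_real e2 - w))"
      unfolding kern_def by (simp only: mult_ac)
  qed
qed

lemma open_convex_inter_reflect:
  fixes S S' :: "real set"
  assumes "open S" "convex S" "open S'" "convex S'"
  shows "open {y \<in> S. c - y \<in> S'}" "convex {y \<in> S. c - y \<in> S'}"
proof -
  have eq: "{y \<in> S. c - y \<in> S'} = S \<inter> (\<lambda>y. c - y) -` S'" by auto
  show "open {y \<in> S. c - y \<in> S'}"
    unfolding eq using assms by (intro open_Int open_vimage continuous_intros) auto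
  have "(\<lambda>y. c - y) -` S' = (\<lambda>y. c - y) ` S'" by (auto simp: image_iff intro!: bexI[of _ "c - _"])
  moreover have "convex ((\<lambda>y. c + (-1) *\<^sub>R y) ` S')" using convex_affinity[OF assms(4), of c "-1"] .
  ultimately show "convex {y \<in> S. c - y \<in> S'}"
    unfolding eq using assms by (intro convex_Int) simp_all
qed

text \<open>The twisted convolution at the point \<open>(r1, r2)\<close> along the contour with imaginary parts \<open>s\<close>, \<open>t\<close>.\<close>

definition cprod :: "real \<Rightarrow> real \<Rightarrow> real \<Rightarrow> real \<Rightarrow> (complex \<Rightarrow> complex \<Rightarrow> complex) \<Rightarrow> (complex \<Rightarrow> complex \<Rightarrow> complex) \<Rightarrow>
    complex \<Rightarrow> complex \<Rightarrow> complex" where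
  "cprod e1 e2 s t f k r1 r2 = (\<integral>p. slice (kern e1 e2 f k r1 r2) (\<i> * of_real s) (\<i> * of_real t) p \<partial>lborel)"

lemma cprod_shift:
  assumes "strip_fun S T f" "strip_fun S' T' k"
    and "s \<in> S" "Im r1 - e1 - s \<in> S'" "t \<in> T" "Im r2 - e2 - t \<in> T'"
    and "s' \<in> S" "Im r1 - e1 - s' \<in> S'" "t' \<in> T" "Im r2 - e2 - t' \<in> T'"
  shows "cprod e1 e2 s t f k r1 r2 = cprod e1 e2 s' t' f k r1 r2"
proof -
  note f = strip_funD[OF assms(1)] and k = strip_funD[OF assms(2)]
  show ?thesis
    unfolding cprod_def
    by (rule slice_integral_shift[OF strip_decay_kern[OF f(1) k(1)]])
       (use open_convex_inter_reflect[OF f(2,3) k(2,3)] open_convex_inter_reflect[OF f(5,6) k(5,6)] assms in auto)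
qed

text \<open>The height Im r - e that the two factors must share is divided in each variable: the
  first factor receives the fraction \<open>l\<close> or \<open>m\<close>, the second the rest.
  Fraction 1 burdens only the first factor, 0 only the second, 1/2 both alike.\<close>

definition cprod_interp :: "real \<Rightarrow> real \<Rightarrow> real \<Rightarrow> real \<Rightarrow> (complex \<Rightarrow> complex \<Rightarrow> complex) \<Rightarrow> (complex \<Rightarrow> complex \<Rightarrow> complex) \<Rightarrow>
    complex \<Rightarrow> complex \<Rightarrow> complex" where
  "cprod_interp e1 e2 l m f k r1 r2 = cprod e1 e2 (l * (Im r1 - e1)) (m * (Im r2 - e2)) f k r1 r2"

lemma strip_decay_cprod_interp:
  assumes f: "strip_fun S T f" and k: "strip_fun S' T' k"
    and U: "open U" "open V"
    and U1: "\<And>y. y \<in> U \<Longrightarrow> l * (y - e1) \<in> S" "\<And>y. y \<in> U \<Longrightarrow> (1 - l) * (y - e1) \<in> S'"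
    and V1: "\<And>y. y \<in> V \<Longrightarrow> m * (y - e2) \<in> T" "\<And>y. y \<in> V \<Longrightarrow> (1 - m) * (y - e2) \<in> T'"
  shows "strip_decay U V (cprod_interp e1 e2 l m f k)"
proof -
  note fD = strip_funD[OF f] and kD = strip_funD[OF k]
  have split: "y - e - l * (y - e) = (1 - l) * (y - e)" for y e l :: real by (simp add: algebra_simps)
  have key: "\<exists>U0 V0. open U0 \<and> open V0 \<and> Im a \<in> U0 \<and> Im b \<in> V0 \<and> U0 \<subseteq> U \<and> V0 \<subseteq> V \<and>
      (\<exists>h. (\<forall>r1 r2. Im r1 \<in> U0 \<longrightarrow> Im r2 \<in> V0 \<longrightarrow> cprod_interp e1 e2 l m f k r1 r2 = h r1 r2) \<and>
       continuous_on {z. Im (fst z) \<in> U0 \<and> Im (snd z) \<in> V0} (\<lambda>z. h (fst z) (snd z)) \<and>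
       (\<forall>w. Im w \<in> V0 \<longrightarrow> (\<lambda>z. h z w) holomorphic_on {z. Im z \<in> U0}) \<and>
       (\<forall>z. Im z \<in> U0 \<longrightarrow> h z holomorphic_on {w. Im w \<in> V0}))"
    if ab: "Im a \<in> U" "Im b \<in> V" for a b
  proof -
    define s where "s = l * (Im a - e1)"
    define t where "t = m * (Im b - e2)"
    have st: "s \<in> S" "t \<in> T" "Im a - e1 - s \<in> S'" "Im b - e2 - t \<in> T'"
      using U1 V1 ab split unfolding s_def t_def by auto
    define U0 where "U0 = {y \<in> U. y - e1 - s \<in> S'}"
    define V0 where "V0 = {y \<in> V. y - e2 - t \<in> T'}"
    have op: "open {y \<in> U. y - e - s \<in> S'}" if "open U" "open S'" for U S' :: "real set" and e s
    proof -
      have "{y \<in> U. y - e - s \<in> S'} = U \<inter> (\<lambda>y. y - e - s) -` S'" by auto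
      then show ?thesis using that by (simp only:) (intro open_Int open_vimage continuous_intros, auto)
    qed
    have U0: "open U0" "open V0" "Im a \<in> U0" "Im b \<in> V0" "U0 \<subseteq> U" "V0 \<subseteq> V"
      using st ab U kD by (auto simp: U0_def V0_def op)
    define q where "q r1 r2 p = slice (kern e1 e2 f k r1 r2) (\<i> * of_real s) (\<i> * of_real t) p" for r1 r2 p
    have eq: "cprod_interp e1 e2 l m f k r1 r2 = (\<integral>p. q r1 r2 p \<partial>lborel)" if "Im r1 \<in> U0" "Im r2 \<in> V0" for r1 r2
      unfolding cprod_interp_def q_def cprod_def[symmetric]
      by (rule cprod_shift[OF f k]) (use that st U1 V1 split in \<open>auto simp: U0_def V0_def\<close>)
    have q_meas: "q r1 r2 \<in> borel_measurable borel" if "Im r1 \<in> U0" "Im r2 \<in> V0" for r1 r2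
      unfolding q_def[abs_def] using that st
      by (intro slice_measurable[OF strip_decay_kern[OF fD(1) kD(1)]]) (auto simp: U0_def V0_def)
    have q_eq: "q r1 r2 p = f (of_real (fst p) + \<i> * of_real s) (of_real (snd p) + \<i> * of_real t) *
       k (r1 - (\<i> * of_real e1 + (of_real (fst p) + \<i> * of_real s))) (r2 - (\<i> * of_real e2 + (of_real (snd p) + \<i> * of_real t))) *
       exp (phase e1 e2 r1 r2 (of_real (fst p) + \<i> * of_real s) (of_real (snd p) + \<i> * of_real t))" for r1 r2 p
      by (simp add: q_def slice_def kern_def diff_diff_eq)
    have kk: "strip_decay U0 V0 (\<lambda>r1 r2. k (r1 - (\<i> * of_real e1 + (of_real x + \<i> * of_real s))) (r2 - (\<i> * of_real e2 + (of_real y + \<i> * of_real t))))" for x y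
    proof -
      have "strip_decay U0 V0 (\<lambda>r1 r2. k (- (\<i> * of_real e1 + (of_real x + \<i> * of_real s)) + r1) (- (\<i> * of_real e2 + (of_real y + \<i> * of_real t)) + r2))"
        by (rule strip_decay_mono[OF strip_decay_shift[OF kD(1)]]) (auto simp: U0_def V0_def algebra_simps)
      then show ?thesis by (simp only: uminus_add_conv_diff)
    qed
    have dom: "locally_dominated U0 V0 q"
      unfolding locally_dominated_def
    proof (intro allI impI)
      fix c d assume cd: "Im c \<in> U0" "Im d \<in> V0"
      obtain d1 where d1: "d1 > 0" "cball (Im c) d1 \<subseteq> U0" "\<And>z. dist z c < d1 \<Longrightarrow> Im z \<in> cball (Im c) d1 \<and> \<bar>Re z\<bar> \<le> \<bar>Re c\<bar> + 1"
        using compact_Im_nbhd[OF U0(1) cd(1)] by metis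
      obtain d2 where d2: "d2 > 0" "cball (Im d) d2 \<subseteq> V0" "\<And>z. dist z d < d2 \<Longrightarrow> Im z \<in> cball (Im d) d2 \<and> \<bar>Re z\<bar> \<le> \<bar>Re d\<bar> + 1"
        using compact_Im_nbhd[OF U0(2) cd(2)] by metis
      obtain M where M: "M > 0" "\<And>r1 r2 z w. Im z \<in> {s} \<Longrightarrow> Im w \<in> {t} \<Longrightarrow>
         Im r1 - e1 - Im z \<in> (\<lambda>y. y - e1 - s) ` cball (Im c) d1 \<Longrightarrow> Im r2 - e2 - Im w \<in> (\<lambda>y. y - e2 - t) ` cball (Im d) d2 \<Longrightarrow>
         cmod (kern e1 e2 f k r1 r2 z w) \<le> M * (exp (- (0 * (\<bar>Re r1\<bar> + \<bar>Re r2\<bar>))) * exp (- (\<bar>Re z\<bar> + \<bar>Re w\<bar>)))"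
      proof (rule kern_bound[OF fD(1) kD(1), of "{s}" "{t}" "(\<lambda>y. y - e1 - s) ` cball (Im c) d1" "(\<lambda>y. y - e2 - t) ` cball (Im d) d2" 0 e1 e2])
        show "compact ((\<lambda>y. y - e1 - s) ` cball (Im c) d1)" "compact ((\<lambda>y. y - e2 - t) ` cball (Im d) d2)"
          by (intro compact_continuous_image continuous_intros compact_cball)+
        show "(\<lambda>y. y - e1 - s) ` cball (Im c) d1 \<subseteq> S'" "(\<lambda>y. y - e2 - t) ` cball (Im d) d2 \<subseteq> T'"
          using d1(2) d2(2) by (auto simp: U0_def V0_def subset_iff)
      qed (use st in auto)
      have "cmod (q z w p) \<le> M * exp (- (\<bar>fst p\<bar> + \<bar>snd p\<bar>))" if "dist z c < min d1 d2" "dist w d < min d1 d2" for z w p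
        using M(2)[of "of_real (fst p) + \<i> * of_real s" "of_real (snd p) + \<i> * of_real t" z w] d1(3)[of z] d2(3)[of w] that
        unfolding q_def slice_def by auto
      then show "\<exists>e>0. \<exists>M. \<forall>z w p. dist z c < e \<longrightarrow> dist w d < e \<longrightarrow> Im z \<in> U0 \<longrightarrow> Im w \<in> V0 \<longrightarrow> cmod (q z w p) \<le> M * exp (- (\<bar>fst p\<bar> + \<bar>snd p\<bar>))"
        using d1(1) d2(1) by (meson min_less_iff_conj)
    qed
    have "continuous_on {z. Im (fst z) \<in> U0 \<and> Im (snd z) \<in> V0} (\<lambda>z. \<integral>p. q (fst z) (snd z) p \<partial>lborel)"
    proof (rule integral_continuous[OF dom U0(1,2) _ q_meas])
      fix p show "continuous_on {z. Im (fst z) \<in> U0 \<and> Im (snd z) \<in> V0} (\<lambda>z. q (fst z) (snd z) p)"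
        unfolding q_eq phase_def by (intro continuous_intros strip_decayD(1)[OF kk])
    qed
    moreover have "(\<lambda>z. \<integral>p. q z w p \<partial>lborel) holomorphic_on {z. Im z \<in> U0}" if w: "Im w \<in> V0" for w
    proof (rule integral_holomorphic1[OF dom U0(1) w _ q_meas[OF _ w]])
      fix p show "(\<lambda>z. q z w p) holomorphic_on {z. Im z \<in> U0}"
        unfolding q_eq phase_def by (intro holomorphic_intros strip_decayD(2)[OF kk w])
    qed
    moreover have "(\<lambda>w. \<integral>p. q z w p \<partial>lborel) holomorphic_on {w. Im w \<in> V0}" if z: "Im z \<in> U0" for z
    proof (rule integral_holomorphic2[OF dom U0(2) z _ q_meas[OF z]])
      fix p show "(\<lambda>w. q z w p) holomorphic_on {w. Im w \<in> V0}"
        unfolding q_eq phase_def by (intro holomorphic_intros strip_decayD(3)[OF kk z])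
    qed
    ultimately show ?thesis using U0 eq
      by (intro exI[of _ U0] exI[of _ V0] conjI exI[of _ "\<lambda>r1 r2. \<integral>p. q r1 r2 p \<partial>lborel"]) auto
  qed
  show ?thesis
  proof (rule strip_decayI)
    show "continuous_on {z. Im (fst z) \<in> U \<and> Im (snd z) \<in> V} (\<lambda>z. cprod_interp e1 e2 l m f k (fst z) (snd z))"
    proof (rule continuous_on_local)
      fix z assume "z \<in> {z. Im (fst z) \<in> U \<and> Im (snd z) \<in> V}"
      then obtain U0 V0 h where o: "open U0" "open V0" "Im (fst z) \<in> U0" "Im (snd z) \<in> V0"
        and h: "\<And>r1 r2. Im r1 \<in> U0 \<Longrightarrow> Im r2 \<in> V0 \<Longrightarrow> cprod_interp e1 e2 l m f k r1 r2 = h r1 r2"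
          "continuous_on {z. Im (fst z) \<in> U0 \<and> Im (snd z) \<in> V0} (\<lambda>z. h (fst z) (snd z))"
        using key[of "fst z" "snd z"] by auto
      have "{z. Im (fst z) \<in> U0 \<and> Im (snd z) \<in> V0} = {z. Im z \<in> U0} \<times> {z. Im z \<in> V0}" by auto
      then have "open {z. Im (fst z) \<in> U0 \<and> Im (snd z) \<in> V0}" using o by (simp add: open_Times open_Im)
      moreover have "continuous_on {z. Im (fst z) \<in> U0 \<and> Im (snd z) \<in> V0} (\<lambda>z. cprod_interp e1 e2 l m f k (fst z) (snd z))"
        by (rule continuous_on_eq[OF h(2)]) (simp add: h(1))
      ultimately show "\<exists>W. open W \<and> z \<in> W \<and> continuous_on W (\<lambda>z. cprod_interp e1 e2 l m f k (fst z) (snd z))"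
        using o(3,4) by blast
    qed
    show "(\<lambda>z. cprod_interp e1 e2 l m f k z w) holomorphic_on {z. Im z \<in> U}" if w: "Im w \<in> V" for w
    proof (rule holomorphic_on_local[OF open_Im[OF U(1)]])
      fix z assume "z \<in> {z. Im z \<in> U}"
      then obtain U0 V0 h where o: "open U0" "Im z \<in> U0" "Im w \<in> V0"
        and h: "\<And>r1 r2. Im r1 \<in> U0 \<Longrightarrow> Im r2 \<in> V0 \<Longrightarrow> cprod_interp e1 e2 l m f k r1 r2 = h r1 r2"
          "(\<lambda>z. h z w) holomorphic_on {z. Im z \<in> U0}"
        using key[of z w] w by auto
      have "(\<lambda>z. cprod_interp e1 e2 l m f k z w) holomorphic_on {z. Im z \<in> U0}"
        by (rule holomorphic_transform[OF h(2)]) (simp add: h(1) o)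
      then show "\<exists>W. open W \<and> z \<in> W \<and> (\<lambda>z. cprod_interp e1 e2 l m f k z w) holomorphic_on W"
        using open_Im[OF o(1)] o(2) by blast
    qed
    show "cprod_interp e1 e2 l m f k z holomorphic_on {w. Im w \<in> V}" if z: "Im z \<in> U" for z
    proof (rule holomorphic_on_local[OF open_Im[OF U(2)]])
      fix w assume "w \<in> {w. Im w \<in> V}"
      then obtain U0 V0 h where o: "open V0" "Im z \<in> U0" "Im w \<in> V0"
        and h: "\<And>r1 r2. Im r1 \<in> U0 \<Longrightarrow> Im r2 \<in> V0 \<Longrightarrow> cprod_interp e1 e2 l m f k r1 r2 = h r1 r2"
          "h z holomorphic_on {w. Im w \<in> V0}"
        using key[of z w] z by auto
      have "cprod_interp e1 e2 l m f k z holomorphic_on {w. Im w \<in> V0}"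
        by (rule holomorphic_transform[OF h(2)]) (simp add: h(1) o)
      then show "\<exists>W. open W \<and> w \<in> W \<and> cprod_interp e1 e2 l m f k z holomorphic_on W"
        using open_Im[OF o(1)] o(3) by blast
    qed
    fix K L :: "real set" and c :: real assume K: "compact K" "K \<subseteq> U" "compact L" "L \<subseteq> V" and c: "c \<ge> 0"
    \<comment> \<open>Here the contour keeps moving: as the heights of \<open>r1\<close>,
      \<open>r2\<close> range over compact sets, so do those of the arguments of both
      factors.\<close>
    obtain M where M: "M > 0" "\<And>r1 r2 z w. Im z \<in> (\<lambda>y. l * (y - e1)) ` K \<Longrightarrow> Im w \<in> (\<lambda>y. m * (y - e2)) ` L \<Longrightarrow>
         Im r1 - e1 - Im z \<in> (\<lambda>y. (1 - l) * (y - e1)) ` K \<Longrightarrow> Im r2 - e2 - Im w \<in> (\<lambda>y. (1 - m) * (y - e2)) ` L \<Longrightarrow>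
         cmod (kern e1 e2 f k r1 r2 z w) \<le> M * (exp (- (c * (\<bar>Re r1\<bar> + \<bar>Re r2\<bar>))) * exp (- (\<bar>Re z\<bar> + \<bar>Re w\<bar>)))"
    proof (rule kern_bound[OF fD(1) kD(1), of "(\<lambda>y. l * (y - e1)) ` K" "(\<lambda>y. m * (y - e2)) ` L" "(\<lambda>y. (1 - l) * (y - e1)) ` K" "(\<lambda>y. (1 - m) * (y - e2)) ` L" c e1 e2])
      show "compact ((\<lambda>y. l * (y - e1)) ` K)" "compact ((\<lambda>y. m * (y - e2)) ` L)" "compact ((\<lambda>y. (1 - l) * (y - e1)) ` K)" "compact ((\<lambda>y. (1 - m) * (y - e2)) ` L)"
        by (intro compact_continuous_image continuous_intros K)+
    qed (use K U1 V1 c in auto)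
    define I where "I = (\<integral>p. exp (- (1 * (\<bar>fst p\<bar> + \<bar>snd p\<bar>))) \<partial>(lborel :: (real \<times> real) measure))"
    have I: "integrable lborel (\<lambda>p::real\<times>real. exp (- (1 * (\<bar>fst p\<bar> + \<bar>snd p\<bar>))))" by (rule integrable_exp_abs2) simp
    show "\<exists>M. \<forall>z w. Im z \<in> K \<longrightarrow> Im w \<in> L \<longrightarrow> cmod (cprod_interp e1 e2 l m f k z w) \<le> M * exp (- (c * (\<bar>Re z\<bar> + \<bar>Re w\<bar>)))"
    proof (intro exI[of _ "M * I"] allI impI)
      fix r1 r2 assume r: "Im r1 \<in> K" "Im r2 \<in> L"
      define J where "J p = slice (kern e1 e2 f k r1 r2) (\<i> * of_real (l * (Im r1 - e1))) (\<i> * of_real (m * (Im r2 - e2))) p" for p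
      have J: "cmod (J p) \<le> (M * exp (- (c * (\<bar>Re r1\<bar> + \<bar>Re r2\<bar>)))) * exp (- (1 * (\<bar>fst p\<bar> + \<bar>snd p\<bar>)))" for p
        using M(2)[of "of_real (fst p) + \<i> * of_real (l * (Im r1 - e1))" "of_real (snd p) + \<i> * of_real (m * (Im r2 - e2))" r1 r2] split
          imageI[OF r(1), of "\<lambda>y. l * (y - e1)"] imageI[OF r(1), of "\<lambda>y. (1 - l) * (y - e1)"]
          imageI[OF r(2), of "\<lambda>y. m * (y - e2)"] imageI[OF r(2), of "\<lambda>y. (1 - m) * (y - e2)"]
        by (simp add: J_def slice_def mult.assoc)
      have "cmod (cprod_interp e1 e2 l m f k r1 r2) = cmod (\<integral>p. J p \<partial>lborel)"
        by (simp add: cprod_interp_def cprod_def J_def)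
      also have "\<dots> \<le> (\<integral>p. cmod (J p) \<partial>lborel)" by (rule integral_norm_bound)
      also have "\<dots> \<le> (\<integral>p. (M * exp (- (c * (\<bar>Re r1\<bar> + \<bar>Re r2\<bar>)))) * exp (- (1 * (\<bar>fst p\<bar> + \<bar>snd p\<bar>))) \<partial>lborel)"
        by (rule integral_mono'[OF integrable_mult_right[OF I] J]) (use M in simp)
      also have "\<dots> = M * exp (- (c * (\<bar>Re r1\<bar> + \<bar>Re r2\<bar>))) * I"
        unfolding I_def by (rule integral_mult_right_zero)
      finally show "cmod (cprod_interp e1 e2 l m f k r1 r2) \<le> M * I * exp (- (c * (\<bar>Re r1\<bar> + \<bar>Re r2\<bar>)))"
        by (simp only: mult_ac)
    qed
  qed
qed

subsection \<open>The function spaces on the Fourier side and their products\<close>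

locale quantum_plane =
  fixes \<alpha> \<beta> :: real
  assumes nonzero: "0 < \<bar>\<alpha> * \<beta>\<bar>" and small: "\<bar>\<alpha> * \<beta>\<bar> < 1 / 3"
begin

lemma alpha_beta: "\<alpha> \<noteq> 0" "\<beta> \<noteq> 0" "\<bar>\<alpha>\<bar> > 0" "\<bar>\<beta>\<bar> > 0"
  using nonzero by auto

text \<open>Through \<^term>\<open>of_strip\<close>, the set \<open>A0\<close> corresponds to \<^term>\<open>frakA\<close> and \<open>A1\<close>, \<open>A2\<close>, \<open>A12\<close> to
  \<^term>\<open>frakA1 \<alpha> \<beta>\<close>, \<^term>\<open>frakA2 \<alpha> \<beta>\<close>, \<^term>\<open>frakA12 \<alpha> \<beta>\<close>; \<open>N\<close> is the product
  \<^term>\<open>natural \<alpha> \<beta>\<close>, the contour running half-way between the boundaries of the domains of the two factors.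
  All these functions only matter on the common strip \<open>S1 \<times> S2\<close>, hence the equality \<open>eqB\<close>.\<close>

definition S1 :: "real set" where "S1 = {- (\<bar>\<alpha>\<bar> / 2) <..< \<bar>\<alpha>\<bar> / 2}"
definition S2 :: "real set" where "S2 = {- (\<bar>\<beta>\<bar> / 2) <..< \<bar>\<beta>\<bar> / 2}"

lemma S_iff: "y \<in> S1 \<longleftrightarrow> \<bar>y\<bar> < \<bar>\<alpha>\<bar> / 2" "y \<in> S2 \<longleftrightarrow> \<bar>y\<bar> < \<bar>\<beta>\<bar> / 2"
  by (auto simp: S1_def S2_def abs_less_iff)

lemma S_props: "open S1" "convex S1" "0 \<in> S1" "open S2" "convex S2" "0 \<in> S2"
  using alpha_beta by (auto simp: S1_def S2_def)

definition eqB :: "(complex \<Rightarrow> complex \<Rightarrow> complex) \<Rightarrow> (complex \<Rightarrow> complex \<Rightarrow> complex) \<Rightarrow> bool" where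
  "eqB f g \<longleftrightarrow> (\<forall>z w. Im z \<in> S1 \<longrightarrow> Im w \<in> S2 \<longrightarrow> f z w = g z w)"

definition B :: "(complex \<Rightarrow> complex \<Rightarrow> complex) set" where
  "B = {f. strip_decay S1 S2 f}"

definition A0 :: "(complex \<Rightarrow> complex \<Rightarrow> complex) set" where
  "A0 = {f. \<exists>b. strip_decay UNIV UNIV b \<and> eqB f b}"

text \<open>For (a, b) = (2 pi \<beta>, 0) or (0, 2 pi \<alpha>) and c = 1, -1 these are the
  exponentials that make up f_\<alpha> or f_\<beta>. The constant i pi \<alpha> \<beta> equals a i
  \<alpha>/2 + b i \<beta>/2, which makes them multiplicative along the product.\<close>

definition exp_symbol :: "real \<Rightarrow> real \<Rightarrow> real \<Rightarrow> complex \<Rightarrow> complex \<Rightarrow> complex" where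
  "exp_symbol a b c z w = exp (of_real c * (of_real a * z + of_real b * w + \<i> * of_real (pi * (\<alpha> * \<beta>))))"

definition sinh_fun :: "real \<Rightarrow> real \<Rightarrow> complex \<Rightarrow> complex \<Rightarrow> complex" where
  "sinh_fun a b z w = exp_symbol a b (-1) z w - exp_symbol a b 1 z w"

text \<open>Multiplication by the symbol replaces division, which keeps the condition linear and
  suits the twisted Leibniz rule; \<open>sinh_fun_reciprocal\<close> recovers the quotient. One
  definition covers both symbols.\<close>

definition Asym :: "real \<Rightarrow> real \<Rightarrow> (complex \<Rightarrow> complex \<Rightarrow> complex) set" where
  "Asym a b = {f. strip_decay S1 S2 f \<and> (\<lambda>z w. sinh_fun a b z w * f z w) \<in> A0}"

definition A1 where "A1 = Asym (2 * pi * \<beta>) 0"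
definition A2 where "A2 = Asym 0 (2 * pi * \<alpha>)"

definition A12 :: "(complex \<Rightarrow> complex \<Rightarrow> complex) set" where
  "A12 = {f. \<exists>f1\<in>A1. \<exists>f2\<in>A2. eqB f (\<lambda>z w. f1 z w + f2 z w)}"

definition N :: "(complex \<Rightarrow> complex \<Rightarrow> complex) \<Rightarrow> (complex \<Rightarrow> complex \<Rightarrow> complex) \<Rightarrow> complex \<Rightarrow> complex \<Rightarrow> complex" where
  "N = cprod_interp (\<alpha> / 2) (\<beta> / 2) (1 / 2) (1 / 2)"

definition strip_star :: "(complex \<Rightarrow> complex \<Rightarrow> complex) \<Rightarrow> complex \<Rightarrow> complex \<Rightarrow> complex" where
  "strip_star f z w = exp (of_real pi * (of_real \<beta> * z - of_real \<alpha> * w)) * cnj (f (- cnj z) (- cnj w))"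

lemma eqB_refl: "eqB f f" by (simp add: eqB_def)
lemma eqB_trans: "eqB f g \<Longrightarrow> eqB g h \<Longrightarrow> eqB f h" by (simp add: eqB_def)

lemma B_strip_fun: "f \<in> B \<Longrightarrow> strip_fun S1 S2 f"
  using S_props by (simp add: B_def strip_fun_def)

lemma B_cong: "f \<in> B \<Longrightarrow> eqB g f \<Longrightarrow> g \<in> B"
  unfolding B_def eqB_def using strip_decay_cong by blast

lemma A0_cong: "f \<in> A0 \<Longrightarrow> eqB g f \<Longrightarrow> g \<in> A0"
  unfolding A0_def using eqB_trans by blast

lemma A0I: "strip_decay UNIV UNIV b \<Longrightarrow> b \<in> A0"
  unfolding A0_def using eqB_refl by blast

lemma A0_B: "f \<in> A0 \<Longrightarrow> f \<in> B"
  unfolding A0_def using B_cong strip_decay_mono[of UNIV UNIV _ S1 S2] by (auto simp: B_def)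

lemma B_add: "f \<in> B \<Longrightarrow> g \<in> B \<Longrightarrow> (\<lambda>z w. f z w + g z w) \<in> B"
  by (simp add: B_def strip_decay_add)

lemma B_cmult: "f \<in> B \<Longrightarrow> (\<lambda>z w. c * f z w) \<in> B"
  by (simp add: B_def strip_decay_cmult)

lemma A0_add: "f \<in> A0 \<Longrightarrow> g \<in> A0 \<Longrightarrow> (\<lambda>z w. f z w + g z w) \<in> A0"
proof -
  assume "f \<in> A0" "g \<in> A0"
  then obtain b b' where "strip_decay UNIV UNIV b" "eqB f b" "strip_decay UNIV UNIV b'" "eqB g b'" by (auto simp: A0_def)
  then show ?thesis unfolding A0_def
    by (intro CollectI exI[of _ "\<lambda>z w. b z w + b' z w"]) (simp add: strip_decay_add eqB_def)
qed

lemma A0_cmult: "f \<in> A0 \<Longrightarrow> (\<lambda>z w. c * f z w) \<in> A0"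
proof -
  assume "f \<in> A0"
  then obtain b where "strip_decay UNIV UNIV b" "eqB f b" by (auto simp: A0_def)
  then show ?thesis unfolding A0_def
    by (intro CollectI exI[of _ "\<lambda>z w. c * b z w"]) (simp add: strip_decay_cmult eqB_def)
qed

lemma exp_symbol_mult: "strip_decay S T f \<Longrightarrow> strip_decay S T (\<lambda>z w. exp_symbol a b c z w * f z w)"
proof -
  assume "strip_decay S T f"
  from strip_decay_exp_mult[OF this, of "of_real (c * a)" "of_real (c * b)" "of_real c * (\<i> * of_real (pi * (\<alpha> * \<beta>)))"]
  show ?thesis unfolding exp_symbol_def by (simp add: algebra_simps)
qed

lemma A0_exp_symbol_mult: "f \<in> A0 \<Longrightarrow> (\<lambda>z w. exp_symbol a b c z w * f z w) \<in> A0"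
proof -
  assume "f \<in> A0"
  then obtain b' where "strip_decay UNIV UNIV b'" "eqB f b'" by (auto simp: A0_def)
  then show ?thesis unfolding A0_def
    by (intro CollectI exI[of _ "\<lambda>z w. exp_symbol a b c z w * b' z w"]) (simp add: exp_symbol_mult eqB_def)
qed

lemma A0_sinh_fun_mult: assumes "f \<in> A0" shows "(\<lambda>z w. sinh_fun a b z w * f z w) \<in> A0"
proof -
  have "(\<lambda>z w. exp_symbol a b (-1) z w * f z w + (-1) * (exp_symbol a b 1 z w * f z w)) \<in> A0"
    by (intro A0_add A0_cmult A0_exp_symbol_mult assms)
  then show ?thesis by (simp add: sinh_fun_def left_diff_distrib)
qed

lemma Asym_B: "f \<in> Asym a b \<Longrightarrow> f \<in> B" by (simp add: Asym_def B_def)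

lemma A0_Asym: "f \<in> A0 \<Longrightarrow> f \<in> Asym a b"
  using A0_B A0_sinh_fun_mult by (simp add: Asym_def B_def)

lemma Asym_add: "f \<in> Asym a b \<Longrightarrow> g \<in> Asym a b \<Longrightarrow> (\<lambda>z w. f z w + g z w) \<in> Asym a b"
  unfolding Asym_def using A0_add[of "\<lambda>z w. sinh_fun a b z w * f z w" "\<lambda>z w. sinh_fun a b z w * g z w"]
  by (simp add: strip_decay_add distrib_left)

lemma Asym_cmult: "f \<in> Asym a b \<Longrightarrow> (\<lambda>z w. c * f z w) \<in> Asym a b"
  unfolding Asym_def using A0_cmult[of "\<lambda>z w. sinh_fun a b z w * f z w" c]
  by (simp add: strip_decay_cmult mult.left_commute)

lemma Asym_cong: "f \<in> Asym a b \<Longrightarrow> eqB g f \<Longrightarrow> g \<in> Asym a b"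
  unfolding Asym_def using B_cong[of f g] A0_cong[of "\<lambda>z w. sinh_fun a b z w * f z w" "\<lambda>z w. sinh_fun a b z w * g z w"]
  by (simp add: B_def eqB_def)

lemma A12I:
  assumes "f1 \<in> A1" "f2 \<in> A2" "eqB f (\<lambda>z w. f1 z w + f2 z w)" shows "f \<in> A12"
  unfolding A12_def mem_Collect_eq by (rule bexI[OF _ assms(1)], rule bexI[OF _ assms(2)], rule assms(3))

lemma A12_B: "f \<in> A12 \<Longrightarrow> f \<in> B"
  unfolding A12_def A1_def A2_def using B_cong B_add Asym_B by blast

lemma A12_add:
  assumes "f \<in> A12" "g \<in> A12" shows "(\<lambda>z w. f z w + g z w) \<in> A12"
proof -
  obtain f1 f2 g1 g2 where *: "f1 \<in> A1" "f2 \<in> A2" "eqB f (\<lambda>z w. f1 z w + f2 z w)" "g1 \<in> A1" "g2 \<in> A2" "eqB g (\<lambda>z w. g1 z w + g2 z w)"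
    using assms by (auto simp: A12_def)
  have m: "(\<lambda>z w. f1 z w + g1 z w) \<in> A1" "(\<lambda>z w. f2 z w + g2 z w) \<in> A2"
    using * by (auto simp: A1_def A2_def Asym_add)
  have "eqB (\<lambda>z w. f z w + g z w) (\<lambda>z w. (f1 z w + g1 z w) + (f2 z w + g2 z w))"
    using * by (simp add: eqB_def)
  then show ?thesis by (rule A12I[OF m])
qed

lemma A12_cmult:
  assumes "f \<in> A12" shows "(\<lambda>z w. c * f z w) \<in> A12"
proof -
  obtain f1 f2 where *: "f1 \<in> A1" "f2 \<in> A2" "eqB f (\<lambda>z w. f1 z w + f2 z w)"
    using assms by (auto simp: A12_def)
  have m: "(\<lambda>z w. c * f1 z w) \<in> A1" "(\<lambda>z w. c * f2 z w) \<in> A2"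
    using * by (auto simp: A1_def A2_def Asym_cmult)
  have "eqB (\<lambda>z w. c * f z w) (\<lambda>z w. c * f1 z w + c * f2 z w)"
    using * by (simp add: eqB_def distrib_left)
  then show ?thesis by (rule A12I[OF m])
qed

lemma A0_zero: "(\<lambda>z w. 0) \<in> A0" by (rule A0I) (rule strip_decay_zero)

lemma A1_A12: assumes "f \<in> A1" shows "f \<in> A12"
proof -
  have z: "(\<lambda>z w. 0) \<in> A2" unfolding A2_def by (rule A0_Asym[OF A0_zero])
  show ?thesis by (rule A12I[OF assms z]) (simp add: eqB_def)
qed

lemma A2_A12: assumes "f \<in> A2" shows "f \<in> A12"
proof -
  have z: "(\<lambda>z w. 0) \<in> A1" unfolding A1_def by (rule A0_Asym[OF A0_zero])
  show ?thesis by (rule A12I[OF z assms]) (simp add: eqB_def)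
qed

lemma A0_A1: "f \<in> A0 \<Longrightarrow> f \<in> A1" and A0_A2: "f \<in> A0 \<Longrightarrow> f \<in> A2"
  by (simp_all add: A1_def A2_def A0_Asym)

lemma A0_A12: "f \<in> A0 \<Longrightarrow> f \<in> A12" using A0_A1 A1_A12 by blast

text \<open>The zeros of the symbols lie outside the strips since \<open>2 \<bar>\<alpha> \<beta>\<bar> < 1\<close>.\<close>

lemma norm_sinh_fun_ge: "cmod (sinh_fun a b z w) \<ge> 2 * \<bar>sin (a * Im z + b * Im w + pi * (\<alpha> * \<beta>))\<bar>"
proof -
  define u where "u = a * Re z + b * Re w"
  define v where "v = a * Im z + b * Im w + pi * (\<alpha> * \<beta>)"
  \<comment> \<open>The imaginary part of the symbol is, up to sign, 2 cosh u, which is at least 2,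
    times the sine of a quantity depending on the heights only; so the bound is uniform in the real
    parts.\<close>
  have "Im (exp_symbol a b c z w) = exp (c * u) * sin (c * v)" for c
    by (simp add: exp_symbol_def Im_exp u_def v_def)
  then have "Im (sinh_fun a b z w) = - ((exp u + exp (- u)) * sin v)"
    by (simp add: sinh_fun_def algebra_simps)
  then have "\<bar>Im (sinh_fun a b z w)\<bar> = (exp u + exp (- u)) * \<bar>sin v\<bar>" by (simp add: abs_mult)
  moreover have "2 \<le> exp u + exp (- u)"
    using exp_ge_add_one_self[of u] exp_ge_add_one_self[of "- u"] by linarith
  ultimately have "2 * \<bar>sin v\<bar> \<le> \<bar>Im (sinh_fun a b z w)\<bar>" by (simp add: mult_right_mono)
  also have "\<dots> \<le> cmod (sinh_fun a b z w)" by (rule abs_Im_le_cmod)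
  finally show ?thesis unfolding v_def .
qed

lemma sin_nonzero:
  assumes "\<bar>x\<bar> < pi * \<bar>\<alpha> * \<beta>\<bar>" shows "sin (x + pi * (\<alpha> * \<beta>)) \<noteq> 0"
proof -
  have pg: "pi * \<bar>\<alpha> * \<beta>\<bar> < pi / 3" using mult_strict_left_mono[OF small pi_gt_zero] by simp
  show ?thesis
  proof (cases "\<alpha> * \<beta> > 0")
    case True
    then have "\<bar>\<alpha> * \<beta>\<bar> = \<alpha> * \<beta>" by simp
    then have "0 < x + pi * (\<alpha> * \<beta>)" "x + pi * (\<alpha> * \<beta>) < pi" using assms pg pi_gt_zero by linarith+
    then show ?thesis using sin_gt_zero by (metis less_irrefl)
  next
    case False
    then have "pi * \<bar>\<alpha> * \<beta>\<bar> = - (pi * (\<alpha> * \<beta>))" by (simp add: not_less abs_of_nonpos)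
    then have "0 < - (x + pi * (\<alpha> * \<beta>))" "- (x + pi * (\<alpha> * \<beta>)) < pi" using assms pg pi_gt_zero by linarith+
    then have "sin (- (x + pi * (\<alpha> * \<beta>))) > 0" by (rule sin_gt_zero)
    then show ?thesis by (simp only: sin_minus)
  qed
qed

text \<open>Each symbol depends on one variable, so dividing by it restricts one strip; the
  disjunction treats both cases together. Over compact sets of heights the sine in
  \<open>norm_sinh_fun_ge\<close> has a positive minimum in absolute value, which bounds the
  reciprocal.\<close>

lemma sinh_fun_reciprocal:
  fixes a b :: real
  assumes S: "S = S1 \<and> T = UNIV \<and> a = 2 * pi * \<beta> \<and> b = 0 \<or> S = UNIV \<and> T = S2 \<and> a = 0 \<and> b = 2 * pi * \<alpha>"
    and f: "strip_decay UNIV UNIV f"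
  shows "strip_decay S T (\<lambda>z w. inverse (sinh_fun a b z w) * f z w)"
    and "\<And>z w. Im z \<in> S \<Longrightarrow> Im w \<in> T \<Longrightarrow> sinh_fun a b z w \<noteq> 0"
proof -
  have arg: "\<bar>a * y1 + b * y2\<bar> < pi * \<bar>\<alpha> * \<beta>\<bar>" if "y1 \<in> S" "y2 \<in> T" for y1 y2
    using S
  proof
    assume *: "S = S1 \<and> T = UNIV \<and> a = 2 * pi * \<beta> \<and> b = 0"
    then have "\<bar>y1\<bar> < \<bar>\<alpha>\<bar> / 2" using that by (simp add: S_iff)
    then have "2 * pi * \<bar>\<beta>\<bar> * \<bar>y1\<bar> < 2 * pi * \<bar>\<beta>\<bar> * (\<bar>\<alpha>\<bar> / 2)" using alpha_beta by (intro mult_strict_left_mono) auto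
    then show ?thesis using * by (simp add: abs_mult mult_ac)
  next
    assume *: "S = UNIV \<and> T = S2 \<and> a = 0 \<and> b = 2 * pi * \<alpha>"
    then have "\<bar>y2\<bar> < \<bar>\<beta>\<bar> / 2" using that by (simp add: S_iff)
    then have "2 * pi * \<bar>\<alpha>\<bar> * \<bar>y2\<bar> < 2 * pi * \<bar>\<alpha>\<bar> * (\<bar>\<beta>\<bar> / 2)" using alpha_beta by (intro mult_strict_left_mono) auto
    then show ?thesis using * by (simp add: abs_mult mult_ac)
  qed
  have sin0: "sin (a * y1 + b * y2 + pi * (\<alpha> * \<beta>)) \<noteq> 0" if "y1 \<in> S" "y2 \<in> T" for y1 y2
    by (rule sin_nonzero[OF arg[OF that]])
  show nz: "sinh_fun a b z w \<noteq> 0" if "Im z \<in> S" "Im w \<in> T" for z w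
    using norm_sinh_fun_ge[of a z b w] sin0[OF that] by auto
  show "strip_decay S T (\<lambda>z w. inverse (sinh_fun a b z w) * f z w)"
  proof (rule strip_decay_mult[OF strip_decay_mono[OF f]])
    show "continuous_on {z. Im (fst z) \<in> S \<and> Im (snd z) \<in> T} (\<lambda>z::complex\<times>complex. inverse (sinh_fun a b (fst z) (snd z)))"
      by (intro continuous_on_inverse) (use nz in \<open>auto simp: sinh_fun_def exp_symbol_def intro!: continuous_intros\<close>)
    show "(\<lambda>z. inverse (sinh_fun a b z w)) holomorphic_on {z. Im z \<in> S}" if "Im w \<in> T" for w
      by (intro holomorphic_on_inverse) (use nz that in \<open>auto simp: sinh_fun_def exp_symbol_def intro!: holomorphic_intros\<close>)
    show "(\<lambda>w. inverse (sinh_fun a b z w)) holomorphic_on {w. Im w \<in> T}" if "Im z \<in> S" for z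
      by (intro holomorphic_on_inverse) (use nz that in \<open>auto simp: sinh_fun_def exp_symbol_def intro!: holomorphic_intros\<close>)
    fix K L :: "real set" assume K: "compact K" "K \<subseteq> S" "compact L" "L \<subseteq> T"
    show "\<exists>M c. \<forall>z w. Im z \<in> K \<longrightarrow> Im w \<in> L \<longrightarrow> cmod (inverse (sinh_fun a b z w)) \<le> M * exp (c * (\<bar>Re z\<bar> + \<bar>Re w\<bar>))"
    proof (cases "K = {} \<or> L = {}")
      case False
      have "compact (K \<times> L)" using K by (simp add: compact_Times)
      moreover have "K \<times> L \<noteq> {}" using False by auto
      moreover have "continuous_on (K \<times> L) (\<lambda>y. \<bar>sin (a * fst y + b * snd y + pi * (\<alpha> * \<beta>))\<bar>)" by (intro continuous_intros)
      ultimately have "\<exists>x\<in>K \<times> L. \<forall>y\<in>K \<times> L. \<bar>sin (a * fst x + b * snd x + pi * (\<alpha> * \<beta>))\<bar> \<le> \<bar>sin (a * fst y + b * snd y + pi * (\<alpha> * \<beta>))\<bar>"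
        by (rule continuous_attains_inf)
      then obtain y0 where y0: "y0 \<in> K \<times> L" "\<And>y. y \<in> K \<times> L \<Longrightarrow> \<bar>sin (a * fst y0 + b * snd y0 + pi * (\<alpha> * \<beta>))\<bar> \<le> \<bar>sin (a * fst y + b * snd y + pi * (\<alpha> * \<beta>))\<bar>"
      proof (rule bexE)
        fix x assume x: "x \<in> K \<times> L" and le: "\<forall>y\<in>K \<times> L. \<bar>sin (a * fst x + b * snd x + pi * (\<alpha> * \<beta>))\<bar> \<le> \<bar>sin (a * fst y + b * snd y + pi * (\<alpha> * \<beta>))\<bar>"
        show thesis by (rule that[OF x bspec[OF le]])
      qed
      define d where "d = 2 * \<bar>sin (a * fst y0 + b * snd y0 + pi * (\<alpha> * \<beta>))\<bar>"
      have "fst y0 \<in> S" "snd y0 \<in> T" using y0(1) K by auto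
      then have d: "d > 0" unfolding d_def using sin0[of "fst y0" "snd y0"] by simp
      have "cmod (inverse (sinh_fun a b z w)) \<le> inverse d" if "Im z \<in> K" "Im w \<in> L" for z w
      proof -
        have "d \<le> cmod (sinh_fun a b z w)" using y0(2)[of "(Im z, Im w)"] that norm_sinh_fun_ge[of a z b w] by (simp add: d_def)
        then show ?thesis unfolding norm_inverse using d by (simp add: le_imp_inverse_le)
      qed
      then show ?thesis by - (rule exI[of _ "inverse d"], rule exI[of _ "0::real"], simp)
    qed auto
  qed auto
qed

section \<open>Products of the component spaces\<close>

text \<open>Membership in \<open>A1\<close> speaks of the common strip. The representation as an
  entire function divided by f_\<alpha> continues \<open>f\<close> to all heights of the second
  variable, which makes room for the contours in mixed products.\<close>

lemma A1_ext: assumes "f \<in> A1" obtains g where "strip_decay S1 UNIV g" "eqB f g"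
proof -
  obtain b where b: "strip_decay UNIV UNIV b" "eqB (\<lambda>z w. sinh_fun (2 * pi * \<beta>) 0 z w * f z w) b"
    using assms by (auto simp: A1_def Asym_def A0_def)
  note r = sinh_fun_reciprocal[OF disjI1[OF conjI[OF refl conjI[OF refl conjI[OF refl refl]]]] b(1)]
  have "eqB f (\<lambda>z w. inverse (sinh_fun (2 * pi * \<beta>) 0 z w) * b z w)"
    unfolding eqB_def
  proof (intro allI impI)
    fix z w assume zw: "Im z \<in> S1" "Im w \<in> S2"
    then have "b z w = sinh_fun (2 * pi * \<beta>) 0 z w * f z w" using b(2) by (simp add: eqB_def)
    then show "f z w = inverse (sinh_fun (2 * pi * \<beta>) 0 z w) * b z w" using r(2)[of z w] zw by simp
  qed
  then show ?thesis by (rule that[OF r(1)])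
qed

lemma A2_ext: assumes "f \<in> A2" obtains g where "strip_decay UNIV S2 g" "eqB f g"
proof -
  obtain b where b: "strip_decay UNIV UNIV b" "eqB (\<lambda>z w. sinh_fun 0 (2 * pi * \<alpha>) z w * f z w) b"
    using assms by (auto simp: A2_def Asym_def A0_def)
  note r = sinh_fun_reciprocal[OF disjI2[OF conjI[OF refl conjI[OF refl conjI[OF refl refl]]]] b(1)]
  have "eqB f (\<lambda>z w. inverse (sinh_fun 0 (2 * pi * \<alpha>) z w) * b z w)"
    unfolding eqB_def
  proof (intro allI impI)
    fix z w assume zw: "Im z \<in> S1" "Im w \<in> S2"
    then have "b z w = sinh_fun 0 (2 * pi * \<alpha>) z w * f z w" using b(2) by (simp add: eqB_def)
    then show "f z w = inverse (sinh_fun 0 (2 * pi * \<alpha>) z w) * b z w" using r(2)[of z w] zw by simp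
  qed
  then show ?thesis by (rule that[OF r(1)])
qed

text \<open>The distance of y from \<alpha>/2 is below |\<alpha>|, so half of it fits into the
  strip: the half-way contour is admissible at every point of the common strip.\<close>

lemma half_mem:
  "y \<in> S1 \<Longrightarrow> 1 / 2 * (y - \<alpha> / 2) \<in> S1" "y \<in> S2 \<Longrightarrow> 1 / 2 * (y - \<beta> / 2) \<in> S2"
  "y \<in> S1 \<Longrightarrow> y - \<alpha> / 2 - 1 / 2 * (y - \<alpha> / 2) \<in> S1" "y \<in> S2 \<Longrightarrow> y - \<beta> / 2 - 1 / 2 * (y - \<beta> / 2) \<in> S2"
proof -
  have h: "x - e - 1 / 2 * (x - e) = 1 / 2 * (x - e)" for x e :: real by (simp add: field_simps)
  have 1: "1 / 2 * (y - \<alpha> / 2) \<in> S1" if "y \<in> S1" for y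
    using that abs_triangle_ineq4[of y "\<alpha> / 2"] by (auto simp: S_iff abs_mult)
  have 2: "1 / 2 * (y - \<beta> / 2) \<in> S2" if "y \<in> S2" for y
    using that abs_triangle_ineq4[of y "\<beta> / 2"] by (auto simp: S_iff abs_mult)
  show "y \<in> S1 \<Longrightarrow> 1 / 2 * (y - \<alpha> / 2) \<in> S1" "y \<in> S2 \<Longrightarrow> 1 / 2 * (y - \<beta> / 2) \<in> S2"
    "y \<in> S1 \<Longrightarrow> y - \<alpha> / 2 - 1 / 2 * (y - \<alpha> / 2) \<in> S1" "y \<in> S2 \<Longrightarrow> y - \<beta> / 2 - 1 / 2 * (y - \<beta> / 2) \<in> S2"
    unfolding h by (fact 1 2)+
qed

lemma N_B: "f \<in> B \<Longrightarrow> k \<in> B \<Longrightarrow> N f k \<in> B"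
  unfolding N_def B_def mem_Collect_eq
  by (rule strip_decay_cprod_interp[of S1 S2 f S1 S2 k]) (use B_strip_fun half_mem S_props in \<open>auto simp: B_def\<close>)

lemma N_eq_cprod:
  assumes f: "f \<in> B" and k: "k \<in> B" and r: "Im r1 \<in> S1" "Im r2 \<in> S2"
    and s: "s \<in> S1" "Im r1 - \<alpha> / 2 - s \<in> S1" "t \<in> S2" "Im r2 - \<beta> / 2 - t \<in> S2"
  shows "N f k r1 r2 = cprod (\<alpha> / 2) (\<beta> / 2) s t f k r1 r2"
proof -
  show ?thesis unfolding N_def cprod_interp_def
    by (rule cprod_shift[OF B_strip_fun[OF f] B_strip_fun[OF k]]) (use half_mem(1,3)[OF r(1)] half_mem(2,4)[OF r(2)] s in simp_all)
qed

lemma kern_cong: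
  assumes "eqB f f'" "eqB k k'" "s \<in> S1" "Im r1 - \<alpha> / 2 - s \<in> S1" "t \<in> S2" "Im r2 - \<beta> / 2 - t \<in> S2"
  shows "slice (kern (\<alpha> / 2) (\<beta> / 2) f k r1 r2) (\<i> * of_real s) (\<i> * of_real t) p =
     slice (kern (\<alpha> / 2) (\<beta> / 2) f' k' r1 r2) (\<i> * of_real s) (\<i> * of_real t) p"
  unfolding slice_def kern_def using assms by (simp add: eqB_def)

lemma N_cong:
  assumes "eqB f f'" "eqB k k'" shows "eqB (N f k) (N f' k')"
  unfolding eqB_def
proof (intro allI impI)
  fix z w assume zw: "Im z \<in> S1" "Im w \<in> S2"
  show "N f k z w = N f' k' z w"
    unfolding N_def cprod_interp_def cprod_def
    by (intro Bochner_Integration.integral_cong refl kern_cong[OF assms]) (use half_mem(1,3)[OF zw(1)] half_mem(2,4)[OF zw(2)] in simp_all)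
qed

lemma kern_slice_integrable:
  assumes "f \<in> B" "k \<in> B" "s \<in> S1" "Im r1 - \<alpha> / 2 - s \<in> S1" "t \<in> S2" "Im r2 - \<beta> / 2 - t \<in> S2"
  shows "integrable lborel (slice (kern (\<alpha> / 2) (\<beta> / 2) f k r1 r2) (\<i> * of_real s) (\<i> * of_real t))"
  by (rule slice_integrable[OF strip_decay_kern[of S1 S2 f S1 S2 k]]) (use assms in \<open>auto simp: B_def\<close>)

text \<open>A pointwise identity of kernels integrates to one of products, the contour being the
  same in all terms. The factor \<open>c\<close> may depend on \<open>r1\<close>, \<open>r2\<close>,
  as the symbol does in \<open>N_Asym\<close>.\<close>

lemma N_kern_sum:
  assumes f: "f \<in> B" "k \<in> B" "f1 \<in> B" "k1 \<in> B" "f2 \<in> B" "k2 \<in> B"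
    and r: "Im r1 \<in> S1" "Im r2 \<in> S2"
    and eq: "\<And>z w. kern (\<alpha> / 2) (\<beta> / 2) f k r1 r2 z w * c = kern (\<alpha> / 2) (\<beta> / 2) f1 k1 r1 r2 z w + kern (\<alpha> / 2) (\<beta> / 2) f2 k2 r1 r2 z w"
  shows "N f k r1 r2 * c = N f1 k1 r1 r2 + N f2 k2 r1 r2"
proof -
  have i: "integrable lborel (slice (kern (\<alpha> / 2) (\<beta> / 2) f k r1 r2) (\<i> * of_real (1 / 2 * (Im r1 - \<alpha> / 2))) (\<i> * of_real (1 / 2 * (Im r2 - \<beta> / 2))))"
    if "f \<in> B" "k \<in> B" for f k
    by (rule kern_slice_integrable[OF that]) (use half_mem(1,3)[OF r(1)] half_mem(2,4)[OF r(2)] in simp_all)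
  have "N f k r1 r2 * c = (\<integral>p. slice (kern (\<alpha> / 2) (\<beta> / 2) f k r1 r2) (\<i> * of_real (1 / 2 * (Im r1 - \<alpha> / 2))) (\<i> * of_real (1 / 2 * (Im r2 - \<beta> / 2))) p * c \<partial>lborel)"
    unfolding N_def cprod_interp_def cprod_def by (rule integral_mult_left_zero[symmetric])
  also have "\<dots> = (\<integral>p. slice (kern (\<alpha> / 2) (\<beta> / 2) f1 k1 r1 r2) (\<i> * of_real (1 / 2 * (Im r1 - \<alpha> / 2))) (\<i> * of_real (1 / 2 * (Im r2 - \<beta> / 2))) p
     + slice (kern (\<alpha> / 2) (\<beta> / 2) f2 k2 r1 r2) (\<i> * of_real (1 / 2 * (Im r1 - \<alpha> / 2))) (\<i> * of_real (1 / 2 * (Im r2 - \<beta> / 2))) p \<partial>lborel)"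
    unfolding slice_def eq ..
  also have "\<dots> = N f1 k1 r1 r2 + N f2 k2 r1 r2"
    unfolding N_def cprod_interp_def cprod_def by (rule Bochner_Integration.integral_add[OF i[OF f(3,4)] i[OF f(5,6)]])
  finally show ?thesis .
qed

lemma N_add_left:
  assumes "f1 \<in> B" "f2 \<in> B" "k \<in> B" shows "eqB (N (\<lambda>z w. f1 z w + f2 z w) k) (\<lambda>z w. N f1 k z w + N f2 k z w)"
  unfolding eqB_def
proof (intro allI impI)
  fix r1 r2 assume r: "Im r1 \<in> S1" "Im r2 \<in> S2"
  from N_kern_sum[OF B_add[OF assms(1,2)] assms(3) assms(1,3) assms(2,3) r, of 1]
  show "N (\<lambda>z w. f1 z w + f2 z w) k r1 r2 = N f1 k r1 r2 + N f2 k r1 r2" by (simp add: kern_def distrib_right)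
qed

lemma N_add_right:
  assumes "f \<in> B" "k1 \<in> B" "k2 \<in> B" shows "eqB (N f (\<lambda>z w. k1 z w + k2 z w)) (\<lambda>z w. N f k1 z w + N f k2 z w)"
  unfolding eqB_def
proof (intro allI impI)
  fix r1 r2 assume r: "Im r1 \<in> S1" "Im r2 \<in> S2"
  from N_kern_sum[OF assms(1) B_add[OF assms(2,3)] assms(1,2) assms(1,3) r, of 1]
  show "N f (\<lambda>z w. k1 z w + k2 z w) r1 r2 = N f k1 r1 r2 + N f k2 r1 r2" by (simp add: kern_def distrib_right distrib_left)
qed

lemma N_cmult: "N (\<lambda>z w. c * f z w) k r1 r2 = c * N f k r1 r2" "N f (\<lambda>z w. c * k z w) r1 r2 = c * N f k r1 r2"
proof -
  have *: "slice (kern e1 e2 (\<lambda>z w. c * f z w) k r1 r2) a b p = c * slice (kern e1 e2 f k r1 r2) a b p"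
    "slice (kern e1 e2 f (\<lambda>z w. c * k z w) r1 r2) a b p = c * slice (kern e1 e2 f k r1 r2) a b p" for e1 e2 a b p
    by (simp_all add: slice_def kern_def)
  show "N (\<lambda>z w. c * f z w) k r1 r2 = c * N f k r1 r2" "N f (\<lambda>z w. c * k z w) r1 r2 = c * N f k r1 r2"
    unfolding N_def cprod_interp_def cprod_def * by (rule integral_mult_right_zero)+
qed

text \<open>If some division of an arbitrary height is admissible for both factors, the integral
  along the divided contour is entire; moving the contour from half-way shows that it agrees with
  \<open>N\<close> on the common strip.\<close>

lemma N_in_A0:
  assumes f: "strip_fun S T f" and k: "strip_fun S' T' k"
    and sub: "S1 \<subseteq> S" "S2 \<subseteq> T" "S1 \<subseteq> S'" "S2 \<subseteq> T'"
    and l: "\<And>y. l * (y - \<alpha> / 2) \<in> S" "\<And>y. (1 - l) * (y - \<alpha> / 2) \<in> S'"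
    and m: "\<And>y. m * (y - \<beta> / 2) \<in> T" "\<And>y. (1 - m) * (y - \<beta> / 2) \<in> T'"
  shows "N f k \<in> A0"
proof -
  have "strip_decay UNIV UNIV (cprod_interp (\<alpha> / 2) (\<beta> / 2) l m f k)"
    by (rule strip_decay_cprod_interp[OF f k]) (use l m in auto)
  moreover have "eqB (N f k) (cprod_interp (\<alpha> / 2) (\<beta> / 2) l m f k)"
    unfolding eqB_def
  proof (intro allI impI)
    fix r1 r2 assume r: "Im r1 \<in> S1" "Im r2 \<in> S2"
    have *: "Im r - e - x * (Im r - e) = (1 - x) * (Im r - e)" for r e x by (simp add: algebra_simps)
    have h: "1 / 2 * (Im r1 - \<alpha> / 2) \<in> S1" "1 / 2 * (Im r2 - \<beta> / 2) \<in> S2" "(1 - 1 / 2) * (Im r1 - \<alpha> / 2) \<in> S1" "(1 - 1 / 2) * (Im r2 - \<beta> / 2) \<in> S2"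
      using half_mem(1)[OF r(1)] half_mem(2)[OF r(2)] by simp_all
    show "N f k r1 r2 = cprod_interp (\<alpha> / 2) (\<beta> / 2) l m f k r1 r2"
      unfolding N_def cprod_interp_def
      by (rule cprod_shift[OF f k]; (unfold *)?) (use h sub l m in blast)+
  qed
  ultimately show ?thesis by (auto simp: A0_def)
qed

lemma N_A0_left: assumes "f \<in> A0" "k \<in> B" shows "N f k \<in> A0"
proof -
  obtain b where b: "strip_decay UNIV UNIV b" "eqB f b" using assms by (auto simp: A0_def)
  \<comment> \<open>The fractions 1, 1 give the whole height to the entire factor; the argument of
    \<open>k\<close> stays real.\<close>
  have "N b k \<in> A0"
    by (rule N_in_A0[of UNIV UNIV b S1 S2 k 1 1]) (use b B_strip_fun[OF assms(2)] S_props in \<open>auto simp: strip_fun_UNIV\<close>)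
  then show ?thesis by (rule A0_cong) (rule N_cong[OF b(2) eqB_refl])
qed

lemma N_A0_right: assumes "f \<in> B" "k \<in> A0" shows "N f k \<in> A0"
proof -
  obtain b where b: "strip_decay UNIV UNIV b" "eqB k b" using assms by (auto simp: A0_def)
  have "N f b \<in> A0"
    by (rule N_in_A0[of S1 S2 f UNIV UNIV b 0 0]) (use b B_strip_fun[OF assms(1)] S_props in \<open>auto simp: strip_fun_UNIV\<close>)
  then show ?thesis by (rule A0_cong) (rule N_cong[OF eqB_refl b(2)])
qed

lemma N_A1_A2: assumes "f \<in> A1" "k \<in> A2" shows "N f k \<in> A0"
proof -
  obtain g where g: "strip_decay S1 UNIV g" "eqB f g" using A1_ext[OF assms(1)] .
  obtain h where h: "strip_decay UNIV S2 h" "eqB k h" using A2_ext[OF assms(2)] .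
  \<comment> \<open>The fractions 0 and 1 give the height to \<open>h\<close> in the first variable
    and to \<open>g\<close> in the second, each being unrestricted there.\<close>
  have "N g h \<in> A0"
    by (rule N_in_A0[of S1 UNIV g UNIV S2 h 0 1]) (use g h S_props in \<open>auto simp: strip_fun_def\<close>)
  then show ?thesis by (rule A0_cong) (rule N_cong[OF g(2) h(2)])
qed

lemma N_A2_A1: assumes "f \<in> A2" "k \<in> A1" shows "N f k \<in> A0"
proof -
  obtain g where g: "strip_decay UNIV S2 g" "eqB f g" using A2_ext[OF assms(1)] .
  obtain h where h: "strip_decay S1 UNIV h" "eqB k h" using A1_ext[OF assms(2)] .
  have "N g h \<in> A0"
    by (rule N_in_A0[of UNIV S2 g S1 UNIV h 1 0]) (use g h S_props in \<open>auto simp: strip_fun_def\<close>)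
  then show ?thesis by (rule A0_cong) (rule N_cong[OF g(2) h(2)])
qed

text \<open>The exponentials are multiplicative along the convolution, so the symbol satisfies a twisted Leibniz rule.\<close>

lemma N_Asym:
  assumes ab: "a = 2 * pi * \<beta> \<and> b = 0 \<or> a = 0 \<and> b = 2 * pi * \<alpha>"
    and f: "f \<in> Asym a b" and k: "k \<in> Asym a b"
  shows "N f k \<in> Asym a b"
proof -
  have fB: "f \<in> B" and kB: "k \<in> B" using f k Asym_B by auto
  have exB: "(\<lambda>z w. exp_symbol a b c z w * h z w) \<in> B" if "h \<in> B" for h c using that by (simp add: B_def exp_symbol_mult)
  have fs: "(\<lambda>z w. sinh_fun a b z w * f z w) \<in> A0" and ks: "(\<lambda>z w. sinh_fun a b z w * k z w) \<in> A0" using f k by (auto simp: Asym_def)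
  have ex_prod: "exp_symbol a b c r1 r2 = exp_symbol a b c z w * exp_symbol a b c (r1 - \<i> * of_real (\<alpha> / 2) - z) (r2 - \<i> * of_real (\<beta> / 2) - w)" for c r1 r2 z w
  proof -
    \<comment> \<open>The arguments of the two factors sum to r - i e, and what the shift removes
      from the exponent is exactly the second copy of the constant i pi \<alpha> \<beta>.\<close>
    have "of_real a * (\<i> * of_real (\<alpha> / 2)) + of_real b * (\<i> * of_real (\<beta> / 2)) = \<i> * of_real (pi * (\<alpha> * \<beta>))"
      using ab by auto
    then have e: "of_real a * r1 + of_real b * r2 + \<i> * of_real (pi * (\<alpha> * \<beta>)) =
      (of_real a * z + of_real b * w + \<i> * of_real (pi * (\<alpha> * \<beta>))) +
      (of_real a * (r1 - \<i> * of_real (\<alpha> / 2) - z) + of_real b * (r2 - \<i> * of_real (\<beta> / 2) - w) + \<i> * of_real (pi * (\<alpha> * \<beta>)))"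
      unfolding right_diff_distrib by (simp only: algebra_simps)
    show ?thesis unfolding exp_symbol_def exp_add[symmetric] distrib_left[symmetric] e[symmetric] ..
  qed
  have eq: "eqB (\<lambda>z w. sinh_fun a b z w * N f k z w)
     (\<lambda>z w. N (\<lambda>z w. sinh_fun a b z w * f z w) (\<lambda>z w. exp_symbol a b (-1) z w * k z w) z w + N (\<lambda>z w. exp_symbol a b 1 z w * f z w) (\<lambda>z w. sinh_fun a b z w * k z w) z w)"
    unfolding eqB_def
  proof (intro allI impI)
    fix r1 r2 assume r: "Im r1 \<in> S1" "Im r2 \<in> S2"
    have "kern (\<alpha> / 2) (\<beta> / 2) f k r1 r2 z w * sinh_fun a b r1 r2 =
        kern (\<alpha> / 2) (\<beta> / 2) (\<lambda>z w. sinh_fun a b z w * f z w) (\<lambda>z w. exp_symbol a b (-1) z w * k z w) r1 r2 z w +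
        kern (\<alpha> / 2) (\<beta> / 2) (\<lambda>z w. exp_symbol a b 1 z w * f z w) (\<lambda>z w. sinh_fun a b z w * k z w) r1 r2 z w" for z w
    proof -
      define X where "X c = exp_symbol a b c z w" for c
      define Y where "Y c = exp_symbol a b c (r1 - \<i> * of_real (\<alpha> / 2) - z) (r2 - \<i> * of_real (\<beta> / 2) - w)" for c
      \<comment> \<open>The Leibniz rule is X' Y' - X Y = (X' - X) Y' + X (Y' - Y), with X', Y' the
        values at c = -1.\<close>
      have s: "sinh_fun a b r1 r2 = X (-1) * Y (-1) - X 1 * Y 1"
        unfolding sinh_fun_def[of a b r1 r2] ex_prod[of _ r1 r2 z w] X_def Y_def ..
      show ?thesis unfolding kern_def s sinh_fun_def[of a b z w] sinh_fun_def[of a b "r1 - \<i> * of_real (\<alpha> / 2) - z"] X_def[symmetric] Y_def[symmetric]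
        by (simp add: algebra_simps)
    qed
    from N_kern_sum[OF fB kB A0_B[OF fs] exB[OF kB] exB[OF fB] A0_B[OF ks] r this]
    show "sinh_fun a b r1 r2 * N f k r1 r2 = N (\<lambda>z w. sinh_fun a b z w * f z w) (\<lambda>z w. exp_symbol a b (-1) z w * k z w) r1 r2 + N (\<lambda>z w. exp_symbol a b 1 z w * f z w) (\<lambda>z w. sinh_fun a b z w * k z w) r1 r2"
      by (simp add: mult.commute)
  qed
  have "(\<lambda>z w. sinh_fun a b z w * N f k z w) \<in> A0"
    by (rule A0_cong[OF A0_add eq]) (intro N_A0_left N_A0_right fs ks exB fB kB)+
  then show ?thesis using N_B[OF fB kB] by (simp add: Asym_def B_def)
qed

lemma N_A1: "f \<in> A1 \<Longrightarrow> k \<in> A1 \<Longrightarrow> N f k \<in> A1"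
  unfolding A1_def by (rule N_Asym) auto

lemma N_A2: "f \<in> A2 \<Longrightarrow> k \<in> A2 \<Longrightarrow> N f k \<in> A2"
  unfolding A2_def by (rule N_Asym) auto

lemma A1_B: "f \<in> A1 \<Longrightarrow> f \<in> B" and A2_B: "f \<in> A2 \<Longrightarrow> f \<in> B"
  by (auto simp: A1_def A2_def Asym_B)

text \<open>After splitting the factor from \<open>A12\<close>, the mixed summand lies in
  \<open>A0\<close>, which is contained in every component space.\<close>

lemma N_A12_A2: assumes "f \<in> A12" "k \<in> A2" shows "N f k \<in> A2"
proof -
  obtain f1 f2 where *: "f1 \<in> A1" "f2 \<in> A2" "eqB f (\<lambda>z w. f1 z w + f2 z w)" using assms by (auto simp: A12_def)
  have "(\<lambda>z w. N f1 k z w + N f2 k z w) \<in> A2"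
    unfolding A2_def by (intro Asym_add) (use N_A1_A2[OF *(1) assms(2)] N_A2[OF *(2) assms(2)] A0_A2 in \<open>auto simp: A2_def\<close>)
  moreover have "eqB (N f k) (\<lambda>z w. N f1 k z w + N f2 k z w)"
    using eqB_trans[OF N_cong[OF *(3) eqB_refl] N_add_left[OF A1_B[OF *(1)] A2_B[OF *(2)] A2_B[OF assms(2)]]] .
  ultimately show ?thesis unfolding A2_def by (rule Asym_cong)
qed

lemma N_A2_A12: assumes "f \<in> A2" "k \<in> A12" shows "N f k \<in> A2"
proof -
  obtain k1 k2 where *: "k1 \<in> A1" "k2 \<in> A2" "eqB k (\<lambda>z w. k1 z w + k2 z w)" using assms by (auto simp: A12_def)
  have "(\<lambda>z w. N f k1 z w + N f k2 z w) \<in> A2"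
    unfolding A2_def by (intro Asym_add) (use N_A2_A1[OF assms(1) *(1)] N_A2[OF assms(1) *(2)] A0_A2 in \<open>auto simp: A2_def\<close>)
  moreover have "eqB (N f k) (\<lambda>z w. N f k1 z w + N f k2 z w)"
    using eqB_trans[OF N_cong[OF eqB_refl *(3)] N_add_right[OF A2_B[OF assms(1)] A1_B[OF *(1)] A2_B[OF *(2)]]] .
  ultimately show ?thesis unfolding A2_def by (rule Asym_cong)
qed

lemma N_A12_A1: assumes "f \<in> A12" "k \<in> A1" shows "N f k \<in> A1"
proof -
  obtain f1 f2 where *: "f1 \<in> A1" "f2 \<in> A2" "eqB f (\<lambda>z w. f1 z w + f2 z w)" using assms by (auto simp: A12_def)
  have "(\<lambda>z w. N f1 k z w + N f2 k z w) \<in> A1"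
    unfolding A1_def by (intro Asym_add) (use N_A2_A1[OF *(2) assms(2)] N_A1[OF *(1) assms(2)] A0_A1 in \<open>auto simp: A1_def\<close>)
  moreover have "eqB (N f k) (\<lambda>z w. N f1 k z w + N f2 k z w)"
    using eqB_trans[OF N_cong[OF *(3) eqB_refl] N_add_left[OF A1_B[OF *(1)] A2_B[OF *(2)] A1_B[OF assms(2)]]] .
  ultimately show ?thesis unfolding A1_def by (rule Asym_cong)
qed

lemma N_A1_A12: assumes "f \<in> A1" "k \<in> A12" shows "N f k \<in> A1"
proof -
  obtain k1 k2 where *: "k1 \<in> A1" "k2 \<in> A2" "eqB k (\<lambda>z w. k1 z w + k2 z w)" using assms by (auto simp: A12_def)
  have "(\<lambda>z w. N f k1 z w + N f k2 z w) \<in> A1"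
    unfolding A1_def by (intro Asym_add) (use N_A1_A2[OF assms(1) *(2)] N_A1[OF assms(1) *(1)] A0_A1 in \<open>auto simp: A1_def\<close>)
  moreover have "eqB (N f k) (\<lambda>z w. N f k1 z w + N f k2 z w)"
    using eqB_trans[OF N_cong[OF eqB_refl *(3)] N_add_right[OF A1_B[OF assms(1)] A1_B[OF *(1)] A2_B[OF *(2)]]] .
  ultimately show ?thesis unfolding A1_def by (rule Asym_cong)
qed

lemma N_A12: assumes "f \<in> A12" "k \<in> A12" shows "N f k \<in> A12"
proof -
  obtain k1 k2 where *: "k1 \<in> A1" "k2 \<in> A2" "eqB k (\<lambda>z w. k1 z w + k2 z w)" using assms by (auto simp: A12_def)
  have "eqB (N f k) (\<lambda>z w. N f k1 z w + N f k2 z w)"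
    using eqB_trans[OF N_cong[OF eqB_refl *(3)] N_add_right[OF A12_B[OF assms(1)] A1_B[OF *(1)] A2_B[OF *(2)]]] .
  then show ?thesis by (rule A12I[OF N_A12_A1[OF assms(1) *(1)] N_A12_A2[OF assms(1) *(2)]])
qed

end

section \<open>Associativity and the involution\<close>

text \<open>The phase satisfies a cocycle identity: both bracketings collect the same total
  exponent. This is the algebraic content of associativity.\<close>

lemma kern_assoc:
  "kern e1 e2 f k z' w' z w * (l (r1 - \<i> * of_real e1 - z') (r2 - \<i> * of_real e2 - w') * exp (phase e1 e2 r1 r2 z' w')) =
   f z w * (kern e1 e2 k l (r1 - \<i> * of_real e1 - z) (r2 - \<i> * of_real e2 - w) (z' - \<i> * of_real e1 - z) (w' - \<i> * of_real e2 - w)) *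
     exp (phase e1 e2 r1 r2 z w)"
proof -
  let ?z = "z' - \<i> * of_real e1 - z" and ?w = "w' - \<i> * of_real e2 - w"
  let ?r1 = "r1 - \<i> * of_real e1 - z" and ?r2 = "r2 - \<i> * of_real e2 - w"
  have 1: "?r1 - \<i> * of_real e1 - ?z = r1 - \<i> * of_real e1 - z'" "?r2 - \<i> * of_real e2 - ?w = r2 - \<i> * of_real e2 - w'" by simp_all
  have "phase e1 e2 z' w' z w + phase e1 e2 r1 r2 z' w' = phase e1 e2 ?r1 ?r2 ?z ?w + phase e1 e2 r1 r2 z w"
    by (simp add: phase_def algebra_simps)
  then have "exp (phase e1 e2 z' w' z w) * exp (phase e1 e2 r1 r2 z' w') = exp (phase e1 e2 ?r1 ?r2 ?z ?w) * exp (phase e1 e2 r1 r2 z w)"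
    by (simp only: exp_add[symmetric])
  moreover have "F * K * a * (L * b) = F * (K * L * c) * d" if "a * b = c * d" for F K L a b c d :: complex
    using arg_cong[OF that, of "\<lambda>x. F * K * L * x"] by (simp only: mult_ac)
  ultimately show ?thesis unfolding kern_def 1 by blast
qed

context quantum_plane
begin

text \<open>Both sides become the same double integral once the two contours are fixed at
  the imaginary parts \<open>- \<alpha> / 6\<close> and \<open>- \<alpha> / 3\<close> (and likewise for \<open>\<beta>\<close>).\<close>

lemma N_assoc:
  assumes f: "f \<in> B" and k: "k \<in> B" and l: "l \<in> B" and r: "Im r1 = 0" "Im r2 = 0"
  shows "N (N f k) l r1 r2 = N f (N k l) r1 r2"
proof -
  define e1 where "e1 = \<alpha> / 2"
  define e2 where "e2 = \<beta> / 2"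
  \<comment> \<open>At real \<open>r\<close> the heights of the three arguments of \<open>f\<close>,
    \<open>k\<close>, \<open>l\<close> add up to -2 e. The contours give each the equal share -2 e /
    3, which fits because |\<alpha>|/3 < |\<alpha>|/2.\<close>
  have m1: "- e1 / 3 \<in> S1" "- 2 * e1 / 3 \<in> S1" "- e2 / 3 \<in> S2" "- 2 * e2 / 3 \<in> S2"
    using alpha_beta by (auto simp: S_iff e1_def e2_def abs_mult)
  have m: "0 - e1 - (- e1 / 3) = - 2 * e1 / 3" "0 - e1 - (- 2 * e1 / 3) = - e1 / 3" "- e1 / 3 - e1 - (- 2 * e1 / 3) = - 2 * e1 / 3"
    "0 - e2 - (- e2 / 3) = - 2 * e2 / 3" "0 - e2 - (- 2 * e2 / 3) = - e2 / 3" "- e2 / 3 - e2 - (- 2 * e2 / 3) = - 2 * e2 / 3"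
    by (simp_all add: field_simps)
  define z where "z p = of_real (fst p) + \<i> * of_real (- e1 / 3)" for p :: "real \<times> real"
  define w where "w p = of_real (snd p) + \<i> * of_real (- e2 / 3)" for p :: "real \<times> real"
  define z' where "z' p = of_real (fst p) + \<i> * of_real (- 2 * e1 / 3)" for p :: "real \<times> real"
  define w' where "w' p = of_real (snd p) + \<i> * of_real (- 2 * e2 / 3)" for p :: "real \<times> real"
  have im: "Im (z p) = - e1 / 3" "Im (w p) = - e2 / 3" "Im (z' p) = - 2 * e1 / 3" "Im (w' p) = - 2 * e2 / 3" for p
    by (simp_all add: z_def w_def z'_def w'_def)
  have S0: "0 \<in> S1" "0 \<in> S2" using S_props by auto
  have imr: "Im (r1 - \<i> * of_real e1 - z' p) = - e1 / 3" "Im (r2 - \<i> * of_real e2 - w' p) = - e2 / 3" for p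
    using im m r by simp_all
  have zz: "z p - \<i> * of_real e1 - z' s = z' (- s + p)" "w p - \<i> * of_real e2 - w' s = w' (- s + p)" for p s
    by (simp_all add: z_def w_def z'_def w'_def complex_eq_iff field_simps)
  note BD = f[unfolded B_def mem_Collect_eq] k[unfolded B_def mem_Collect_eq] l[unfolded B_def mem_Collect_eq]
  define L where "L p = l (r1 - \<i> * of_real e1 - z p) (r2 - \<i> * of_real e2 - w p) * exp (phase e1 e2 r1 r2 (z p) (w p))" for p
  define A where "A p s = kern e1 e2 f k (z p) (w p) (z' s) (w' s) * L p" for p s
  have inner1: "N f k (z p) (w p) = (\<integral>s. kern e1 e2 f k (z p) (w p) (z' s) (w' s) \<partial>lborel)" for p
  proof -
    have "N f k (z p) (w p) = cprod e1 e2 (- 2 * e1 / 3) (- 2 * e2 / 3) f k (z p) (w p)"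
      unfolding e1_def e2_def by (rule N_eq_cprod[OF f k]; unfold e1_def[symmetric] e2_def[symmetric] im m; rule m1)
    then show ?thesis by (simp only: cprod_def slice_def z'_def[symmetric] w'_def[symmetric])
  qed
  have "N (N f k) l r1 r2 = cprod e1 e2 (- e1 / 3) (- e2 / 3) (N f k) l r1 r2"
    unfolding e1_def e2_def by (rule N_eq_cprod[OF N_B[OF f k] l]; unfold e1_def[symmetric] e2_def[symmetric] r m; rule m1 S0)
  also have "\<dots> = (\<integral>p. N f k (z p) (w p) * L p \<partial>lborel)"
    unfolding cprod_def slice_def z_def[symmetric] w_def[symmetric] kern_def L_def mult.assoc ..
  also have "\<dots> = (\<integral>p. \<integral>s. A p s \<partial>lborel \<partial>lborel)"
    unfolding inner1 A_def integral_mult_left_zero ..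
  finally have lhs: "N (N f k) l r1 r2 = (\<integral>p. \<integral>s. A p s \<partial>lborel \<partial>lborel)" .
  have inner2: "N k l (r1 - \<i> * of_real e1 - z' s) (r2 - \<i> * of_real e2 - w' s) =
    (\<integral>p. kern e1 e2 k l (r1 - \<i> * of_real e1 - z' s) (r2 - \<i> * of_real e2 - w' s) (z p - \<i> * of_real e1 - z' s) (w p - \<i> * of_real e2 - w' s) \<partial>lborel)" for s
  proof -
    define u v where "u = r1 - \<i> * of_real e1 - z' s" and "v = r2 - \<i> * of_real e2 - w' s"
    have imu: "Im u = - e1 / 3" "Im v = - e2 / 3" using imr by (simp_all only: u_def v_def)
    have "N k l u v = cprod e1 e2 (- 2 * e1 / 3) (- 2 * e2 / 3) k l u v"
      unfolding e1_def e2_def by (rule N_eq_cprod[OF k l]; unfold e1_def[symmetric] e2_def[symmetric] imu m; rule m1)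
    also have "\<dots> = (\<integral>q. kern e1 e2 k l u v (z' q) (w' q) \<partial>lborel)" by (simp only: cprod_def slice_def z'_def[symmetric] w'_def[symmetric])
    \<comment> \<open>The translation turns the inner variable into the outer variable of the other
      bracketing.\<close>
    also have "\<dots> = (\<integral>p. kern e1 e2 k l u v (z' (- s + p)) (w' (- s + p)) \<partial>lborel)"
      by (rule lborel_integral_translate[symmetric])
    finally show ?thesis by (simp only: u_def v_def zz)
  qed
  have "N f (N k l) r1 r2 = cprod e1 e2 (- 2 * e1 / 3) (- 2 * e2 / 3) f (N k l) r1 r2"
    unfolding e1_def e2_def by (rule N_eq_cprod[OF f N_B[OF k l]]; unfold e1_def[symmetric] e2_def[symmetric] r m; rule m1 S0)
  also have "\<dots> = (\<integral>s. f (z' s) (w' s) * N k l (r1 - \<i> * of_real e1 - z' s) (r2 - \<i> * of_real e2 - w' s) * exp (phase e1 e2 r1 r2 (z' s) (w' s)) \<partial>lborel)"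
    unfolding cprod_def slice_def z'_def[symmetric] w'_def[symmetric] kern_def ..
  also have "\<dots> = (\<integral>s. \<integral>p. A p s \<partial>lborel \<partial>lborel)"
    unfolding inner2 A_def L_def kern_assoc integral_mult_left_zero integral_mult_right_zero ..
  finally have rhs: "N f (N k l) r1 r2 = (\<integral>s. \<integral>p. A p s \<partial>lborel \<partial>lborel)" .
  have Ldec: "strip_decay {y. Im (r1 - \<i> * of_real e1) - y \<in> S1} {y. Im (r2 - \<i> * of_real e2) - y \<in> S2}
     (\<lambda>x y. exp ((- of_real pi * \<i> * r2 + of_real (pi * e2)) * x + (of_real pi * \<i> * r1 - of_real (pi * e1)) * y
       + of_real pi * (of_real e1 * r2 - of_real e2 * r1)) * l (r1 - \<i> * of_real e1 - x) (r2 - \<i> * of_real e2 - y))"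
    by (rule strip_decay_exp_mult[OF strip_decay_reflect[OF BD(3)]])
  have Lslice: "L = slice (\<lambda>x y. exp ((- of_real pi * \<i> * r2 + of_real (pi * e2)) * x + (of_real pi * \<i> * r1 - of_real (pi * e1)) * y
       + of_real pi * (of_real e1 * r2 - of_real e2 * r1)) * l (r1 - \<i> * of_real e1 - x) (r2 - \<i> * of_real e2 - y)) (\<i> * of_real (- e1 / 3)) (\<i> * of_real (- e2 / 3))"
  proof
    fix p
    have "phase e1 e2 r1 r2 (z p) (w p) = (- of_real pi * \<i> * r2 + of_real (pi * e2)) * z p + (of_real pi * \<i> * r1 - of_real (pi * e1)) * w p
       + of_real pi * (of_real e1 * r2 - of_real e2 * r1)"
      by (simp add: phase_def algebra_simps)
    then show "L p = slice (\<lambda>x y. exp ((- of_real pi * \<i> * r2 + of_real (pi * e2)) * x + (of_real pi * \<i> * r1 - of_real (pi * e1)) * y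
       + of_real pi * (of_real e1 * r2 - of_real e2 * r1)) * l (r1 - \<i> * of_real e1 - x) (r2 - \<i> * of_real e2 - y)) (\<i> * of_real (- e1 / 3)) (\<i> * of_real (- e2 / 3)) p"
      unfolding L_def slice_def z_def[symmetric] w_def[symmetric] by (simp only: mult.commute)
  qed
  have mem: "Im (\<i> * of_real (- e1 / 3)) \<in> {y. Im (r1 - \<i> * of_real e1) - y \<in> S1}" "Im (\<i> * of_real (- e2 / 3)) \<in> {y. Im (r2 - \<i> * of_real e2) - y \<in> S2}"
    using m1 m r by simp_all
  have Lm [measurable]: "L \<in> borel_measurable borel" unfolding Lslice by (rule slice_measurable[OF Ldec mem])
  obtain M' where M': "M' > 0" "\<And>p. cmod (L p) \<le> M'"
    by (rule slice_bound[OF Ldec mem, of 0]) (simp, simp add: Lslice)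
  obtain M where M: "M > 0" "\<And>r1 r2 z w. Im z \<in> {- 2 * e1 / 3} \<Longrightarrow> Im w \<in> {- 2 * e2 / 3} \<Longrightarrow>
     Im r1 - e1 - Im z \<in> {- 2 * e1 / 3} \<Longrightarrow> Im r2 - e2 - Im w \<in> {- 2 * e2 / 3} \<Longrightarrow>
     cmod (kern e1 e2 f k r1 r2 z w) \<le> M * (exp (- (1 * (\<bar>Re r1\<bar> + \<bar>Re r2\<bar>))) * exp (- (\<bar>Re z\<bar> + \<bar>Re w\<bar>)))"
    by (rule kern_bound[OF BD(1,2), of "{- 2 * e1 / 3}" "{- 2 * e2 / 3}" "{- 2 * e1 / 3}" "{- 2 * e2 / 3}" 1 e1 e2]) (use m1 in auto)
  define g where "g p = complex_of_real (exp (- (1 * (\<bar>fst p\<bar> + \<bar>snd p\<bar>))))" for p :: "real \<times> real"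
  have g: "integrable lborel g" unfolding g_def by (rule integrable_of_real[OF integrable_exp_abs2]) simp
  \<comment> \<open>\<open>kern_bound\<close> at rate 1 gives decay in the base point as well as in
    the integration variable, and \<open>L\<close> is bounded: an integrable majorant for Fubini's
    theorem.\<close>
  have Ab: "cmod (A p s) \<le> M * M' * (cmod (g p) * cmod (g s))" for p s
  proof -
    have "cmod (kern e1 e2 f k (z p) (w p) (z' s) (w' s)) \<le> M * (exp (- (1 * (\<bar>Re (z p)\<bar> + \<bar>Re (w p)\<bar>))) * exp (- (\<bar>Re (z' s)\<bar> + \<bar>Re (w' s)\<bar>)))"
      by (rule M(2); unfold im m) auto
    also have "\<dots> = M * (cmod (g p) * cmod (g s))" by (simp add: g_def z_def w_def z'_def w'_def)
    finally have "cmod (A p s) \<le> M * (cmod (g p) * cmod (g s)) * M'"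
      unfolding A_def norm_mult using M(1) by (intro mult_mono M'(2)) auto
    then show ?thesis by (simp only: mult_ac)
  qed
  have fm [measurable]: "(\<lambda>s. f (z' s) (w' s)) \<in> borel_measurable borel" and km [measurable]: "(\<lambda>s. k (z' s) (w' s)) \<in> borel_measurable borel"
    using slice_measurable[OF BD(1), of "\<i> * of_real (- 2 * e1 / 3)" "\<i> * of_real (- 2 * e2 / 3)"]
      slice_measurable[OF BD(2), of "\<i> * of_real (- 2 * e1 / 3)" "\<i> * of_real (- 2 * e2 / 3)"] m1
    by (simp_all add: slice_def[abs_def] z'_def w'_def)
  have em [measurable]: "(\<lambda>x. exp (phase e1 e2 (z (fst x)) (w (fst x)) (z' (snd x)) (w' (snd x)))) \<in> borel_measurable (borel \<Otimes>\<^sub>M borel)"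
    unfolding borel_prod phase_def z_def w_def z'_def w'_def by (intro borel_measurable_continuous_onI continuous_intros)
  have "integrable (lborel \<Otimes>\<^sub>M lborel) (\<lambda>(p, s). A p s)"
  proof (rule Bochner_Integration.integrable_bound)
    show "integrable (lborel \<Otimes>\<^sub>M lborel) (\<lambda>x. of_real (M * M') * (case x of (p, s) \<Rightarrow> g p * g s * cis 0))"
      by (rule integrable_mult_right) (use integrable_product_phase[OF g g continuous_on_const, of 0] in \<open>simp add: lborel_prod split_def\<close>)
    have "(\<lambda>x. (f (z' (snd x)) (w' (snd x)) * k (z' (- snd x + fst x)) (w' (- snd x + fst x)) *
        exp (phase e1 e2 (z (fst x)) (w (fst x)) (z' (snd x)) (w' (snd x)))) * L (fst x)) \<in> borel_measurable (lborel \<Otimes>\<^sub>M lborel)"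
      by measurable
    then show "(\<lambda>(p, s). A p s) \<in> borel_measurable (lborel \<Otimes>\<^sub>M lborel)"
      unfolding A_def kern_def zz split_def .
    show "AE x in lborel \<Otimes>\<^sub>M lborel. norm (case x of (p, s) \<Rightarrow> A p s) \<le> norm (of_real (M * M') * (case x of (p, s) \<Rightarrow> g p * g s * cis 0))"
      using Ab M(1) M'(1) by (auto simp: norm_mult split_def)
  qed
  from lborel_pair.Fubini_integral[OF this] show ?thesis unfolding lhs rhs by simp
qed

lemma strip_star_B: "f \<in> B \<Longrightarrow> strip_star f \<in> B"
proof -
  assume f: "f \<in> B"
  have "strip_decay S1 S2 (\<lambda>z w. exp (of_real (pi * \<beta>) * z + of_real (- (pi * \<alpha>)) * w + 0) * cnj (f (- cnj z) (- cnj w)))"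
    by (rule strip_decay_exp_mult[OF strip_decay_cnj]) (use f S_props in \<open>auto simp: B_def\<close>)
  then show ?thesis by (simp add: B_def strip_star_def[abs_def] algebra_simps)
qed

lemma strip_star_cong: "eqB f g \<Longrightarrow> eqB (strip_star f) (strip_star g)"
  by (simp add: eqB_def strip_star_def)

lemma strip_star_A0: "f \<in> A0 \<Longrightarrow> strip_star f \<in> A0"
proof -
  assume "f \<in> A0"
  then obtain b where b: "strip_decay UNIV UNIV b" "eqB f b" by (auto simp: A0_def)
  have "strip_decay UNIV UNIV (\<lambda>z w. exp (of_real (pi * \<beta>) * z + of_real (- (pi * \<alpha>)) * w + 0) * cnj (b (- cnj z) (- cnj w)))"
    by (rule strip_decay_exp_mult[OF strip_decay_cnj[OF b(1)]]) auto
  then have "strip_decay UNIV UNIV (strip_star b)" by (simp add: strip_star_def[abs_def] algebra_simps)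
  then show ?thesis using strip_star_cong[OF b(2)] by (auto simp: A0_def)
qed

text \<open>Under the reflected conjugation the exponents change sign, which exchanges the two
  exponentials; hence the star preserves \<open>Asym\<close>.\<close>

lemma sinh_fun_cnj: "cnj (sinh_fun a b (- cnj z) (- cnj w)) = - sinh_fun a b z w"
proof -
  have "cnj (exp_symbol a b c (- cnj z) (- cnj w)) = exp_symbol a b (- c) z w" for c
    by (simp add: exp_symbol_def exp_cnj) (rule arg_cong[of _ _ exp], simp add: algebra_simps)
  then show ?thesis by (simp add: sinh_fun_def)
qed

lemma strip_star_Asym: assumes "f \<in> Asym a b" shows "strip_star f \<in> Asym a b"
proof -
  have "(\<lambda>z w. (-1) * strip_star (\<lambda>z w. sinh_fun a b z w * f z w) z w) \<in> A0"
    using assms by (intro A0_cmult strip_star_A0) (simp add: Asym_def)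
  moreover have "(\<lambda>z w. (-1) * strip_star (\<lambda>z w. sinh_fun a b z w * f z w) z w) = (\<lambda>z w. sinh_fun a b z w * strip_star f z w)"
    by (simp add: strip_star_def sinh_fun_cnj mult_ac)
  ultimately show ?thesis using strip_star_B[OF Asym_B[OF assms]] by (simp add: Asym_def B_def)
qed

lemma strip_star_add: "strip_star (\<lambda>z w. f z w + g z w) = (\<lambda>z w. strip_star f z w + strip_star g z w)"
  by (intro ext) (simp add: strip_star_def distrib_left)

lemma strip_star_cmult: "strip_star (\<lambda>z w. c * f z w) = (\<lambda>z w. cnj c * strip_star f z w)"
  by (intro ext) (simp add: strip_star_def)

lemma strip_star_A12: assumes "f \<in> A12" shows "strip_star f \<in> A12"
proof -
  obtain f1 f2 where *: "f1 \<in> A1" "f2 \<in> A2" "eqB f (\<lambda>z w. f1 z w + f2 z w)" using assms by (auto simp: A12_def)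
  have "strip_star f1 \<in> A1" "strip_star f2 \<in> A2" using * strip_star_Asym by (auto simp: A1_def A2_def)
  then show ?thesis by (rule A12I) (use strip_star_cong[OF *(3)] in \<open>simp add: strip_star_add\<close>)
qed

lemma strip_star_strip_star: "strip_star (strip_star f) = f"
proof (intro ext)
  fix z w :: complex
  have "exp (of_real pi * (of_real \<beta> * z - of_real \<alpha> * w)) * exp (of_real pi * (of_real \<alpha> * w - of_real \<beta> * z)) = 1"
    by (simp add: exp_add[symmetric] algebra_simps)
  then show "strip_star (strip_star f) z w = f z w"
    by (simp add: strip_star_def exp_cnj mult.assoc[symmetric])
qed

text \<open>At real points the half-way contour has the heights to which \<open>natural_left\<close>
  and \<open>natural_right\<close> continue their arguments.\<close>

lemma N_real:
  assumes "f \<in> B" "k \<in> B" "Im r1 = 0" "Im r2 = 0"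
  shows "N f k r1 r2 = (\<integral>p. kern (\<alpha> / 2) (\<beta> / 2) f k r1 r2 (of_real (fst p) - \<i> * of_real (\<alpha> / 4)) (of_real (snd p) - \<i> * of_real (\<beta> / 4)) \<partial>lborel)"
proof -
  have "N f k r1 r2 = cprod (\<alpha> / 2) (\<beta> / 2) (- \<alpha> / 4) (- \<beta> / 4) f k r1 r2"
    by (rule N_eq_cprod) (use assms alpha_beta in \<open>auto simp: S_iff\<close>)
  then show ?thesis by (simp add: cprod_def slice_def)
qed

text \<open>Both arguments sit at the same height, so conjugating and translating the variable by
  (x, y) exchanges them and reverses the product; what remains is an identity of phases.\<close>

lemma N_strip_star:
  assumes f: "f \<in> B" and k: "k \<in> B"
  shows "strip_star (N f k) (of_real x) (of_real y) = N (strip_star k) (strip_star f) (of_real x) (of_real y)"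
proof -
  let ?K = "\<lambda>p. kern (\<alpha> / 2) (\<beta> / 2) f k (- of_real x) (- of_real y) (of_real (fst p) - \<i> * of_real (\<alpha> / 4)) (of_real (snd p) - \<i> * of_real (\<beta> / 4))"
  let ?K' = "\<lambda>p. kern (\<alpha> / 2) (\<beta> / 2) (strip_star k) (strip_star f) (of_real x) (of_real y) (of_real (fst p) - \<i> * of_real (\<alpha> / 4)) (of_real (snd p) - \<i> * of_real (\<beta> / 4))"
  have eq: "exp (of_real pi * (of_real \<beta> * of_real x - of_real \<alpha> * of_real y)) * cnj (?K p) = ?K' ((x, y) + p)" for p
  proof -
    have 1: "- cnj (of_real (fst ((x, y) + p)) - \<i> * of_real (\<alpha> / 4)) = - of_real x - \<i> * of_real (\<alpha> / 2) - (of_real (fst p) - \<i> * of_real (\<alpha> / 4))"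
      "- cnj (of_real (snd ((x, y) + p)) - \<i> * of_real (\<beta> / 4)) = - of_real y - \<i> * of_real (\<beta> / 2) - (of_real (snd p) - \<i> * of_real (\<beta> / 4))"
      "- cnj (of_real x - \<i> * of_real (\<alpha> / 2) - (of_real (fst ((x, y) + p)) - \<i> * of_real (\<alpha> / 4))) = of_real (fst p) - \<i> * of_real (\<alpha> / 4)"
      "- cnj (of_real y - \<i> * of_real (\<beta> / 2) - (of_real (snd ((x, y) + p)) - \<i> * of_real (\<beta> / 4))) = of_real (snd p) - \<i> * of_real (\<beta> / 4)"
      by (simp_all add: complex_eq_iff field_simps)
    have ph: "of_real pi * (of_real \<beta> * of_real x - of_real \<alpha> * of_real y) +
        cnj (phase (\<alpha> / 2) (\<beta> / 2) (- of_real x) (- of_real y) (of_real (fst p) - \<i> * of_real (\<alpha> / 4)) (of_real (snd p) - \<i> * of_real (\<beta> / 4))) =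
      of_real pi * (of_real \<beta> * (of_real (fst ((x, y) + p)) - \<i> * of_real (\<alpha> / 4)) - of_real \<alpha> * (of_real (snd ((x, y) + p)) - \<i> * of_real (\<beta> / 4))) +
      of_real pi * (of_real \<beta> * (of_real x - \<i> * of_real (\<alpha> / 2) - (of_real (fst ((x, y) + p)) - \<i> * of_real (\<alpha> / 4)))
        - of_real \<alpha> * (of_real y - \<i> * of_real (\<beta> / 2) - (of_real (snd ((x, y) + p)) - \<i> * of_real (\<beta> / 4)))) +
      phase (\<alpha> / 2) (\<beta> / 2) (of_real x) (of_real y) (of_real (fst ((x, y) + p)) - \<i> * of_real (\<alpha> / 4)) (of_real (snd ((x, y) + p)) - \<i> * of_real (\<beta> / 4))"
      by (simp add: phase_def complex_eq_iff field_simps)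
    have ac: "E * (F * K * P) = (E1 * K) * (E2 * F) * P'" if "E * P = E1 * E2 * P'" for E F K P E1 E2 P' :: complex
      using arg_cong[OF that, of "\<lambda>x. F * K * x"] by (simp only: mult_ac)
    show ?thesis
      unfolding kern_def strip_star_def 1 complex_cnj_mult exp_cnj by (rule ac) (unfold exp_add[symmetric], rule arg_cong[OF ph])
  qed
  have "strip_star (N f k) (of_real x) (of_real y) = exp (of_real pi * (of_real \<beta> * of_real x - of_real \<alpha> * of_real y)) * cnj (N f k (- of_real x) (- of_real y))"
    by (simp add: strip_star_def)
  also have "N f k (- of_real x) (- of_real y) = (\<integral>p. ?K p \<partial>lborel)"
    by (rule N_real[OF f k]) auto
  also have "exp (of_real pi * (of_real \<beta> * of_real x - of_real \<alpha> * of_real y)) * cnj (\<integral>p. ?K p \<partial>lborel) =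
     (\<integral>p. exp (of_real pi * (of_real \<beta> * of_real x - of_real \<alpha> * of_real y)) * cnj (?K p) \<partial>lborel)"
    unfolding integral_mult_right_zero Bochner_Integration.integral_cnj ..
  also have "\<dots> = (\<integral>p. ?K' ((x, y) + p) \<partial>lborel)" unfolding eq ..
  also have "\<dots> = (\<integral>p. ?K' p \<partial>lborel)" by (rule lborel_integral_translate)
  also have "\<dots> = N (strip_star k) (strip_star f) (of_real x) (of_real y)"
    by (rule N_real[OF strip_star_B[OF k] strip_star_B[OF f], symmetric]) auto
  finally show ?thesis .
qed

end

subsection \<open>The algebra \<open>frakA_4\<close>\<close>

text \<open>On the Fourier side the Q-operators translate by t / (2 pi) in the imaginary direction
  and the P-operators multiply by exponentials. The membership conditions keep each intermediate
  element in the domain of the next operator.\<close>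

lemma exp_tensor_of_strip:
  fixes s1 s2 :: real
  assumes f: "strip_fun S T f" and t: "t1 / (2 * pi) \<in> S" "t2 / (2 * pi) \<in> T"
  defines "g \<equiv> (\<lambda>z w. exp (of_real s1 * z + of_real s2 * w) * f (\<i> * of_real (t1 / (2 * pi)) + z) (\<i> * of_real (t2 / (2 * pi)) + w))"
  shows "((exp_P1 s1 \<circ>\<^sub>m exp_Q1 t1) \<circ>\<^sub>m (exp_P2 s2 \<circ>\<^sub>m exp_Q2 t2)) (of_strip f) = Some (of_strip g)"
    and "strip_fun {y. t1 / (2 * pi) + y \<in> S} {y. t2 / (2 * pi) + y \<in> T} g"
proof -
  have S0: "0 / (2 * pi) \<in> S" "0 \<in> T" using strip_funD[OF f] by auto
  define f1 where "f1 = (\<lambda>z w. f (\<i> * of_real (0 / (2 * pi)) + z) (\<i> * of_real (t2 / (2 * pi)) + w))"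
  define f2 where "f2 = (\<lambda>z w. exp (of_real 0 * z + of_real s2 * w) * f1 z w)"
  define f3 where "f3 = (\<lambda>z w. f2 (\<i> * of_real (t1 / (2 * pi)) + z) (\<i> * of_real (0 / (2 * pi)) + w))"
  define f4 where "f4 = (\<lambda>z w. exp (of_real s1 * z + of_real 0 * w) * f3 z w)"
  have s1: "strip_fun S {y. t2 / (2 * pi) + y \<in> T} f1"
    using strip_fun_shift[OF f S0(1) t(2)] by (simp add: f1_def)
  have s2: "strip_fun S {y. t2 / (2 * pi) + y \<in> T} f2"
    using strip_fun_exp_mult[OF s1, of 0 "of_real s2" 0] by (simp add: f2_def)
  have m: "0 / (2 * pi) \<in> {y. t2 / (2 * pi) + y \<in> T}" using t by simp
  have s3: "strip_fun {y. t1 / (2 * pi) + y \<in> S} {y. t2 / (2 * pi) + y \<in> T} f3"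
    using strip_fun_shift[OF s2 t(1) m] by (simp add: f3_def)
  have s4: "strip_fun {y. t1 / (2 * pi) + y \<in> S} {y. t2 / (2 * pi) + y \<in> T} f4"
    using strip_fun_exp_mult[OF s3, of "of_real s1" 0 0] by (simp add: f4_def)
  have "exp_Q2 t2 (of_strip f) = Some (of_strip f1)"
    using exp_Q_of_strip[OF f S0(1) t(2)] by (simp add: exp_Q2_def f1_def)
  moreover have "exp_P2 s2 (of_strip f1) = Some (of_strip f2)"
    using exp_P_of_strip[OF s1, of 0 s2] by (simp add: exp_P2_def f2_def)
  moreover have "exp_Q1 t1 (of_strip f2) = Some (of_strip f3)"
    using exp_Q_of_strip[OF s2 t(1) m] by (simp add: exp_Q1_def f3_def)
  moreover have "exp_P1 s1 (of_strip f3) = Some (of_strip f4)"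
    using exp_P_of_strip[OF s3, of s1 0] by (simp add: exp_P1_def f4_def)
  moreover have "f4 = g" by (intro ext) (simp add: f4_def f3_def f2_def f1_def g_def exp_add)
  ultimately show "((exp_P1 s1 \<circ>\<^sub>m exp_Q1 t1) \<circ>\<^sub>m (exp_P2 s2 \<circ>\<^sub>m exp_Q2 t2)) (of_strip f) = Some (of_strip g)"
    and "strip_fun {y. t1 / (2 * pi) + y \<in> S} {y. t2 / (2 * pi) + y \<in> T} g"
    using s4 by (simp_all add: map_comp_def)
qed

lemma scale_l2_linear:
  "scale_l2 c (a + b) = scale_l2 c a + scale_l2 c b" "scale_l2 (c + d) a = scale_l2 c a + scale_l2 d a"
  "scale_l2 c (scale_l2 d a) = scale_l2 (c * d) a" "scale_l2 1 a = a"
  by (transfer; simp add: l2_rel_def square_integrable_add square_integrable_mult_const distrib_left distrib_right mult.assoc)+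

lemma vector_space_scale_4: "vector_space scale_4"
  by unfold_locales (auto simp: scale_4_def scale_l2_linear split: prod.splits)

context quantum_plane
begin

text \<open>The exponents -(pi/2) \<alpha> and -(pi/2) \<beta> divided by 2 pi are the heights
  -\<alpha>/4 and -\<beta>/4, and the P-exponentials join the phase of the twisted convolution to
  form \<open>phase\<close>. As this holds on all of \<open>B\<close>, the product is defined for
  all pairs of components at once.\<close>

lemma natural_opt_of_strip:
  assumes f: "f \<in> B" and k: "k \<in> B"
  shows "natural_opt \<alpha> \<beta> (of_strip f) (of_strip k) = Some (of_strip (N f k))"
proof -
  have t: "- (pi / 2) * \<alpha> / (2 * pi) = - \<alpha> / 4" "- (pi / 2) * \<beta> / (2 * pi) = - \<beta> / 4" by simp_all
  have m: "- \<alpha> / 4 \<in> S1" "- \<beta> / 4 \<in> S2" using alpha_beta by (simp_all add: S_iff)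
  note m' = m[folded t]
  define L where "L = (\<lambda>z w. exp (of_real (pi / 4 * \<beta>) * z + of_real (- (pi / 4) * \<alpha>) * w) * f (\<i> * of_real (- \<alpha> / 4) + z) (\<i> * of_real (- \<beta> / 4) + w))"
  define R where "R = (\<lambda>z w. exp (of_real (- (pi / 4) * \<beta>) * z + of_real (pi / 4 * \<alpha>) * w) * k (\<i> * of_real (- \<alpha> / 4) + z) (\<i> * of_real (- \<beta> / 4) + w))"
  note l = exp_tensor_of_strip[OF B_strip_fun[OF f] m', of "pi / 4 * \<beta>" "- (pi / 4) * \<alpha>", unfolded t, folded L_def]
  note r = exp_tensor_of_strip[OF B_strip_fun[OF k] m', of "- (pi / 4) * \<beta>" "pi / 4 * \<alpha>", unfolded t, folded R_def]
  have "slice (N f k) 0 0 = twisted_conv (slice L 0 0) (slice R 0 0)"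
  proof
    fix x
    have "kern (\<alpha> / 2) (\<beta> / 2) f k (of_real (fst x)) (of_real (snd x)) (of_real (fst p) - \<i> * of_real (\<alpha> / 4)) (of_real (snd p) - \<i> * of_real (\<beta> / 4)) =
        slice L 0 0 p * slice R 0 0 (x - p) * cis (- pi * bracket p x)" for p
    proof -
      have 1: "of_real (fst p) - \<i> * of_real (\<alpha> / 4) = \<i> * of_real (- \<alpha> / 4) + (of_real (fst p) + 0)"
        "of_real (snd p) - \<i> * of_real (\<beta> / 4) = \<i> * of_real (- \<beta> / 4) + (of_real (snd p) + 0)"
        "of_real (fst x) - \<i> * of_real (\<alpha> / 2) - (\<i> * of_real (- \<alpha> / 4) + (of_real (fst p) + 0)) = \<i> * of_real (- \<alpha> / 4) + (of_real (fst (x - p)) + 0)"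
        "of_real (snd x) - \<i> * of_real (\<beta> / 2) - (\<i> * of_real (- \<beta> / 4) + (of_real (snd p) + 0)) = \<i> * of_real (- \<beta> / 4) + (of_real (snd (x - p)) + 0)"
        by (simp_all add: complex_eq_iff field_simps)
      have ph: "phase (\<alpha> / 2) (\<beta> / 2) (of_real (fst x)) (of_real (snd x)) (\<i> * of_real (- \<alpha> / 4) + (of_real (fst p) + 0)) (\<i> * of_real (- \<beta> / 4) + (of_real (snd p) + 0)) =
        (of_real (pi / 4 * \<beta>) * (of_real (fst p) + 0) + of_real (- (pi / 4) * \<alpha>) * (of_real (snd p) + 0)) +
        (of_real (- (pi / 4) * \<beta>) * (of_real (fst (x - p)) + 0) + of_real (pi / 4 * \<alpha>) * (of_real (snd (x - p)) + 0)) + \<i> * of_real (- pi * bracket p x)"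
        by (simp add: phase_def bracket_def complex_eq_iff field_simps)
      have ac: "F * K * P = (E1 * F) * (E2 * K) * E3" if "P = E1 * E2 * E3" for F K P E1 E2 E3 :: complex
        unfolding that by (simp only: mult_ac)
      show ?thesis unfolding kern_def slice_def L_def R_def 1 cis_conv_exp
        by (rule ac) (unfold exp_add[symmetric], rule arg_cong[OF ph])
    qed
    then show "slice (N f k) 0 0 x = twisted_conv (slice L 0 0) (slice R 0 0) x"
      using N_real[OF f k, of "of_real (fst x)" "of_real (snd x)"] by (simp add: slice_def[of "N f k"] twisted_conv_def)
  qed
  from twisted_of_strip[OF l(2) r(2) B_strip_fun[OF N_B[OF f k]] this]
  show ?thesis unfolding natural_opt_def natural_left_def natural_right_def l(1) r(1) by simp
qed

lemma star_opt_of_strip: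
  assumes f: "f \<in> B" shows "star_opt \<alpha> \<beta> (of_strip f) = Some (of_strip (strip_star f))"
proof -
  have "(\<lambda>p :: real \<times> real. complex_of_real (exp (pi * (\<beta> * fst p - \<alpha> * snd p)))) = (\<lambda>p. of_real (exp (pi * \<beta> * fst p + (- (pi * \<alpha>)) * snd p)))"
    by (simp add: right_diff_distrib mult.assoc)
  moreover have "(\<lambda>z w. exp (of_real (pi * \<beta>) * z + of_real (- (pi * \<alpha>)) * w) * cnj (f (- cnj z) (- cnj w))) = strip_star f"
    by (intro ext) (simp add: strip_star_def right_diff_distrib mult.assoc)
  ultimately show ?thesis
    unfolding star_opt_def cnj_of_strip[OF B_strip_fun[OF f]]
    using exp_P_of_strip[OF strip_fun_cnj[OF B_strip_fun[OF f]], of "pi * \<beta>" "- (pi * \<alpha>)"] by simp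
qed

lemma of_strip_eqB: "eqB f g \<Longrightarrow> of_strip f = of_strip g"
  using S_props by (intro of_strip_cong) (simp add: eqB_def)

lemma frakA_image: "frakA = of_strip ` A0"
proof
  show "frakA \<subseteq> of_strip ` A0" unfolding frakA_eq using A0I by auto
  show "of_strip ` A0 \<subseteq> frakA" unfolding frakA_eq using of_strip_eqB by (auto simp: A0_def)
qed

text \<open>The symbol has no zeros on the common strip, so multiplying and dividing by it undo each
  other there; at real arguments the quotient is the multiplier of the functional calculus.\<close>

lemma Asym_image:
  fixes a b :: real
  assumes S: "S = S1 \<and> T = UNIV \<and> a = 2 * pi * \<beta> \<and> b = 0 \<or> S = UNIV \<and> T = S2 \<and> a = 0 \<and> b = 2 * pi * \<alpha>"
  shows "of_strip ` Asym a b = {g. \<exists>u\<in>frakA. fun_P (\<lambda>p. inverse (sinh_fun a b (of_real (fst p)) (of_real (snd p)))) u = Some g}"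
proof -
  have sub: "S1 \<subseteq> S" "S2 \<subseteq> T" and ST: "open S" "convex S" "0 \<in> S" "open T" "convex T" "0 \<in> T"
    using S S_props by auto
  define h where "h c = (\<lambda>z w. inverse (sinh_fun a b z w) * c z w)" for c
  have val: "fun_P (\<lambda>p. inverse (sinh_fun a b (of_real (fst p)) (of_real (snd p)))) (of_strip c) = Some (of_strip (h c))"
    if c: "strip_decay UNIV UNIV c" for c
  proof (rule fun_P_of_strip)
    show "strip_fun UNIV UNIV c" using c by (simp add: strip_fun_UNIV)
    show "strip_fun S T (h c)" using sinh_fun_reciprocal(1)[OF S c] ST by (simp add: strip_fun_def h_def)
    have "continuous_on UNIV (\<lambda>p::real\<times>real. sinh_fun a b (of_real (fst p)) (of_real (snd p)))"
      unfolding sinh_fun_def exp_symbol_def by (intro continuous_intros)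
    then show "(\<lambda>p::real\<times>real. inverse (sinh_fun a b (of_real (fst p)) (of_real (snd p)))) \<in> borel_measurable borel"
      by (intro borel_measurable_inverse borel_measurable_continuous_onI)
  qed (simp add: slice_def h_def)
  show ?thesis
  proof (intro equalityI subsetI)
    fix g assume "g \<in> of_strip ` Asym a b"
    then obtain f c where f: "g = of_strip f" and c: "strip_decay UNIV UNIV c" "eqB (\<lambda>z w. sinh_fun a b z w * f z w) c"
      by (auto simp: Asym_def A0_def)
    have "eqB (h c) f"
      unfolding eqB_def h_def
    proof (intro allI impI)
      fix z w assume zw: "Im z \<in> S1" "Im w \<in> S2"
      then have "sinh_fun a b z w \<noteq> 0" using sinh_fun_reciprocal(2)[OF S c(1)] sub by blast
      moreover have "c z w = sinh_fun a b z w * f z w" using c(2) zw by (simp add: eqB_def)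
      ultimately show "inverse (sinh_fun a b z w) * c z w = f z w" by simp
    qed
    then have "of_strip (h c) = g" unfolding f by (rule of_strip_eqB)
    then show "g \<in> {g. \<exists>u\<in>frakA. fun_P (\<lambda>p. inverse (sinh_fun a b (of_real (fst p)) (of_real (snd p)))) u = Some g}"
      using val[OF c(1)] c(1) unfolding frakA_eq by blast
  next
    fix g assume "g \<in> {g. \<exists>u\<in>frakA. fun_P (\<lambda>p. inverse (sinh_fun a b (of_real (fst p)) (of_real (snd p)))) u = Some g}"
    then obtain c where c: "strip_decay UNIV UNIV c" and g: "g = of_strip (h c)"
      using val unfolding frakA_eq by auto
    have "strip_decay S1 S2 (h c)"
      unfolding h_def by (rule strip_decay_mono[OF sinh_fun_reciprocal(1)[OF S c] sub])
    moreover have "(\<lambda>z w. sinh_fun a b z w * h c z w) \<in> A0"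
    proof (rule A0_cong[OF A0I[OF c]])
      show "eqB (\<lambda>z w. sinh_fun a b z w * h c z w) c"
        unfolding eqB_def h_def using sinh_fun_reciprocal(2)[OF S c] sub by (simp add: subset_iff)
    qed
    ultimately show "g \<in> of_strip ` Asym a b" unfolding g Asym_def by blast
  qed
qed

lemma sinh_symbol_eq:
  "sinh_symbol \<alpha> \<beta> x = sinh_fun (2 * pi * \<beta>) 0 (of_real x) w"
  "sinh_symbol \<beta> \<alpha> x = sinh_fun 0 (2 * pi * \<alpha>) z (of_real x)"
  by (simp_all add: sinh_symbol_def sinh_fun_def exp_symbol_def sinh_def algebra_simps)

lemma frakA1_image: "frakA1 \<alpha> \<beta> = of_strip ` A1"
proof -
  have "sinh_symbol \<alpha> \<beta> (fst p) = sinh_fun (2 * pi * \<beta>) 0 (of_real (fst p)) (of_real (snd p))" for p :: "real \<times> real"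
    by (rule sinh_symbol_eq)
  then show ?thesis unfolding frakA1_def A1_def by (subst Asym_image[of S1 UNIV]) auto
qed

lemma frakA2_image: "frakA2 \<alpha> \<beta> = of_strip ` A2"
proof -
  have "sinh_symbol \<beta> \<alpha> (snd p) = sinh_fun 0 (2 * pi * \<alpha>) (of_real (fst p)) (of_real (snd p))" for p :: "real \<times> real"
    by (rule sinh_symbol_eq)
  then show ?thesis unfolding frakA2_def A2_def by (subst Asym_image[of UNIV S2]) auto
qed

lemma of_strip_B_add: "f \<in> B \<Longrightarrow> g \<in> B \<Longrightarrow> of_strip f + of_strip g = of_strip (\<lambda>z w. f z w + g z w)"
  by (rule of_strip_add[symmetric, OF B_strip_fun B_strip_fun B_strip_fun[OF B_add]])

lemma of_strip_B_scale: "f \<in> B \<Longrightarrow> scale_l2 c (of_strip f) = of_strip (\<lambda>z w. c * f z w)"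
  by (rule of_strip_scale[symmetric, OF B_strip_fun])

lemma frakA12_image: "frakA12 \<alpha> \<beta> = of_strip ` A12"
proof (intro equalityI subsetI)
  fix u assume "u \<in> frakA12 \<alpha> \<beta>"
  then obtain f1 f2 where *: "f1 \<in> A1" "f2 \<in> A2" "u = of_strip f1 + of_strip f2"
    unfolding frakA12_def frakA1_image frakA2_image by blast
  then have "u = of_strip (\<lambda>z w. f1 z w + f2 z w)" by (simp add: of_strip_B_add A1_B A2_B)
  moreover have "(\<lambda>z w. f1 z w + f2 z w) \<in> A12" by (rule A12I[OF *(1,2) eqB_refl])
  ultimately show "u \<in> of_strip ` A12" by blast
next
  fix u assume "u \<in> of_strip ` A12"
  then obtain f f1 f2 where *: "f1 \<in> A1" "f2 \<in> A2" "eqB f (\<lambda>z w. f1 z w + f2 z w)" "u = of_strip f"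
    by (auto simp: A12_def)
  then have "u = of_strip f1 + of_strip f2" using of_strip_eqB[OF *(3)] by (simp add: of_strip_B_add A1_B A2_B)
  then show "u \<in> frakA12 \<alpha> \<beta>" unfolding frakA12_def frakA1_image frakA2_image using * by blast
qed

text \<open>A common ambient space of the four components, closed under all operations. The
  algebraic identities are proved here once for all combinations of components.\<close>

definition W :: "l2 set" where "W = of_strip ` B"

lemma frak_W: "frakA12 \<alpha> \<beta> \<subseteq> W" "frakA2 \<alpha> \<beta> \<subseteq> W" "frakA1 \<alpha> \<beta> \<subseteq> W" "frakA \<subseteq> W"
  unfolding frakA12_image frakA2_image frakA1_image frakA_image W_def
  using A12_B A2_B A1_B A0_B by blast+

lemma natural_eq: "f \<in> B \<Longrightarrow> k \<in> B \<Longrightarrow> natural \<alpha> \<beta> (of_strip f) (of_strip k) = of_strip (N f k)"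
  by (simp add: natural_def natural_opt_of_strip)

lemma star_eq: "f \<in> B \<Longrightarrow> star \<alpha> \<beta> (of_strip f) = of_strip (strip_star f)"
  by (simp add: star_def star_opt_of_strip)

lemma W_closed:
  "a \<in> W \<Longrightarrow> b \<in> W \<Longrightarrow> a + b \<in> W" "a \<in> W \<Longrightarrow> scale_l2 c a \<in> W"
  "a \<in> W \<Longrightarrow> b \<in> W \<Longrightarrow> natural \<alpha> \<beta> a b \<in> W" "a \<in> W \<Longrightarrow> star \<alpha> \<beta> a \<in> W"
  unfolding W_def by (auto simp: of_strip_B_add of_strip_B_scale natural_eq star_eq B_add B_cmult N_B strip_star_B)

lemma natural_bilinear:
  "a \<in> W \<Longrightarrow> b \<in> W \<Longrightarrow> c \<in> W \<Longrightarrow> natural \<alpha> \<beta> (a + b) c = natural \<alpha> \<beta> a c + natural \<alpha> \<beta> b c"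
  "a \<in> W \<Longrightarrow> b \<in> W \<Longrightarrow> c \<in> W \<Longrightarrow> natural \<alpha> \<beta> a (b + c) = natural \<alpha> \<beta> a b + natural \<alpha> \<beta> a c"
  "a \<in> W \<Longrightarrow> b \<in> W \<Longrightarrow> natural \<alpha> \<beta> (scale_l2 x a) b = scale_l2 x (natural \<alpha> \<beta> a b)"
  "a \<in> W \<Longrightarrow> b \<in> W \<Longrightarrow> natural \<alpha> \<beta> a (scale_l2 x b) = scale_l2 x (natural \<alpha> \<beta> a b)"
  unfolding W_def
  by (auto simp: of_strip_B_add of_strip_B_scale natural_eq B_add B_cmult N_B N_cmult[abs_def]
      intro!: of_strip_eqB N_add_left N_add_right)

lemma natural_assoc:
  assumes "a \<in> W" "b \<in> W" "c \<in> W"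
  shows "natural \<alpha> \<beta> (natural \<alpha> \<beta> a b) c = natural \<alpha> \<beta> a (natural \<alpha> \<beta> b c)"
proof -
  obtain f k l where *: "a = of_strip f" "f \<in> B" "b = of_strip k" "k \<in> B" "c = of_strip l" "l \<in> B"
    using assms by (auto simp: W_def)
  have "of_strip (N (N f k) l) = of_strip (N f (N k l))"
    by (rule of_strip_cong) (simp add: N_assoc *)
  then show ?thesis using * by (simp add: natural_eq N_B)
qed

lemma star_props:
  "a \<in> W \<Longrightarrow> b \<in> W \<Longrightarrow> star \<alpha> \<beta> (a + b) = star \<alpha> \<beta> a + star \<alpha> \<beta> b"
  "a \<in> W \<Longrightarrow> star \<alpha> \<beta> (scale_l2 x a) = scale_l2 (cnj x) (star \<alpha> \<beta> a)"
  "a \<in> W \<Longrightarrow> star \<alpha> \<beta> (star \<alpha> \<beta> a) = a"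
  unfolding W_def
  by (auto simp: of_strip_B_add of_strip_B_scale star_eq B_add B_cmult strip_star_B strip_star_strip_star strip_star_add strip_star_cmult)

lemma star_natural:
  assumes "a \<in> W" "b \<in> W"
  shows "star \<alpha> \<beta> (natural \<alpha> \<beta> a b) = natural \<alpha> \<beta> (star \<alpha> \<beta> b) (star \<alpha> \<beta> a)"
proof -
  obtain f k where *: "a = of_strip f" "f \<in> B" "b = of_strip k" "k \<in> B"
    using assms by (auto simp: W_def)
  have "of_strip (strip_star (N f k)) = of_strip (N (strip_star k) (strip_star f))"
    by (rule of_strip_cong) (simp add: N_strip_star *)
  then show ?thesis using * by (simp add: natural_eq star_eq N_B strip_star_B)
qed

lemma frak_closed:
  "a \<in> frakA12 \<alpha> \<beta> \<Longrightarrow> b \<in> frakA12 \<alpha> \<beta> \<Longrightarrow> a + b \<in> frakA12 \<alpha> \<beta>" "a \<in> frakA12 \<alpha> \<beta> \<Longrightarrow> scale_l2 x a \<in> frakA12 \<alpha> \<beta>"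
  "a \<in> frakA2 \<alpha> \<beta> \<Longrightarrow> b \<in> frakA2 \<alpha> \<beta> \<Longrightarrow> a + b \<in> frakA2 \<alpha> \<beta>" "a \<in> frakA2 \<alpha> \<beta> \<Longrightarrow> scale_l2 x a \<in> frakA2 \<alpha> \<beta>"
  "a \<in> frakA1 \<alpha> \<beta> \<Longrightarrow> b \<in> frakA1 \<alpha> \<beta> \<Longrightarrow> a + b \<in> frakA1 \<alpha> \<beta>" "a \<in> frakA1 \<alpha> \<beta> \<Longrightarrow> scale_l2 x a \<in> frakA1 \<alpha> \<beta>"
  "a \<in> frakA \<Longrightarrow> b \<in> frakA \<Longrightarrow> a + b \<in> frakA" "a \<in> frakA \<Longrightarrow> scale_l2 x a \<in> frakA"
  unfolding frakA12_image frakA2_image frakA1_image frakA_image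
  by (auto simp: of_strip_B_add of_strip_B_scale A12_B A2_B A1_B A0_B A12_add A12_cmult A0_add A0_cmult
      A1_def A2_def Asym_add Asym_cmult Asym_B intro!: imageI)

lemma frak_zero: "0 \<in> frakA12 \<alpha> \<beta>" "0 \<in> frakA2 \<alpha> \<beta>" "0 \<in> frakA1 \<alpha> \<beta>" "0 \<in> frakA"
proof -
  \<comment> \<open>In a group an element with x + x = x is 0.\<close>
  have "of_strip (\<lambda>z w. 0) + of_strip (\<lambda>z w. 0) = of_strip (\<lambda>z w. 0)"
    using of_strip_B_add[OF A0_B[OF A0_zero] A0_B[OF A0_zero]] by simp
  then have "0 = of_strip (\<lambda>z w. 0)" by simp
  then show "0 \<in> frakA12 \<alpha> \<beta>" "0 \<in> frakA2 \<alpha> \<beta>" "0 \<in> frakA1 \<alpha> \<beta>" "0 \<in> frakA"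
    unfolding frakA12_image frakA2_image frakA1_image frakA_image using A0_zero A0_A12 A0_A1 A0_A2 by auto
qed

text \<open>The multiplication table of the Klein four-group: \<open>frakA12\<close> is the identity
  component, squares fall into it, and two different components among the other three multiply into
  the third.\<close>

lemma frak_natural:
  "a \<in> frakA12 \<alpha> \<beta> \<Longrightarrow> b \<in> frakA12 \<alpha> \<beta> \<Longrightarrow> natural \<alpha> \<beta> a b \<in> frakA12 \<alpha> \<beta>"
  "a \<in> frakA12 \<alpha> \<beta> \<Longrightarrow> b \<in> frakA2 \<alpha> \<beta> \<Longrightarrow> natural \<alpha> \<beta> a b \<in> frakA2 \<alpha> \<beta>"
  "a \<in> frakA12 \<alpha> \<beta> \<Longrightarrow> b \<in> frakA1 \<alpha> \<beta> \<Longrightarrow> natural \<alpha> \<beta> a b \<in> frakA1 \<alpha> \<beta>"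
  "a \<in> frakA12 \<alpha> \<beta> \<Longrightarrow> b \<in> frakA \<Longrightarrow> natural \<alpha> \<beta> a b \<in> frakA"
  "a \<in> frakA2 \<alpha> \<beta> \<Longrightarrow> b \<in> frakA12 \<alpha> \<beta> \<Longrightarrow> natural \<alpha> \<beta> a b \<in> frakA2 \<alpha> \<beta>"
  "a \<in> frakA2 \<alpha> \<beta> \<Longrightarrow> b \<in> frakA2 \<alpha> \<beta> \<Longrightarrow> natural \<alpha> \<beta> a b \<in> frakA12 \<alpha> \<beta>"
  "a \<in> frakA2 \<alpha> \<beta> \<Longrightarrow> b \<in> frakA1 \<alpha> \<beta> \<Longrightarrow> natural \<alpha> \<beta> a b \<in> frakA"
  "a \<in> frakA2 \<alpha> \<beta> \<Longrightarrow> b \<in> frakA \<Longrightarrow> natural \<alpha> \<beta> a b \<in> frakA1 \<alpha> \<beta>"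
  "a \<in> frakA1 \<alpha> \<beta> \<Longrightarrow> b \<in> frakA12 \<alpha> \<beta> \<Longrightarrow> natural \<alpha> \<beta> a b \<in> frakA1 \<alpha> \<beta>"
  "a \<in> frakA1 \<alpha> \<beta> \<Longrightarrow> b \<in> frakA2 \<alpha> \<beta> \<Longrightarrow> natural \<alpha> \<beta> a b \<in> frakA"
  "a \<in> frakA1 \<alpha> \<beta> \<Longrightarrow> b \<in> frakA1 \<alpha> \<beta> \<Longrightarrow> natural \<alpha> \<beta> a b \<in> frakA12 \<alpha> \<beta>"
  "a \<in> frakA1 \<alpha> \<beta> \<Longrightarrow> b \<in> frakA \<Longrightarrow> natural \<alpha> \<beta> a b \<in> frakA2 \<alpha> \<beta>"
  "a \<in> frakA \<Longrightarrow> b \<in> frakA12 \<alpha> \<beta> \<Longrightarrow> natural \<alpha> \<beta> a b \<in> frakA"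
  "a \<in> frakA \<Longrightarrow> b \<in> frakA2 \<alpha> \<beta> \<Longrightarrow> natural \<alpha> \<beta> a b \<in> frakA1 \<alpha> \<beta>"
  "a \<in> frakA \<Longrightarrow> b \<in> frakA1 \<alpha> \<beta> \<Longrightarrow> natural \<alpha> \<beta> a b \<in> frakA2 \<alpha> \<beta>"
  "a \<in> frakA \<Longrightarrow> b \<in> frakA \<Longrightarrow> natural \<alpha> \<beta> a b \<in> frakA12 \<alpha> \<beta>"
  unfolding frakA12_image frakA2_image frakA1_image frakA_image
  by (auto simp: natural_eq A12_B A2_B A1_B A0_B N_A12 N_A12_A2 N_A12_A1 N_A2_A12 N_A1_A12 N_A1_A2 N_A2_A1
      N_A0_left N_A0_right N_A1[THEN A1_A12] N_A2[THEN A2_A12] A0_A1 A0_A2 A0_A12 intro!: imageI)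

lemma frak_star:
  "a \<in> frakA12 \<alpha> \<beta> \<Longrightarrow> star \<alpha> \<beta> a \<in> frakA12 \<alpha> \<beta>" "a \<in> frakA2 \<alpha> \<beta> \<Longrightarrow> star \<alpha> \<beta> a \<in> frakA2 \<alpha> \<beta>"
  "a \<in> frakA1 \<alpha> \<beta> \<Longrightarrow> star \<alpha> \<beta> a \<in> frakA1 \<alpha> \<beta>" "a \<in> frakA \<Longrightarrow> star \<alpha> \<beta> a \<in> frakA"
  unfolding frakA12_image frakA2_image frakA1_image frakA_image
  by (auto simp: star_eq A12_B A2_B A1_B A0_B strip_star_A12 strip_star_A0 A1_def A2_def strip_star_Asym Asym_B intro!: imageI)

lemma star_algebra_frakA_4: "star_algebra scale_4 (frakA_4 \<alpha> \<beta>) (circ_4 \<alpha> \<beta>) (star_4 \<alpha> \<beta>)"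
proof -
  interpret vs: vector_space scale_4 by (rule vector_space_scale_4)
  have W: "x1 \<in> W \<and> x2 \<in> W \<and> x3 \<in> W \<and> x4 \<in> W" if "(x1, x2, x3, x4) \<in> frakA_4 \<alpha> \<beta>" for x1 x2 x3 x4
    using that frak_W by (auto simp: frakA_4_def)
  \<comment> \<open>These rules expand both sides of each axiom into sums of products of components;
    the sums agree up to order because the indices of \<open>circ_4\<close> multiply as in the Klein
    four-group, which is commutative and associative.\<close>
  note simps = circ_4_def scale_4_def star_4_def Let_def natural_bilinear W_closed scale_l2_linear star_props star_natural
  show ?thesis
  proof (intro star_algebra.intro star_algebra_axioms.intro vector_space_scale_4)
    show "vs.subspace (frakA_4 \<alpha> \<beta>)"
      unfolding vs.subspace_def by (auto simp: frakA_4_def scale_4_def frak_closed frak_zero zero_prod_def)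
    fix x y z c
    assume x: "x \<in> frakA_4 \<alpha> \<beta>"
    obtain x1 x2 x3 x4 where x': "x = (x1, x2, x3, x4)" by (cases x)
    note wx = W[OF x[unfolded x']]
    show "star_4 \<alpha> \<beta> x \<in> frakA_4 \<alpha> \<beta>" using x by (simp add: x' frakA_4_def star_4_def frak_star)
    show "star_4 \<alpha> \<beta> (scale_4 c x) = scale_4 (cnj c) (star_4 \<alpha> \<beta> x)" "star_4 \<alpha> \<beta> (star_4 \<alpha> \<beta> x) = x"
      using wx by (simp_all add: x' simps)
    assume y: "y \<in> frakA_4 \<alpha> \<beta>"
    obtain y1 y2 y3 y4 where y': "y = (y1, y2, y3, y4)" by (cases y)
    note wy = W[OF y[unfolded y']]
    show "circ_4 \<alpha> \<beta> x y \<in> frakA_4 \<alpha> \<beta>" using x y by (simp add: x' y' frakA_4_def circ_4_def scale_4_def Let_def frak_closed frak_natural)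
    show "circ_4 \<alpha> \<beta> (scale_4 c x) y = scale_4 c (circ_4 \<alpha> \<beta> x y)" "circ_4 \<alpha> \<beta> x (scale_4 c y) = scale_4 c (circ_4 \<alpha> \<beta> x y)"
      using wx wy by (simp_all add: x' y' simps mult.commute)
    show "star_4 \<alpha> \<beta> (x + y) = star_4 \<alpha> \<beta> x + star_4 \<alpha> \<beta> y"
      using wx wy by (simp add: x' y' simps)
    show "star_4 \<alpha> \<beta> (circ_4 \<alpha> \<beta> x y) = circ_4 \<alpha> \<beta> (star_4 \<alpha> \<beta> y) (star_4 \<alpha> \<beta> x)"
      using wx wy by (simp add: x' y' simps add_ac)
    assume z: "z \<in> frakA_4 \<alpha> \<beta>"
    obtain z1 z2 z3 z4 where z': "z = (z1, z2, z3, z4)" by (cases z)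
    note wz = W[OF z[unfolded z']]
    show "circ_4 \<alpha> \<beta> (x + y) z = circ_4 \<alpha> \<beta> x z + circ_4 \<alpha> \<beta> y z" "circ_4 \<alpha> \<beta> x (y + z) = circ_4 \<alpha> \<beta> x y + circ_4 \<alpha> \<beta> x z"
      using wx wy wz by (simp_all add: x' y' z' simps add_ac)
    show "circ_4 \<alpha> \<beta> (circ_4 \<alpha> \<beta> x y) z = circ_4 \<alpha> \<beta> x (circ_4 \<alpha> \<beta> y z)"
      using wx wy wz by (simp add: x' y' z' simps natural_assoc add_ac)
  qed
qed

end

theorem proposition27:
  fixes q :: complex and \<alpha> \<beta> \<gamma> :: real
  assumes "cmod q = 1" and "q \<noteq> 1" and "q \<noteq> - 1"
    and "q = exp (2 * of_real pi * \<i> * of_real \<gamma>)"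
    and "\<alpha> * \<beta> = \<gamma>"
    and "0 < \<bar>\<gamma>\<bar>" and "\<bar>\<gamma>\<bar> < 1 / 3"
  shows "(\<forall>a \<in> frakA12 \<alpha> \<beta> \<union> frakA2 \<alpha> \<beta> \<union> frakA1 \<alpha> \<beta> \<union> frakA.
           \<forall>b \<in> frakA12 \<alpha> \<beta> \<union> frakA2 \<alpha> \<beta> \<union> frakA1 \<alpha> \<beta> \<union> frakA.
             natural_opt \<alpha> \<beta> a b \<noteq> None) \<and>
         (\<forall>a \<in> frakA12 \<alpha> \<beta> \<union> frakA2 \<alpha> \<beta> \<union> frakA1 \<alpha> \<beta> \<union> frakA.
             star_opt \<alpha> \<beta> a \<noteq> None) \<and>
         star_algebra scale_4 (frakA_4 \<alpha> \<beta>) (circ_4 \<alpha> \<beta>) (star_4 \<alpha> \<beta>)"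
proof -
  interpret quantum_plane \<alpha> \<beta> using assms(5-7) by unfold_locales auto
  have "natural_opt \<alpha> \<beta> a b \<noteq> None" "star_opt \<alpha> \<beta> a \<noteq> None" if "a \<in> W" "b \<in> W" for a b
    using that by (auto simp: W_def natural_opt_of_strip star_opt_of_strip)
  then show ?thesis using frak_W star_algebra_frakA_4 by blast
qed

end
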